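(* Let $(S,\mathfrak{n},k)$ be a regular local ring and let $R=S/I$ be a non-regular one-dimensional domain with maximal ideal $\mathfrak{m}$ such that $\mu(\mathfrak{m})=n$. Let $M$ be a finitely generated rank one $R$-module with $\mu(M)\geq 2$. Assume that $I\subseteq \mathfrak{n}^{s+1}$ for some integer $s\geq 1$ and that $J\subseteq \mathfrak{m}^s$ for some partial trace ideal $J$ of $M$. If $$\mathrm{h}(M)<\frac{-\dim_k\operatorname{Tor}^R_1(M,k)+\mu(I)}{n}+\binom{n+s}{s}\frac{s}{s+1},$$ then $\tau(M)\neq 0$.
   Context: Here $\mu(\cdot)$ denotes the minimal number of generators and $\lambda(\cdot)$ denotes length as an $R$-module. $Q$ is the fraction field of $R$; the rank of $M$ is $\dim_Q(M\otimes_R Q)$, and $\tau(M)=\ker(M\to M\otimes_R Q)$ is the torsion submodule of $M$. For a finitely generated module $M$ over a one-dimensional Noetherian local domain $R$, $$\mathrm{h}(M):=\min\{\lambda(R/J)\mid J\subseteq R \text{ an ideal such that there is a surjection } M\to J\}.$$ An ideal $J$ of $R$ is called a partial trace ideal of $M$ (equivalently, $J$ realizes $M$) if there is a surjective $R$-linear map $M\to J$ and $\lambda(R/J)=\mathrm{h}(M)$. *)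

theory Defs
  imports
    "HOL-Algebra.Ring_Divisibility"
    "HOL-Algebra.Ideal_Product"
    "HOL-Algebra.QuotRing"
    "HOL-Library.Extended_Real"
    "Jordan_Normal_Form.Missing_VectorSpace"
begin

section \<open>Modules: generators, quotients, length\<close>

text \<open>
  The record type of modules extends that of rings.  The fields for multiplication and unit play
  no role for a module that is not an algebra; they are left \<^const>\<open>undefined\<close> below.

  Two locales are called \<open>submodule\<close> in the imported theories; the one of \<open>HOL-Algebra\<close>
  is meant here, hence the qualified name.
\<close>

definition ring_module :: "('a, 'c) ring_scheme \<Rightarrow> ('a, 'a) module" where
  "ring_module R = \<lparr>carrier = carrier R, mult = mult R, one = one R, zero = zero R,
     add = add R, smult = mult R\<rparr>"

definition ideal_module :: "('a, 'c) ring_scheme \<Rightarrow> 'a set \<Rightarrow> ('a, 'a) module" where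
  "ideal_module R J = (ring_module R)\<lparr>carrier := J\<rparr>"

definition fin_gen_module :: "('a, 'c) ring_scheme \<Rightarrow> ('a, 'm, 'd) module_scheme \<Rightarrow> bool" where
  "fin_gen_module R M \<longleftrightarrow> (\<exists>A. finite A \<and> A \<subseteq> carrier M \<and> module.span R M A = carrier M)"

text \<open>The minimal number of generators; meaningful for finitely generated modules only.\<close>

definition min_gens :: "('a, 'c) ring_scheme \<Rightarrow> ('a, 'm, 'd) module_scheme \<Rightarrow> nat" where
  "min_gens R M =
     (LEAST k. \<exists>A. finite A \<and> card A = k \<and> A \<subseteq> carrier M \<and> module.span R M A = carrier M)"

text \<open>
  In \<open>smult\<close>, the union over representatives is the single coset of \<open>a \<cdot> x\<close> for any
  \<open>x \<in> X\<close>.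
\<close>

definition quot_module ::
    "('a, 'c) ring_scheme \<Rightarrow> ('a, 'm, 'd) module_scheme \<Rightarrow> 'm set \<Rightarrow> ('a, 'm set) module" where
  "quot_module R M N = \<lparr>carrier = a_rcosets\<^bsub>M\<^esub> N, mult = undefined, one = undefined, zero = N,
     add = set_add M, smult = (\<lambda>a X. \<Union>x\<in>X. N +>\<^bsub>M\<^esub> (a \<odot>\<^bsub>M\<^esub> x))\<rparr>"

definition module_length :: "('a, 'c) ring_scheme \<Rightarrow> ('a, 'm, 'd) module_scheme \<Rightarrow> enat" where
  "module_length R M = Sup {enat l | l. \<exists>N :: nat \<Rightarrow> 'm set.
     (\<forall>i\<le>l. Module.submodule (N i) R M) \<and> (\<forall>i<l. N i \<subset> N (Suc i))}"

section \<open>Local rings\<close>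

definition krull_dim :: "('a, 'c) ring_scheme \<Rightarrow> enat" where
  "krull_dim R = Sup {enat l | l. \<exists>P :: nat \<Rightarrow> 'a set.
     (\<forall>i\<le>l. primeideal (P i) R) \<and> (\<forall>i<l. P i \<subset> P (Suc i))}"

definition local_ring :: "('a, 'c) ring_scheme \<Rightarrow> bool" where
  "local_ring R \<longleftrightarrow> cring R \<and> (\<exists>!\<mm>. maximalideal \<mm> R)"

definition regular_local_ring :: "('a, 'c) ring_scheme \<Rightarrow> bool" where
  "regular_local_ring R \<longleftrightarrow> noetherian_ring R \<and> local_ring R \<and>
     (\<forall>\<mm>. maximalideal \<mm> R \<longrightarrow> enat (min_gens R (ideal_module R \<mm>)) = krull_dim R)"

section \<open>Free modules and extension of scalars\<close>

definition free_module :: "('a, 'c) ring_scheme \<Rightarrow> 'x set \<Rightarrow> ('a, 'x \<Rightarrow> 'a) module" where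
  "free_module R X =
     \<lparr>carrier = {g. (\<forall>x\<in>X. g x \<in> carrier R) \<and> (\<forall>x. x \<notin> X \<longrightarrow> g x = \<zero>\<^bsub>R\<^esub>) \<and>
                    finite {x. g x \<noteq> \<zero>\<^bsub>R\<^esub>}},
      mult = undefined, one = undefined, zero = (\<lambda>x. \<zero>\<^bsub>R\<^esub>),
      add = (\<lambda>g h x. g x \<oplus>\<^bsub>R\<^esub> h x), smult = (\<lambda>a g x. a \<otimes>\<^bsub>R\<^esub> g x)\<rparr>"

definition free_gen :: "('a, 'c) ring_scheme \<Rightarrow> 'x \<Rightarrow> 'x \<Rightarrow> 'a" where
  "free_gen R x = (\<lambda>y. if y = x then \<one>\<^bsub>R\<^esub> else \<zero>\<^bsub>R\<^esub>)"

text \<open>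
  The tensor product \<open>M \<otimes>\<^sub>R A\<close> for a ring homomorphism \<open>\<phi> : R \<rightarrow> A\<close>, as an \<open>A\<close>-module.  It is
  the free \<open>A\<close>-module on the symbols \<open>(m, a)\<close> modulo the relations making \<open>(m, a)\<close> biadditive
  and \<open>R\<close>-balanced, together with \<open>b \<cdot> (m, a) = (m, b a)\<close>.
\<close>

definition tensor_rels ::
    "('r, 'c) ring_scheme \<Rightarrow> ('a, 'd) ring_scheme \<Rightarrow> ('r \<Rightarrow> 'a) \<Rightarrow> ('r, 'm, 'e) module_scheme \<Rightarrow>
     ('m \<times> 'a \<Rightarrow> 'a) set" where
  "tensor_rels R A \<phi> M =
     (let F = free_module A (carrier M \<times> carrier A); e = free_gen A in
        {e (m \<oplus>\<^bsub>M\<^esub> m', a) \<ominus>\<^bsub>F\<^esub> (e (m, a) \<oplus>\<^bsub>F\<^esub> e (m', a)) | m m' a.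
            m \<in> carrier M \<and> m' \<in> carrier M \<and> a \<in> carrier A} \<union>
        {e (m, a \<oplus>\<^bsub>A\<^esub> a') \<ominus>\<^bsub>F\<^esub> (e (m, a) \<oplus>\<^bsub>F\<^esub> e (m, a')) | m a a'.
            m \<in> carrier M \<and> a \<in> carrier A \<and> a' \<in> carrier A} \<union>
        {e (r \<odot>\<^bsub>M\<^esub> m, a) \<ominus>\<^bsub>F\<^esub> e (m, \<phi> r \<otimes>\<^bsub>A\<^esub> a) | r m a.
            r \<in> carrier R \<and> m \<in> carrier M \<and> a \<in> carrier A} \<union>
        {e (m, b \<otimes>\<^bsub>A\<^esub> a) \<ominus>\<^bsub>F\<^esub> (b \<odot>\<^bsub>F\<^esub> e (m, a)) | m a b.
            m \<in> carrier M \<and> a \<in> carrier A \<and> b \<in> carrier A})"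

definition tensor_kernel ::
    "('r, 'c) ring_scheme \<Rightarrow> ('a, 'd) ring_scheme \<Rightarrow> ('r \<Rightarrow> 'a) \<Rightarrow> ('r, 'm, 'e) module_scheme \<Rightarrow>
     ('m \<times> 'a \<Rightarrow> 'a) set" where
  "tensor_kernel R A \<phi> M =
     module.span A (free_module A (carrier M \<times> carrier A)) (tensor_rels R A \<phi> M)"

definition tensor ::
    "('r, 'c) ring_scheme \<Rightarrow> ('a, 'd) ring_scheme \<Rightarrow> ('r \<Rightarrow> 'a) \<Rightarrow> ('r, 'm, 'e) module_scheme \<Rightarrow>
     ('a, ('m \<times> 'a \<Rightarrow> 'a) set) module" where
  "tensor R A \<phi> M =
     quot_module A (free_module A (carrier M \<times> carrier A)) (tensor_kernel R A \<phi> M)"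

definition pure_tensor ::
    "('r, 'c) ring_scheme \<Rightarrow> ('a, 'd) ring_scheme \<Rightarrow> ('r \<Rightarrow> 'a) \<Rightarrow> ('r, 'm, 'e) module_scheme \<Rightarrow>
     'm \<Rightarrow> 'a \<Rightarrow> ('m \<times> 'a \<Rightarrow> 'a) set" where
  "pure_tensor R A \<phi> M m a =
     tensor_kernel R A \<phi> M +>\<^bsub>free_module A (carrier M \<times> carrier A)\<^esub> free_gen A (m, a)"

text \<open>The \<open>A\<close>-linear map \<open>f \<otimes> A\<close> induced by an \<open>R\<close>-linear map \<open>f : M \<rightarrow> N\<close>.\<close>

definition tensor_map ::
    "('r, 'c) ring_scheme \<Rightarrow> ('a, 'd) ring_scheme \<Rightarrow> ('r \<Rightarrow> 'a) \<Rightarrow>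
     ('r, 'm, 'e) module_scheme \<Rightarrow> ('r, 'n, 'f) module_scheme \<Rightarrow> ('m \<Rightarrow> 'n) \<Rightarrow>
     ('m \<times> 'a \<Rightarrow> 'a) set \<Rightarrow> ('n \<times> 'a \<Rightarrow> 'a) set" where
  "tensor_map R A \<phi> M N f =
     (THE h. h \<in> module_hom A (tensor R A \<phi> M) (tensor R A \<phi> N) \<and>
             h \<in> extensional (carrier (tensor R A \<phi> M)) \<and>
             (\<forall>m\<in>carrier M. \<forall>a\<in>carrier A.
                h (pure_tensor R A \<phi> M m a) = pure_tensor R A \<phi> N (f m) a))"

section \<open>Tor in degree one\<close>

text \<open>
  The start \<open>F\<^sub>2 \<rightarrow> F\<^sub>1 \<rightarrow> F\<^sub>0 \<rightarrow> M \<rightarrow> 0\<close> of the canonical free resolution: \<open>F\<^sub>0\<close> is free on the elements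
  of \<open>M\<close>, and each further \<open>F\<^sub>i\<close> is free on the elements of the kernel of the preceding map.
\<close>

definition free_eval ::
    "('r, 'c) ring_scheme \<Rightarrow> ('r, 'm, 'd) module_scheme \<Rightarrow> ('m \<Rightarrow> 'r) \<Rightarrow> 'm" where
  "free_eval R P g = module.lincomb P g {x. g x \<noteq> \<zero>\<^bsub>R\<^esub>}"

definition res0 :: "('r, 'c) ring_scheme \<Rightarrow> ('r, 'm, 'd) module_scheme \<Rightarrow> ('r, 'm \<Rightarrow> 'r) module" where
  "res0 R M = free_module R (carrier M)"

definition res1 ::
    "('r, 'c) ring_scheme \<Rightarrow> ('r, 'm, 'd) module_scheme \<Rightarrow> ('r, ('m \<Rightarrow> 'r) \<Rightarrow> 'r) module" where
  "res1 R M = free_module R (a_kernel (res0 R M) M (free_eval R M))"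

definition res2 ::
    "('r, 'c) ring_scheme \<Rightarrow> ('r, 'm, 'd) module_scheme \<Rightarrow>
     ('r, (('m \<Rightarrow> 'r) \<Rightarrow> 'r) \<Rightarrow> 'r) module" where
  "res2 R M = free_module R (a_kernel (res1 R M) (res0 R M) (free_eval R (res0 R M)))"

text \<open>
  \<open>Tor\<^sub>1\<^sup>R(M, A)\<close> as an \<open>A\<close>-module: the homology of
  \<open>F\<^sub>2 \<otimes> A \<rightarrow> F\<^sub>1 \<otimes> A \<rightarrow> F\<^sub>0 \<otimes> A\<close> in the middle.
\<close>

definition tor1 ::
    "('r, 'c) ring_scheme \<Rightarrow> ('a, 'd) ring_scheme \<Rightarrow> ('r \<Rightarrow> 'a) \<Rightarrow> ('r, 'm, 'e) module_scheme \<Rightarrow>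
     ('a, (((('m \<Rightarrow> 'r) \<Rightarrow> 'r) \<times> 'a \<Rightarrow> 'a) set) set) module" where
  "tor1 R A \<phi> M =
     (let T0 = tensor R A \<phi> (res0 R M); T1 = tensor R A \<phi> (res1 R M); T2 = tensor R A \<phi> (res2 R M);
          d1 = tensor_map R A \<phi> (res1 R M) (res0 R M) (free_eval R (res0 R M));
          d2 = tensor_map R A \<phi> (res2 R M) (res1 R M) (free_eval R (res1 R M))
      in quot_module A (T1\<lparr>carrier := a_kernel T1 T0 d1\<rparr>) (d2 ` carrier T2))"

section \<open>Fraction field, rank and torsion\<close>

text \<open>
  Fractions are classes of pairs under \<open>a d = c b\<close>; in sums and products the unions over
  representatives collapse to a single class, as for \<^const>\<open>quot_module\<close>.
\<close>

definition frac_rel :: "('a, 'c) ring_scheme \<Rightarrow> (('a \<times> 'a) \<times> ('a \<times> 'a)) set" where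
  "frac_rel R = {((a, b), (c, d)). a \<in> carrier R \<and> b \<in> carrier R - {\<zero>\<^bsub>R\<^esub>} \<and>
     c \<in> carrier R \<and> d \<in> carrier R - {\<zero>\<^bsub>R\<^esub>} \<and> a \<otimes>\<^bsub>R\<^esub> d = c \<otimes>\<^bsub>R\<^esub> b}"

definition frac :: "('a, 'c) ring_scheme \<Rightarrow> 'a \<Rightarrow> 'a \<Rightarrow> ('a \<times> 'a) set" where
  "frac R a b = frac_rel R `` {(a, b)}"

definition fraction_field :: "('a, 'c) ring_scheme \<Rightarrow> ('a \<times> 'a) set ring" where
  "fraction_field R =
     \<lparr>carrier = (carrier R \<times> (carrier R - {\<zero>\<^bsub>R\<^esub>})) // frac_rel R,
      mult = (\<lambda>X Y. \<Union>(a, b)\<in>X. \<Union>(c, d)\<in>Y. frac R (a \<otimes>\<^bsub>R\<^esub> c) (b \<otimes>\<^bsub>R\<^esub> d)),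
      one = frac R \<one>\<^bsub>R\<^esub> \<one>\<^bsub>R\<^esub>,
      zero = frac R \<zero>\<^bsub>R\<^esub> \<one>\<^bsub>R\<^esub>,
      add = (\<lambda>X Y. \<Union>(a, b)\<in>X. \<Union>(c, d)\<in>Y.
               frac R (a \<otimes>\<^bsub>R\<^esub> d \<oplus>\<^bsub>R\<^esub> c \<otimes>\<^bsub>R\<^esub> b) (b \<otimes>\<^bsub>R\<^esub> d))\<rparr>"

definition frac_embed :: "('a, 'c) ring_scheme \<Rightarrow> 'a \<Rightarrow> ('a \<times> 'a) set" where
  "frac_embed R r = frac R r \<one>\<^bsub>R\<^esub>"

definition frac_tensor ::
    "('r, 'c) ring_scheme \<Rightarrow> ('r, 'm, 'd) module_scheme \<Rightarrow>
     (('r \<times> 'r) set, ('m \<times> ('r \<times> 'r) set \<Rightarrow> ('r \<times> 'r) set) set) module" where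
  "frac_tensor R M = tensor R (fraction_field R) (frac_embed R) M"

definition module_rank :: "('r, 'c) ring_scheme \<Rightarrow> ('r, 'm, 'd) module_scheme \<Rightarrow> nat" where
  "module_rank R M = vectorspace.dim (fraction_field R) (frac_tensor R M)"

definition torsion_submodule :: "('r, 'c) ring_scheme \<Rightarrow> ('r, 'm, 'd) module_scheme \<Rightarrow> 'm set" where
  "torsion_submodule R M = a_kernel M (frac_tensor R M)
     (\<lambda>m. pure_tensor R (fraction_field R) (frac_embed R) M m \<one>\<^bsub>fraction_field R\<^esub>)"

section \<open>Partial trace ideals\<close>

definition surjects_onto_ideal ::
    "('r, 'c) ring_scheme \<Rightarrow> ('r, 'm, 'd) module_scheme \<Rightarrow> 'r set \<Rightarrow> bool" where
  "surjects_onto_ideal R M J \<longleftrightarrow>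
     ideal J R \<and> (\<exists>f \<in> module_hom R M (ideal_module R J). f ` carrier M = J)"

abbreviation colength :: "('r, 'c) ring_scheme \<Rightarrow> 'r set \<Rightarrow> enat" where
  "colength R J \<equiv> module_length R (quot_module R (ring_module R) J)"

text \<open>The infimum is attained: \<open>J = 0\<close> is always admissible, and \<^typ>\<open>enat\<close> is well-ordered.\<close>

definition h_inv :: "('r, 'c) ring_scheme \<Rightarrow> ('r, 'm, 'd) module_scheme \<Rightarrow> enat" where
  "h_inv R M = Inf {colength R J | J. surjects_onto_ideal R M J}"

definition partial_trace_ideal ::
    "('r, 'c) ring_scheme \<Rightarrow> ('r, 'm, 'd) module_scheme \<Rightarrow> 'r set \<Rightarrow> bool" where
  "partial_trace_ideal R M J \<longleftrightarrow> surjects_onto_ideal R M J \<and> colength R J = h_inv R M"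

end

theory Submission
  imports Defs
begin

text \<open>
  If \<open>M\<close> is torsion-free of rank one, then every nonzero linear map from \<open>M\<close> to \<open>R\<close> is
  injective, so \<open>M\<close> is isomorphic to a partial trace ideal \<open>J \<subseteq> \<mm>\<^sup>s\<close>. Let \<open>D\<close> be the dimension
  of \<open>Tor\<^sub>1(M, k)\<close> and \<open>l\<close> the length of \<open>\<mm>\<^sup>s/J\<close>. The hypothesis on \<open>h(M)\<close>, the length of \<open>R/J\<close>,
  is refuted by the inequality \<open>D + n h(M) \<ge> \<mu>(I) + n (n+s choose s) - (n+s choose s+1)\<close>, since
  \<open>(n+s choose s+1) = (n+s choose s) n/(s+1)\<close>.

  The inequality compares relations. For a presentation \<open>p\<close> of a module by a free module \<open>F\<close>,
  with kernel \<open>K\<close>, let \<open>rel_len\<close> be the length of \<open>(K \<inter> \<mm>F)/\<mm>K\<close>. It depends only on the module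
  presented (\<open>compare_presentations_len\<close>), and the canonical resolution shows that it is at most
  \<open>D\<close> for \<open>M\<close>, hence for \<open>J\<close> (\<open>rel_len_le_dim_tor\<close>). When an ideal grows by one step of length
  one, \<open>rel_len\<close> grows by at most \<open>n\<close>, the length of \<open>\<mm>/\<mm>\<^sup>2\<close> (\<open>gen_rel_len_larger_ideal\<close>). So
  \<open>rel_len\<close> is at most \<open>D + n l\<close> for the ideal \<open>\<mm>\<^sup>s\<close>.

  The same number is bounded below by the presentation of \<open>\<mm>\<^sup>s\<close> with the monomials of degree \<open>s\<close>
  as generators. Its relations lift to the forms over \<open>S\<close> whose value lies in \<open>I\<close>. As
  \<open>I \<subseteq> \<nn>\<^sup>s\<^sup>+\<^sup>1\<close>, quasi-regularity of a regular system of parameters puts all their coefficients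
  into \<open>\<nn>\<close>. The values in \<open>I\<close> contribute \<open>\<mu>(I)\<close>, and the forms with value zero at least
  \<open>n (n+s-1 choose s) - (n+s choose s+1)\<close> (\<open>monomial_relations_clen\<close>, \<open>clen_le_rel_len\<close>).

  Finally, \<open>h(M)\<close> is at least \<open>l\<close> plus the number of monomials of degree below \<open>s\<close>, because the
  monomials of each degree \<open>t < s\<close> are independent modulo \<open>\<mm>\<^sup>t\<^sup>+\<^sup>1\<close>: the ideal \<open>I\<close> starts in
  degree \<open>s + 1\<close> (\<open>colength_bound\<close>). There are \<open>(n+s choose s)\<close> monomials of degree at most \<open>s\<close>,
  and adding up gives the inequality (\<open>betti_bound\<close>, \<open>binomial_arith\<close>).

  Quasi-regularity is derived from the equality of dimension and number of generators: by
  Krull's principal ideal theorem the generators of \<open>\<nn>\<close> form a regular sequence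
  (\<open>prime_chain_regseq\<close>), and regular sequences are quasi-regular (\<open>quasi_regular\<close>).
\<close>

(* The symbol is used for sums of ideals and of submodules. *)
no_notation Sum_Type.Plus (infixr \<open><+>\<close> 65)

section \<open>Chains of sets\<close>

text \<open>
  Lengths are measured inside one ambient module, by chains between two submodules \<open>A\<close> and \<open>B\<close>.
  No quotient modules have to be formed, and comparing two lengths amounts to finding a map that
  preserves strict inclusions.
\<close>

definition chain_in :: "('b set \<Rightarrow> bool) \<Rightarrow> 'b set \<Rightarrow> 'b set \<Rightarrow> nat \<Rightarrow> (nat \<Rightarrow> 'b set) \<Rightarrow> bool" where
  "chain_in P A B l N \<longleftrightarrow> (\<forall>i\<le>l. P (N i) \<and> A \<subseteq> N i \<and> N i \<subseteq> B) \<and> (\<forall>i<l. N i \<subset> N (Suc i))"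

definition clen :: "('b set \<Rightarrow> bool) \<Rightarrow> 'b set \<Rightarrow> 'b set \<Rightarrow> enat" where
  "clen P A B = Sup {enat l | l. \<exists>N. chain_in P A B l N}"

lemma clen_leI: "(\<And>l N. chain_in P A B l N \<Longrightarrow> enat l \<le> k) \<Longrightarrow> clen P A B \<le> k"
  unfolding clen_def by (rule Sup_least) auto

lemma clen_geI: "chain_in P A B l N \<Longrightarrow> enat l \<le> clen P A B"
  unfolding clen_def by (rule Sup_upper) auto

lemma chain_in_prefix: "chain_in P A B l N \<Longrightarrow> k \<le> l \<Longrightarrow> chain_in P A B k N"
  unfolding chain_in_def by auto

lemma clen_ge_iff:
  assumes "P A" "A \<subseteq> B"
  shows "enat k \<le> clen P A B \<longleftrightarrow> (\<exists>N. chain_in P A B k N)"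
proof
  assume k: "enat k \<le> clen P A B"
  show "\<exists>N. chain_in P A B k N"
  proof (rule ccontr)
    assume no: "\<nexists>N. chain_in P A B k N"
    have "chain_in P A B 0 (\<lambda>_. A)" using assms by (auto simp: chain_in_def)
    with no have k0: "k > 0" by (metis gr0I)
    have "clen P A B \<le> enat (k - 1)"
    proof (rule clen_leI)
      fix l N assume "chain_in P A B l N"
      with no chain_in_prefix have "\<not> k \<le> l" by metis
      then show "enat l \<le> enat (k - 1)" by simp
    qed
    with k have "enat k \<le> enat (k - 1)" by (rule order_trans)
    with k0 show False by simp
  qed
qed (use clen_geI in blast)

text \<open>Adding lengths through their finite lower bounds covers the infinite cases as well.\<close>

lemma enat_add_leI:
  assumes "\<And>a b. enat a \<le> x \<Longrightarrow> enat b \<le> y \<Longrightarrow> enat (a + b) \<le> z"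
  shows "x + y \<le> (z :: enat)"
proof (cases x; cases y)
  fix a b assume "x = enat a" "y = enat b" then show ?thesis using assms[of a b] by simp
next
  fix a assume x: "x = enat a" and y: "y = \<infinity>"
  have "enat b \<le> z" for b
    using assms[of a b] x y by (metis enat_ord_simps(1) enat_ord_simps(3) le_add2 order_refl order_trans)
  then show ?thesis by (metis enat.exhaust enat_ord_simps(1) enat_ord_simps(3) not_less_eq_eq order_refl)
next
  fix b assume y: "y = enat b" and x: "x = \<infinity>"
  have "enat a \<le> z" for a
    using assms[of a b] x y by (metis enat_ord_simps(1) enat_ord_simps(3) le_add1 order_refl order_trans)
  then show ?thesis by (metis enat.exhaust enat_ord_simps(1) enat_ord_simps(3) not_less_eq_eq order_refl)
next
  assume y: "y = \<infinity>" and x: "x = \<infinity>"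
  have "enat a \<le> z" for a
    using assms[of a 0] x y by simp
  then show ?thesis by (metis enat.exhaust enat_ord_simps(1) enat_ord_simps(3) not_less_eq_eq order_refl)
qed

lemma clen_superadd:
  assumes "P A" "A \<subseteq> B" "P B" "B \<subseteq> C"
  shows "clen P A B + clen P B C \<le> clen P A C"
proof (rule enat_add_leI)
  fix a b assume "enat a \<le> clen P A B" "enat b \<le> clen P B C"
  then obtain N N' where N: "chain_in P A B a N" and N': "chain_in P B C b N'"
    using clen_ge_iff assms by metis
  have "chain_in P A C (a + b) (\<lambda>i. if i \<le> a then N i else N' (i - a))"
    unfolding chain_in_def
  proof (intro conjI allI impI)
    fix i assume i: "i \<le> a + b"
    have "i \<le> a \<Longrightarrow> P (N i) \<and> A \<subseteq> N i \<and> N i \<subseteq> B" "P (N' (i - a)) \<and> B \<subseteq> N' (i - a) \<and> N' (i - a) \<subseteq> C"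
      using N N' i unfolding chain_in_def by auto
    then show "P (if i \<le> a then N i else N' (i - a))" "A \<subseteq> (if i \<le> a then N i else N' (i - a))"
      "(if i \<le> a then N i else N' (i - a)) \<subseteq> C"
      using assms(2,4) by (simp_all split: if_split) (meson order_trans)+
  next
    fix i assume i: "i < a + b"
    show "(if i \<le> a then N i else N' (i - a)) \<subset> (if Suc i \<le> a then N (Suc i) else N' (Suc i - a))"
    proof (cases "Suc i \<le> a")
      case True then show ?thesis using N unfolding chain_in_def by auto
    next
      case False
      have *: "N' (i - a) \<subset> N' (Suc (i - a))" using N' i False unfolding chain_in_def by auto
      show ?thesis
      proof (cases "i = a")
        case True
        have "N a \<subseteq> B" "B \<subseteq> N' 0" using N N' unfolding chain_in_def by auto
        with * True show ?thesis by auto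
      next
        case False with \<open>\<not> Suc i \<le> a\<close> * show ?thesis by (auto simp: Suc_diff_le)
      qed
    qed
  qed
  then show "enat (a + b) \<le> clen P A C" by (rule clen_geI)
qed

lemma clen_map_le:
  assumes "\<And>V. P V \<Longrightarrow> A \<subseteq> V \<Longrightarrow> V \<subseteq> B \<Longrightarrow> Q (\<Phi> V) \<and> A' \<subseteq> \<Phi> V \<and> \<Phi> V \<subseteq> B'"
    and "\<And>V W. P V \<Longrightarrow> P W \<Longrightarrow> A \<subseteq> V \<Longrightarrow> V \<subset> W \<Longrightarrow> W \<subseteq> B \<Longrightarrow> \<Phi> V \<subset> \<Phi> W"
  shows "clen P A B \<le> clen Q A' B'"
proof (rule clen_leI)
  fix l N assume N: "chain_in P A B l N"
  have 1: "\<And>i. i \<le> l \<Longrightarrow> P (N i) \<and> A \<subseteq> N i \<and> N i \<subseteq> B" using N unfolding chain_in_def by auto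
  have "\<Phi> (N i) \<subset> \<Phi> (N (Suc i))" if "i < l" for i
    using 1[of i] 1[of "Suc i"] that N assms(2) unfolding chain_in_def by auto
  then have "chain_in Q A' B' l (\<lambda>i. \<Phi> (N i))"
    using 1 assms(1) unfolding chain_in_def by auto
  then show "enat l \<le> clen Q A' B'" by (rule clen_geI)
qed

lemma clen_mono:
  assumes "A' \<subseteq> A" "B \<subseteq> B'"
  shows "clen P A B \<le> clen P A' B'"
  by (rule clen_map_le[where \<Phi> = "\<lambda>V. V"]) (use assms in auto)

lemma chain_in_extend:
  assumes "chain_in P A B l N" "P V" "V \<subseteq> B" "N l \<subset> V"
  shows "\<exists>N'. chain_in P A B (Suc l) N' \<and> N' (Suc l) = V"
proof (rule exI[of _ "N(Suc l := V)"], unfold chain_in_def, intro conjI allI impI)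
  show "(N(Suc l := V)) (Suc l) = V" by simp
next
  fix i assume "i \<le> Suc l"
  moreover have "A \<subseteq> V" using assms unfolding chain_in_def by auto
  ultimately show "P ((N(Suc l := V)) i)" "A \<subseteq> (N(Suc l := V)) i" "(N(Suc l := V)) i \<subseteq> B"
    using assms unfolding chain_in_def by (auto simp: le_Suc_eq)
next
  fix i assume "i < Suc l"
  then show "(N(Suc l := V)) i \<subset> (N(Suc l := V)) (Suc i)"
    using assms unfolding chain_in_def by (auto simp: less_Suc_eq)
qed

lemma chain_in_raise:
  assumes "chain_in P A B l N" "P V" "V \<subseteq> B" "N l \<subseteq> V"
  shows "\<exists>N'. chain_in P A B l N' \<and> N' l = V"
proof (rule exI[of _ "N(l := V)"], unfold chain_in_def, intro conjI allI impI)
  show "(N(l := V)) l = V" by simp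
next
  fix i assume "i \<le> l"
  moreover have "A \<subseteq> V" using assms unfolding chain_in_def by auto
  ultimately show "P ((N(l := V)) i)" "A \<subseteq> (N(l := V)) i" "(N(l := V)) i \<subseteq> B"
    using assms unfolding chain_in_def by auto
next
  fix i assume "i < l"
  then show "(N(l := V)) i \<subset> (N(l := V)) (Suc i)"
    using assms unfolding chain_in_def by (cases "Suc i = l") (auto, (meson less_or_eq_imp_le lessI psubsetD subsetD)+)
qed

text \<open>
  Each step of a chain is strict under one of the two maps; the images of the chain, with
  repetitions removed, are two chains that share its steps.
\<close>

lemma clen_two_maps_le:
  assumes 1: "\<And>V. P V \<Longrightarrow> A \<subseteq> V \<Longrightarrow> V \<subseteq> B \<Longrightarrow> Q (\<Phi> V) \<and> A\<^sub>1 \<subseteq> \<Phi> V \<and> \<Phi> V \<subseteq> B\<^sub>1"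
    and 2: "\<And>V. P V \<Longrightarrow> A \<subseteq> V \<Longrightarrow> V \<subseteq> B \<Longrightarrow> Q' (\<Psi> V) \<and> A\<^sub>2 \<subseteq> \<Psi> V \<and> \<Psi> V \<subseteq> B\<^sub>2"
    and mono: "\<And>V W. V \<subseteq> W \<Longrightarrow> \<Phi> V \<subseteq> \<Phi> W \<and> \<Psi> V \<subseteq> \<Psi> W"
    and strict: "\<And>V W. P V \<Longrightarrow> P W \<Longrightarrow> A \<subseteq> V \<Longrightarrow> V \<subset> W \<Longrightarrow> W \<subseteq> B \<Longrightarrow> \<Phi> V \<subset> \<Phi> W \<or> \<Psi> V \<subset> \<Psi> W"
  shows "clen P A B \<le> clen Q A\<^sub>1 B\<^sub>1 + clen Q' A\<^sub>2 B\<^sub>2"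
proof (rule clen_leI)
  fix l N assume N: "chain_in P A B l N"
  have "\<exists>l\<^sub>1 l\<^sub>2 N\<^sub>1 N\<^sub>2. k \<le> l\<^sub>1 + l\<^sub>2 \<and> chain_in Q A\<^sub>1 B\<^sub>1 l\<^sub>1 N\<^sub>1 \<and> N\<^sub>1 l\<^sub>1 = \<Phi> (N k) \<and>
      chain_in Q' A\<^sub>2 B\<^sub>2 l\<^sub>2 N\<^sub>2 \<and> N\<^sub>2 l\<^sub>2 = \<Psi> (N k)" if "k \<le> l" for k
    using that
  proof (induction k)
    case 0
    have "P (N 0)" "A \<subseteq> N 0" "N 0 \<subseteq> B" using N unfolding chain_in_def by auto
    then have "chain_in Q A\<^sub>1 B\<^sub>1 0 (\<lambda>_. \<Phi> (N 0))" "chain_in Q' A\<^sub>2 B\<^sub>2 0 (\<lambda>_. \<Psi> (N 0))"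
      using 1 2 unfolding chain_in_def by auto
    then show ?case by (intro exI[of _ 0] exI[of _ "\<lambda>_. \<Phi> (N 0)"] exI[of _ "\<lambda>_. \<Psi> (N 0)"]) auto
  next
    case (Suc k)
    then obtain l\<^sub>1 l\<^sub>2 N\<^sub>1 N\<^sub>2 where IH: "k \<le> l\<^sub>1 + l\<^sub>2" "chain_in Q A\<^sub>1 B\<^sub>1 l\<^sub>1 N\<^sub>1" "N\<^sub>1 l\<^sub>1 = \<Phi> (N k)"
      "chain_in Q' A\<^sub>2 B\<^sub>2 l\<^sub>2 N\<^sub>2" "N\<^sub>2 l\<^sub>2 = \<Psi> (N k)" by auto
    have P: "P (N k)" "A \<subseteq> N k" "N k \<subset> N (Suc k)" "P (N (Suc k))" "A \<subseteq> N (Suc k)" "N (Suc k) \<subseteq> B"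
      using N Suc.prems unfolding chain_in_def by auto
    note ext1 = 1[OF P(4-6)] and ext2 = 2[OF P(4-6)]
    have m: "N\<^sub>1 l\<^sub>1 \<subseteq> \<Phi> (N (Suc k))" "N\<^sub>2 l\<^sub>2 \<subseteq> \<Psi> (N (Suc k))" using mono P IH by auto
    from strict[OF P(1,4,2,3,6)] show ?case
    proof
      assume "\<Phi> (N k) \<subset> \<Phi> (N (Suc k))"
      then obtain N\<^sub>1' where a: "chain_in Q A\<^sub>1 B\<^sub>1 (Suc l\<^sub>1) N\<^sub>1'" "N\<^sub>1' (Suc l\<^sub>1) = \<Phi> (N (Suc k))"
        using chain_in_extend[OF IH(2)] ext1 IH(3) by metis
      obtain N\<^sub>2' where b: "chain_in Q' A\<^sub>2 B\<^sub>2 l\<^sub>2 N\<^sub>2'" "N\<^sub>2' l\<^sub>2 = \<Psi> (N (Suc k))"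
        using chain_in_raise[OF IH(4)] ext2 m by metis
      show ?thesis using a b IH(1) by (intro exI[of _ "Suc l\<^sub>1"] exI[of _ l\<^sub>2]) auto
    next
      assume "\<Psi> (N k) \<subset> \<Psi> (N (Suc k))"
      then obtain N\<^sub>2' where a: "chain_in Q' A\<^sub>2 B\<^sub>2 (Suc l\<^sub>2) N\<^sub>2'" "N\<^sub>2' (Suc l\<^sub>2) = \<Psi> (N (Suc k))"
        using chain_in_extend[OF IH(4)] ext2 IH(5) by metis
      obtain N\<^sub>1' where b: "chain_in Q A\<^sub>1 B\<^sub>1 l\<^sub>1 N\<^sub>1'" "N\<^sub>1' l\<^sub>1 = \<Phi> (N (Suc k))"
        using chain_in_raise[OF IH(2)] ext1 m by metis
      show ?thesis using a b IH(1) by (intro exI[of _ l\<^sub>1] exI[of _ "Suc l\<^sub>2"]) auto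
    qed
  qed
  then obtain l\<^sub>1 l\<^sub>2 N\<^sub>1 N\<^sub>2 where "l \<le> l\<^sub>1 + l\<^sub>2" "chain_in Q A\<^sub>1 B\<^sub>1 l\<^sub>1 N\<^sub>1" "chain_in Q' A\<^sub>2 B\<^sub>2 l\<^sub>2 N\<^sub>2" by blast
  then have "enat l \<le> enat l\<^sub>1 + enat l\<^sub>2" "enat l\<^sub>1 \<le> clen Q A\<^sub>1 B\<^sub>1" "enat l\<^sub>2 \<le> clen Q' A\<^sub>2 B\<^sub>2"
    using clen_geI by auto
  then show "enat l \<le> clen Q A\<^sub>1 B\<^sub>1 + clen Q' A\<^sub>2 B\<^sub>2" by (meson add_mono order_trans)
qed

section \<open>Submodules\<close>

abbreviation subm :: "('a, 'c) ring_scheme \<Rightarrow> ('a, 'b, 'd) module_scheme \<Rightarrow> 'b set \<Rightarrow> bool" where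
  "subm R M N \<equiv> Module.submodule N R M"

text \<open>
  The product of an ideal and a submodule. Closure under scalars is automatic because \<open>I\<close>
  absorbs them.
\<close>

inductive_set iprod :: "('a, 'b, 'd) module_scheme \<Rightarrow> 'a set \<Rightarrow> 'b set \<Rightarrow> 'b set"
  for M I N where
    prod: "i \<in> I \<Longrightarrow> x \<in> N \<Longrightarrow> i \<odot>\<^bsub>M\<^esub> x \<in> iprod M I N"
  | sum: "u \<in> iprod M I N \<Longrightarrow> v \<in> iprod M I N \<Longrightarrow> u \<oplus>\<^bsub>M\<^esub> v \<in> iprod M I N"

lemma iprod_mono: "I \<subseteq> I' \<Longrightarrow> N \<subseteq> N' \<Longrightarrow> iprod M I N \<subseteq> iprod M I' N'"
proof
  fix x assume "I \<subseteq> I'" "N \<subseteq> N'" "x \<in> iprod M I N"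
  from this(3,1,2) show "x \<in> iprod M I' N'" by induction (auto intro: iprod.intros)
qed

context module begin

lemma subm_carrier: "subm R M N \<Longrightarrow> x \<in> N \<Longrightarrow> x \<in> carrier M"
  using submoduleE(1) by blast
lemma subm_subset: "subm R M N \<Longrightarrow> N \<subseteq> carrier M"
  using submoduleE(1) by blast
lemma subm_add: "subm R M N \<Longrightarrow> x \<in> N \<Longrightarrow> y \<in> N \<Longrightarrow> x \<oplus>\<^bsub>M\<^esub> y \<in> N"
  using submoduleE(5) by blast
lemma subm_smult: "subm R M N \<Longrightarrow> r \<in> carrier R \<Longrightarrow> x \<in> N \<Longrightarrow> r \<odot>\<^bsub>M\<^esub> x \<in> N"
  using submoduleE(4) by blast
lemma subm_neg: "subm R M N \<Longrightarrow> x \<in> N \<Longrightarrow> \<ominus>\<^bsub>M\<^esub> x \<in> N"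
  using submoduleE(3) by blast
lemma subm_zero: "subm R M N \<Longrightarrow> \<zero>\<^bsub>M\<^esub> \<in> N"
  using subgroup.one_closed[OF submodule.axioms(1)] by fastforce
lemma subm_minus: "subm R M N \<Longrightarrow> x \<in> N \<Longrightarrow> y \<in> N \<Longrightarrow> x \<ominus>\<^bsub>M\<^esub> y \<in> N"
  by (simp add: a_minus_def subm_add subm_neg)

lemma submI:
  assumes "H \<subseteq> carrier M" "\<zero>\<^bsub>M\<^esub> \<in> H" "\<And>a b. a \<in> H \<Longrightarrow> b \<in> H \<Longrightarrow> a \<oplus>\<^bsub>M\<^esub> b \<in> H"
    "\<And>a x. a \<in> carrier R \<Longrightarrow> x \<in> H \<Longrightarrow> a \<odot>\<^bsub>M\<^esub> x \<in> H"
  shows "subm R M H"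
proof (rule submoduleI)
  fix a assume a: "a \<in> H"
  have "\<ominus>\<^bsub>M\<^esub> a = (\<ominus> \<one>) \<odot>\<^bsub>M\<^esub> a" using a assms(1) smult_minus_1 by auto
  then show "\<ominus>\<^bsub>M\<^esub> a \<in> H" using assms(4) a by auto
qed (use assms in auto)

lemma subm_add_cancel:
  assumes "subm R M N" "x \<oplus>\<^bsub>M\<^esub> y \<in> N" "x \<in> N" "y \<in> carrier M"
  shows "y \<in> N"
proof -
  have "y = (x \<oplus>\<^bsub>M\<^esub> y) \<ominus>\<^bsub>M\<^esub> x"
    using assms subm_carrier[OF assms(1,3)]
    by (simp add: a_minus_def M.a_assoc M.a_comm M.r_neg1)
  then show ?thesis using subm_minus assms by metis
qed

lemma minus_add_cancel: "x \<in> carrier M \<Longrightarrow> y \<in> carrier M \<Longrightarrow> (x \<ominus>\<^bsub>M\<^esub> y) \<oplus>\<^bsub>M\<^esub> y = x"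
  by (simp add: a_minus_def M.a_assoc M.l_neg)

lemma subm_minus_cancel:
  assumes "subm R M N" "x \<ominus>\<^bsub>M\<^esub> y \<in> N" "y \<in> N" "x \<in> carrier M"
  shows "x \<in> N"
  using subm_add[OF assms(1,2,3)] minus_add_cancel assms subm_carrier by metis

lemma subm_inter: "subm R M A \<Longrightarrow> subm R M B \<Longrightarrow> subm R M (A \<inter> B)"
  by (rule submI) (auto simp: subm_carrier subm_zero subm_add subm_smult)

lemma smult_l_diff: "r \<in> carrier R \<Longrightarrow> s \<in> carrier R \<Longrightarrow> x \<in> carrier M \<Longrightarrow>
    (r \<ominus> s) \<odot>\<^bsub>M\<^esub> x = r \<odot>\<^bsub>M\<^esub> x \<ominus>\<^bsub>M\<^esub> s \<odot>\<^bsub>M\<^esub> x"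
  by (simp add: R.minus_eq M.minus_eq smult_l_distr smult_l_minus)

lemma smult_r_diff: "r \<in> carrier R \<Longrightarrow> x \<in> carrier M \<Longrightarrow> y \<in> carrier M \<Longrightarrow>
    r \<odot>\<^bsub>M\<^esub> (x \<ominus>\<^bsub>M\<^esub> y) = r \<odot>\<^bsub>M\<^esub> x \<ominus>\<^bsub>M\<^esub> r \<odot>\<^bsub>M\<^esub> y"
  by (simp add: M.minus_eq smult_r_distr smult_r_minus)

lemma diff_add_diff: "a \<in> carrier M \<Longrightarrow> b \<in> carrier M \<Longrightarrow> c \<in> carrier M \<Longrightarrow> d \<in> carrier M \<Longrightarrow>
    (a \<oplus>\<^bsub>M\<^esub> b) \<ominus>\<^bsub>M\<^esub> (c \<oplus>\<^bsub>M\<^esub> d) = (a \<ominus>\<^bsub>M\<^esub> c) \<oplus>\<^bsub>M\<^esub> (b \<ominus>\<^bsub>M\<^esub> d)"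
  by (simp add: M.minus_eq M.minus_add M.a_ac)

lemma set_add_subm:
  assumes "subm R M A" "subm R M B"
  shows "subm R M (A <+>\<^bsub>M\<^esub> B)"
proof (rule submI)
  show "A <+>\<^bsub>M\<^esub> B \<subseteq> carrier M" using assms by (auto simp: set_add_def' subm_carrier)
  show "\<zero>\<^bsub>M\<^esub> \<in> A <+>\<^bsub>M\<^esub> B" using subm_zero[OF assms(1)] subm_zero[OF assms(2)]
    by (force simp: set_add_def')
next
  fix u v assume "u \<in> A <+>\<^bsub>M\<^esub> B" "v \<in> A <+>\<^bsub>M\<^esub> B"
  then obtain a b a' b' where *: "a \<in> A" "b \<in> B" "a' \<in> A" "b' \<in> B" "u = a \<oplus>\<^bsub>M\<^esub> b" "v = a' \<oplus>\<^bsub>M\<^esub> b'"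
    by (auto simp: set_add_def')
  then have "u \<oplus>\<^bsub>M\<^esub> v = (a \<oplus>\<^bsub>M\<^esub> a') \<oplus>\<^bsub>M\<^esub> (b \<oplus>\<^bsub>M\<^esub> b')"
    using assms by (simp add: subm_carrier M.a_ac)
  then show "u \<oplus>\<^bsub>M\<^esub> v \<in> A <+>\<^bsub>M\<^esub> B"
    using * assms subm_add unfolding set_add_def' by blast
next
  fix r u assume r: "r \<in> carrier R" and "u \<in> A <+>\<^bsub>M\<^esub> B"
  then obtain a b where *: "a \<in> A" "b \<in> B" "u = a \<oplus>\<^bsub>M\<^esub> b" by (auto simp: set_add_def')
  then have "r \<odot>\<^bsub>M\<^esub> u = r \<odot>\<^bsub>M\<^esub> a \<oplus>\<^bsub>M\<^esub> r \<odot>\<^bsub>M\<^esub> b" using assms r by (simp add: subm_carrier smult_r_distr)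
  then show "r \<odot>\<^bsub>M\<^esub> u \<in> A <+>\<^bsub>M\<^esub> B"
    using * assms r subm_smult unfolding set_add_def' by blast
qed

lemma set_addI: "a \<in> A \<Longrightarrow> b \<in> B \<Longrightarrow> a \<oplus>\<^bsub>M\<^esub> b \<in> A <+>\<^bsub>M\<^esub> B"
  by (auto simp: set_add_def')

lemma set_addE: "u \<in> A <+>\<^bsub>M\<^esub> B \<Longrightarrow> (\<And>a b. a \<in> A \<Longrightarrow> b \<in> B \<Longrightarrow> u = a \<oplus>\<^bsub>M\<^esub> b \<Longrightarrow> thesis) \<Longrightarrow> thesis"
  by (auto simp: set_add_def')

lemma set_add_upper1: "subm R M A \<Longrightarrow> subm R M B \<Longrightarrow> A \<subseteq> A <+>\<^bsub>M\<^esub> B"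
  using set_addI[of _ A "\<zero>\<^bsub>M\<^esub>" B] subm_zero[of B] subm_carrier[of A] by fastforce

lemma set_add_upper2: "subm R M A \<Longrightarrow> subm R M B \<Longrightarrow> B \<subseteq> A <+>\<^bsub>M\<^esub> B"
  using set_addI[of "\<zero>\<^bsub>M\<^esub>" A _ B] subm_zero[of A] subm_carrier[of B] by fastforce

lemma set_add_least: "subm R M C \<Longrightarrow> A \<subseteq> C \<Longrightarrow> B \<subseteq> C \<Longrightarrow> A <+>\<^bsub>M\<^esub> B \<subseteq> C"
  using subm_add[of C] by (fastforce simp: set_add_def')

definition cyclic :: "'c \<Rightarrow> 'c set" where "cyclic x = {r \<odot>\<^bsub>M\<^esub> x | r. r \<in> carrier R}"

lemma cyclic_subm: "x \<in> carrier M \<Longrightarrow> subm R M (cyclic x)"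
  unfolding cyclic_def
  by (rule submI) (auto simp: smult_l_distr[symmetric] smult_assoc1[symmetric] intro: exI[of _ "\<zero>"])

lemma cyclic_self: "x \<in> carrier M \<Longrightarrow> x \<in> cyclic x"
  unfolding cyclic_def using smult_one by force

lemma cyclic_least: "subm R M C \<Longrightarrow> x \<in> C \<Longrightarrow> cyclic x \<subseteq> C"
  unfolding cyclic_def using subm_smult by auto

lemma iprod_subset: "I \<subseteq> carrier R \<Longrightarrow> subm R M N \<Longrightarrow> iprod M I N \<subseteq> N"
proof
  fix x assume "x \<in> iprod M I N" "I \<subseteq> carrier R" "subm R M N"
  then show "x \<in> N" by induction (auto simp: subm_smult subm_add)
qed

lemma iprod_least:
  assumes "subm R M C" "\<And>i x. i \<in> I \<Longrightarrow> x \<in> N \<Longrightarrow> i \<odot>\<^bsub>M\<^esub> x \<in> C"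
  shows "iprod M I N \<subseteq> C"
proof
  fix x assume "x \<in> iprod M I N"
  then show "x \<in> C" by induction (use assms subm_add in auto)
qed

lemma iprod_subm:
  assumes "ideal I R" "subm R M N"
  shows "subm R M (iprod M I N)"
proof (rule submI)
  interpret I: ideal I R by fact
  have IR: "I \<subseteq> carrier R" using I.Icarr by auto
  have NM: "N \<subseteq> carrier M" using assms subm_carrier by auto
  show c: "iprod M I N \<subseteq> carrier M" using iprod_subset[OF IR assms(2)] subm_carrier[OF assms(2)] by blast
  show "\<zero>\<^bsub>M\<^esub> \<in> iprod M I N"
    using iprod.prod[OF I.zero_closed subm_zero[OF assms(2)], of M] by simp
  show "a \<oplus>\<^bsub>M\<^esub> b \<in> iprod M I N" if "a \<in> iprod M I N" "b \<in> iprod M I N" for a b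
    using that by (rule iprod.sum)
  fix r x assume r: "r \<in> carrier R" and "x \<in> iprod M I N"
  from this(2) show "r \<odot>\<^bsub>M\<^esub> x \<in> iprod M I N"
  proof induction
    case (prod i x)
    have "r \<odot>\<^bsub>M\<^esub> (i \<odot>\<^bsub>M\<^esub> x) = (r \<otimes> i) \<odot>\<^bsub>M\<^esub> x"
      using r prod IR NM by (simp add: smult_assoc1 subset_iff)
    then show ?case using prod r I.I_l_closed by (auto intro: iprod.prod)
  next
    case (sum u v)
    then have "u \<in> carrier M" "v \<in> carrier M" using c by auto
    then show ?case using r sum by (auto simp: smult_r_distr intro: iprod.sum)
  qed
qed

end

section \<open>Module homomorphisms\<close>

lemma mod_homI: "module R M \<Longrightarrow> module R N \<Longrightarrow> f \<in> module_hom R M N \<Longrightarrow> mod_hom R M N f"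
  by (simp add: mod_hom_def mod_hom_axioms_def)

lemma module_homI:
  assumes "\<And>x. x \<in> carrier M \<Longrightarrow> f x \<in> carrier N"
    "\<And>x y. x \<in> carrier M \<Longrightarrow> y \<in> carrier M \<Longrightarrow> f (x \<oplus>\<^bsub>M\<^esub> y) = f x \<oplus>\<^bsub>N\<^esub> f y"
    "\<And>r x. r \<in> carrier R \<Longrightarrow> x \<in> carrier M \<Longrightarrow> f (r \<odot>\<^bsub>M\<^esub> x) = r \<odot>\<^bsub>N\<^esub> f x"
  shows "f \<in> module_hom R M N"
  using assms unfolding module_hom_def by auto

context mod_hom begin

lemma subm_vimage:
  assumes "subm R N V" shows "subm R M {x \<in> carrier M. f x \<in> V}"
  by (rule M.submI) (use assms in \<open>auto simp: N.subm_zero N.subm_add N.subm_smult\<close>)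

lemma subm_image:
  assumes "subm R M V" shows "subm R N (f ` V)"
proof (rule N.submI)
  note c = M.subm_carrier[OF assms]
  show "f ` V \<subseteq> carrier N" using c by auto
  show "\<zero>\<^bsub>N\<^esub> \<in> f ` V" using M.subm_zero[OF assms] by force
  fix a b assume "a \<in> f ` V" "b \<in> f ` V"
  then obtain x y where "x \<in> V" "y \<in> V" "a = f x" "b = f y" by auto
  then show "a \<oplus>\<^bsub>N\<^esub> b \<in> f ` V" using M.subm_add[OF assms] c f_add by (metis imageI)
next
  fix r b assume "r \<in> carrier R" "b \<in> f ` V"
  then obtain y where "y \<in> V" "b = f y" by auto
  then show "r \<odot>\<^bsub>N\<^esub> b \<in> f ` V"
    using M.subm_smult[OF assms] M.subm_carrier[OF assms] f_smult \<open>r \<in> carrier R\<close> by (metis imageI)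
qed

definition hker where "hker = {x \<in> carrier M. f x = \<zero>\<^bsub>N\<^esub>}"

lemma hker_subm: "subm R M hker"
  unfolding hker_def by (rule M.submI) auto

lemma image_iprod: "I \<subseteq> carrier R \<Longrightarrow> V \<subseteq> carrier M \<Longrightarrow> x \<in> iprod M I V \<Longrightarrow> f x \<in> iprod N I (f ` V)"
proof -
  assume I: "I \<subseteq> carrier R" and V: "V \<subseteq> carrier M" and "x \<in> iprod M I V"
  from this(3) have "x \<in> carrier M \<and> f x \<in> iprod N I (f ` V)"
  proof induction
    case (prod i x)
    then have "i \<in> carrier R" "x \<in> carrier M" using I V by auto
    then show ?case using prod by (auto intro!: iprod.prod)
  next
    case (sum u v) then show ?case by (auto intro: iprod.sum)
  qed
  then show ?thesis ..
qed

text \<open>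
  Comparable submodules with the same intersection with the kernel and the same image are equal,
  so each step of a chain survives in the kernel or in the image.
\<close>

lemma clen_le_kernel_image:
  assumes A: "subm R M A" and C: "subm R M C"
  shows "clen (subm R M) A C \<le> clen (subm R M) (A \<inter> hker) (C \<inter> hker) + clen (subm R N) (f ` A) (f ` C)"
proof (rule clen_two_maps_le[where \<Phi> = "\<lambda>V. V \<inter> hker" and \<Psi> = "\<lambda>V. f ` V"])
  fix V W assume VW: "subm R M V" "subm R M W" "A \<subseteq> V" "V \<subset> W" "W \<subseteq> C"
  show "V \<inter> hker \<subset> W \<inter> hker \<or> f ` V \<subset> f ` W"
  proof (rule ccontr)
    assume "\<not> ?thesis"
    then have eq: "V \<inter> hker = W \<inter> hker" "f ` V = f ` W" using VW by auto
    have "W \<subseteq> V"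
    proof
      fix w assume w: "w \<in> W"
      then obtain v where v: "v \<in> V" "f v = f w" using eq(2) by (metis imageE imageI)
      have c: "w \<in> carrier M" "v \<in> carrier M" using w v VW M.subm_carrier by auto
      have "w \<ominus>\<^bsub>M\<^esub> v \<in> W" using w v VW by (auto simp: M.subm_minus)
      moreover have "f (w \<ominus>\<^bsub>M\<^esub> v) = \<zero>\<^bsub>N\<^esub>" using c v by simp
      ultimately have "w \<ominus>\<^bsub>M\<^esub> v \<in> W \<inter> hker" using c unfolding hker_def by simp
      then have "w \<ominus>\<^bsub>M\<^esub> v \<in> V" unfolding eq(1)[symmetric] by (rule IntD1)
      then show "w \<in> V" by (rule M.subm_minus_cancel[OF VW(1) _ v(1) c(1)])
    qed
    then show False using VW by auto
  qed
qed (auto simp: M.subm_inter hker_subm subm_image)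

end

context module begin

text \<open>
  Comparable submodules with the same intersection with \<open>B\<close> and the same sum with \<open>B\<close> are equal,
  by the modular law.
\<close>

lemma clen_subadd:
  assumes "subm R M A" "subm R M B" "subm R M C" "A \<subseteq> B" "B \<subseteq> C"
  shows "clen (subm R M) A C \<le> clen (subm R M) A B + clen (subm R M) B C"
proof (rule clen_two_maps_le[where \<Phi> = "\<lambda>V. V \<inter> B" and \<Psi> = "\<lambda>V. V <+>\<^bsub>M\<^esub> B"])
  fix V W assume VW: "subm R M V" "subm R M W" "A \<subseteq> V" "V \<subset> W" "W \<subseteq> C"
  show "V \<inter> B \<subset> W \<inter> B \<or> V <+>\<^bsub>M\<^esub> B \<subset> W <+>\<^bsub>M\<^esub> B"
  proof (rule ccontr)
    assume "\<not> ?thesis"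
    moreover have "V <+>\<^bsub>M\<^esub> B \<subseteq> W <+>\<^bsub>M\<^esub> B" using VW by (auto simp: set_add_def')
    ultimately have eq: "V \<inter> B = W \<inter> B" "V <+>\<^bsub>M\<^esub> B = W <+>\<^bsub>M\<^esub> B" using VW by auto
    have "W \<subseteq> V"
    proof
      fix w assume w: "w \<in> W"
      then have "w \<in> V <+>\<^bsub>M\<^esub> B" using set_add_upper1[OF VW(2) assms(2)] eq(2) by blast
      then obtain v b where vb: "v \<in> V" "b \<in> B" "w = v \<oplus>\<^bsub>M\<^esub> b" by (rule set_addE)
      then have "b \<in> W" using subm_add_cancel[OF VW(2), of v b] w VW assms subm_carrier by auto
      then have "b \<in> W \<inter> B" using vb by simp
      then have "b \<in> V" unfolding eq(1)[symmetric] by (rule IntD1)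
      then show "w \<in> V" using vb subm_add VW by auto
    qed
    then show False using VW by auto
  qed
next
  fix V assume "subm R M V" "A \<subseteq> V" "V \<subseteq> C"
  then show "subm R M (V <+>\<^bsub>M\<^esub> B) \<and> B \<subseteq> V <+>\<^bsub>M\<^esub> B \<and> V <+>\<^bsub>M\<^esub> B \<subseteq> C"
    using assms set_add_subm set_add_upper2 set_add_least by simp
qed (use assms in \<open>auto simp: subm_inter set_add_def'\<close>)

text \<open>
  An element \<open>a + r z\<close> outside \<open>A\<close> has a unit as coefficient \<open>r\<close>, because \<open>\<mm> z \<subseteq> A\<close>; so it
  generates \<open>z\<close> over \<open>A\<close>.
\<close>

lemma clen_adjoin_le_1:
  assumes A: "subm R M A" and z: "z \<in> carrier M"
    and units: "\<And>r. r \<in> carrier R \<Longrightarrow> r \<notin> \<mm> \<Longrightarrow> r \<in> Units R" and mz: "\<And>r. r \<in> \<mm> \<Longrightarrow> r \<odot>\<^bsub>M\<^esub> z \<in> A"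
  shows "clen (subm R M) A (A <+>\<^bsub>M\<^esub> cyclic z) \<le> 1"
proof (rule clen_leI)
  fix l N assume N: "chain_in (subm R M) A (A <+>\<^bsub>M\<^esub> cyclic z) l N"
  have full: "V = A <+>\<^bsub>M\<^esub> cyclic z" if V: "subm R M V" "A \<subset> V" "V \<subseteq> A <+>\<^bsub>M\<^esub> cyclic z" for V
  proof -
    obtain v where v: "v \<in> V" "v \<notin> A" using V by auto
    then obtain a c where ac: "a \<in> A" "c \<in> cyclic z" "v = a \<oplus>\<^bsub>M\<^esub> c" using V set_addE by blast
    then obtain r where r: "r \<in> carrier R" "c = r \<odot>\<^bsub>M\<^esub> z" unfolding cyclic_def by auto
    have "r \<notin> \<mm>"
    proof
      assume "r \<in> \<mm>" then have "v \<in> A" using mz ac r subm_add A by simp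
      with v show False by simp
    qed
    then have u: "r \<in> Units R" using units r by simp
    have "c \<in> V" using subm_add_cancel[OF V(1), of a c] v ac V r z by auto
    then have "inv r \<odot>\<^bsub>M\<^esub> (r \<odot>\<^bsub>M\<^esub> z) \<in> V" using subm_smult V u r by auto
    moreover have "inv r \<odot>\<^bsub>M\<^esub> (r \<odot>\<^bsub>M\<^esub> z) = z"
      using u z r by (simp add: smult_assoc1[symmetric])
    ultimately have "cyclic z \<subseteq> V" using cyclic_least V by simp
    then show ?thesis using V set_add_least by blast
  qed
  show "enat l \<le> 1"
  proof (rule ccontr)
    assume "\<not> enat l \<le> 1"
    then have l: "1 < l" by (simp add: one_enat_def)
    have "A \<subseteq> N 0" "N 0 \<subset> N 1" "N 1 \<subset> N 2" "subm R M (N 1)" "N 1 \<subseteq> A <+>\<^bsub>M\<^esub> cyclic z" "N 2 \<subseteq> A <+>\<^bsub>M\<^esub> cyclic z"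
      using N l unfolding chain_in_def numeral_2_eq_2 by (auto simp: less_Suc_eq_le)
    then show False using full[of "N 1"] by auto
  qed
qed

lemma clen_adjoin_le:
  assumes fin: "finite G"
    and units: "\<And>r. r \<in> carrier R \<Longrightarrow> r \<notin> \<mm> \<Longrightarrow> r \<in> Units R"
    and m: "\<mm> \<subseteq> carrier R"
    and "subm R M A" "subm R M B" "A \<subseteq> B" "G \<subseteq> B"
    and "\<And>r g. r \<in> \<mm> \<Longrightarrow> g \<in> G \<Longrightarrow> r \<odot>\<^bsub>M\<^esub> g \<in> A"
    and "\<And>V. subm R M V \<Longrightarrow> A \<subseteq> V \<Longrightarrow> G \<subseteq> V \<Longrightarrow> B \<subseteq> V"
  shows "clen (subm R M) A B \<le> enat (card G)"
  using fin assms(4-)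
proof (induction G arbitrary: A)
  case empty
  then have "B \<subseteq> A" by auto
  show ?case
  proof (rule clen_leI)
    fix l N assume N: "chain_in (subm R M) A B l N"
    show "enat l \<le> enat (card {})"
    proof (cases l)
      case (Suc k)
      then have "A \<subseteq> N 0" "N 0 \<subset> N 1" "N 1 \<subseteq> B" using N unfolding chain_in_def by auto
      then show ?thesis using \<open>B \<subseteq> A\<close> by auto
    qed simp
  qed
next
  case (insert g G)
  have g: "g \<in> carrier M" using insert.prems subm_carrier by auto
  let ?A' = "A <+>\<^bsub>M\<^esub> cyclic g"
  have A': "subm R M ?A'" "A \<subseteq> ?A'" "cyclic g \<subseteq> ?A'"
    using set_add_subm set_add_upper1 set_add_upper2 insert.prems(1) cyclic_subm[OF g] by auto
  have A'B: "?A' \<subseteq> B" using set_add_least cyclic_least insert.prems by auto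
  have "clen (subm R M) A B \<le> clen (subm R M) A ?A' + clen (subm R M) ?A' B"
    using clen_subadd[OF insert.prems(1) A'(1) insert.prems(2)] A' A'B by simp
  also have "\<dots> \<le> 1 + enat (card G)"
  proof (rule add_mono)
    show "clen (subm R M) A ?A' \<le> 1"
      by (rule clen_adjoin_le_1[OF _ g units]) (use insert.prems in auto)
    show "clen (subm R M) ?A' B \<le> enat (card G)"
    proof (rule insert.IH)
      show "B \<subseteq> V" if "subm R M V" "?A' \<subseteq> V" "G \<subseteq> V" for V
        using insert.prems(6)[of V] that A' cyclic_self[OF g] by auto
      show "r \<odot>\<^bsub>M\<^esub> h \<in> ?A'" if "r \<in> \<mm>" "h \<in> G" for r h
        using insert.prems(5)[of r h] that A' by auto
    qed (use A' A'B insert.prems in auto)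
  qed
  also have "\<dots> = enat (card (insert g G))" using insert.hyps by (simp add: one_enat_def)
  finally show ?case .
qed

text \<open>
  Adjoin the members of the family to \<open>A\<close> one after the other. No step is trivial: otherwise the
  new member would satisfy a relation in which its own coefficient is \<open>1\<close>, outside \<open>\<mm>\<close>.
\<close>

lemma clen_ge_card_independent:
  assumes fin: "finite X"
    and m: "\<one> \<notin> \<mm>" "\<And>r. r \<in> \<mm> \<Longrightarrow> \<ominus> r \<in> \<mm>"
    and "subm R M A" "subm R M B" "A \<subseteq> B" "\<And>x. x \<in> X \<Longrightarrow> v x \<in> B"
    and "\<And>c. c \<in> X \<rightarrow> carrier R \<Longrightarrow> (\<Oplus>\<^bsub>M\<^esub>x\<in>X. c x \<odot>\<^bsub>M\<^esub> v x) \<in> A \<Longrightarrow> (\<forall>x\<in>X. c x \<in> \<mm>)"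
  shows "enat (card X) \<le> clen (subm R M) A B"
  using fin assms(4-)
proof (induction X arbitrary: A)
  case empty
  then show ?case by (simp add: zero_enat_def[symmetric])
next
  case (insert y X)
  have vB: "\<And>x. x \<in> insert y X \<Longrightarrow> v x \<in> carrier M" using insert.prems subm_carrier by blast
  let ?A' = "A <+>\<^bsub>M\<^esub> cyclic (v y)"
  have A': "subm R M ?A'" "A \<subseteq> ?A'" "cyclic (v y) \<subseteq> ?A'"
    using set_add_subm set_add_upper1 set_add_upper2 insert.prems(1) cyclic_subm vB by auto
  have A'B: "?A' \<subseteq> B" using set_add_least cyclic_least insert.prems by auto
  have "v y \<notin> A"
  proof
    assume vA: "v y \<in> A"
    let ?c = "\<lambda>x. if x = y then \<one> else \<zero>"
    have "(\<Oplus>\<^bsub>M\<^esub>x\<in>insert y X. ?c x \<odot>\<^bsub>M\<^esub> v x) = ?c y \<odot>\<^bsub>M\<^esub> v y \<oplus>\<^bsub>M\<^esub> (\<Oplus>\<^bsub>M\<^esub>x\<in>X. ?c x \<odot>\<^bsub>M\<^esub> v x)"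
      using insert.hyps vB by (intro M.finsum_insert) auto
    also have "(\<Oplus>\<^bsub>M\<^esub>x\<in>X. ?c x \<odot>\<^bsub>M\<^esub> v x) = (\<Oplus>\<^bsub>M\<^esub>x\<in>X. \<zero>\<^bsub>M\<^esub>)"
      using insert.hyps vB by (intro M.finsum_cong') auto
    also have "\<dots> = \<zero>\<^bsub>M\<^esub>" by simp
    finally have "(\<Oplus>\<^bsub>M\<^esub>x\<in>insert y X. ?c x \<odot>\<^bsub>M\<^esub> v x) = v y" using vB by simp
    then have "\<one> \<in> \<mm>" using insert.prems(5)[of ?c] vA by auto
    then show False using m by simp
  qed
  then have "A \<subset> ?A'" using A' cyclic_self vB[of y] by blast
  then have "chain_in (subm R M) A ?A' 1 (\<lambda>i. if i = 0 then A else ?A')"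
    using A' insert.prems unfolding chain_in_def by auto
  then have 1: "enat 1 \<le> clen (subm R M) A ?A'" by (rule clen_geI)
  have 2: "enat (card X) \<le> clen (subm R M) ?A' B"
  proof (rule insert.IH[OF A'(1) insert.prems(2) A'B])
    show "v x \<in> B" if "x \<in> X" for x using insert.prems that by auto
    fix c assume c: "c \<in> X \<rightarrow> carrier R" and "(\<Oplus>\<^bsub>M\<^esub>x\<in>X. c x \<odot>\<^bsub>M\<^esub> v x) \<in> ?A'"
    then obtain a d where ad: "a \<in> A" "d \<in> cyclic (v y)" "(\<Oplus>\<^bsub>M\<^esub>x\<in>X. c x \<odot>\<^bsub>M\<^esub> v x) = a \<oplus>\<^bsub>M\<^esub> d"
      using set_addE by blast
    then obtain r where r: "r \<in> carrier R" "d = r \<odot>\<^bsub>M\<^esub> v y" unfolding cyclic_def by auto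
    let ?c = "c(y := \<ominus> r)"
    have "(\<Oplus>\<^bsub>M\<^esub>x\<in>insert y X. ?c x \<odot>\<^bsub>M\<^esub> v x) = ?c y \<odot>\<^bsub>M\<^esub> v y \<oplus>\<^bsub>M\<^esub> (\<Oplus>\<^bsub>M\<^esub>x\<in>X. ?c x \<odot>\<^bsub>M\<^esub> v x)"
      using insert.hyps vB c r by (intro M.finsum_insert) (auto simp: Pi_iff)
    also have "(\<Oplus>\<^bsub>M\<^esub>x\<in>X. ?c x \<odot>\<^bsub>M\<^esub> v x) = (\<Oplus>\<^bsub>M\<^esub>x\<in>X. c x \<odot>\<^bsub>M\<^esub> v x)"
      using insert.hyps vB c by (intro M.finsum_cong') (auto simp: Pi_iff)
    also have "?c y \<odot>\<^bsub>M\<^esub> v y \<oplus>\<^bsub>M\<^esub> \<dots> = a"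
      using ad r vB subm_carrier[OF insert.prems(1)]
      by (simp add: smult_l_minus M.a_ac M.r_neg1 M.r_neg)
    finally have eq: "(\<Oplus>\<^bsub>M\<^esub>x\<in>insert y X. ?c x \<odot>\<^bsub>M\<^esub> v x) = a" .
    have "?c \<in> insert y X \<rightarrow> carrier R" using c r by (auto simp: Pi_iff)
    from insert.prems(5)[OF this] have "\<forall>x\<in>insert y X. ?c x \<in> \<mm>" using ad(1) unfolding eq by simp
    then show "\<forall>x\<in>X. c x \<in> \<mm>" using insert.hyps by (auto split: if_splits)
  qed
  have "enat (card (insert y X)) = enat 1 + enat (card X)" using insert.hyps by simp
  also have "\<dots> \<le> clen (subm R M) A ?A' + clen (subm R M) ?A' B" using 1 2 by (rule add_mono)
  also have "\<dots> \<le> clen (subm R M) A B" using clen_superadd[of "subm R M" A ?A' B] insert.prems A' A'B by simp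
  finally show ?case .
qed

end

section \<open>Ideals and Nakayama's lemma\<close>

context cring begin

lemma idl_carr: "ideal J R \<Longrightarrow> x \<in> J \<Longrightarrow> x \<in> carrier R" by (rule ideal.Icarr)
lemma idl_subset: "ideal J R \<Longrightarrow> J \<subseteq> carrier R" using idl_carr by auto
lemma idl_zero: "ideal J R \<Longrightarrow> \<zero> \<in> J"
  by (simp add: additive_subgroup.zero_closed ideal.axioms(1))
lemma idl_add: "ideal J R \<Longrightarrow> x \<in> J \<Longrightarrow> y \<in> J \<Longrightarrow> x \<oplus> y \<in> J"
  by (simp add: additive_subgroup.a_closed ideal.axioms(1))
lemma idl_mult: "ideal J R \<Longrightarrow> x \<in> J \<Longrightarrow> r \<in> carrier R \<Longrightarrow> r \<otimes> x \<in> J" by (rule ideal.I_l_closed)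
lemma idl_mult_r: "ideal J R \<Longrightarrow> x \<in> J \<Longrightarrow> r \<in> carrier R \<Longrightarrow> x \<otimes> r \<in> J" by (rule ideal.I_r_closed)
lemma idl_neg: "ideal J R \<Longrightarrow> x \<in> J \<Longrightarrow> \<ominus> x \<in> J"
  by (simp add: additive_subgroup.a_inv_closed ideal.axioms(1) is_abelian_group)
lemma idl_minus: "ideal J R \<Longrightarrow> x \<in> J \<Longrightarrow> y \<in> J \<Longrightarrow> x \<ominus> y \<in> J"
  unfolding a_minus_def by (rule idl_add[OF _ _ idl_neg])

lemma idl_add_cancel:
  assumes "ideal J R" "x \<oplus> y \<in> J" "x \<in> J" "y \<in> carrier R"
  shows "y \<in> J"
proof -
  have x: "x \<in> carrier R" using assms idl_carr by simp
  have "y = (x \<oplus> y) \<ominus> x"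
    using assms x by (simp add: a_minus_def a_assoc a_comm r_neg1)
  then show ?thesis using idl_minus[OF assms(1,2,3)] by simp
qed

lemma idlI:
  assumes "H \<subseteq> carrier R" "\<zero> \<in> H" "\<And>a b. a \<in> H \<Longrightarrow> b \<in> H \<Longrightarrow> a \<oplus> b \<in> H"
    "\<And>a x. a \<in> carrier R \<Longrightarrow> x \<in> H \<Longrightarrow> a \<otimes> x \<in> H"
  shows "ideal H R"
proof (rule idealI[OF ring_axioms])
  show "subgroup H (add_monoid R)"
  proof (rule add.subgroupI)
    fix a assume a: "a \<in> H"
    have "\<ominus> a = (\<ominus> \<one>) \<otimes> a" using a assms(1) l_minus by auto
    then show "\<ominus> a \<in> H" using assms(4) a by auto
  qed (use assms in auto)
next
  fix a x assume "a \<in> H" "x \<in> carrier R"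
  then show "a \<otimes> x \<in> H" using assms(1,4) m_comm[of a x] by auto
qed (use assms in auto)

lemma sum_addI: "a \<in> A \<Longrightarrow> b \<in> B \<Longrightarrow> a \<oplus> b \<in> A <+> B" by (auto simp: set_add_def')
lemma sum_addE: "u \<in> A <+> B \<Longrightarrow> (\<And>a b. a \<in> A \<Longrightarrow> b \<in> B \<Longrightarrow> u = a \<oplus> b \<Longrightarrow> thesis) \<Longrightarrow> thesis"
  by (auto simp: set_add_def')
lemma sum_upper1: "ideal A R \<Longrightarrow> ideal B R \<Longrightarrow> A \<subseteq> A <+> B"
  using sum_addI[of _ A \<zero> B] idl_zero[of B] idl_carr[of A] by fastforce
lemma sum_upper2: "ideal A R \<Longrightarrow> ideal B R \<Longrightarrow> B \<subseteq> A <+> B"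
  using sum_addI[of \<zero> A _ B] idl_zero[of A] idl_carr[of B] by fastforce
lemma sum_least: "ideal C R \<Longrightarrow> A \<subseteq> C \<Longrightarrow> B \<subseteq> C \<Longrightarrow> A <+> B \<subseteq> C"
  using idl_add[of C] by (fastforce simp: set_add_def')

lemma PIdlE: "y \<in> PIdl x \<Longrightarrow> (\<And>r. r \<in> carrier R \<Longrightarrow> y = r \<otimes> x \<Longrightarrow> thesis) \<Longrightarrow> thesis"
  unfolding cgenideal_def by auto
lemma Idl_insert:
  assumes "G \<subseteq> carrier R" "g \<in> carrier R"
  shows "Idl (insert g G) = PIdl g <+> Idl G"
proof
  have i: "ideal (PIdl g) R" "ideal (Idl G) R" using assms cgenideal_ideal genideal_ideal by auto
  show "Idl (insert g G) \<subseteq> PIdl g <+> Idl G"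
  proof (rule genideal_minimal[OF add_ideals[OF i]])
    show "insert g G \<subseteq> PIdl g <+> Idl G"
      using sum_upper1[OF i] sum_upper2[OF i] cgenideal_self[OF assms(2)] genideal_self[OF assms(1)] by auto
  qed
  have c: "insert g G \<subseteq> carrier R" using assms by simp
  have j: "ideal (Idl (insert g G)) R" by (rule genideal_ideal[OF c])
  have "insert g G \<subseteq> Idl (insert g G)" by (rule genideal_self[OF c])
  then show "PIdl g <+> Idl G \<subseteq> Idl (insert g G)"
    using sum_least[OF j] cgenideal_minimal[OF j] genideal_minimal[OF j] by auto
qed

lemma Idl_empty: "Idl {} = {\<zero>}"
  using genideal_minimal[OF zeroideal, of "{}"] idl_zero[OF genideal_ideal[of "{}"]] by auto

lemma ideal_prodE_PIdl:
  assumes "ideal T R" "g \<in> carrier R" "x \<in> T \<cdot> (PIdl g)"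
  shows "\<exists>t\<in>T. x = t \<otimes> g"
  using assms(3)
proof induction
  case (prod i j)
  then obtain r where r: "r \<in> carrier R" "j = r \<otimes> g" by (auto elim: PIdlE)
  have "i \<in> carrier R" using prod assms idl_carr by auto
  then have "i \<otimes> j = (r \<otimes> i) \<otimes> g" using r assms by (simp add: m_ac)
  then show ?case using prod r idl_mult[OF assms(1)] by auto
next
  case (sum s1 s2)
  then obtain t1 t2 where "t1 \<in> T" "t2 \<in> T" "s1 = t1 \<otimes> g" "s2 = t2 \<otimes> g" by auto
  then show ?case using assms idl_carr[OF assms(1)] idl_add[OF assms(1)] by (auto simp: l_distr[symmetric])
qed

lemma ideal_prod_subset2: "ideal I R \<Longrightarrow> ideal J R \<Longrightarrow> I \<cdot> J \<subseteq> J"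
  using ideal_prod_inter by blast
lemma ideal_prod_subset1: "ideal I R \<Longrightarrow> ideal J R \<Longrightarrow> I \<cdot> J \<subseteq> I"
  using ideal_prod_inter by blast

lemma ideal_prod_least:
  assumes "ideal C R" "\<And>i x. i \<in> I \<Longrightarrow> x \<in> N \<Longrightarrow> i \<otimes> x \<in> C"
  shows "I \<cdot> N \<subseteq> C"
proof
  fix x assume "x \<in> I \<cdot> N"
  then show "x \<in> C" by induction (use assms idl_add in auto)
qed

lemma primeideal_mult_notin:
  assumes "primeideal T R" "a \<in> carrier R - T" "b \<in> carrier R - T"
  shows "a \<otimes> b \<in> carrier R - T"
  using assms primeideal.I_prime[OF assms(1), of a b] by auto

text \<open>
  Nakayama's lemma in the localisation at \<open>T\<close>, with denominators cleared: elements outside \<open>T\<close>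
  play the role of units. One generator \<open>g\<close> is eliminated at a time: if \<open>v g = b + t g + z\<close>,
  with \<open>t \<in> T\<close> and \<open>z\<close> a combination of the other generators with coefficients in \<open>T\<close>, then
  \<open>v - t\<close> lies outside \<open>T\<close> and \<open>(v - t) g = b + z\<close>.
\<close>

lemma nakayama_prime:
  assumes T: "primeideal T R" and B: "ideal B R" and "finite G" "G \<subseteq> carrier R"
    and "v \<in> carrier R - T" "\<And>g. g \<in> G \<Longrightarrow> v \<otimes> g \<in> B <+> T \<cdot> (Idl G)"
  shows "\<exists>w \<in> carrier R - T. \<forall>a\<in>Idl G. w \<otimes> a \<in> B"
  using assms(3-)
proof (induction G arbitrary: v)
  case empty
  then show ?case using idl_zero[OF B] by (auto simp: Idl_empty intro!: bexI[of _ v])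
next
  case (insert g G)
  have Ti: "ideal T R" using T by (rule primeideal.axioms(1))
  have g: "g \<in> carrier R" and G: "G \<subseteq> carrier R" using insert.prems by auto
  have v: "v \<in> carrier R" using insert.prems by simp
  have iG: "ideal (Idl G) R" and ig: "ideal (PIdl g) R" using G g genideal_ideal cgenideal_ideal by auto
  have iTG: "ideal (T \<cdot> (Idl G)) R" by (rule ideal_prod_is_ideal[OF Ti iG])
  have expand: "\<exists>b\<in>B. \<exists>t\<in>T. \<exists>z\<in>T \<cdot> (Idl G). v \<otimes> h = b \<oplus> (t \<otimes> g \<oplus> z)" if "h \<in> insert g G" for h
  proof -
    have "v \<otimes> h \<in> B <+> T \<cdot> (Idl (insert g G))" using insert.prems(3) that .
    then obtain b y where bdy: "b \<in> B" "y \<in> T \<cdot> (Idl (insert g G))" "v \<otimes> h = b \<oplus> y" by (rule sum_addE)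
    have "y \<in> T \<cdot> (PIdl g) <+> T \<cdot> (Idl G)"
      using bdy(2) ideal_prod_r_distr[OF Ti ig iG] Idl_insert[OF G g] by simp
    then obtain p z where pz: "p \<in> T \<cdot> (PIdl g)" "z \<in> T \<cdot> (Idl G)" "y = p \<oplus> z" by (rule sum_addE)
    then obtain t where "t \<in> T" "p = t \<otimes> g" using ideal_prodE_PIdl[OF Ti g] by auto
    then show ?thesis using pz bdy by blast
  qed
  note cB = idl_carr[OF B] and cT = idl_carr[OF Ti] and cZ = idl_carr[OF iTG]
  obtain b t z where btz: "b \<in> B" "t \<in> T" "z \<in> T \<cdot> (Idl G)" "v \<otimes> g = b \<oplus> (t \<otimes> g \<oplus> z)"
    using expand[of g] by auto
  define v' where "v' = v \<ominus> t"
  have btzc: "b \<in> carrier R" "t \<in> carrier R" "z \<in> carrier R" using btz cB cT cZ by auto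
  have v'c: "v' \<in> carrier R" unfolding v'_def using v btzc by simp
  have v'T: "v' \<in> carrier R - T"
  proof -
    have "t \<oplus> v' = v" unfolding v'_def using v btzc(2) by algebra
    then have "v' \<in> T \<Longrightarrow> v \<in> T" using idl_add[OF Ti btz(2), of v'] by simp
    then show ?thesis using v'c insert.prems by auto
  qed
  have v'g: "v' \<otimes> g = b \<oplus> z"
  proof -
    have "v' \<otimes> g = v \<otimes> g \<ominus> t \<otimes> g" unfolding v'_def using v btzc g by (simp add: a_minus_def l_distr l_minus)
    also have "\<dots> = b \<oplus> z" unfolding btz(4) using btzc g by algebra
    finally show ?thesis .
  qed
  have "\<exists>w \<in> carrier R - T. \<forall>a\<in>Idl G. w \<otimes> a \<in> B"
  proof (rule insert.IH[OF G])
    show "v' \<otimes> v \<in> carrier R - T" using primeideal_mult_notin[OF T v'T insert.prems(2)] .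
    fix h assume h: "h \<in> G"
    have hc: "h \<in> carrier R" using h G by auto
    obtain b' t' z' where b': "b' \<in> B" "t' \<in> T" "z' \<in> T \<cdot> (Idl G)" "v \<otimes> h = b' \<oplus> (t' \<otimes> g \<oplus> z')"
      using expand[of h] h by auto
    have b'c: "b' \<in> carrier R" "t' \<in> carrier R" "z' \<in> carrier R" using b' cB cT cZ by auto
    have "v' \<otimes> v \<otimes> h = v' \<otimes> b' \<oplus> (t' \<otimes> (v' \<otimes> g) \<oplus> v' \<otimes> z')"
      using v v'c hc b'c g b'(4) by (simp add: m_assoc r_distr m_lcomm)
    also have "\<dots> = (v' \<otimes> b' \<oplus> t' \<otimes> b) \<oplus> (t' \<otimes> z \<oplus> v' \<otimes> z')"
      unfolding v'g using v'c b'c btzc by (simp add: r_distr a_ac)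
    also have "\<dots> \<in> B <+> T \<cdot> (Idl G)"
      by (intro sum_addI idl_add[OF B] idl_add[OF iTG] idl_mult[OF B b'(1) v'c] idl_mult[OF B btz(1) b'c(2)]
          idl_mult[OF iTG btz(3) b'c(2)] idl_mult[OF iTG b'(3) v'c])
    finally show "v' \<otimes> v \<otimes> h \<in> B <+> T \<cdot> (Idl G)" .
  qed
  then obtain w where w: "w \<in> carrier R - T" "\<And>a. a \<in> Idl G \<Longrightarrow> w \<otimes> a \<in> B" by auto
  have wc: "w \<in> carrier R" using w by simp
  show ?case
  proof (rule bexI[of _ "w \<otimes> v'"], rule ballI)
    show "w \<otimes> v' \<in> carrier R - T" using primeideal_mult_notin[OF T w(1) v'T] .
    fix a assume "a \<in> Idl (insert g G)"
    then have "a \<in> PIdl g <+> Idl G" using Idl_insert[OF G g] by simp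
    then obtain p y where pd: "p \<in> PIdl g" "y \<in> Idl G" "a = p \<oplus> y" by (rule sum_addE)
    obtain r where r: "r \<in> carrier R" "p = r \<otimes> g" using pd(1) by (rule PIdlE)
    have yc: "y \<in> carrier R" using pd(2) idl_carr iG by auto
    have zG: "z \<in> Idl G" using btz ideal_prod_subset2[OF Ti iG] by auto
    have "w \<otimes> v' \<otimes> a = r \<otimes> (w \<otimes> (v' \<otimes> g)) \<oplus> v' \<otimes> (w \<otimes> y)"
      unfolding pd(3) r(2) using wc v'c r g yc by (simp add: m_ac r_distr)
    also have "\<dots> = r \<otimes> (w \<otimes> b \<oplus> w \<otimes> z) \<oplus> v' \<otimes> (w \<otimes> y)"
      unfolding v'g using wc btzc by (simp add: r_distr)
    also have "\<dots> \<in> B"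
      by (intro idl_add[OF B] idl_mult[OF B _ r(1)] idl_mult[OF B _ v'c] idl_mult[OF B btz(1) wc] w(2) zG pd(2))
    finally show "w \<otimes> v' \<otimes> a \<in> B" .
  qed
qed

text \<open>The product of the multipliers of the single generators is still outside \<open>T\<close>.\<close>

lemma common_multiplier:
  assumes T: "primeideal T R" and B: "ideal B R" and "finite G" "G \<subseteq> carrier R"
    and "\<And>g. g \<in> G \<Longrightarrow> \<exists>w\<in>carrier R - T. w \<otimes> g \<in> B"
  shows "\<exists>v\<in>carrier R - T. \<forall>g\<in>G. v \<otimes> g \<in> B"
  using assms(3-)
proof (induction G)
  case empty
  have "\<one> \<notin> T"
    using ideal.one_imp_carrier[OF primeideal.axioms(1)[OF T]] primeideal.I_notcarr[OF T] by auto
  then show ?case by auto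
next
  case (insert g G)
  then obtain v where v: "v \<in> carrier R - T" "\<And>h. h \<in> G \<Longrightarrow> v \<otimes> h \<in> B" by auto
  obtain w where w: "w \<in> carrier R - T" "w \<otimes> g \<in> B" using insert.prems by auto
  show ?case
  proof (rule bexI[of _ "w \<otimes> v"], rule ballI)
    show "w \<otimes> v \<in> carrier R - T" using primeideal_mult_notin[OF T w(1) v(1)] .
    fix h assume h: "h \<in> insert g G"
    then have hc: "h \<in> carrier R" using insert.prems by auto
    have c: "w \<in> carrier R" "v \<in> carrier R" using v w by auto
    show "w \<otimes> v \<otimes> h \<in> B"
    proof (cases "h = g")
      case True
      have "w \<otimes> v \<otimes> h = v \<otimes> (w \<otimes> g)" using True c hc by (simp add: m_ac)
      then show ?thesis using idl_mult[OF B w(2) c(2)] by simp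
    next
      case False
      then have "v \<otimes> h \<in> B" using v h by simp
      then show ?thesis using idl_mult[OF B _ c(1)] c hc by (simp add: m_assoc)
    qed
  qed
qed

lemma primeideal_one_notin: "primeideal T R \<Longrightarrow> \<one> \<in> carrier R - T"
  using ideal.one_imp_carrier[OF primeideal.axioms(1)] primeideal.I_notcarr by blast

abbreviation ipow :: "'a set \<Rightarrow> nat \<Rightarrow> 'a set" where "ipow J k \<equiv> J [^]\<^bsub>ideals_set R\<^esub> k"

lemma ipow_0: "ipow J 0 = carrier R"
  using monoid.nat_pow_0[OF comm_monoid.axioms(1)[OF ideals_set_is_comm_monoid]] by (simp add: ideals_set_def)

lemma ipow_ideal: "ideal J R \<Longrightarrow> ideal (ipow J k) R"
  using monoid.nat_pow_closed[OF comm_monoid.axioms(1)[OF ideals_set_is_comm_monoid], of J k]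
  by (simp add: ideals_set_def)

lemma ipow_Suc: "ipow J (Suc k) = ipow J k \<cdot> J"
  using monoid.nat_pow_Suc[OF comm_monoid.axioms(1)[OF ideals_set_is_comm_monoid], of J k]
  by (simp add: ideals_set_def)

lemma ipow_Suc2: "ideal J R \<Longrightarrow> ipow J (Suc k) = J \<cdot> ipow J k"
  unfolding ipow_Suc by (rule ideal_prod_commute[OF ipow_ideal])

lemma ipow_1: "ideal J R \<Longrightarrow> ipow J (Suc 0) = J"
  using monoid.nat_pow_eone[OF comm_monoid.axioms(1)[OF ideals_set_is_comm_monoid], of J]
  by (simp add: ideals_set_def)

lemma ipow_antimono: "ideal J R \<Longrightarrow> k \<le> l \<Longrightarrow> ipow J l \<subseteq> ipow J k"
proof (induction l)
  case (Suc l)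
  have "ipow J (Suc l) \<subseteq> ipow J l"
    unfolding ipow_Suc by (rule ideal_prod_subset1[OF ipow_ideal[OF Suc.prems(1)] Suc.prems(1)])
  then show ?case using Suc by (cases "k = Suc l") auto
qed simp

lemma pow_in_ipow: "ideal J R \<Longrightarrow> a \<in> J \<Longrightarrow> a [^] k \<in> ipow J k"
proof (induction k)
  case 0 then show ?case using idl_carr unfolding ipow_0 by simp
next
  case (Suc k) then show ?case unfolding ipow_Suc by (simp add: ideal_prod.prod)
qed

lemma primeideal_pow:
  assumes "primeideal P R" "a \<in> carrier R" "a [^] (k::nat) \<in> P"
  shows "a \<in> P"
  using assms(3)
proof (induction k)
  case 0 then show ?case using primeideal_one_notin[OF assms(1)] by simp
next
  case (Suc k)
  then show ?case using primeideal.I_prime[OF assms(1), of "a [^] k" a] assms(2) by auto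
qed

end

section \<open>Krull's principal ideal theorem\<close>

locale noetherian_cring = cring R + noetherian_ring R for R (structure)
begin

lemma ideal_fg: "ideal J R \<Longrightarrow> \<exists>G. finite G \<and> G \<subseteq> J \<and> J = Idl G"
  using finetely_gen[of J] genideal_self by blast

lemma ex_maximal_ideal_in:
  assumes "C \<noteq> {}" "\<And>J. J \<in> C \<Longrightarrow> ideal J R"
  shows "\<exists>J\<in>C. \<forall>K\<in>C. J \<subseteq> K \<longrightarrow> K = J"
proof (rule subset_Zorn)
  fix D assume D: "subset.chain C D"
  show "\<exists>U\<in>C. \<forall>X\<in>D. X \<subseteq> U"
  proof (cases "D = {}")
    case False
    have "subset.chain {I. ideal I R} D" using D assms(2) unfolding pred_on.chain_def by auto
    then have "\<Union>D \<in> D" using ideal_chain_is_trivial False by blast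
    then show ?thesis using D unfolding pred_on.chain_def by auto
  qed (use assms in auto)
qed

lemma ideal_ascending_stable:
  assumes "\<And>i. ideal (F i) R" "\<And>i. F i \<subseteq> F (Suc i)"
  shows "\<exists>k. \<forall>j\<ge>k. F j = F (k::nat)"
proof -
  obtain k where k: "\<And>j. F k \<subseteq> F j \<Longrightarrow> F j = F k"
    using ex_maximal_ideal_in[of "range F"] assms(1) by auto
  have "F i \<subseteq> F j" if "i \<le> j" for i j by (rule lift_Suc_mono_le[of F]) (use assms(2) that in auto)
  then show ?thesis using k by blast
qed

text \<open>
  In the localisation at \<open>T\<close>, the member \<open>i\<close> consists of the elements that \<open>T\<^sup>i\<close> multiplies into
  \<open>A\<close>.
\<close>

primrec socle_series :: "'a set \<Rightarrow> 'a set \<Rightarrow> nat \<Rightarrow> 'a set" where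
  "socle_series T A 0 = {a \<in> carrier R. \<exists>u\<in>carrier R - T. u \<otimes> a \<in> A}"
| "socle_series T A (Suc i) = {a \<in> carrier R. \<forall>t\<in>T. t \<otimes> a \<in> socle_series T A i}"

lemma saturation_ideal:
  assumes T: "primeideal T R" and A: "ideal A R"
  shows "ideal {a \<in> carrier R. \<exists>u\<in>carrier R - T. u \<otimes> a \<in> A} R"
proof (rule idlI)
  show "\<zero> \<in> {a \<in> carrier R. \<exists>u\<in>carrier R - T. u \<otimes> a \<in> A}"
    using primeideal_one_notin[OF T] idl_zero[OF A] by (auto intro!: bexI[of _ \<one>])
next
  fix a b assume "a \<in> {a \<in> carrier R. \<exists>u\<in>carrier R - T. u \<otimes> a \<in> A}" "b \<in> {a \<in> carrier R. \<exists>u\<in>carrier R - T. u \<otimes> a \<in> A}"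
  then obtain u v where uv: "a \<in> carrier R" "b \<in> carrier R" "u \<in> carrier R - T" "v \<in> carrier R - T"
    "u \<otimes> a \<in> A" "v \<otimes> b \<in> A" by auto
  have "(u \<otimes> v) \<otimes> (a \<oplus> b) = v \<otimes> (u \<otimes> a) \<oplus> u \<otimes> (v \<otimes> b)" using uv by (simp add: m_ac r_distr)
  also have "\<dots> \<in> A" by (rule idl_add[OF A idl_mult[OF A uv(5)] idl_mult[OF A uv(6)]]) (use uv in auto)
  finally show "a \<oplus> b \<in> {a \<in> carrier R. \<exists>u\<in>carrier R - T. u \<otimes> a \<in> A}"
    using uv primeideal_mult_notin[OF T uv(3,4)] by auto
next
  fix r a assume "r \<in> carrier R" "a \<in> {a \<in> carrier R. \<exists>u\<in>carrier R - T. u \<otimes> a \<in> A}"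
  then obtain u where u: "a \<in> carrier R" "u \<in> carrier R - T" "u \<otimes> a \<in> A" "r \<in> carrier R" by auto
  have "u \<otimes> (r \<otimes> a) = r \<otimes> (u \<otimes> a)" using u by (simp add: m_lcomm)
  also have "\<dots> \<in> A" using idl_mult[OF A] u by simp
  finally show "r \<otimes> a \<in> {a \<in> carrier R. \<exists>u\<in>carrier R - T. u \<otimes> a \<in> A}" using u by auto
qed auto

lemma socle_series_ideal:
  assumes T: "primeideal T R" and A: "ideal A R"
  shows "ideal (socle_series T A i) R"
proof (induction i)
  case 0 show ?case unfolding socle_series.simps by (rule saturation_ideal[OF assms])
next
  case (Suc i)
  note cT = idl_carr[OF primeideal.axioms(1)[OF T]]
  show ?case unfolding socle_series.simps
    by (rule idlI) (use cT Suc in \<open>auto simp: idl_zero r_distr idl_add m_lcomm idl_mult\<close>)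
qed

lemma socle_series_saturated:
  assumes T: "primeideal T R"
  shows "u \<in> carrier R - T \<Longrightarrow> a \<in> carrier R \<Longrightarrow> u \<otimes> a \<in> socle_series T A i \<Longrightarrow> a \<in> socle_series T A i"
proof (induction i arbitrary: a)
  case 0
  then obtain v where v: "v \<in> carrier R - T" "v \<otimes> (u \<otimes> a) \<in> A" by auto
  then have "(v \<otimes> u) \<otimes> a \<in> A" using 0 by (simp add: m_assoc)
  then show ?case using primeideal_mult_notin[OF T v(1) 0(1)] 0 by auto
next
  case (Suc i)
  note cT = idl_carr[OF primeideal.axioms(1)[OF T]]
  have "t \<otimes> a \<in> socle_series T A i" if "t \<in> T" for t
  proof (rule Suc.IH[OF Suc.prems(1)])
    show "t \<otimes> a \<in> carrier R" using that cT Suc.prems by simp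
    have "u \<otimes> (t \<otimes> a) = t \<otimes> (u \<otimes> a)" using that cT Suc.prems by (simp add: m_lcomm)
    then show "u \<otimes> (t \<otimes> a) \<in> socle_series T A i" using Suc.prems that by simp
  qed
  then show ?case using Suc.prems by simp
qed

lemma socle_series_mono:
  assumes T: "primeideal T R" and A: "ideal A R"
  shows "socle_series T A i \<subseteq> socle_series T A (Suc i)"
  using idl_carr[OF socle_series_ideal[OF assms]] idl_mult[OF socle_series_ideal[OF assms]]
    idl_carr[OF primeideal.axioms(1)[OF T]] by auto

text \<open>
  If \<open>T\<close> is minimal over \<open>A\<close>, the localisation of \<open>R/A\<close> at \<open>T\<close> has finite length. The ascending
  series stops at some member; were it proper, a maximal ideal of the form
  \<open>(socle_series T A N : a)\<close> would be a prime between \<open>A\<close> and \<open>T\<close>, hence \<open>T\<close> itself, and \<open>a\<close>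
  would enter at the next member.
\<close>

lemma socle_series_exhausts:
  assumes T: "primeideal T R" and A: "ideal A R"
    and min: "\<And>Q. primeideal Q R \<Longrightarrow> A \<subseteq> Q \<Longrightarrow> Q \<subseteq> T \<Longrightarrow> Q = T"
  shows "\<exists>N. socle_series T A N = carrier R"
proof -
  let ?S = "socle_series T A"
  note i = socle_series_ideal[OF T A]
  obtain N where N: "\<forall>j\<ge>N. ?S j = ?S N"
    using ideal_ascending_stable[of ?S, OF i socle_series_mono[OF T A]] by auto
  have "?S N = carrier R"
  proof (rule ccontr)
    assume "?S N \<noteq> carrier R"
    then obtain a0 where a0: "a0 \<in> carrier R" "a0 \<notin> ?S N" using idl_carr[OF i[of N]] by blast
    define col where "col a = {r \<in> carrier R. r \<otimes> a \<in> ?S N}" for a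
    have coli: "ideal (col a) R" if a: "a \<in> carrier R" for a
    proof (rule idlI)
      show "\<zero> \<in> col a" unfolding col_def using idl_zero[OF i] a by simp
      show "b \<oplus> c \<in> col a" if "b \<in> col a" "c \<in> col a" for b c
        using that a idl_add[OF i] unfolding col_def by (simp add: l_distr)
      show "r \<otimes> b \<in> col a" if "r \<in> carrier R" "b \<in> col a" for r b
        using that a idl_mult[OF i] unfolding col_def by (simp add: m_assoc)
    qed (auto simp: col_def)
    obtain J where J: "J \<in> col ` (carrier R - ?S N)" "\<forall>K\<in>col ` (carrier R - ?S N). J \<subseteq> K \<longrightarrow> K = J"
      using ex_maximal_ideal_in[of "col ` (carrier R - ?S N)"] a0 coli by auto
    then obtain a where a: "a \<in> carrier R" "a \<notin> ?S N" "J = col a" by auto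
    have "primeideal (col a) R"
    proof (rule primeidealI[OF coli[OF a(1)] cring_axioms])
      have "\<one> \<in> carrier R - col a" using a unfolding col_def by simp
      then show "carrier R \<noteq> col a" by blast
      fix b c assume bc: "b \<in> carrier R" "c \<in> carrier R" "b \<otimes> c \<in> col a"
      show "b \<in> col a \<or> c \<in> col a"
      proof (rule disjCI)
        assume "c \<notin> col a"
        then have ca: "c \<otimes> a \<in> carrier R - ?S N" using bc a unfolding col_def by auto
        have "col a \<subseteq> col (c \<otimes> a)"
        proof
          fix r assume "r \<in> col a"
          then have r: "r \<in> carrier R" "r \<otimes> a \<in> ?S N" unfolding col_def by auto
          have "r \<otimes> (c \<otimes> a) = c \<otimes> (r \<otimes> a)" using r(1) a(1) bc(2) by (simp add: m_lcomm)
          then show "r \<in> col (c \<otimes> a)" unfolding col_def using r idl_mult[OF i r(2) bc(2)] by simp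
        qed
        then have "col (c \<otimes> a) = col a" using J(2)[rule_format, OF imageI[OF ca]] unfolding a(3) by simp
        moreover have "b \<in> col (c \<otimes> a)" using bc a unfolding col_def by (auto simp: m_assoc)
        ultimately show "b \<in> col a" by simp
      qed
    qed
    moreover have "A \<subseteq> col a"
    proof
      fix x assume x: "x \<in> A"
      then have xc: "x \<in> carrier R" using idl_carr A by simp
      have "x \<in> ?S 0" using x xc primeideal_one_notin[OF T] by (auto intro!: bexI[of _ \<one>])
      moreover have "?S 0 \<subseteq> ?S N" by (rule lift_Suc_mono_le[of ?S 0 N, OF socle_series_mono[OF T A]]) (rule le0)
      ultimately have "x \<in> ?S N" by (rule rev_subsetD)
      then show "x \<in> col a" unfolding col_def using xc idl_mult_r[OF i[of N] _ a(1)] by simp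
    qed
    moreover have "col a \<subseteq> T"
      using socle_series_saturated[OF T, of _ a A N] a unfolding col_def by blast
    ultimately have "col a = T" using min by simp
    then have "a \<in> ?S (Suc N)" using a(1) unfolding col_def by auto
    moreover have "?S (Suc N) = ?S N" by (rule N[rule_format]) simp
    ultimately show False using a(2) by (simp del: socle_series.simps)
  qed
  then show ?thesis by (rule exI)
qed

text \<open>
  After localisation at \<open>T\<close> the filtration \<open>C\<close> has quotients that are vector spaces over the
  residue field, of finite dimension because \<open>R\<close> is noetherian. So the descending chain \<open>D\<close>
  becomes stationary if all its members contain the last member of \<open>C\<close>. Otherwise there are
  elements \<open>d k\<close> of \<open>D k\<close> that do not lie in \<open>D (Suc k)\<close> locally. Infinitely many of them are
  represented in the same layer \<open>C j / C (Suc j)\<close>, by elements that are linearly independent,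
  and this contradicts finite generation.
\<close>

lemma descending_stable_at_prime:
  assumes T: "primeideal T R" and Di: "\<And>k. ideal (D k) R" and D: "\<And>k. D (Suc k) \<subseteq> D k"
    and Ci: "\<And>j. ideal (C j) R" and C0: "C 0 = carrier R"
    and CT: "\<And>j t c. j < N \<Longrightarrow> t \<in> T \<Longrightarrow> c \<in> C j \<Longrightarrow> t \<otimes> c \<in> C (Suc j)"
    and CN: "\<And>k c. c \<in> C N \<Longrightarrow> \<exists>w\<in>carrier R - T. w \<otimes> c \<in> D k"
  shows "\<exists>k::nat. \<forall>a\<in>D k. \<exists>w\<in>carrier R - T. w \<otimes> a \<in> D (Suc k)"
proof (rule ccontr)
  assume neg: "\<not> ?thesis"
  have Dm: "D l \<subseteq> D k" if "k \<le> l" for k l by (rule lift_Suc_antimono_le[of D]) (use D that in auto)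
  obtain d where d: "\<And>k. d k \<in> D k" "\<And>k w. w \<in> carrier R - T \<Longrightarrow> w \<otimes> d k \<notin> D (Suc k)"
    using neg by (metis (no_types, lifting))
  have dc: "d k \<in> carrier R" for k using d(1) idl_carr[OF Di] by blast
  (* d k has a representative in the layer j: modulo D (Suc k) it lies in C j, up to a multiplier *)
  define good where "good k j \<longleftrightarrow> (\<exists>w\<in>carrier R - T. w \<otimes> d k \<in> D (Suc k) <+> C j)" for k j
  have good0: "good k 0" for k
  proof -
    have "\<one> \<otimes> d k \<in> D (Suc k) <+> C 0" using sum_upper2[OF Di Ci, of 0 "Suc k"] C0 dc[of k] by auto
    then show ?thesis unfolding good_def using primeideal_one_notin[OF T] by blast
  qed
  have goodN: "\<not> good k N" for k
  proof
    assume "good k N"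
    then obtain w where w: "w \<in> carrier R - T" "w \<otimes> d k \<in> D (Suc k) <+> C N" unfolding good_def by auto
    from w(2) obtain e c where ec: "e \<in> D (Suc k)" "c \<in> C N" "w \<otimes> d k = e \<oplus> c" by (rule sum_addE)
    obtain u where u: "u \<in> carrier R - T" "u \<otimes> c \<in> D (Suc k)" using CN[OF ec(2)] by blast
    have cc: "e \<in> carrier R" "c \<in> carrier R" using ec idl_carr[OF Di] idl_carr[OF Ci] by auto
    have "(u \<otimes> w) \<otimes> d k = u \<otimes> e \<oplus> u \<otimes> c" using u w dc cc ec(3) by (simp add: m_assoc r_distr)
    also have "\<dots> \<in> D (Suc k)" by (rule idl_add[OF Di idl_mult[OF Di ec(1)] u(2)]) (use u in auto)
    finally show False using d(2) primeideal_mult_notin[OF T u(1) w(1)] by blast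
  qed
  have "\<exists>j<N. good k j \<and> \<not> good k (Suc j)" for k
    using ex_least_nat_less[of "\<lambda>j. \<not> good k j" N] goodN[of k] good0[of k] by auto
  then obtain J where J: "\<And>k. J k < N" "\<And>k. good k (J k)" "\<And>k. \<not> good k (Suc (J k))" by metis
  have "\<exists>j. infinite {k. J k = j}"
  proof -
    have "finite (J ` UNIV)" using J(1) by (metis finite_nat_iff_bounded imageE lessThan_iff subsetI)
    then obtain k0 where "infinite {k \<in> UNIV. J k = J k0}"
      using pigeonhole_infinite[of UNIV J] infinite_UNIV_nat by auto
    then show ?thesis by auto
  qed
  then obtain j where inf: "infinite {k. J k = j}" by blast
  define K where "K = {k. J k = j}"
  have jN: "j < N" using inf J(1) by (metis (mono_tags, lifting) Collect_empty_eq finite.emptyI)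
  have "\<exists>t. t \<in> D k \<and> t \<in> C j \<and> (\<forall>w\<in>carrier R - T. w \<otimes> t \<notin> D (Suc k) <+> C (Suc j))" if "k \<in> K" for k
  proof -
    have "good k j" using J(2)[of k] that unfolding K_def by simp
    then obtain w where w: "w \<in> carrier R - T" "w \<otimes> d k \<in> D (Suc k) <+> C j" unfolding good_def by auto
    from w(2) obtain e t where et: "e \<in> D (Suc k)" "t \<in> C j" "w \<otimes> d k = e \<oplus> t" by (rule sum_addE)
    have c: "e \<in> carrier R" "t \<in> carrier R" "w \<in> carrier R" using et w idl_carr[OF Di] idl_carr[OF Ci] by auto
    have "t \<in> D k"
    proof (rule idl_add_cancel[OF Di])
      show "e \<oplus> t \<in> D k" using idl_mult[OF Di d(1)[of k] c(3)] et by simp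
    qed (use et D c in auto)
    moreover have "v \<otimes> t \<notin> D (Suc k) <+> C (Suc j)" if v: "v \<in> carrier R - T" for v
    proof
      assume a: "v \<otimes> t \<in> D (Suc k) <+> C (Suc j)"
      have s: "ideal (D (Suc k) <+> C (Suc j)) R" by (rule add_ideals[OF Di Ci])
      have "v \<otimes> e \<in> D (Suc k) <+> C (Suc j)"
        using subsetD[OF sum_upper1[OF Di Ci] idl_mult[OF Di et(1)]] v by simp
      then have "v \<otimes> e \<oplus> v \<otimes> t \<in> D (Suc k) <+> C (Suc j)" using idl_add[OF s] a by simp
      moreover have "v \<otimes> e \<oplus> v \<otimes> t = (v \<otimes> w) \<otimes> d k" using v c dc et(3) by (simp add: m_assoc r_distr)
      ultimately have "good k (Suc j)"
        unfolding good_def using primeideal_mult_notin[OF T v w(1)] by auto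
      then show False using J(3)[of k] \<open>k \<in> K\<close> unfolding K_def by simp
    qed
    ultimately show ?thesis using et by blast
  qed
  then obtain t where t: "\<And>k. k \<in> K \<Longrightarrow> t k \<in> D k" "\<And>k. k \<in> K \<Longrightarrow> t k \<in> C j"
    "\<And>k w. k \<in> K \<Longrightarrow> w \<in> carrier R - T \<Longrightarrow> w \<otimes> t k \<notin> D (Suc k) <+> C (Suc j)" by metis
  have tc: "t k \<in> carrier R" if "k \<in> K" for k using t(1)[OF that] idl_carr[OF Di] by blast
  (* The t i with i below k generate t k for some k, because the ideals they generate become
     stationary. The terms of such a combination are then moved into C (Suc j), the one with least
     index first. *)
  define G where "G l k = Idl (t ` {i \<in> K. l \<le> i \<and> i < k})" for l k
  have Gc: "t ` {i \<in> K. l \<le> i \<and> i < k} \<subseteq> carrier R" for l k using tc by auto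
  have Gi: "ideal (G l k) R" for l k unfolding G_def by (rule genideal_ideal[OF Gc])
  have Gm: "G 0 k \<subseteq> G 0 (Suc k)" for k
    unfolding G_def by (rule subset_Idl_subset[OF Gc]) auto
  obtain k0 where k0: "\<forall>k\<ge>k0. G 0 k = G 0 k0" using ideal_ascending_stable[of "G 0", OF Gi Gm] by auto
  obtain k where k: "k \<in> K" "k \<ge> k0"
    using inf unfolding K_def infinite_nat_iff_unbounded_le by blast
  have "t k \<in> G 0 (Suc k)" unfolding G_def by (rule subsetD[OF genideal_self[OF Gc]]) (use k in auto)
  also have "G 0 (Suc k) = G 0 k"
    by (rule trans[OF k0[rule_format, of "Suc k"] k0[rule_format, of k, symmetric]]) (use k(2) in linarith)+
  finally have start: "t k \<in> G 0 k" .
  have "t k \<in> C (Suc j) <+> G l k" if "l \<le> k" for l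
    using that
  proof (induction l)
    case 0 then show ?case using subsetD[OF sum_upper2[OF Ci Gi] start] by simp
  next
    case (Suc l)
    then have IH: "t k \<in> C (Suc j) <+> G l k" by simp
    show ?case
    proof (cases "l \<in> K")
      case False
      then have "{i \<in> K. l \<le> i \<and> i < k} = {i \<in> K. Suc l \<le> i \<and> i < k}" by (auto simp: Suc_le_eq order_le_less)
      then show ?thesis using IH unfolding G_def by simp
    next
      case True
      have "{i \<in> K. l \<le> i \<and> i < k} = insert l {i \<in> K. Suc l \<le> i \<and> i < k}"
        using True Suc.prems by (auto simp: Suc_le_eq)
      then have Gl: "G l k = PIdl (t l) <+> G (Suc l) k"
        unfolding G_def using Idl_insert[OF Gc tc[OF True], of "Suc l" k] by simp
      from IH obtain z y where zy: "z \<in> C (Suc j)" "y \<in> G l k" "t k = z \<oplus> y" by (rule sum_addE)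
      from zy(2) obtain p y' where py: "p \<in> PIdl (t l)" "y' \<in> G (Suc l) k" "y = p \<oplus> y'"
        unfolding Gl by (rule sum_addE)
      obtain a where a: "a \<in> carrier R" "p = a \<otimes> t l" using py(1) by (rule PIdlE)
      have GD: "G (Suc l) k \<subseteq> D (Suc l)"
        unfolding G_def by (rule genideal_minimal[OF Di]) (use t(1) Dm in blast)
      have c: "z \<in> carrier R" "y' \<in> carrier R" "p \<in> carrier R"
        using zy py idl_carr[OF Ci] idl_carr[OF Gi] a tc[OF True] by auto
      (* All other members of the combination lie in D (Suc l) + C (Suc j), which does not contain a
         multiple of t l by an element outside T. *)
      have "a \<in> T"
      proof (rule ccontr)
        assume "a \<notin> T"
        have s: "ideal (D (Suc l) <+> C (Suc j)) R" by (rule add_ideals[OF Di Ci])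
        note u1 = sum_upper1[OF Di Ci, of "Suc l" "Suc j"] and u2 = sum_upper2[OF Di Ci, of "Suc j" "Suc l"]
        have "t k \<in> D (Suc l)" using t(1)[OF k(1)] Dm[of "Suc l" k] Suc.prems by auto
        moreover have "y' \<in> D (Suc l)" using py GD by auto
        ultimately have m: "t k \<in> D (Suc l) <+> C (Suc j)" "y' \<in> D (Suc l) <+> C (Suc j)"
          "z \<in> D (Suc l) <+> C (Suc j)" using u1 u2 zy by auto
        have "t k = (z \<oplus> y') \<oplus> p" using zy py c by (simp add: a_ac)
        then have "p \<in> D (Suc l) <+> C (Suc j)"
          using idl_add_cancel[OF s, of "z \<oplus> y'" p] idl_add[OF s m(3,2)] m(1) c by simp
        then show False using t(3)[OF True, of a] a \<open>a \<notin> T\<close> by auto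
      qed
      then have "p \<in> C (Suc j)" using CT[OF jN] t(2)[OF True] a by auto
      then have "z \<oplus> p \<in> C (Suc j)" using zy idl_add[OF Ci] by simp
      moreover have "t k = (z \<oplus> p) \<oplus> y'" using zy py c by (simp add: a_ac)
      ultimately show ?thesis using py sum_addI by simp
    qed
  qed
  from this[of k] have "t k \<in> C (Suc j) <+> G k k" by simp
  moreover have "G k k = {\<zero>}"
  proof -
    have e: "{i \<in> K. k \<le> i \<and> i < k} = {}" by auto
    show ?thesis unfolding G_def e by (simp only: image_empty Idl_empty)
  qed
  ultimately have "t k \<in> C (Suc j)" using idl_carr[OF Ci, of _ "Suc j"] by (auto simp: set_add_def')
  then have "\<one> \<otimes> t k \<in> D (Suc k) <+> C (Suc j)" using sum_upper2[OF Di Ci, of "Suc j" "Suc k"] tc[OF k(1)] by auto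
  then show False using t(3)[OF k(1) primeideal_one_notin[OF T]] by simp
qed

text \<open>
  Krull's principal ideal theorem, in a form that produces the smaller prime. If there is no
  \<open>Q'\<close>, then \<open>T\<close> is minimal over \<open>P + (x)\<close>, so locally at \<open>T\<close> the symbolic powers of \<open>Q\<close> modulo
  \<open>P\<close> become stationary modulo \<open>x\<close>. As \<open>x \<notin> Q\<close>, an element \<open>r x\<close> of a symbolic power has \<open>r\<close> in
  the same symbolic power, and Nakayama's lemma at \<open>T\<close> shows that two consecutive symbolic
  powers agree. Then \<open>Q\<^sup>k \<subseteq> Q\<^sup>k\<^sup>+\<^sup>1 + P\<close> locally at \<open>Q\<close>, hence \<open>Q\<^sup>k \<subseteq> P\<close> by Nakayama's lemma at
  \<open>Q\<close>, and \<open>Q \<subseteq> P\<close>.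
\<close>

lemma principal_ideal_theorem:
  assumes P: "primeideal P R" and Q: "primeideal Q R" and T: "primeideal T R"
    and PQ: "P \<subset> Q" and QT: "Q \<subset> T" and x: "x \<in> T" "x \<notin> Q"
  shows "\<exists>Q'. primeideal Q' R \<and> P \<subseteq> Q' \<and> x \<in> Q' \<and> Q' \<subset> T"
proof (rule ccontr)
  assume neg: "\<not> ?thesis"
  note Pi = primeideal.axioms(1)[OF P] and Qi = primeideal.axioms(1)[OF Q] and Ti = primeideal.axioms(1)[OF T]
  have xc: "x \<in> carrier R" using x idl_carr[OF Ti] by simp
  define A where "A = P <+> PIdl x"
  have Ai: "ideal A R" unfolding A_def by (rule add_ideals[OF Pi cgenideal_ideal[OF xc]])
  have A: "P \<subseteq> A" "x \<in> A"
    unfolding A_def using sum_upper1[OF Pi cgenideal_ideal[OF xc]] sum_upper2[OF Pi cgenideal_ideal[OF xc]]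
      cgenideal_self[OF xc] by auto
  have "\<exists>N. socle_series T A N = carrier R"
  proof (rule socle_series_exhausts[OF T Ai])
    show "Q' = T" if "primeideal Q' R" "A \<subseteq> Q'" "Q' \<subseteq> T" for Q'
      using neg that A by blast
  qed
  then obtain N where N: "socle_series T A N = carrier R" by blast
  define C where "C j = socle_series T A (N - j)" for j
  (* Qs k is the contraction of the k-th power of Q modulo P from the localisation at Q: a symbolic
     power. *)
  define Qs where "Qs k = {a \<in> carrier R. \<exists>u\<in>carrier R - Q. u \<otimes> a \<in> ipow Q k <+> P}" for k
  have pk: "ideal (ipow Q k <+> P) R" for k by (rule add_ideals[OF ipow_ideal[OF Qi] Pi])
  have Qsi: "ideal (Qs k) R" for k unfolding Qs_def by (rule saturation_ideal[OF Q pk])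
  have in_Qs: "ipow Q k <+> P \<subseteq> Qs k" for k
    unfolding Qs_def using idl_carr[OF pk] primeideal_one_notin[OF Q] by (auto intro!: bexI[of _ \<one>])
  have PQs: "P \<subseteq> Qs k" for k using in_Qs[of k] sum_upper2[OF ipow_ideal[OF Qi] Pi, of k] by blast
  have Qs_anti: "Qs (Suc k) \<subseteq> Qs k" for k
  proof -
    have "ipow Q (Suc k) <+> P \<subseteq> ipow Q k <+> P"
      using ipow_antimono[OF Qi, of k "Suc k"] by (auto simp: set_add_def')
    then show ?thesis unfolding Qs_def by blast
  qed
  have px: "ideal (PIdl x) R" by (rule cgenideal_ideal[OF xc])
  have "\<exists>k. \<forall>a\<in>Qs k <+> PIdl x. \<exists>w\<in>carrier R - T. w \<otimes> a \<in> Qs (Suc k) <+> PIdl x"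
  proof (rule descending_stable_at_prime[OF T, where C = C and N = N])
    show "ideal (Qs k <+> PIdl x) R" for k by (rule add_ideals[OF Qsi px])
    show "Qs (Suc k) <+> PIdl x \<subseteq> Qs k <+> PIdl x" for k
      using Qs_anti[of k] by (auto simp: set_add_def')
    show "ideal (C j) R" for j unfolding C_def by (rule socle_series_ideal[OF T Ai])
    show "C 0 = carrier R" unfolding C_def using N by simp
    show "t \<otimes> c \<in> C (Suc j)" if "j < N" "t \<in> T" "c \<in> C j" for j t c
    proof -
      have "N - j = Suc (N - Suc j)" using that by simp
      then have "c \<in> socle_series T A (Suc (N - Suc j))" using that(3) unfolding C_def by metis
      then show ?thesis using that(2) unfolding C_def by simp
    qed
    show "\<exists>w\<in>carrier R - T. w \<otimes> c \<in> Qs k <+> PIdl x" if "c \<in> C N" for k c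
    proof -
      have "c \<in> socle_series T A 0" using that unfolding C_def by (simp only: diff_self_eq_0)
      then obtain u where u: "u \<in> carrier R - T" "u \<otimes> c \<in> A" unfolding socle_series.simps(1) by blast
      have "A \<subseteq> Qs k <+> PIdl x" unfolding A_def set_add_def' using PQs[of k] by blast
      then show ?thesis using u by (intro bexI[of _ u]) auto
    qed
  qed
  then obtain k where k: "\<forall>a\<in>Qs k <+> PIdl x. \<exists>w\<in>carrier R - T. w \<otimes> a \<in> Qs (Suc k) <+> PIdl x"
    by (rule exE)
  obtain G where G: "finite G" "G \<subseteq> Qs k" "Qs k = Idl G" using ideal_fg[OF Qsi] by blast
  have Gc: "G \<subseteq> carrier R" using G idl_subset[OF Qsi] by blast
  have s: "ideal (Qs (Suc k) <+> T \<cdot> (Idl G)) R"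
    by (rule add_ideals[OF Qsi ideal_prod_is_ideal[OF Ti genideal_ideal[OF Gc]]])
  have "\<exists>v\<in>carrier R - T. \<forall>g\<in>G. v \<otimes> g \<in> Qs (Suc k) <+> T \<cdot> (Idl G)"
  proof (rule common_multiplier[OF T s G(1) Gc])
    fix g assume g: "g \<in> G"
    then have gQ: "g \<in> Qs k" using G by auto
    then have "g \<in> Qs k <+> PIdl x" using sum_upper1[OF Qsi[of k] px] by blast
    then obtain w where w: "w \<in> carrier R - T" "w \<otimes> g \<in> Qs (Suc k) <+> PIdl x" by (rule bspec[OF k, THEN bexE])
    from w(2) obtain q p where qp: "q \<in> Qs (Suc k)" "p \<in> PIdl x" "w \<otimes> g = q \<oplus> p" by (rule sum_addE)
    obtain r where r: "r \<in> carrier R" "p = r \<otimes> x" using qp(2) by (rule PIdlE)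
    have "q \<oplus> p \<in> Qs k" using idl_mult[OF Qsi gQ, of w] w qp by simp
    then have "p \<in> Qs k" using idl_add_cancel[OF Qsi, of q p k] qp Qs_anti[of k] r xc by auto
    then obtain u where u: "u \<in> carrier R - Q" "u \<otimes> p \<in> ipow Q k <+> P" unfolding Qs_def by auto
    have "(u \<otimes> x) \<otimes> r \<in> ipow Q k <+> P" using u r xc by (simp add: m_ac)
    moreover have "u \<otimes> x \<in> carrier R - Q" using primeideal_mult_notin[OF Q u(1)] x xc by simp
    ultimately have "r \<in> Qs k" using r unfolding Qs_def by blast
    then have "x \<otimes> r \<in> T \<cdot> (Idl G)" using ideal_prod.prod[OF x(1), of r "Idl G" R] G(3) by simp
    then have "p \<in> T \<cdot> (Idl G)" using r xc by (simp add: m_comm)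
    then have "w \<otimes> g \<in> Qs (Suc k) <+> T \<cdot> (Idl G)" using qp sum_addI by simp
    then show "\<exists>w\<in>carrier R - T. w \<otimes> g \<in> Qs (Suc k) <+> T \<cdot> (Idl G)" using w by blast
  qed
  then obtain v where v: "v \<in> carrier R - T" "\<forall>g\<in>G. v \<otimes> g \<in> Qs (Suc k) <+> T \<cdot> (Idl G)" by (rule bexE)
  have "\<exists>w\<in>carrier R - T. \<forall>a\<in>Idl G. w \<otimes> a \<in> Qs (Suc k)"
    by (rule nakayama_prime[OF T Qsi G(1) Gc v(1)]) (use v(2) in simp)
  then obtain w where w: "w \<in> carrier R - T" "\<forall>a\<in>Qs k. w \<otimes> a \<in> Qs (Suc k)"
    unfolding G(3)[symmetric] by (rule bexE)
  have wQ: "w \<in> carrier R - Q" using w QT by auto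
  obtain H where H: "finite H" "H \<subseteq> ipow Q k" "ipow Q k = Idl H" using ideal_fg[OF ipow_ideal[OF Qi]] by blast
  have Hc: "H \<subseteq> carrier R" using H idl_subset[OF ipow_ideal[OF Qi]] by blast
  have "\<exists>v\<in>carrier R - Q. \<forall>h\<in>H. v \<otimes> h \<in> ipow Q (Suc k) <+> P"
  proof (rule common_multiplier[OF Q pk H(1) Hc])
    fix h assume "h \<in> H"
    then have hc: "h \<in> carrier R" and "h \<in> Qs k"
      using Hc H in_Qs[of k] sum_upper1[OF ipow_ideal[OF Qi] Pi, of k] by auto
    then have "w \<otimes> h \<in> Qs (Suc k)" using w by simp
    then obtain u where u: "u \<in> carrier R - Q" "u \<otimes> (w \<otimes> h) \<in> ipow Q (Suc k) <+> P" unfolding Qs_def by auto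
    then have "(u \<otimes> w) \<otimes> h \<in> ipow Q (Suc k) <+> P" using hc wQ by (simp add: m_assoc)
    then show "\<exists>w\<in>carrier R - Q. w \<otimes> h \<in> ipow Q (Suc k) <+> P"
      using primeideal_mult_notin[OF Q u(1) wQ] by blast
  qed
  then obtain v' where v': "v' \<in> carrier R - Q" "\<forall>h\<in>H. v' \<otimes> h \<in> ipow Q (Suc k) <+> P" by (rule bexE)
  have eq: "ipow Q (Suc k) <+> P = P <+> Q \<cdot> (Idl H)"
    unfolding H(3)[symmetric] ipow_Suc2[OF Qi, symmetric]
    by (rule set_add_comm[OF idl_subset[OF ipow_ideal[OF Qi]] idl_subset[OF Pi]])
  have "\<exists>w\<in>carrier R - Q. \<forall>a\<in>Idl H. w \<otimes> a \<in> P"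
    by (rule nakayama_prime[OF Q Pi H(1) Hc v'(1)]) (use v'(2) eq in simp)
  then obtain w' where w': "w' \<in> carrier R - Q" "\<forall>a\<in>ipow Q k. w' \<otimes> a \<in> P"
    unfolding H(3)[symmetric] by (rule bexE)
  have "Q \<subseteq> P"
  proof
    fix a assume a: "a \<in> Q"
    then have ac: "a \<in> carrier R" using idl_carr Qi by simp
    have "w' \<otimes> a [^] k \<in> P" using w' pow_in_ipow[OF Qi a] by simp
    then have "a [^] k \<in> P" using primeideal.I_prime[OF P, of w' "a [^] k"] w' ac PQ by auto
    then show "a \<in> P" using primeideal_pow[OF P ac] by simp
  qed
  then show False using PQ by auto
qed

end

section \<open>Regular sequences\<close>

context cring begin

lemma nakayama_local:
  assumes T: "primeideal T R" and units: "\<And>u. u \<in> carrier R - T \<Longrightarrow> u \<in> Units R"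
    and B: "ideal B R" and G: "finite G" "G \<subseteq> carrier R" "J = Idl G" and J: "J \<subseteq> B <+> T \<cdot> J"
  shows "J \<subseteq> B"
proof
  have Ji: "ideal J R" unfolding G(3) by (rule genideal_ideal[OF G(2)])
  have one: "\<one> \<in> carrier R - T" by (rule primeideal_one_notin[OF T])
  have "\<exists>w \<in> carrier R - T. \<forall>a\<in>Idl G. w \<otimes> a \<in> B"
  proof (rule nakayama_prime[OF T B G(1,2) one])
    fix g assume "g \<in> G"
    then have "g \<in> J" "g \<in> carrier R" using G genideal_self by auto
    then show "\<one> \<otimes> g \<in> B <+> T \<cdot> (Idl G)" using J G(3) by auto
  qed
  then obtain w where w: "w \<in> carrier R - T" "\<forall>a\<in>J. w \<otimes> a \<in> B" unfolding G(3) by (rule bexE)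
  fix a assume a: "a \<in> J"
  have u: "w \<in> Units R" by (rule units[OF w(1)])
  have ac: "a \<in> carrier R" using idl_carr Ji a by simp
  have "inv w \<otimes> (w \<otimes> a) \<in> B" using idl_mult[OF B, of "w \<otimes> a" "inv w"] w(2) a u by simp
  moreover have "inv w \<otimes> (w \<otimes> a) = a" using u ac by (simp add: m_assoc[symmetric] Units_closed)
  ultimately show "a \<in> B" by simp
qed

text \<open>
  Each \<open>y\<close> is a nonzerodivisor modulo \<open>A\<close> and the preceding members; nothing is required of the
  ideal generated by all of them.
\<close>

primrec regseq :: "'a set \<Rightarrow> 'a list \<Rightarrow> bool" where
  "regseq A [] \<longleftrightarrow> True"
| "regseq A (y # ys) \<longleftrightarrow> (\<forall>a\<in>carrier R. a \<otimes> y \<in> A \<longrightarrow> a \<in> A) \<and> regseq (A <+> PIdl y) ys"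

end

context noetherian_cring begin

definition prime_chain :: "nat \<Rightarrow> 'a set \<Rightarrow> 'a set \<Rightarrow> bool" where
  "prime_chain l P T \<longleftrightarrow> (\<exists>C. (\<forall>i\<le>l. primeideal (C i) R) \<and> (\<forall>i<l. C i \<subset> C (Suc i)) \<and> C 0 = P \<and> C l = T)"

text \<open>
  Going down from the top, the principal ideal theorem exchanges one member of the chain at a
  time for a prime that contains \<open>x\<close>.
\<close>

lemma prime_chain_move_down:
  assumes "\<forall>i\<le>Suc l. primeideal (C i) R" "\<forall>i<Suc l. C i \<subset> C (Suc i)" "x \<in> C (Suc l)"
  shows "\<exists>C'. (\<forall>i\<le>Suc l. primeideal (C' i) R) \<and> (\<forall>i<Suc l. C' i \<subset> C' (Suc i)) \<and>
    C' 0 = C 0 \<and> C' (Suc l) = C (Suc l) \<and> x \<in> C' 1"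
  using assms
proof (induction l arbitrary: C)
  case 0
  then show ?case by (intro exI[of _ C]) auto
next
  case (Suc l)
  have "\<exists>Q. primeideal Q R \<and> C l \<subset> Q \<and> x \<in> Q \<and> Q \<subset> C (Suc (Suc l))"
  proof (cases "x \<in> C (Suc l)")
    case True
    have "primeideal (C (Suc l)) R" "C l \<subset> C (Suc l)" "C (Suc l) \<subset> C (Suc (Suc l))" using Suc.prems by auto
    then show ?thesis using True by blast
  next
    case False
    have p: "primeideal (C l) R" "primeideal (C (Suc l)) R" "primeideal (C (Suc (Suc l))) R"
      "C l \<subset> C (Suc l)" "C (Suc l) \<subset> C (Suc (Suc l))" using Suc.prems by auto
    obtain Q where Q: "primeideal Q R" "C l \<subseteq> Q" "x \<in> Q" "Q \<subset> C (Suc (Suc l))"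
      using principal_ideal_theorem[OF p Suc.prems(3) False] by auto
    have "C l \<noteq> Q" using Q(3) False p(4) by auto
    then show ?thesis using Q by (intro exI[of _ Q]) auto
  qed
  then obtain Q where Q: "primeideal Q R" "C l \<subset> Q" "x \<in> Q" "Q \<subset> C (Suc (Suc l))" by auto
  define D where "D = C(Suc l := Q)"
  have "\<exists>C'. (\<forall>i\<le>Suc l. primeideal (C' i) R) \<and> (\<forall>i<Suc l. C' i \<subset> C' (Suc i)) \<and>
    C' 0 = D 0 \<and> C' (Suc l) = D (Suc l) \<and> x \<in> C' 1"
  proof (rule Suc.IH)
    show "\<forall>i\<le>Suc l. primeideal (D i) R" unfolding D_def using Q Suc.prems by auto
    show "\<forall>i<Suc l. D i \<subset> D (Suc i)" unfolding D_def using Q Suc.prems by (auto simp: less_Suc_eq)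
    show "x \<in> D (Suc l)" unfolding D_def using Q by simp
  qed
  then obtain C' where C': "\<forall>i\<le>Suc l. primeideal (C' i) R" "\<forall>i<Suc l. C' i \<subset> C' (Suc i)"
    "C' 0 = D 0" "C' (Suc l) = D (Suc l)" "x \<in> C' 1" by auto
  have top: "C' (Suc l) = Q" using C'(4) unfolding D_def by simp
  show ?case
  proof (intro exI[of _ "C'(Suc (Suc l) := C (Suc (Suc l)))"] conjI allI impI)
    fix i assume "i \<le> Suc (Suc l)"
    then show "primeideal ((C'(Suc (Suc l) := C (Suc (Suc l)))) i) R"
      using C'(1) Suc.prems(1) by (auto simp: le_Suc_eq)
  next
    fix i assume "i < Suc (Suc l)"
    then show "(C'(Suc (Suc l) := C (Suc (Suc l)))) i \<subset> (C'(Suc (Suc l) := C (Suc (Suc l)))) (Suc i)"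
      using C'(2) top Q(4) by (auto simp: less_Suc_eq)
  qed (use C' in \<open>auto simp: D_def\<close>)
qed

lemma prime_chain_step:
  assumes "prime_chain (Suc l) P T" "x \<in> T"
  shows "\<exists>Q. primeideal Q R \<and> P \<subset> Q \<and> x \<in> Q \<and> prime_chain l Q T"
proof -
  obtain C where C: "\<forall>i\<le>Suc l. primeideal (C i) R" "\<forall>i<Suc l. C i \<subset> C (Suc i)" "C 0 = P" "C (Suc l) = T"
    using assms(1) unfolding prime_chain_def by auto
  then obtain D where D: "\<forall>i\<le>Suc l. primeideal (D i) R" "\<forall>i<Suc l. D i \<subset> D (Suc i)"
    "D 0 = P" "D (Suc l) = T" "x \<in> D 1"
    using prime_chain_move_down[of l C x] assms(2) by auto
  have "prime_chain l (D 1) T"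
    unfolding prime_chain_def using D by (intro exI[of _ "\<lambda>i. D (Suc i)"]) auto
  then show ?thesis using D by (intro exI[of _ "D 1"]) auto
qed

text \<open>Each generator, once moved into the second member of the chain, uses up one step.\<close>

lemma prime_chain_length_le:
  assumes "prime_chain l P T" "set ys \<subseteq> T"
    and "\<And>J. ideal J R \<Longrightarrow> P \<subseteq> J \<Longrightarrow> set ys \<subseteq> J \<Longrightarrow> T \<subseteq> J"
  shows "l \<le> length ys"
  using assms
proof (induction ys arbitrary: l P)
  case (Nil l P)
  show ?case
  proof (cases l)
    case (Suc k)
    then obtain C where C: "\<forall>i\<le>l. primeideal (C i) R" "\<forall>i<l. C i \<subset> C (Suc i)" "C 0 = P" "C l = T"
      using Nil.prems unfolding prime_chain_def by auto
    have "primeideal (C 0) R" using C(1) by simp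
    then have "T \<subseteq> P" using Nil.prems(3)[of P] primeideal.axioms(1) C(3) by auto
    moreover have "C 0 \<subset> C (Suc 0)" using C(2) Suc by simp
    moreover {
    have "i \<le> k \<Longrightarrow> C (Suc 0) \<subseteq> C (Suc i)" for i
      using C(2) Suc by (induction i) (simp_all, metis Suc_leD less_Suc_eq_le psubsetE subset_trans Suc_le_eq)
    then have "C (Suc 0) \<subseteq> C (Suc k)" by simp
    then have "C (Suc 0) \<subseteq> T" using C(4) Suc by simp }
    ultimately show ?thesis using C(3) by auto
  qed simp
next
  case (Cons y ys l P)
  show ?case
  proof (cases l)
    case (Suc k)
    obtain Q where Q: "primeideal Q R" "P \<subset> Q" "y \<in> Q" "prime_chain k Q T"
      using prime_chain_step[of k P T y] Cons.prems Suc by auto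
    have "k \<le> length ys"
    proof (rule Cons.IH[OF Q(4)])
      show "T \<subseteq> J" if "ideal J R" "Q \<subseteq> J" "set ys \<subseteq> J" for J
        using Cons.prems(3)[of J] that Q by auto
    qed (use Cons.prems in auto)
    then show ?thesis using Suc by simp
  qed simp
qed

lemma prime_chain_0: "prime_chain 0 P T \<longleftrightarrow> primeideal P R \<and> P = T"
  unfolding prime_chain_def by (auto intro!: exI[of _ "\<lambda>_. P"])

text \<open>
  A chain as long as the number of generators leaves no room. After \<open>y\<close> has been moved into the
  second member \<open>Q\<close>, induction gives \<open>Q = A + (y)\<close>. Moreover \<open>y \<notin> P\<close>, as otherwise fewer
  generators would suffice for the same chain. Hence \<open>P = A + y P\<close>, and \<open>P = A\<close> by Nakayama's
  lemma; so \<open>A\<close> is prime and \<open>y\<close> is a nonzerodivisor modulo \<open>A\<close>.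
\<close>

lemma prime_chain_regseq:
  assumes T: "primeideal T R" and units: "\<And>u. u \<in> carrier R - T \<Longrightarrow> u \<in> Units R"
    and "ideal A R" "A \<subseteq> P" "primeideal P R" "set ys \<subseteq> T"
    and "\<And>J. ideal J R \<Longrightarrow> A \<subseteq> J \<Longrightarrow> set ys \<subseteq> J \<Longrightarrow> T \<subseteq> J"
    and "prime_chain (length ys) P T"
  shows "P = A \<and> regseq A ys"
  using assms(3-)
proof (induction ys arbitrary: A P)
  case (Nil A P)
  then have "P = T" "T \<subseteq> A" using prime_chain_0 by auto
  then show ?case using Nil by auto
next
  case (Cons y ys A P)
  have Ti: "ideal T R" by (rule primeideal.axioms(1)[OF T])
  have y: "y \<in> T" "y \<in> carrier R" using Cons.prems idl_carr[OF Ti] by auto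
  have Pi: "ideal P R" by (rule primeideal.axioms(1)[OF Cons.prems(3)])
  obtain Q where Q: "primeideal Q R" "P \<subset> Q" "y \<in> Q" "prime_chain (length ys) Q T"
    using prime_chain_step[of "length ys" P T y] Cons.prems y by auto
  have Qi: "ideal Q R" by (rule primeideal.axioms(1)[OF Q(1)])
  have yi: "ideal (PIdl y) R" by (rule cgenideal_ideal[OF y(2)])
  have up: "A \<subseteq> A <+> PIdl y" "PIdl y \<subseteq> A <+> PIdl y"
    using sum_upper1 sum_upper2 Cons.prems(1) yi by auto
  have IH: "Q = A <+> PIdl y \<and> regseq (A <+> PIdl y) ys"
  proof (rule Cons.IH[OF add_ideals[OF Cons.prems(1) yi] _ Q(1)])
    show "A <+> PIdl y \<subseteq> Q"
      by (rule sum_least[OF Qi]) (use Cons.prems Q cgenideal_minimal[OF Qi Q(3)] in auto)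
    show "T \<subseteq> J" if "ideal J R" "A <+> PIdl y \<subseteq> J" "set ys \<subseteq> J" for J
      using Cons.prems(5)[of J] that up cgenideal_self[OF y(2)] by auto
  qed (use Cons.prems Q in auto)
  have yP: "y \<notin> P"
  proof
    assume "y \<in> P"
    have "length (y # ys) \<le> length ys"
    proof (rule prime_chain_length_le[OF Cons.prems(6)])
      show "T \<subseteq> J" if "ideal J R" "P \<subseteq> J" "set ys \<subseteq> J" for J
        using Cons.prems(5)[of J] that \<open>y \<in> P\<close> Cons.prems(2) by auto
    qed (use Cons.prems in auto)
    then show False by simp
  qed
  have "P \<subseteq> A"
  proof -
    obtain G where G: "finite G" "G \<subseteq> P" "P = Idl G" using ideal_fg[OF Pi] by auto
    have Gc: "G \<subseteq> carrier R" using G idl_subset[OF Pi] by blast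
    show ?thesis
    proof (rule nakayama_local[OF T units Cons.prems(1) G(1) Gc G(3)])
      show "P \<subseteq> A <+> T \<cdot> P"
      proof
        fix p assume p: "p \<in> P"
        then have "p \<in> A <+> PIdl y" using Q IH by auto
        then obtain a q where aq: "a \<in> A" "q \<in> PIdl y" "p = a \<oplus> q" by (rule sum_addE)
        obtain r where r: "r \<in> carrier R" "q = r \<otimes> y" using aq(2) by (rule PIdlE)
        have "q \<in> P" by (rule idl_add_cancel[OF Pi, of a]) (use aq p Cons.prems r y in auto)
        then have "r \<in> P" using primeideal.I_prime[OF Cons.prems(3), of r y] r y yP by auto
        then have "y \<otimes> r \<in> T \<cdot> P" using y by (intro ideal_prod.prod) auto
        then have "q \<in> T \<cdot> P" using r y by (simp add: m_comm)
        then show "p \<in> A <+> T \<cdot> P" using aq sum_addI by simp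
      qed
    qed
  qed
  then have PA: "P = A" using Cons.prems by auto
  have "\<forall>a\<in>carrier R. a \<otimes> y \<in> A \<longrightarrow> a \<in> A"
    using primeideal.I_prime[OF Cons.prems(3)] yP y(2) unfolding PA by blast
  then show ?case using PA IH by simp
qed

end

section \<open>Linear combinations with coefficients in an ideal\<close>

context cring begin

definition lin :: "'a set \<Rightarrow> ('x \<Rightarrow> 'a) \<Rightarrow> 'x set \<Rightarrow> 'a set" where
  "lin J f X = {(\<Oplus>x\<in>X. e x \<otimes> f x) | e. e \<in> X \<rightarrow> J}"

lemma finsum_in_ideal:
  assumes J: "ideal J R" and "finite X" "\<And>x. x \<in> X \<Longrightarrow> g x \<in> J"
  shows "(\<Oplus>x\<in>X. g x) \<in> J"
  using assms(2-)
proof (induction X)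
  case empty then show ?case using idl_zero[OF J] by simp
next
  case (insert y X)
  have "(\<Oplus>x\<in>insert y X. g x) = g y \<oplus> (\<Oplus>x\<in>X. g x)"
    using insert idl_carr[OF J] by (intro finsum_insert) auto
  then show ?case using insert idl_add[OF J] by simp
qed

lemma linI: "e \<in> X \<rightarrow> J \<Longrightarrow> (\<Oplus>x\<in>X. e x \<otimes> f x) \<in> lin J f X"
  unfolding lin_def by auto

lemma linE: "a \<in> lin J f X \<Longrightarrow> (\<And>e. e \<in> X \<rightarrow> J \<Longrightarrow> a = (\<Oplus>x\<in>X. e x \<otimes> f x) \<Longrightarrow> thesis) \<Longrightarrow> thesis"
  unfolding lin_def by auto

lemma lin_ideal:
  assumes J: "ideal J R" and X: "finite X" and f: "\<And>x. x \<in> X \<Longrightarrow> f x \<in> carrier R"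
  shows "ideal (lin J f X) R"
proof (rule idlI)
  note Jc = idl_carr[OF J]
  show "lin J f X \<subseteq> carrier R" unfolding lin_def using Jc f by (auto intro!: finsum_closed)
  have "(\<Oplus>x\<in>X. \<zero> \<otimes> f x) = (\<Oplus>x\<in>X. \<zero>)" by (rule finsum_cong') (use f in auto)
  then have "(\<Oplus>x\<in>X. \<zero> \<otimes> f x) = \<zero>" by simp
  then show "\<zero> \<in> lin J f X" using linI[of "\<lambda>_. \<zero>" X J f] idl_zero[OF J] by simp
  fix a assume "a \<in> lin J f X"
  then obtain e where e: "e \<in> X \<rightarrow> J" "a = (\<Oplus>x\<in>X. e x \<otimes> f x)" by (rule linE)
  have ec: "e \<in> X \<rightarrow> carrier R" using e Jc by auto
  { fix b assume "b \<in> lin J f X"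
    then obtain d where d: "d \<in> X \<rightarrow> J" "b = (\<Oplus>x\<in>X. d x \<otimes> f x)" by (rule linE)
    have dc: "d \<in> X \<rightarrow> carrier R" using d Jc by auto
    have "a \<oplus> b = (\<Oplus>x\<in>X. e x \<otimes> f x \<oplus> d x \<otimes> f x)"
      unfolding e(2) d(2) using ec dc f by (intro finsum_addf[symmetric]) auto
    also have "\<dots> = (\<Oplus>x\<in>X. (e x \<oplus> d x) \<otimes> f x)"
      using ec dc f by (intro finsum_cong') (auto simp: l_distr Pi_iff)
    also have "\<dots> \<in> lin J f X" using e d idl_add[OF J] by (intro linI) auto
    finally show "a \<oplus> b \<in> lin J f X" . }
  fix r assume r: "r \<in> carrier R"
  have "r \<otimes> a = (\<Oplus>x\<in>X. r \<otimes> (e x \<otimes> f x))"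
    unfolding e(2) using X r ec f by (intro finsum_rdistr) auto
  also have "\<dots> = (\<Oplus>x\<in>X. (r \<otimes> e x) \<otimes> f x)"
    using ec f r by (intro finsum_cong') (auto simp: m_assoc Pi_iff)
  also have "\<dots> \<in> lin J f X" using e r idl_mult[OF J] by (intro linI) auto
  finally show "r \<otimes> a \<in> lin J f X" .
qed

lemma lin_gen:
  assumes J: "ideal J R" and X: "finite X" and f: "\<And>x. x \<in> X \<Longrightarrow> f x \<in> carrier R"
    and "j \<in> J" "y \<in> X"
  shows "j \<otimes> f y \<in> lin J f X"
proof -
  have jc: "j \<in> carrier R" using idl_carr J assms by simp
  have "(\<Oplus>x\<in>X. (if x = y then j else \<zero>) \<otimes> f x) = (\<Oplus>x\<in>X. if y = x then j \<otimes> f x else \<zero>)"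
    using jc f by (intro finsum_cong') auto
  also have "\<dots> = j \<otimes> f y" using add.finprod_singleton[OF \<open>y \<in> X\<close> X, of "\<lambda>x. j \<otimes> f x"] jc f
    by (simp add: finsum_def)
  finally show ?thesis using linI[of "\<lambda>x. if x = y then j else \<zero>" X J f] idl_zero[OF J] assms by auto
qed

lemma lin_least:
  assumes C: "ideal C R" and X: "finite X" and "\<And>j x. j \<in> J \<Longrightarrow> x \<in> X \<Longrightarrow> j \<otimes> f x \<in> C"
  shows "lin J f X \<subseteq> C"
  using finsum_in_ideal[OF C X] assms(3) by (auto simp: lin_def Pi_iff)

lemma lin_carrier_eq_Idl:
  assumes X: "finite X" and f: "\<And>x. x \<in> X \<Longrightarrow> f x \<in> carrier R"
  shows "lin (carrier R) f X = Idl (f ` X)"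
proof
  have c: "f ` X \<subseteq> carrier R" using f by auto
  have i: "ideal (Idl (f ` X)) R" by (rule genideal_ideal[OF c])
  show "lin (carrier R) f X \<subseteq> Idl (f ` X)"
  proof (rule lin_least[OF i X])
    fix j x assume "j \<in> carrier R" "x \<in> X"
    then show "j \<otimes> f x \<in> Idl (f ` X)" using idl_mult[OF i, of "f x" j] genideal_self[OF c] by auto
  qed
  show "Idl (f ` X) \<subseteq> lin (carrier R) f X"
  proof (rule genideal_minimal[OF lin_ideal[OF oneideal X f]])
    show "f ` X \<subseteq> lin (carrier R) f X"
    proof
      fix y assume "y \<in> f ` X"
      then obtain x where "x \<in> X" "y = f x" by auto
      then show "y \<in> lin (carrier R) f X" using lin_gen[OF oneideal X f, where j = \<one> and y = x] f by simp
    qed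
  qed
qed

end

section \<open>Monomials and quasi-regularity\<close>

definition Mon :: "nat \<Rightarrow> nat \<Rightarrow> nat multiset set" where
  "Mon n s = {A. set_mset A \<subseteq> {..<n} \<and> size A = s}"

lemma Mon_0: "Mon n 0 = {{#}}" unfolding Mon_def by auto
lemma Mon_0_Suc: "Mon 0 (Suc s) = {}" unfolding Mon_def by auto

lemma Mon_Suc_Suc: "Mon (Suc n) (Suc s) = Mon n (Suc s) \<union> add_mset n ` Mon (Suc n) s"
proof
  show "Mon (Suc n) (Suc s) \<subseteq> Mon n (Suc s) \<union> add_mset n ` Mon (Suc n) s"
  proof
    fix A assume A: "A \<in> Mon (Suc n) (Suc s)"
    show "A \<in> Mon n (Suc s) \<union> add_mset n ` Mon (Suc n) s"
    proof (cases "n \<in># A")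
      case True
      then obtain B where "A = add_mset n B" by (rule mset_add)
      then show ?thesis using A unfolding Mon_def by auto
    next
      case False
      have "set_mset A \<subseteq> {..<n}"
      proof
        fix i assume i: "i \<in> set_mset A"
        then have "i < Suc n" using A unfolding Mon_def by auto
        moreover have "i \<noteq> n" using False i by auto
        ultimately show "i \<in> {..<n}" by simp
      qed
      then show ?thesis using A unfolding Mon_def by auto
    qed
  qed
qed (auto simp: Mon_def less_Suc_eq)

lemma Mon_disjoint: "Mon n (Suc s) \<inter> add_mset n ` Mon (Suc n) s = {}"
  unfolding Mon_def by auto

lemma finite_Mon: "finite (Mon n s)"
proof (induction n arbitrary: s)
  case 0 show ?case by (cases s) (simp_all add: Mon_0 Mon_0_Suc)
next
  case (Suc n)
  show ?case by (induction s) (simp_all add: Mon_0 Mon_Suc_Suc Suc.IH)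
qed

lemma card_Mon_Suc_Suc: "card (Mon (Suc n) (Suc s)) = card (Mon n (Suc s)) + card (Mon (Suc n) s)"
  unfolding Mon_Suc_Suc
  by (subst card_Un_disjoint) (auto simp: finite_Mon Mon_disjoint card_image inj_on_def)

lemma card_Mon: "card (Mon (Suc n) s) = (n + s) choose s"
proof (induction n arbitrary: s)
  case 0
  show ?case by (induction s) (simp_all add: Mon_0 card_Mon_Suc_Suc Mon_0_Suc)
next
  case (Suc n)
  note IH = Suc.IH
  show ?case
  proof (induction s)
    case 0 show ?case by (simp add: Mon_0)
  next
    case (Suc s)
    have "card (Mon (Suc (Suc n)) (Suc s)) = (n + Suc s choose Suc s) + (Suc n + s choose s)"
      unfolding card_Mon_Suc_Suc[of "Suc n"] IH Suc.IH ..
    then show ?case by simp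
  qed
qed

text \<open>A further variable fills up the monomials of degree at most \<open>s\<close> to degree \<open>s\<close>.\<close>

lemma sum_card_Mon: "(\<Sum>t\<le>s. card (Mon n t)) = card (Mon (Suc n) s)"
  by (induction s) (simp_all add: Mon_0 card_Mon_Suc_Suc)

lemma Mon_add: "A \<in> Mon n s \<Longrightarrow> i < n \<Longrightarrow> add_mset i A \<in> Mon n (Suc s)"
  unfolding Mon_def by auto

lemma Mon_SucE:
  assumes "A \<in> Mon n (Suc s)"
  obtains i B where "i < n" "B \<in> Mon n s" "A = add_mset i B"
proof -
  have "A \<noteq> {#}" using assms unfolding Mon_def by auto
  then obtain i B where "A = add_mset i B" by (meson multiset_cases)
  then show ?thesis using that assms unfolding Mon_def by auto
qed

context cring begin

text \<open>
  A monomial is the multiset of its variables. Its value is computed along the sorted list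
  because the ring is commutative on its carrier only.
\<close>

definition mval :: "(nat \<Rightarrow> 'a) \<Rightarrow> nat multiset \<Rightarrow> 'a" where
  "mval x A = foldr (\<otimes>) (map x (sorted_list_of_multiset A)) \<one>"

lemma mval_empty: "mval x {#} = \<one>" unfolding mval_def by simp

lemma mval_add:
  assumes "\<And>i. i \<in># add_mset j A \<Longrightarrow> x i \<in> carrier R"
  shows "mval x (add_mset j A) = x j \<otimes> mval x A"
proof -
  let ?l = "map x (sorted_list_of_multiset (add_mset j A))" and ?k = "x j # map x (sorted_list_of_multiset A)"
  have "mset ?l = mset ?k" unfolding mset_map mset_sorted_list_of_multiset by simp
  moreover have "set ?l \<subseteq> carrier R" using assms by (auto simp del: sorted_list_of_multiset_insert)
  ultimately have "foldr (\<otimes>) ?l \<one> = foldr (\<otimes>) ?k \<one>"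
    by (rule multlist_perm_cong)
  then show ?thesis unfolding mval_def by simp
qed

lemma mval_closed:
  assumes "\<And>i. i \<in># A \<Longrightarrow> x i \<in> carrier R"
  shows "mval x A \<in> carrier R"
  using assms
proof (induction A)
  case (add j A)
  then show ?case using mval_add[of j A x] by auto
qed (simp add: mval_empty)

end

text \<open>
  Below, \<open>N i\<close> is the ideal of the first \<open>i\<close> parameters, \<open>Np i s\<close> its power with exponent \<open>s\<close>,
  written with monomials, and \<open>mon_sum i s c\<close> the form of degree \<open>s\<close> in these parameters with
  coefficients \<open>c\<close>.
\<close>

locale regular_parameters = cring R for R (structure) +
  fixes x :: "nat \<Rightarrow> 'a" and n :: nat
  assumes x_closed: "\<And>i. i < n \<Longrightarrow> x i \<in> carrier R"
    and regular: "\<And>i a. i < n \<Longrightarrow> a \<in> carrier R \<Longrightarrow> a \<otimes> x i \<in> Idl (x ` {..<i}) \<Longrightarrow> a \<in> Idl (x ` {..<i})"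
begin

abbreviation N where "N i \<equiv> Idl (x ` {..<i})"
abbreviation Np where "Np i s \<equiv> lin (carrier R) (mval x) (Mon i s)"

lemma N_ideal: "i \<le> n \<Longrightarrow> ideal (N i) R"
  by (rule genideal_ideal) (use x_closed in auto)

lemma mval_c: "A \<in> Mon i s \<Longrightarrow> i \<le> n \<Longrightarrow> mval x A \<in> carrier R"
  by (rule mval_closed) (use x_closed in \<open>auto simp: Mon_def\<close>)

lemma mval_a: "A \<in> Mon i s \<Longrightarrow> j < i \<Longrightarrow> i \<le> n \<Longrightarrow> mval x (add_mset j A) = x j \<otimes> mval x A"
  by (rule mval_add) (use x_closed in \<open>auto simp: Mon_def\<close>)

lemma Np_ideal: "i \<le> n \<Longrightarrow> ideal (Np i s) R"
  by (rule lin_ideal[OF oneideal finite_Mon]) (rule mval_c)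

lemma linN_ideal: "i \<le> n \<Longrightarrow> ideal (lin (N i) (mval x) (Mon i s)) R"
  by (rule lin_ideal[OF N_ideal finite_Mon]) (auto intro: mval_c)

lemma x_in_N: "j < i \<Longrightarrow> i \<le> n \<Longrightarrow> x j \<in> N i"
  using genideal_self[of "x ` {..<i}"] x_closed by fastforce

lemma Np_Suc_subset: 
  assumes i: "i \<le> n" shows "Np i (Suc s) \<subseteq> lin (N i) (mval x) (Mon i s)"
proof (rule lin_least[OF linN_ideal[OF i] finite_Mon])
  fix r A assume r: "r \<in> carrier R" and "A \<in> Mon i (Suc s)"
  then obtain j B where B: "j < i" "B \<in> Mon i s" "A = add_mset j B" by (meson Mon_SucE)
  have "x j \<otimes> mval x B \<in> lin (N i) (mval x) (Mon i s)"
    by (rule lin_gen[OF N_ideal[OF i] finite_Mon]) (use B x_in_N i mval_c in auto)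
  then show "r \<otimes> mval x A \<in> lin (N i) (mval x) (Mon i s)"
    using idl_mult[OF linN_ideal[OF i]] r mval_a[OF B(2,1) i] B(3) by simp
qed

lemma linN_subset_Np:
  assumes i: "i \<le> n" shows "lin (N i) (mval x) (Mon i s) \<subseteq> Np i (Suc s)"
proof (rule lin_least[OF Np_ideal[OF i] finite_Mon])
  fix r A assume r: "r \<in> N i" and A: "A \<in> Mon i s"
  have mc: "mval x A \<in> carrier R" by (rule mval_c[OF A i])
  have "N i \<subseteq> {a \<in> carrier R. a \<otimes> mval x A \<in> Np i (Suc s)}"
  proof (rule genideal_minimal)
    show "ideal {a \<in> carrier R. a \<otimes> mval x A \<in> Np i (Suc s)} R"
    proof (rule idlI)
      show "\<zero> \<in> {a \<in> carrier R. a \<otimes> mval x A \<in> Np i (Suc s)}" using idl_zero[OF Np_ideal[OF i]] mc by simp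
      show "a \<oplus> b \<in> {a \<in> carrier R. a \<otimes> mval x A \<in> Np i (Suc s)}"
        if "a \<in> {a \<in> carrier R. a \<otimes> mval x A \<in> Np i (Suc s)}" "b \<in> {a \<in> carrier R. a \<otimes> mval x A \<in> Np i (Suc s)}" for a b
        using that idl_add[OF Np_ideal[OF i]] mc by (simp add: l_distr)
      show "a \<otimes> b \<in> {a \<in> carrier R. a \<otimes> mval x A \<in> Np i (Suc s)}"
        if "a \<in> carrier R" "b \<in> {a \<in> carrier R. a \<otimes> mval x A \<in> Np i (Suc s)}" for a b
        using that idl_mult[OF Np_ideal[OF i]] mc by (simp add: m_assoc)
    qed auto
    show "x ` {..<i} \<subseteq> {a \<in> carrier R. a \<otimes> mval x A \<in> Np i (Suc s)}"
    proof
      fix y assume "y \<in> x ` {..<i}"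
      then obtain j where j: "j < i" "y = x j" by auto
      have "\<one> \<otimes> mval x (add_mset j A) \<in> Np i (Suc s)"
        by (rule lin_gen[OF oneideal finite_Mon]) (use Mon_add[OF A j(1)] mval_c i in auto)
      then show "y \<in> {a \<in> carrier R. a \<otimes> mval x A \<in> Np i (Suc s)}"
        using mval_a[OF A j(1) i] x_closed[of j] mc j i by simp
    qed
  qed
  then show "r \<otimes> mval x A \<in> Np i (Suc s)" using r by auto
qed

lemma Np_mono_vars:
  assumes "i < n" shows "Np i s \<subseteq> Np (Suc i) s"
proof (rule lin_least[OF Np_ideal finite_Mon])
  fix j A assume "j \<in> carrier R" "A \<in> Mon i s"
  then show "j \<otimes> mval x A \<in> Np (Suc i) s"
    by (intro lin_gen[OF oneideal finite_Mon]) (use assms mval_c in \<open>auto simp: Mon_def\<close>)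
qed (use assms in simp)

lemma Np_antimono:
  assumes i: "i \<le> n" shows "Np i (Suc s) \<subseteq> Np i s"
proof (rule order_trans[OF Np_Suc_subset[OF i]], rule lin_least[OF Np_ideal[OF i] finite_Mon])
  fix j A assume "j \<in> N i" "A \<in> Mon i s"
  then show "j \<otimes> mval x A \<in> Np i s"
    by (intro lin_gen[OF oneideal finite_Mon]) (use i mval_c idl_carr[OF N_ideal[OF i]] in auto)
qed

definition mon_sum where "mon_sum i s c = (\<Oplus>A\<in>Mon i s. c A \<otimes> mval x A)"

lemma mon_sum_Suc_Suc:
  assumes i: "i < n" and c: "c \<in> Mon (Suc i) (Suc s) \<rightarrow> carrier R"
  shows "mon_sum (Suc i) (Suc s) c = mon_sum i (Suc s) c \<oplus> mon_sum (Suc i) s (\<lambda>B. c (add_mset i B)) \<otimes> x i"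
proof -
  have cA: "c A \<otimes> mval x A \<in> carrier R" if "A \<in> Mon (Suc i) (Suc s)" for A
    using that c i mval_c[OF that] by auto
  have sub: "Mon i (Suc s) \<subseteq> Mon (Suc i) (Suc s)" "add_mset i ` Mon (Suc i) s \<subseteq> Mon (Suc i) (Suc s)"
    unfolding Mon_Suc_Suc by auto
  have cB: "c (add_mset i B) \<in> carrier R" "mval x B \<in> carrier R" if "B \<in> Mon (Suc i) s" for B
  proof -
    have "add_mset i B \<in> Mon (Suc i) (Suc s)" using that sub(2) by blast
    then show "c (add_mset i B) \<in> carrier R" using c by blast
    show "mval x B \<in> carrier R" by (rule mval_c[OF that]) (use i in simp)
  qed
  have "mon_sum (Suc i) (Suc s) c = mon_sum i (Suc s) c \<oplus> (\<Oplus>A\<in>add_mset i ` Mon (Suc i) s. c A \<otimes> mval x A)"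
    unfolding mon_sum_def Mon_Suc_Suc
    by (rule finsum_Un_disjoint) (use finite_Mon Mon_disjoint cA sub in auto)
  also have "(\<Oplus>A\<in>add_mset i ` Mon (Suc i) s. c A \<otimes> mval x A) =
      (\<Oplus>B\<in>Mon (Suc i) s. c (add_mset i B) \<otimes> mval x (add_mset i B))"
    by (rule finsum_reindex) (use cA sub in \<open>auto simp: inj_on_def\<close>)
  also have "\<dots> = (\<Oplus>B\<in>Mon (Suc i) s. (c (add_mset i B) \<otimes> mval x B) \<otimes> x i)"
  proof (rule finsum_cong')
    fix B assume B: "B \<in> Mon (Suc i) s"
    have "c (add_mset i B) \<in> carrier R" using c sub B by auto
    then show "c (add_mset i B) \<otimes> mval x (add_mset i B) = (c (add_mset i B) \<otimes> mval x B) \<otimes> x i"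
      using mval_a[OF B, of i] mval_c[OF B] x_closed[OF i] i by (simp add: m_ac)
  qed (use cB x_closed[OF i] in auto)
  also have "\<dots> = mon_sum (Suc i) s (\<lambda>B. c (add_mset i B)) \<otimes> x i"
    unfolding mon_sum_def by (rule finsum_ldistr[symmetric]) (use finite_Mon x_closed[OF i] cB in auto)
  finally show ?thesis .
qed

lemma mon_sum_closed: "i \<le> n \<Longrightarrow> c \<in> Mon i s \<rightarrow> carrier R \<Longrightarrow> mon_sum i s c \<in> carrier R"
  unfolding mon_sum_def using mval_c by (auto intro!: finsum_closed)

lemma mon_sum_linear:
  assumes "i \<le> n" "c \<in> Mon i s \<rightarrow> carrier R" "d \<in> Mon i s \<rightarrow> carrier R" "r \<in> carrier R"
  shows "mon_sum i s (\<lambda>A. c A \<oplus> d A \<otimes> r) = mon_sum i s c \<oplus> mon_sum i s d \<otimes> r"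
proof -
  have m: "A \<in> Mon i s \<Longrightarrow> c A \<in> carrier R \<and> d A \<in> carrier R \<and> mval x A \<in> carrier R" for A
    using assms mval_c by auto
  have "mon_sum i s d \<otimes> r = (\<Oplus>A\<in>Mon i s. d A \<otimes> mval x A \<otimes> r)"
    unfolding mon_sum_def by (rule finsum_ldistr) (use finite_Mon assms m in auto)
  then have "mon_sum i s c \<oplus> mon_sum i s d \<otimes> r = (\<Oplus>A\<in>Mon i s. c A \<otimes> mval x A \<oplus> d A \<otimes> mval x A \<otimes> r)"
    unfolding mon_sum_def by (simp, intro finsum_addf[symmetric]) (use assms m in auto)
  also have "\<dots> = mon_sum i s (\<lambda>A. c A \<oplus> d A \<otimes> r)"
    unfolding mon_sum_def
  proof (rule finsum_cong')
    fix A assume "A \<in> Mon i s"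
    then have "c A \<in> carrier R" "d A \<in> carrier R" "mval x A \<in> carrier R" using m by auto
    then show "c A \<otimes> mval x A \<oplus> d A \<otimes> mval x A \<otimes> r = (c A \<oplus> d A \<otimes> r) \<otimes> mval x A"
      using assms(4) by algebra
  qed (use assms m in auto)
  finally show ?thesis by simp
qed

text \<open>
  Quasi-regularity for forms with value zero; \<open>qreg_higher\<close> extends it to values in the next
  power.
\<close>

definition qreg where
  "qreg i s \<longleftrightarrow> (\<forall>c\<in>Mon i s \<rightarrow> carrier R. mon_sum i s c = \<zero> \<longrightarrow> (\<forall>A\<in>Mon i s. c A \<in> N i))"

text \<open>
  A value in the next power is also the value of a form with coefficients in \<open>N i\<close>; subtract
  that form.
\<close>

lemma qreg_higher:
  assumes i: "i \<le> n" and q: "qreg i s" and c: "c \<in> Mon i s \<rightarrow> carrier R" and h: "mon_sum i s c \<in> Np i (Suc s)"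
  shows "\<forall>A\<in>Mon i s. c A \<in> N i"
proof -
  have "mon_sum i s c \<in> lin (N i) (mval x) (Mon i s)" using h Np_Suc_subset[OF i] by auto
  then obtain e where e: "e \<in> Mon i s \<rightarrow> N i" "mon_sum i s c = mon_sum i s e" unfolding mon_sum_def by (rule linE)
  have ec: "e \<in> Mon i s \<rightarrow> carrier R" using e idl_carr[OF N_ideal[OF i]] by auto
  have "mon_sum i s (\<lambda>A. c A \<oplus> e A \<otimes> (\<ominus> \<one>)) = mon_sum i s c \<oplus> mon_sum i s e \<otimes> (\<ominus> \<one>)"
    by (rule mon_sum_linear[OF i c ec]) simp
  also have "\<dots> = \<zero>" unfolding e(2) using mon_sum_closed[OF i ec] by (simp add: r_minus r_neg)
  finally have z: "mon_sum i s (\<lambda>A. c A \<oplus> e A \<otimes> (\<ominus> \<one>)) = \<zero>" .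
  show ?thesis
  proof
    fix A assume A: "A \<in> Mon i s"
    have cA: "c A \<in> carrier R" "e A \<in> carrier R" "e A \<in> N i" using c ec e A by auto
    have "c A \<oplus> e A \<otimes> (\<ominus> \<one>) \<in> N i"
      using q z c ec A unfolding qreg_def by (auto dest!: bspec[of _ _ "\<lambda>A. c A \<oplus> e A \<otimes> (\<ominus> \<one>)"])
    then have "e A \<oplus> (c A \<oplus> e A \<otimes> (\<ominus> \<one>)) \<in> N i" using idl_add[OF N_ideal[OF i]] cA by simp
    moreover have "e A \<oplus> (c A \<oplus> e A \<otimes> (\<ominus> \<one>)) = c A" using cA(1,2) by algebra
    ultimately show "c A \<in> N i" by simp
  qed
qed

text \<open>
  Write \<open>a \<in> Np i s\<close> as a form. By quasi-regularity its coefficients multiplied by \<open>x i\<close> lie in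
  \<open>N i\<close>, hence so do the coefficients, and \<open>a\<close> lies in the next power.
\<close>

lemma regular_mod_Np:
  assumes i: "i < n" and q: "\<And>s. qreg i s" and a: "a \<in> carrier R" "a \<otimes> x i \<in> Np i s"
  shows "a \<in> Np i s"
  using a(2)
proof (induction s)
  case 0
  have "\<one> \<otimes> mval x {#} \<in> Np i 0" by (rule lin_gen[OF oneideal finite_Mon]) (auto simp: Mon_0 mval_empty)
  then have "\<one> \<in> Np i 0" by (simp add: mval_empty)
  then show ?case using ideal.one_imp_carrier[OF Np_ideal[of i 0]] a i by simp
next
  case (Suc s)
  have i': "i \<le> n" using i by simp
  have "a \<in> Np i s" using Suc Np_antimono[OF i'] by auto
  then obtain c where c: "c \<in> Mon i s \<rightarrow> carrier R" "a = mon_sum i s c" unfolding mon_sum_def by (rule linE)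
  have xc: "x i \<in> carrier R" using x_closed[OF i] .
  have z: "(\<lambda>A. \<zero>) \<in> Mon i s \<rightarrow> carrier R" by simp
  have z0: "mon_sum i s (\<lambda>A. \<zero>) = \<zero>"
  proof -
    have "mon_sum i s (\<lambda>A. \<zero>) = (\<Oplus>A\<in>Mon i s. \<zero>)" unfolding mon_sum_def
      by (rule finsum_cong') (use mval_c i' in auto)
    then show ?thesis by simp
  qed
  have "mon_sum i s (\<lambda>A. \<zero> \<oplus> c A \<otimes> x i) = a \<otimes> x i"
    unfolding mon_sum_linear[OF i' z c(1) xc] z0 using c mon_sum_closed[OF i' c(1)] xc by simp
  then have "mon_sum i s (\<lambda>A. \<zero> \<oplus> c A \<otimes> x i) \<in> Np i (Suc s)" using Suc.prems by simp
  then have "\<forall>A\<in>Mon i s. \<zero> \<oplus> c A \<otimes> x i \<in> N i"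
    by (intro qreg_higher[OF i' q]) (use c xc in auto)
  moreover have "\<zero> \<oplus> c A \<otimes> x i = c A \<otimes> x i \<and> c A \<in> carrier R" if "A \<in> Mon i s" for A
  proof -
    have "c A \<in> carrier R" using c(1) that by auto
    then show ?thesis using xc by simp
  qed
  ultimately have "\<forall>A\<in>Mon i s. c A \<in> N i" using regular[OF i] by auto
  then have "a \<in> lin (N i) (mval x) (Mon i s)" unfolding c(2) mon_sum_def by (intro linI) auto
  then show ?case using linN_subset_Np[OF i'] by auto
qed

text \<open>
  Induction on the number of variables and on the degree. Splitting off the terms that contain
  the last variable writes the form as \<open>f + H x\<^sub>i\<close>, with \<open>f\<close> a form in the earlier variables. If
  the value is zero, then \<open>H\<close>, like \<open>H x\<^sub>i\<close>, lies in the power of degree \<open>s + 1\<close> of the earlier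
  variables. So the coefficients of \<open>H\<close> lie in \<open>N (Suc i)\<close> by the induction on the degree.
  Rewriting \<open>H\<close> as a form \<open>d\<close> in the earlier variables turns the equation into \<open>f + d x\<^sub>i = 0\<close>,
  to which the induction on the number of variables applies.
\<close>

lemma qreg_all: "i \<le> n \<Longrightarrow> qreg i s"
proof (induction i arbitrary: s)
  case (0 s)
  show ?case
  proof (cases s)
    case 0
    show ?thesis unfolding qreg_def
    proof (intro ballI impI)
      fix c A assume "c \<in> Mon 0 s \<rightarrow> carrier R" "mon_sum 0 s c = \<zero>" "A \<in> Mon 0 s"
      then show "c A \<in> N 0" unfolding mon_sum_def \<open>s = 0\<close> Mon_0 by (simp add: mval_empty Idl_empty)
    qed
  next
    case (Suc t) then show ?thesis unfolding qreg_def by (simp add: Mon_0_Suc)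
  qed
next
  case (Suc i s)
  have i: "i < n" "i \<le> n" "Suc i \<le> n" using Suc.prems by auto
  note qi = Suc.IH[OF i(2)]
  have Nsub: "N i \<subseteq> N (Suc i)" by (rule subset_Idl_subset) (use x_closed i in auto)
  show ?case
  proof (induction s)
    case 0
    show ?case unfolding qreg_def
    proof (intro ballI impI)
      fix c A assume "c \<in> Mon (Suc i) 0 \<rightarrow> carrier R" "mon_sum (Suc i) 0 c = \<zero>" "A \<in> Mon (Suc i) 0"
      then show "c A \<in> N (Suc i)" using idl_zero[OF N_ideal[OF i(3)]] unfolding mon_sum_def Mon_0 by (simp add: mval_empty)
    qed
  next
    case (Suc s)
    show ?case unfolding qreg_def
    proof (intro ballI impI)
      fix c A assume c: "c \<in> Mon (Suc i) (Suc s) \<rightarrow> carrier R" and z: "mon_sum (Suc i) (Suc s) c = \<zero>"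
        and A: "A \<in> Mon (Suc i) (Suc s)"
      have sub: "Mon i (Suc s) \<subseteq> Mon (Suc i) (Suc s)" "add_mset i ` Mon (Suc i) s \<subseteq> Mon (Suc i) (Suc s)"
        unfolding Mon_Suc_Suc by auto
      have ci: "c \<in> Mon i (Suc s) \<rightarrow> carrier R" using c sub by auto
      have cs: "(\<lambda>B. c (add_mset i B)) \<in> Mon (Suc i) s \<rightarrow> carrier R" using c sub by auto
      define H where "H = mon_sum (Suc i) s (\<lambda>B. c (add_mset i B))"
      have Hc: "H \<in> carrier R" unfolding H_def by (rule mon_sum_closed[OF i(3) cs])
      have xc: "x i \<in> carrier R" using x_closed[OF i(1)] .
      have z': "mon_sum i (Suc s) c \<oplus> H \<otimes> x i = \<zero>" using z mon_sum_Suc_Suc[OF i(1) c] unfolding H_def by simp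
      have smN: "mon_sum i (Suc s) c \<in> Np i (Suc s)" unfolding mon_sum_def by (rule linI[OF ci])
      have "H \<otimes> x i \<in> Np i (Suc s)"
        by (rule idl_add_cancel[OF Np_ideal[OF i(2)] _ smN]) (use z' idl_zero[OF Np_ideal[OF i(2)]] Hc xc in auto)
      then have HN: "H \<in> Np i (Suc s)" by (rule regular_mod_Np[OF i(1) qi Hc])
      then have "H \<in> Np (Suc i) (Suc s)" using Np_mono_vars[OF i(1)] by auto
      then have 1: "\<forall>B\<in>Mon (Suc i) s. c (add_mset i B) \<in> N (Suc i)"
        unfolding H_def by (rule qreg_higher[OF i(3) Suc cs])
      obtain d where d: "d \<in> Mon i (Suc s) \<rightarrow> carrier R" "H = mon_sum i (Suc s) d"
        using HN unfolding mon_sum_def by (rule linE)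
      have "mon_sum i (Suc s) (\<lambda>A. c A \<oplus> d A \<otimes> x i) = \<zero>"
        unfolding mon_sum_linear[OF i(2) ci d(1) xc] using z' d(2) by simp
      then have 2: "\<forall>B\<in>Mon i (Suc s). c B \<oplus> d B \<otimes> x i \<in> N i"
        using qi[of "Suc s"] ci d(1) xc unfolding qreg_def
        by (auto dest!: bspec[of _ _ "\<lambda>A. c A \<oplus> d A \<otimes> x i"])
      show "c A \<in> N (Suc i)"
      proof (cases "A \<in> Mon i (Suc s)")
        case True
        have dA: "d A \<in> carrier R" "c A \<in> carrier R" using d ci True by auto
        have "d A \<otimes> x i \<oplus> c A \<in> N (Suc i)" using 2 True Nsub a_comm[of "c A" "d A \<otimes> x i"] dA xc by auto
        moreover have "d A \<otimes> x i \<in> N (Suc i)"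
          using idl_mult[OF N_ideal[OF i(3)] x_in_N[of i "Suc i"]] dA i by simp
        ultimately show ?thesis using idl_add_cancel[OF N_ideal[OF i(3)]] dA by blast
      next
        case False
        then show ?thesis using 1 A unfolding Mon_Suc_Suc by auto
      qed
    qed
  qed
qed

lemma ipow_eq_Np: "ipow (N n) s = Np n s"
proof (induction s)
  case 0
  have "\<one> \<otimes> mval x {#} \<in> Np n 0" by (rule lin_gen[OF oneideal finite_Mon]) (auto simp: Mon_0 mval_empty)
  then have "\<one> \<in> Np n 0" by (simp add: mval_empty)
  then show ?case unfolding ipow_0 using ideal.one_imp_carrier[OF Np_ideal[of n 0]] by simp
next
  case (Suc s)
  have Ni: "ideal (N n) R" by (rule N_ideal) simp
  have step: "N n \<cdot> Np n s = lin (N n) (mval x) (Mon n s)"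
  proof
    show "N n \<cdot> Np n s \<subseteq> lin (N n) (mval x) (Mon n s)"
    proof (rule ideal_prod_least[OF linN_ideal])
      fix a b assume a: "a \<in> N n" and "b \<in> Np n s"
      from this(2) obtain c where c: "c \<in> Mon n s \<rightarrow> carrier R" "b = (\<Oplus>A\<in>Mon n s. c A \<otimes> mval x A)" by (rule linE)
      have ac: "a \<in> carrier R" using idl_carr[OF Ni a] .
      have "a \<otimes> b = (\<Oplus>A\<in>Mon n s. a \<otimes> (c A \<otimes> mval x A))" unfolding c(2)
        by (rule finsum_rdistr) (use finite_Mon ac c mval_c in auto)
      also have "\<dots> \<in> lin (N n) (mval x) (Mon n s)"
      proof (rule finsum_in_ideal[OF linN_ideal finite_Mon])
        fix A assume A: "A \<in> Mon n s"
        have cA: "c A \<in> carrier R" "mval x A \<in> carrier R" using c A mval_c by auto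
        have "(a \<otimes> c A) \<otimes> mval x A \<in> lin (N n) (mval x) (Mon n s)"
          by (rule lin_gen[OF Ni finite_Mon]) (use mval_c A idl_mult_r[OF Ni a cA(1)] in auto)
        then show "a \<otimes> (c A \<otimes> mval x A) \<in> lin (N n) (mval x) (Mon n s)" using ac cA by (simp add: m_assoc)
      qed simp
      finally show "a \<otimes> b \<in> lin (N n) (mval x) (Mon n s)" .
    qed simp
    show "lin (N n) (mval x) (Mon n s) \<subseteq> N n \<cdot> Np n s"
    proof (rule lin_least[OF ideal_prod_is_ideal[OF Ni Np_ideal] finite_Mon])
      fix j A assume j: "j \<in> N n" and A: "A \<in> Mon n s"
      have "\<one> \<otimes> mval x A \<in> Np n s" by (rule lin_gen[OF oneideal finite_Mon]) (use A mval_c in auto)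
      then have "mval x A \<in> Np n s" using mval_c[OF A] by simp
      then show "j \<otimes> mval x A \<in> N n \<cdot> Np n s" using j by (intro ideal_prod.prod)
    qed simp
  qed
  show ?case unfolding ipow_Suc2[OF Ni] Suc step
    using linN_subset_Np[of n s] Np_Suc_subset[of n s] by auto
qed

lemma quasi_regular:
  assumes "c \<in> Mon n s \<rightarrow> carrier R" "(\<Oplus>A\<in>Mon n s. c A \<otimes> mval x A) \<in> ipow (N n) (Suc s)" "A \<in> Mon n s"
  shows "c A \<in> N n"
  using qreg_higher[of n s c] qreg_all[of n s] assms unfolding ipow_eq_Np mon_sum_def by auto

end

section \<open>A ring as a module over itself\<close>

lemma ring_module_simps [simp]:
  "carrier (ring_module R) = carrier R" "smult (ring_module R) = mult R" "add (ring_module R) = add R"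
  "zero (ring_module R) = zero R"
  by (simp_all add: ring_module_def)

lemma a_inv_ring_module [simp]: "a_inv (ring_module R) = a_inv R"
  by (rule ext) (simp add: a_inv_def m_inv_def ring_module_def)

lemma a_minus_ring_module [simp]: "a_minus (ring_module R) = a_minus R"
  by (intro ext) (simp add: a_minus_def)

context cring begin

lemma ring_module_module: "module R (ring_module R)"
proof (rule moduleI[OF cring_axioms])
  show "abelian_group (ring_module R)"
    by (rule abelian_groupI) (auto simp: a_ac intro: l_neg)
qed (auto simp: l_distr r_distr m_assoc)

lemma subm_ring_module_iff: "subm R (ring_module R) J \<longleftrightarrow> ideal J R"
proof
  interpret M: module R "ring_module R" by (rule ring_module_module)
  assume J: "subm R (ring_module R) J"
  show "ideal J R"
    by (rule idlI) (use M.subm_subset[OF J] M.subm_zero[OF J] M.subm_add[OF J] M.subm_smult[OF J] in auto)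
next
  interpret M: module R "ring_module R" by (rule ring_module_module)
  assume J: "ideal J R"
  show "subm R (ring_module R) J"
    by (rule M.submI) (use idl_subset[OF J] idl_zero[OF J] idl_add[OF J] idl_mult[OF J] in auto)
qed

end

section \<open>Free modules\<close>

lemma free_module_simps [simp]:
  "zero (free_module R X) = (\<lambda>x. \<zero>\<^bsub>R\<^esub>)"
  "add (free_module R X) = (\<lambda>g h x. g x \<oplus>\<^bsub>R\<^esub> h x)" "smult (free_module R X) = (\<lambda>a g x. a \<otimes>\<^bsub>R\<^esub> g x)"
  by (simp_all add: free_module_def)

lemma free_module_carrier: "carrier (free_module R X) =
    {g. (\<forall>x\<in>X. g x \<in> carrier R) \<and> (\<forall>x. x \<notin> X \<longrightarrow> g x = \<zero>\<^bsub>R\<^esub>) \<and> finite {x. g x \<noteq> \<zero>\<^bsub>R\<^esub>}}"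
  by (simp add: free_module_def)

lemma iprod_free_module: "iprod (free_module R X) I N = iprod (free_module R Y) I N"
proof -
  have "u \<in> iprod (free_module R X) I N \<Longrightarrow> u \<in> iprod (free_module R Y) I N" for u X Y
  proof (induction rule: iprod.induct)
    case (prod i x) then show ?case using iprod.prod[of i I x N "free_module R Y"] by simp
  next
    case (sum u v) then show ?case using iprod.sum[of u "free_module R Y" I N v] by simp
  qed
  then show ?thesis by blast
qed

context cring begin

lemma free_value: "g \<in> carrier (free_module R X) \<Longrightarrow> g x \<in> carrier R"
  unfolding free_module_carrier by (cases "x \<in> X") auto

lemma free_outside: "g \<in> carrier (free_module R X) \<Longrightarrow> x \<notin> X \<Longrightarrow> g x = \<zero>"
  unfolding free_module_carrier by auto

lemma free_finite: "g \<in> carrier (free_module R X) \<Longrightarrow> finite {x. g x \<noteq> \<zero>}"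
  unfolding free_module_carrier by auto

lemma free_support: "g \<in> carrier (free_module R X) \<Longrightarrow> {x. g x \<noteq> \<zero>} \<subseteq> X"
  unfolding free_module_carrier by auto

lemma free_carrierI:
  assumes "\<And>x. g x \<in> carrier R" "\<And>x. x \<notin> X \<Longrightarrow> g x = \<zero>" "finite {x. g x \<noteq> \<zero>}"
  shows "g \<in> carrier (free_module R X)"
  using assms unfolding free_module_carrier by auto

lemma free_module_module: "module R (free_module R X)"
proof (rule moduleI[OF cring_axioms])
  show "abelian_group (free_module R X)"
  proof (rule abelian_groupI)
    fix g h assume gh: "g \<in> carrier (free_module R X)" "h \<in> carrier (free_module R X)"
    have "finite ({x. g x \<noteq> \<zero>} \<union> {x. h x \<noteq> \<zero>})" using gh free_finite by auto
    then have "finite {x. g x \<oplus> h x \<noteq> \<zero>}"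
      by (rule rev_finite_subset) (auto simp: free_value)
    then show "g \<oplus>\<^bsub>free_module R X\<^esub> h \<in> carrier (free_module R X)"
      using gh by (intro free_carrierI) (auto simp: free_value[OF gh(1)] free_value[OF gh(2)] free_outside)
  next
    fix g assume g: "g \<in> carrier (free_module R X)"
    have "{x. \<ominus> g x \<noteq> \<zero>} \<subseteq> {x. g x \<noteq> \<zero>}" by auto
    then have "finite {x. \<ominus> g x \<noteq> \<zero>}" using free_finite[OF g] by (rule finite_subset)
    then have "(\<lambda>x. \<ominus> g x) \<in> carrier (free_module R X)"
      using g by (intro free_carrierI) (auto simp: free_value[OF g] free_outside)
    moreover have "(\<lambda>x. \<ominus> g x) \<oplus>\<^bsub>free_module R X\<^esub> g = \<zero>\<^bsub>free_module R X\<^esub>"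
      using free_value[OF g] by (auto simp: l_neg)
    ultimately show "\<exists>h\<in>carrier (free_module R X). h \<oplus>\<^bsub>free_module R X\<^esub> g = \<zero>\<^bsub>free_module R X\<^esub>" by blast
  next
    show "\<zero>\<^bsub>free_module R X\<^esub> \<in> carrier (free_module R X)" by (rule free_carrierI) auto
  qed (auto simp: fun_eq_iff a_ac free_value)
next
  fix a g assume a: "a \<in> carrier R" and g: "g \<in> carrier (free_module R X)"
  have "{x. a \<otimes> g x \<noteq> \<zero>} \<subseteq> {x. g x \<noteq> \<zero>}" using a by auto
  then have "finite {x. a \<otimes> g x \<noteq> \<zero>}" using free_finite[OF g] by (rule finite_subset)
  then show "a \<odot>\<^bsub>free_module R X\<^esub> g \<in> carrier (free_module R X)"
    using a g by (intro free_carrierI) (auto simp: free_value[OF g] free_outside)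
qed (auto simp: fun_eq_iff l_distr r_distr m_assoc free_value)

lemma free_gen_closed: "x \<in> X \<Longrightarrow> free_gen R x \<in> carrier (free_module R X)"
  by (rule free_carrierI) (auto simp: free_gen_def)

lemma free_module_mono: "X \<subseteq> Y \<Longrightarrow> carrier (free_module R X) \<subseteq> carrier (free_module R Y)"
  unfolding free_module_carrier by auto

lemma free_induct [consumes 1, case_names zero add]:
  assumes "g \<in> carrier (free_module R X)"
    and zero: "P (\<lambda>x. \<zero>)"
    and add: "\<And>a x h. a \<in> carrier R \<Longrightarrow> x \<in> X \<Longrightarrow> h \<in> carrier (free_module R X) \<Longrightarrow> h x = \<zero> \<Longrightarrow> P h \<Longrightarrow>
      P (a \<odot>\<^bsub>free_module R X\<^esub> free_gen R x \<oplus>\<^bsub>free_module R X\<^esub> h)"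
  shows "P g"
proof -
  have "finite S \<Longrightarrow> g \<in> carrier (free_module R X) \<Longrightarrow> {x. g x \<noteq> \<zero>} = S \<Longrightarrow> P g" for S g
  proof (induction S arbitrary: g rule: finite_induct)
    case (empty g)
    then have "g = (\<lambda>x. \<zero>)" by auto
    then show ?case using zero by simp
  next
    case (insert y S g)
    note g = insert.prems(1)
    have yX: "y \<in> X" using free_outside[OF g, of y] insert.prems by auto
    let ?h = "g(y := \<zero>)"
    have s: "{x. ?h x \<noteq> \<zero>} = S" using insert by auto
    have h: "?h \<in> carrier (free_module R X)"
      by (rule free_carrierI) (use s insert.hyps free_value[OF g] free_outside[OF g] in auto)
    have "P (g y \<odot>\<^bsub>free_module R X\<^esub> free_gen R y \<oplus>\<^bsub>free_module R X\<^esub> ?h)"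
      by (rule add[OF free_value[OF g] yX h _ insert.IH[OF h s]]) simp
    moreover have "g y \<odot>\<^bsub>free_module R X\<^esub> free_gen R y \<oplus>\<^bsub>free_module R X\<^esub> ?h = g"
      using free_value[OF g] by (auto simp: fun_eq_iff free_gen_def)
    ultimately show ?case by simp
  qed
  then show ?thesis using assms(1) free_finite[OF assms(1)] by blast
qed

lemma free_iprod_iff:
  assumes I: "ideal I R"
  shows "g \<in> iprod (free_module R X) I (carrier (free_module R X)) \<longleftrightarrow>
    g \<in> carrier (free_module R X) \<and> (\<forall>x. g x \<in> I)"
proof
  interpret F: module R "free_module R X" by (rule free_module_module)
  have sub: "iprod (free_module R X) I (carrier (free_module R X)) \<subseteq> carrier (free_module R X)"
    using F.iprod_subset[OF idl_subset[OF I] F.carrier_is_submodule] .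
  assume g: "g \<in> iprod (free_module R X) I (carrier (free_module R X))"
  then have "\<forall>x. g x \<in> I"
  proof induction
    case (prod i h) then show ?case using idl_mult_r[OF I prod(1) free_value[OF prod(2)]] by simp
  next
    case (sum u v) then show ?case using idl_add[OF I] by simp
  qed
  then show "g \<in> carrier (free_module R X) \<and> (\<forall>x. g x \<in> I)" using sub g by blast
next
  interpret F: module R "free_module R X" by (rule free_module_module)
  let ?P = "iprod (free_module R X) I (carrier (free_module R X))"
  have P: "subm R (free_module R X) ?P" using F.iprod_subm[OF I F.carrier_is_submodule] .
  assume "g \<in> carrier (free_module R X) \<and> (\<forall>x. g x \<in> I)"
  then have "g \<in> carrier (free_module R X)" "\<forall>x. g x \<in> I" by auto
  then show "g \<in> ?P"
  proof (induction rule: free_induct)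
    case zero show ?case using F.subm_zero[OF P] by simp
  next
    case (add a x h)
    have "a \<in> I" using spec[OF add.prems, of x] add.hyps by (simp add: free_gen_def)
    have "h y \<in> I" for y
      using spec[OF add.prems, of y] add.hyps free_value[OF add.hyps(3)] idl_zero[OF I]
      by (cases "y = x") (auto simp: free_gen_def)
    then have "h \<in> ?P" using add.IH by simp
    moreover have "a \<odot>\<^bsub>free_module R X\<^esub> free_gen R x \<in> ?P"
      by (rule iprod.prod[OF \<open>a \<in> I\<close> free_gen_closed[OF add.hyps(2)]])
    ultimately show ?case using F.subm_add[OF P] by blast
  qed
qed

end

text \<open>The linear extension to the free module of a map \<open>b\<close> on the basis.\<close>

definition (in module) fext :: "('x \<Rightarrow> 'c) \<Rightarrow> ('x \<Rightarrow> 'a) \<Rightarrow> 'c" where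
  "fext b g = (\<Oplus>\<^bsub>M\<^esub>x\<in>{x. g x \<noteq> \<zero>}. g x \<odot>\<^bsub>M\<^esub> b x)"

context module begin

lemma free_eval_eq_fext: "free_eval R M = fext (\<lambda>x. x)"
  by (rule ext) (simp add: free_eval_def fext_def lincomb_def)

lemma fext_superset:
  assumes b: "b \<in> X \<rightarrow> carrier M" and g: "g \<in> carrier (free_module R X)"
    and F: "finite F" "{x. g x \<noteq> \<zero>} \<subseteq> F" "F \<subseteq> X"
  shows "fext b g = (\<Oplus>\<^bsub>M\<^esub>x\<in>F. g x \<odot>\<^bsub>M\<^esub> b x)"
  unfolding fext_def
proof (rule M.add.finprod_mono_neutral_cong_left[folded finsum_def])
  have bF: "\<And>i. i \<in> F \<Longrightarrow> b i \<in> carrier M" using b F by auto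
  show "g i \<odot>\<^bsub>M\<^esub> b i = \<zero>\<^bsub>M\<^esub>" if "i \<in> F - {x. g x \<noteq> \<zero>}" for i using bF that by auto
  show "(\<lambda>x. g x \<odot>\<^bsub>M\<^esub> b x) \<in> F \<rightarrow> carrier M" using bF R.free_value[OF g] by auto
qed (use F in auto)

lemma fext_closed:
  assumes b: "b \<in> X \<rightarrow> carrier M" and g: "g \<in> carrier (free_module R X)"
  shows "fext b g \<in> carrier M"
  unfolding fext_def
proof (rule M.finsum_closed)
  show "(\<lambda>x. g x \<odot>\<^bsub>M\<^esub> b x) \<in> {x. g x \<noteq> \<zero>} \<rightarrow> carrier M"
    using b R.free_value[OF g] R.free_outside[OF g] by blast
qed

lemma fext_hom:
  assumes b: "b \<in> X \<rightarrow> carrier M"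
  shows "fext b \<in> module_hom R (free_module R X) M"
proof (rule module_homI)
  fix g assume g: "g \<in> carrier (free_module R X)"
  then show "fext b g \<in> carrier M" by (rule fext_closed[OF b])
  have bX: "\<And>x. x \<in> X \<Longrightarrow> b x \<in> carrier M" using b by auto
  interpret F: module R "free_module R X" by (rule R.free_module_module)
  { fix h assume h: "h \<in> carrier (free_module R X)"
    let ?F = "{x. g x \<noteq> \<zero>} \<union> {x. h x \<noteq> \<zero>}"
    have F: "finite ?F" "?F \<subseteq> X" using R.free_finite[OF g] R.free_finite[OF h] R.free_support[OF g] R.free_support[OF h] by auto
    have gh: "g \<oplus>\<^bsub>free_module R X\<^esub> h \<in> carrier (free_module R X)" using g h by (rule F.M.a_closed)
    have "fext b (g \<oplus>\<^bsub>free_module R X\<^esub> h) = (\<Oplus>\<^bsub>M\<^esub>x\<in>?F. (g \<oplus>\<^bsub>free_module R X\<^esub> h) x \<odot>\<^bsub>M\<^esub> b x)"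
      by (rule fext_superset[OF b gh F(1) _ F(2)]) auto
    also have "\<dots> = (\<Oplus>\<^bsub>M\<^esub>x\<in>?F. g x \<odot>\<^bsub>M\<^esub> b x \<oplus>\<^bsub>M\<^esub> h x \<odot>\<^bsub>M\<^esub> b x)"
      using R.free_value[OF g] R.free_value[OF h] bX F(2)
      by (intro M.finsum_cong') (auto simp: smult_l_distr)
    also have "\<dots> = (\<Oplus>\<^bsub>M\<^esub>x\<in>?F. g x \<odot>\<^bsub>M\<^esub> b x) \<oplus>\<^bsub>M\<^esub> (\<Oplus>\<^bsub>M\<^esub>x\<in>?F. h x \<odot>\<^bsub>M\<^esub> b x)"
      using R.free_value[OF g] R.free_value[OF h] bX F(2) by (intro M.finsum_addf) auto
    also have "(\<Oplus>\<^bsub>M\<^esub>x\<in>?F. g x \<odot>\<^bsub>M\<^esub> b x) = fext b g"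
      by (rule fext_superset[OF b g F(1) _ F(2), symmetric]) auto
    also have "(\<Oplus>\<^bsub>M\<^esub>x\<in>?F. h x \<odot>\<^bsub>M\<^esub> b x) = fext b h"
      by (rule fext_superset[OF b h F(1) _ F(2), symmetric]) auto
    finally show "fext b (g \<oplus>\<^bsub>free_module R X\<^esub> h) = fext b g \<oplus>\<^bsub>M\<^esub> fext b h" . }
  fix r assume r: "r \<in> carrier R"
  let ?F = "{x. g x \<noteq> \<zero>}"
  have F: "finite ?F" "?F \<subseteq> X" using R.free_finite[OF g] R.free_support[OF g] by auto
  have rg: "r \<odot>\<^bsub>free_module R X\<^esub> g \<in> carrier (free_module R X)" using r g by (rule F.smult_closed)
  have "fext b (r \<odot>\<^bsub>free_module R X\<^esub> g) = (\<Oplus>\<^bsub>M\<^esub>x\<in>?F. (r \<odot>\<^bsub>free_module R X\<^esub> g) x \<odot>\<^bsub>M\<^esub> b x)"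
    by (rule fext_superset[OF b rg F(1) _ F(2)]) (use r in auto)
  also have "\<dots> = (\<Oplus>\<^bsub>M\<^esub>x\<in>?F. r \<odot>\<^bsub>M\<^esub> (g x \<odot>\<^bsub>M\<^esub> b x))"
    using R.free_value[OF g] bX F(2) r by (intro M.finsum_cong') (auto simp: smult_assoc1)
  also have "\<dots> = r \<odot>\<^bsub>M\<^esub> fext b g"
    unfolding fext_def using R.free_value[OF g] bX F r by (intro finsum_smult_ldistr[symmetric]) auto
  finally show "fext b (r \<odot>\<^bsub>free_module R X\<^esub> g) = r \<odot>\<^bsub>M\<^esub> fext b g" .
qed

lemma fext_gen:
  assumes b: "b \<in> X \<rightarrow> carrier M" and x: "x \<in> X"
  shows "fext b (free_gen R x) = b x"
proof -
  have bx: "b x \<in> carrier M" using b x by auto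
  have "fext b (free_gen R x) = (\<Oplus>\<^bsub>M\<^esub>y\<in>{x}. free_gen R x y \<odot>\<^bsub>M\<^esub> b y)"
    by (rule fext_superset[OF b R.free_gen_closed[OF x]]) (use x in \<open>auto simp: free_gen_def\<close>)
  also have "\<dots> = free_gen R x x \<odot>\<^bsub>M\<^esub> b x \<oplus>\<^bsub>M\<^esub> (\<Oplus>\<^bsub>M\<^esub>y\<in>{}. free_gen R x y \<odot>\<^bsub>M\<^esub> b y)"
    using bx by (intro M.finsum_insert) (auto simp: free_gen_def)
  also have "\<dots> = b x" using bx by (simp add: free_gen_def)
  finally show ?thesis .
qed

lemma free_hom_eq:
  assumes "f \<in> module_hom R (free_module R X) M" "h \<in> module_hom R (free_module R X) M"
    and "\<And>x. x \<in> X \<Longrightarrow> f (free_gen R x) = h (free_gen R x)" and "g \<in> carrier (free_module R X)"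
  shows "f g = h g"
proof -
  have F: "module R (free_module R X)" by (rule R.free_module_module)
  interpret f: mod_hom R "free_module R X" M f by (rule mod_homI[OF F module_axioms assms(1)])
  interpret h: mod_hom R "free_module R X" M h by (rule mod_homI[OF F module_axioms assms(2)])
  show ?thesis using assms(4)
  proof (induction rule: R.free_induct)
    case zero show ?case using f.f0_is_0 h.f0_is_0 by simp
  next
    case (add a x k)
    have e: "free_gen R x \<in> carrier (free_module R X)" by (rule R.free_gen_closed[OF add.hyps(2)])
    have c: "a \<odot>\<^bsub>free_module R X\<^esub> free_gen R x \<in> carrier (free_module R X)"
      using add.hyps(1) e by (rule f.M.smult_closed)
    show ?case using f.f_add[OF c add.hyps(3)] h.f_add[OF c add.hyps(3)] f.f_smult[OF add.hyps(1) e]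
        h.f_smult[OF add.hyps(1) e] add.IH assms(3)[OF add.hyps(2)] by argo
  qed
qed

end

text \<open>Free modules are projective: choose preimages of the images of the basis.\<close>

lemma free_module_lift:
  assumes N: "module R N" and F': "module R F'" and p: "p \<in> module_hom R (free_module R X) N"
    and p': "p' \<in> module_hom R F' N" and sub: "p ` carrier (free_module R X) \<subseteq> p' ` carrier F'"
  shows "\<exists>\<phi>\<in>module_hom R (free_module R X) F'. \<forall>v\<in>carrier (free_module R X). p' (\<phi> v) = p v"
proof -
  interpret N: module R N by (rule N)
  interpret F': module R F' by (rule F')
  have "\<forall>x\<in>X. \<exists>y\<in>carrier F'. p' y = p (free_gen R x)"
    using sub N.R.free_gen_closed by (metis (no_types, lifting) image_iff image_subset_iff)
  then obtain \<sigma> where \<sigma>: "\<And>x. x \<in> X \<Longrightarrow> \<sigma> x \<in> carrier F'" "\<And>x. x \<in> X \<Longrightarrow> p' (\<sigma> x) = p (free_gen R x)" by metis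
  have \<sigma>': "\<sigma> \<in> X \<rightarrow> carrier F'" using \<sigma> by auto
  note h = F'.fext_hom[OF \<sigma>']
  have comp: "(\<lambda>v. p' (F'.fext \<sigma> v)) \<in> module_hom R (free_module R X) N"
    using h p' unfolding module_hom_def by (auto simp: Pi_iff)
  have "p' (F'.fext \<sigma> v) = p v" if "v \<in> carrier (free_module R X)" for v
    by (rule N.free_hom_eq[OF comp p _ that]) (simp add: F'.fext_gen[OF \<sigma>'] \<sigma>)
  then show ?thesis using h by auto
qed

section \<open>Relations modulo the maximal ideal\<close>

definition relK :: "('a, 'b, 'd) module_scheme \<Rightarrow> ('a, 'c, 'e) module_scheme \<Rightarrow> ('b \<Rightarrow> 'c) \<Rightarrow> 'b set" where
  "relK F N p = {v \<in> carrier F. p v = \<zero>\<^bsub>N\<^esub>}"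

definition relM :: "'a set \<Rightarrow> ('a, 'b, 'd) module_scheme \<Rightarrow> ('a, 'c, 'e) module_scheme \<Rightarrow> ('b \<Rightarrow> 'c) \<Rightarrow> 'b set" where
  "relM \<mm> F N p = relK F N p \<inter> iprod F \<mm> (carrier F)"

text \<open>
  If \<open>F\<close> is free and \<open>p : F \<rightarrow> N\<close> is onto with kernel \<open>K\<close>, then \<open>(K \<inter> \<mm>F)/\<mm>K\<close> is \<open>Tor\<^sub>1(N, R/\<mm>)\<close>;
  this is its length. The submodule \<open>K \<inter> \<mm>F\<close> is \<open>relM\<close>.
\<close>

definition rel_len :: "('a, 'r) ring_scheme \<Rightarrow> 'a set \<Rightarrow> ('a, 'b, 'd) module_scheme \<Rightarrow> ('a, 'c, 'e) module_scheme \<Rightarrow> ('b \<Rightarrow> 'c) \<Rightarrow> enat" where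
  "rel_len R \<mm> F N p = clen (subm R F) (iprod F \<mm> (relK F N p)) (relM \<mm> F N p)"

context mod_hom begin

lemma relK_subm: "subm R M (relK M N f)"
  using hker_subm unfolding hker_def relK_def .

lemma relM_subm: "ideal \<mm> R \<Longrightarrow> subm R M (relM \<mm> M N f)"
  unfolding relM_def by (intro M.subm_inter relK_subm M.iprod_subm M.carrier_is_submodule)

end

text \<open>
  The map \<open>\<psi> \<circ> \<phi>\<close> differs from the identity by a linear map from \<open>F\<close> to the kernel \<open>K\<close>, hence on
  \<open>\<mm>F\<close> by elements of \<open>\<mm>K\<close>. So pulling back along \<open>\<psi>\<close> preserves strict inclusions between
  submodules above \<open>\<mm>K\<close>.
\<close>

lemma compare_presentations:
  assumes mods: "module R F" "module R F'" "module R N" and m: "ideal \<mm> R"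
    and p: "p \<in> module_hom R F N" and p': "p' \<in> module_hom R F' N"
    and \<phi>: "\<phi> \<in> module_hom R F F'" and \<psi>: "\<psi> \<in> module_hom R F' F"
    and p\<phi>: "\<And>v. v \<in> carrier F \<Longrightarrow> p' (\<phi> v) = p v" and p\<psi>: "\<And>w. w \<in> carrier F' \<Longrightarrow> p (\<psi> w) = p' w"
  shows compare_presentations_diff: "\<And>v. v \<in> iprod F \<mm> (carrier F) \<Longrightarrow> \<psi> (\<phi> v) \<ominus>\<^bsub>F\<^esub> v \<in> iprod F \<mm> (relK F N p)"
    and compare_presentations_relM: "\<And>v. v \<in> relM \<mm> F N p \<Longrightarrow> \<phi> v \<in> relM \<mm> F' N p'"
    and compare_presentations_len: "rel_len R \<mm> F N p \<le> rel_len R \<mm> F' N p'"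
proof -
  interpret F: module R F by (rule mods)
  interpret F': module R F' by (rule mods)
  interpret N: module R N by (rule mods)
  interpret p: mod_hom R F N p by (rule mod_homI[OF mods(1,3) p])
  interpret p': mod_hom R F' N p' by (rule mod_homI[OF mods(2,3) p'])
  interpret \<phi>: mod_hom R F F' \<phi> by (rule mod_homI[OF mods(1,2) \<phi>])
  interpret \<psi>: mod_hom R F' F \<psi> by (rule mod_homI[OF mods(2,1) \<psi>])
  have mR: "\<mm> \<subseteq> carrier R" using F.R.idl_subset[OF m] .
  let ?B = "iprod F \<mm> (relK F N p)" and ?B' = "iprod F' \<mm> (relK F' N p')"
  have B: "subm R F ?B" by (rule F.iprod_subm[OF m p.relK_subm])
  have mF: "iprod F \<mm> (carrier F) \<subseteq> carrier F" by (rule F.iprod_subset[OF mR F.carrier_is_submodule])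
  show diff: "\<psi> (\<phi> v) \<ominus>\<^bsub>F\<^esub> v \<in> ?B" if "v \<in> iprod F \<mm> (carrier F)" for v
    using that
  proof induction
    case (prod i f)
    have i: "i \<in> carrier R" using prod mR by auto
    have "\<psi> (\<phi> f) \<ominus>\<^bsub>F\<^esub> f \<in> relK F N p" unfolding relK_def
      using prod p\<psi>[of "\<phi> f"] p\<phi>[of f] p.f_minus[of "\<psi> (\<phi> f)" f] by (simp add: N.M.minus_eq N.M.r_neg)
    then have "i \<odot>\<^bsub>F\<^esub> (\<psi> (\<phi> f) \<ominus>\<^bsub>F\<^esub> f) \<in> ?B" using prod by (intro iprod.prod)
    then show ?case using prod i F.smult_r_diff[OF i, of "\<psi> (\<phi> f)" f] by simp
  next
    case (sum u v)
    then have uv: "u \<in> carrier F" "v \<in> carrier F" using mF by auto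
    have "\<psi> (\<phi> (u \<oplus>\<^bsub>F\<^esub> v)) \<ominus>\<^bsub>F\<^esub> (u \<oplus>\<^bsub>F\<^esub> v) = (\<psi> (\<phi> u) \<ominus>\<^bsub>F\<^esub> u) \<oplus>\<^bsub>F\<^esub> (\<psi> (\<phi> v) \<ominus>\<^bsub>F\<^esub> v)"
      using uv F.diff_add_diff[of "\<psi> (\<phi> u)" "\<psi> (\<phi> v)" u v] by simp
    then show ?case using sum.IH F.subm_add[OF B] by simp
  qed
  have toK: "\<phi> ` carrier F \<subseteq> carrier F'" "\<psi> ` carrier F' \<subseteq> carrier F"
    "\<phi> ` relK F N p \<subseteq> relK F' N p'" "\<psi> ` relK F' N p' \<subseteq> relK F N p"
    unfolding relK_def using p\<phi> p\<psi> by auto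
  show T: "\<phi> v \<in> relM \<mm> F' N p'" if "v \<in> relM \<mm> F N p" for v
    using that toK \<phi>.image_iprod[OF mR order_refl, of v] iprod_mono[OF order_refl toK(1), of F' \<mm>]
    unfolding relM_def by auto
  have T': "subm R F' (relM \<mm> F' N p')" by (rule p'.relM_subm[OF m])
  have KF: "relK F' N p' \<subseteq> carrier F'" unfolding relK_def by auto
  have B'T': "?B' \<subseteq> relM \<mm> F' N p'" unfolding relM_def
    using F'.iprod_subset[OF mR p'.relK_subm] iprod_mono[OF order_refl KF, of F' \<mm>] by auto
  have \<psi>B: "\<psi> w \<in> ?B" if "w \<in> ?B'" for w
    using \<psi>.image_iprod[OF mR KF that] iprod_mono[OF order_refl toK(4), of F \<mm>] by auto
  show "rel_len R \<mm> F N p \<le> rel_len R \<mm> F' N p'"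
    unfolding rel_len_def
  proof (rule clen_map_le[where \<Phi> = "\<lambda>V. {w \<in> relM \<mm> F' N p'. \<psi> w \<in> V}"])
    fix V assume V: "subm R F V" "?B \<subseteq> V" "V \<subseteq> relM \<mm> F N p"
    have "{w \<in> relM \<mm> F' N p'. \<psi> w \<in> V} = relM \<mm> F' N p' \<inter> {w \<in> carrier F'. \<psi> w \<in> V}"
      using F'.subm_subset[OF T'] by auto
    then show "subm R F' {w \<in> relM \<mm> F' N p'. \<psi> w \<in> V} \<and> ?B' \<subseteq> {w \<in> relM \<mm> F' N p'. \<psi> w \<in> V} \<and>
        {w \<in> relM \<mm> F' N p'. \<psi> w \<in> V} \<subseteq> relM \<mm> F' N p'"
      using F'.subm_inter[OF T' \<psi>.subm_vimage[OF V(1)]] B'T' \<psi>B V(2) by auto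
  next
    fix V W assume VW: "subm R F V" "subm R F W" "?B \<subseteq> V" "V \<subset> W" "W \<subseteq> relM \<mm> F N p"
    obtain v where v: "v \<in> W" "v \<notin> V" using VW by auto
    have vT: "v \<in> relM \<mm> F N p" using v VW by auto
    then have vm: "v \<in> iprod F \<mm> (carrier F)" unfolding relM_def by auto
    then have vc: "v \<in> carrier F" using mF by auto
    have d: "\<psi> (\<phi> v) \<ominus>\<^bsub>F\<^esub> v \<in> V" using diff[OF vm] VW by auto
    have "\<psi> (\<phi> v) \<in> W" by (rule F.subm_minus_cancel[OF VW(2) _ v(1)]) (use d VW vc in auto)
    moreover have "\<psi> (\<phi> v) \<notin> V"
    proof
      assume a: "\<psi> (\<phi> v) \<in> V"
      have "\<psi> (\<phi> v) \<ominus>\<^bsub>F\<^esub> (\<psi> (\<phi> v) \<ominus>\<^bsub>F\<^esub> v) \<in> V" by (rule F.subm_minus[OF VW(1) a d])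
      moreover have "\<psi> (\<phi> v) \<ominus>\<^bsub>F\<^esub> (\<psi> (\<phi> v) \<ominus>\<^bsub>F\<^esub> v) = v"
        using vc by (simp add: F.M.minus_eq F.M.minus_add F.M.r_neg2)
      ultimately show False using v by simp
    qed
    ultimately show "{w \<in> relM \<mm> F' N p'. \<psi> w \<in> V} \<subset> {w \<in> relM \<mm> F' N p'. \<psi> w \<in> W}"
      using T[OF vT] VW by auto
  qed
qed

text \<open>
  Consider the coefficient of the new generator. The relations where it vanishes are those of
  the old presentation. The coefficients of all relations fill an ideal \<open>J\<close> with \<open>\<mm> \<subseteq> J\<close>,
  because \<open>\<mm> y\<close> is already generated; so on the relations with coefficients in \<open>\<mm>\<close> the
  coefficient accounts for at most the length of \<open>\<mm>/\<mm>\<^sup>2\<close>.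
\<close>

lemma (in module) rel_len_insert_le:
  assumes m: "ideal \<mm> R" and b: "b \<in> insert y X \<rightarrow> carrier M" and y: "y \<notin> X"
    and my: "\<And>r. r \<in> \<mm> \<Longrightarrow> r \<odot>\<^bsub>M\<^esub> b y \<in> fext b ` carrier (free_module R X)"
  shows "rel_len R \<mm> (free_module R (insert y X)) M (fext b) \<le>
    rel_len R \<mm> (free_module R X) M (fext b) + clen (\<lambda>J. ideal J R) (ideal_prod R \<mm> \<mm>) \<mm>"
proof -
  define F1 where "F1 = free_module R X"
  define F2 where "F2 = free_module R (insert y X)"
  have b1: "b \<in> X \<rightarrow> carrier M" using b by auto
  have mods: "module R F1" "module R F2" "module R (ring_module R)"
    unfolding F1_def F2_def by (rule R.free_module_module R.ring_module_module)+
  interpret F1: module R F1 by (rule mods)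
  interpret F2: module R F2 by (rule mods)
  have sub: "carrier F1 \<subseteq> carrier F2" unfolding F1_def F2_def by (rule R.free_module_mono) auto
  interpret p1: mod_hom R F1 M "fext b" 
    by (rule mod_homI[OF mods(1) module_axioms]) (unfold F1_def, rule fext_hom[OF b1])
  interpret p2: mod_hom R F2 M "fext b" 
    by (rule mod_homI[OF mods(2) module_axioms]) (unfold F2_def, rule fext_hom[OF b])
  have qh: "(\<lambda>g. g y) \<in> module_hom R F2 (ring_module R)"
    by (rule module_homI) (auto simp: F2_def R.free_value)
  interpret q: mod_hom R F2 "ring_module R" "\<lambda>g. g y" by (rule mod_homI[OF mods(2,3) qh])
  have mR: "\<mm> \<subseteq> carrier R" using R.idl_subset[OF m] .
  let ?K1 = "relK F1 M (fext b)" and ?K2 = "relK F2 M (fext b)"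
  have ker: "g \<in> carrier F2 \<and> g y = \<zero> \<longleftrightarrow> g \<in> carrier F1" for g
    unfolding F1_def F2_def free_module_carrier using y by auto
 have iff1: "g \<in> iprod F1 \<mm> (carrier F1) \<longleftrightarrow> g \<in> carrier F1 \<and> (\<forall>x. g x \<in> \<mm>)" for g
    unfolding F1_def by (rule R.free_iprod_iff[OF m])
  have iff2: "g \<in> iprod F2 \<mm> (carrier F2) \<longleftrightarrow> g \<in> carrier F2 \<and> (\<forall>x. g x \<in> \<mm>)" for g
    unfolding F2_def by (rule R.free_iprod_iff[OF m])
  have hk: "q.hker = carrier F1" unfolding q.hker_def using ker by auto
  have K12: "?K1 = ?K2 \<inter> carrier F1" unfolding relK_def using sub by auto
  have ip: "iprod F1 I V = iprod F2 I V" for I V unfolding F1_def F2_def by (rule iprod_free_module)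
  have A: "subm R F2 (iprod F2 \<mm> ?K2)" by (rule F2.iprod_subm[OF m p2.relK_subm])
  have C: "subm R F2 (relM \<mm> F2 M (fext b))" by (rule p2.relM_subm[OF m])
  have 1: "clen (subm R F2) (iprod F2 \<mm> ?K2 \<inter> q.hker) (relM \<mm> F2 M (fext b) \<inter> q.hker) \<le> rel_len R \<mm> F1 M (fext b)"
    unfolding rel_len_def
  proof (rule clen_map_le[where \<Phi> = "\<lambda>V. V"])
    fix V assume V: "subm R F2 V" "iprod F2 \<mm> ?K2 \<inter> q.hker \<subseteq> V" "V \<subseteq> relM \<mm> F2 M (fext b) \<inter> q.hker"
    have VF: "V \<subseteq> carrier F1" using V hk by auto
    have add_eq: "add F1 = add F2" "smult F1 = smult F2" "zero F1 = zero F2" unfolding F1_def F2_def by simp_all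
    have "subm R F1 V"
      by (rule F1.submI[OF VF]) (use F2.subm_zero[OF V(1)] F2.subm_add[OF V(1)] F2.subm_smult[OF V(1)] add_eq in auto)
    moreover have "iprod F1 \<mm> ?K1 \<subseteq> V"
    proof -
      have "iprod F1 \<mm> ?K1 \<subseteq> iprod F2 \<mm> ?K2" unfolding ip by (rule iprod_mono) (use K12 in auto)
      moreover have "iprod F1 \<mm> ?K1 \<subseteq> carrier F1" using F1.iprod_subset[OF mR p1.relK_subm] K12 by auto
      ultimately show ?thesis using V(2) unfolding hk by auto
    qed
    moreover have "V \<subseteq> relM \<mm> F1 M (fext b)"
    proof
      fix g assume "g \<in> V"
      then have g: "g \<in> ?K2" "g \<in> iprod F2 \<mm> (carrier F2)" "g \<in> carrier F1" using V hk unfolding relM_def by auto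
      then have "g \<in> iprod F1 \<mm> (carrier F1)" unfolding iff1 iff2 by blast
      then show "g \<in> relM \<mm> F1 M (fext b)" unfolding relM_def using g K12 by auto
    qed
    ultimately show "subm R F1 V \<and> iprod F1 \<mm> ?K1 \<subseteq> V \<and> V \<subseteq> relM \<mm> F1 M (fext b)" by (intro conjI)
  qed
  have 2: "clen (subm R (ring_module R)) ((\<lambda>g. g y) ` iprod F2 \<mm> ?K2) ((\<lambda>g. g y) ` relM \<mm> F2 M (fext b))
      \<le> clen (subm R (ring_module R)) (ideal_prod R \<mm> \<mm>) \<mm>"
  proof (rule clen_mono)
    show "(\<lambda>g. g y) ` relM \<mm> F2 M (fext b) \<subseteq> \<mm>" unfolding relM_def using iff2 by auto
    have id: "ideal ((\<lambda>g. g y) ` iprod F2 \<mm> ?K2) R" using q.subm_image[OF A] R.subm_ring_module_iff by simp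
    show "ideal_prod R \<mm> \<mm> \<subseteq> (\<lambda>g. g y) ` iprod F2 \<mm> ?K2"
    proof (rule R.ideal_prod_least[OF id])
      fix i j assume i: "i \<in> \<mm>" and j: "j \<in> \<mm>"
      have jc: "j \<in> carrier R" using j mR by auto
      obtain g where g: "g \<in> carrier F1" "j \<odot>\<^bsub>M\<^esub> b y = fext b g" using my[OF j] unfolding F1_def by auto
      have e: "free_gen R y \<in> carrier F2" unfolding F2_def by (rule R.free_gen_closed) simp
      have gc: "g \<in> carrier F2" using g sub by auto
      have by': "b y \<in> carrier M" using b by auto
      define k where "k = j \<odot>\<^bsub>F2\<^esub> free_gen R y \<ominus>\<^bsub>F2\<^esub> g"
      have kc: "k \<in> carrier F2" unfolding k_def using e gc jc by simp
      have "fext b k = j \<odot>\<^bsub>M\<^esub> b y \<ominus>\<^bsub>M\<^esub> fext b g"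
        unfolding k_def using e gc jc fext_gen[OF b, of y] by simp
      then have "fext b k = \<zero>\<^bsub>M\<^esub>"
        unfolding g(2) using p1.f_im[OF g(1)] by (simp add: M.minus_eq M.r_neg)
      then have kK: "k \<in> ?K2" unfolding relK_def using kc by simp
      have "k y = (j \<odot>\<^bsub>F2\<^esub> free_gen R y) y \<oplus> \<ominus> (g y)"
        using q.f_minus[OF F2.smult_closed[OF jc e] gc]
        unfolding k_def a_minus_ring_module by (simp only: R.minus_eq)
      moreover have "g y = \<zero>" using g(1) ker by blast
      moreover have "(j \<odot>\<^bsub>F2\<^esub> free_gen R y) y = j" unfolding F2_def using jc by (simp add: free_gen_def)
      ultimately have "k y = j" using jc by simp
      moreover have "(i \<odot>\<^bsub>F2\<^esub> k) y = i \<otimes> k y" unfolding F2_def by simp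
      ultimately have "(i \<odot>\<^bsub>F2\<^esub> k) y = i \<otimes> j" by simp
      then have "i \<otimes> j = (i \<odot>\<^bsub>F2\<^esub> k) y" by (rule sym)
      then show "i \<otimes> j \<in> (\<lambda>g. g y) ` iprod F2 \<mm> ?K2" 
        by (rule image_eqI[where f = "\<lambda>g. g y"]) (rule iprod.prod[OF i kK])
    qed
  qed
  have "rel_len R \<mm> F2 M (fext b) \<le> clen (subm R F2) (iprod F2 \<mm> ?K2 \<inter> q.hker) (relM \<mm> F2 M (fext b) \<inter> q.hker) +
     clen (subm R (ring_module R)) ((\<lambda>g. g y) ` iprod F2 \<mm> ?K2) ((\<lambda>g. g y) ` relM \<mm> F2 M (fext b))"
    unfolding rel_len_def by (rule q.clen_le_kernel_image[OF A C])
  also have "\<dots> \<le> rel_len R \<mm> F1 M (fext b) + clen (subm R (ring_module R)) (ideal_prod R \<mm> \<mm>) \<mm>"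
    using 1 2 by (rule add_mono)
  finally show ?thesis unfolding F1_def F2_def R.subm_ring_module_iff .
qed

text \<open>
  Induction on the rank: the coefficients of one basis element over the submodule form an ideal.
\<close>

lemma (in noetherian_cring) free_submodule_fg:
  assumes "finite X" "subm R (free_module R X) V"
  shows "\<exists>G. finite G \<and> G \<subseteq> V \<and> (\<forall>U. subm R (free_module R X) U \<longrightarrow> G \<subseteq> U \<longrightarrow> V \<subseteq> U)"
  using assms
proof (induction X arbitrary: V rule: finite_induct)
  case (empty V)
  interpret F: module R "free_module R {}" by (rule free_module_module)
  have "V \<subseteq> U" if U: "subm R (free_module R {}) U" for U
  proof
    fix v assume "v \<in> V"
    then have "v \<in> carrier (free_module R {})" using F.subm_subset[OF empty] by auto
    then have "v = \<zero>\<^bsub>free_module R {}\<^esub>" unfolding free_module_carrier by auto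
    then show "v \<in> U" using F.subm_zero[OF U] by simp
  qed
  then show ?case by (intro exI[of _ "{}"]) auto
next
  case (insert y X V)
  let ?F1 = "free_module R X" and ?F2 = "free_module R (insert y X)"
  interpret F1: module R ?F1 by (rule free_module_module)
  interpret F2: module R ?F2 by (rule free_module_module)
  have qh: "(\<lambda>g. g y) \<in> module_hom R ?F2 (ring_module R)" by (rule module_homI) (auto simp: free_value)
  interpret q: mod_hom R ?F2 "ring_module R" "\<lambda>g. g y"
    by (rule mod_homI[OF free_module_module ring_module_module qh])
  have ker: "g \<in> carrier ?F2 \<and> g y = \<zero> \<longleftrightarrow> g \<in> carrier ?F1" for g
    unfolding free_module_carrier using insert.hyps by auto
  have restr: "subm R ?F1 (U \<inter> carrier ?F1)" if U: "subm R ?F2 U" for U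
    by (rule F1.submI) (use F2.subm_zero[OF U] F2.subm_add[OF U] F2.subm_smult[OF U] F1.M.zero_closed F1.M.a_closed F1.smult_closed in auto)
  obtain G0 where G0: "finite G0" "G0 \<subseteq> V \<inter> carrier ?F1"
    "\<And>U. subm R ?F1 U \<Longrightarrow> G0 \<subseteq> U \<Longrightarrow> V \<inter> carrier ?F1 \<subseteq> U"
    using insert.IH[OF restr[OF insert.prems]] by blast
  have idl: "ideal ((\<lambda>g. g y) ` U) R" if "subm R ?F2 U" for U
    using q.subm_image[OF that] subm_ring_module_iff by simp
  obtain H where H: "finite H" "H \<subseteq> (\<lambda>g. g y) ` V" "(\<lambda>g. g y) ` V = Idl H"
    using ideal_fg[OF idl[OF insert.prems]] by blast
  obtain G1 where G1: "G1 \<subseteq> V" "finite G1" "H = (\<lambda>g. g y) ` G1"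
    using finite_subset_image[OF H(1,2)] by blast
  show ?case
  proof (intro exI[of _ "G0 \<union> G1"] conjI allI impI)
    show "finite (G0 \<union> G1)" "G0 \<union> G1 \<subseteq> V" using G0 G1 by auto
    fix U assume U: "subm R ?F2 U" "G0 \<union> G1 \<subseteq> U"
    have V0: "V \<inter> carrier ?F1 \<subseteq> U" using G0(3)[OF restr[OF U(1)]] G0(2) U(2) by auto
    have UV: "subm R ?F2 (U \<inter> V)" by (rule F2.subm_inter[OF U(1) insert.prems])
    have "H \<subseteq> (\<lambda>g. g y) ` (U \<inter> V)" unfolding G1(3) using G1(1) U(2) by auto
    then have J: "(\<lambda>g. g y) ` V \<subseteq> (\<lambda>g. g y) ` (U \<inter> V)"
      unfolding H(3) by (rule genideal_minimal[OF idl[OF UV]])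
    show "V \<subseteq> U"
    proof
      fix v assume v: "v \<in> V"
      then obtain u where u: "u \<in> U" "u \<in> V" "v y = u y" using J by blast
      have c: "v \<in> carrier ?F2" "u \<in> carrier ?F2" using u v F2.subm_carrier[OF insert.prems] by auto
      have d: "v \<ominus>\<^bsub>?F2\<^esub> u \<in> V" by (rule F2.subm_minus[OF insert.prems v u(2)])
      have "(v \<ominus>\<^bsub>?F2\<^esub> u) y = \<zero>"
        using q.f_minus[OF c] u(3) free_value[OF c(2)] r_neg[of "u y"] by (simp add: minus_eq)
      then have "v \<ominus>\<^bsub>?F2\<^esub> u \<in> carrier ?F1" using ker[of "v \<ominus>\<^bsub>?F2\<^esub> u"] F2.M.minus_closed[OF c] by blast
      then have "v \<ominus>\<^bsub>?F2\<^esub> u \<in> U" using V0 d by auto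
      then show "v \<in> U" by (rule F2.subm_minus_cancel[OF U(1) _ u(1) c(1)])
    qed
  qed
qed

section \<open>Quotient modules\<close>

context module begin

lemma quot_simps:
  "carrier (quot_module R M N) = a_rcosets\<^bsub>M\<^esub> N" "zero (quot_module R M N) = N"
  "add (quot_module R M N) = set_add M"
  "smult (quot_module R M N) = (\<lambda>a X. \<Union>x\<in>X. N +>\<^bsub>M\<^esub> (a \<odot>\<^bsub>M\<^esub> x))"
  by (simp_all add: quot_module_def)

lemma coset_mem: "y \<in> N +>\<^bsub>M\<^esub> x \<longleftrightarrow> (\<exists>n\<in>N. y = n \<oplus>\<^bsub>M\<^esub> x)"
  by (auto simp: a_r_coset_def')

lemma coset_self:
  assumes N: "subm R M N" and x: "x \<in> carrier M"
  shows "x \<in> N +>\<^bsub>M\<^esub> x"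
  using subm_zero[OF N] x unfolding coset_mem by (intro bexI[of _ "\<zero>\<^bsub>M\<^esub>"]) auto

lemma coset_eq_iff:
  assumes N: "subm R M N" and x: "x \<in> carrier M" and y: "y \<in> carrier M"
  shows "N +>\<^bsub>M\<^esub> x = N +>\<^bsub>M\<^esub> y \<longleftrightarrow> x \<ominus>\<^bsub>M\<^esub> y \<in> N"
proof
  assume "N +>\<^bsub>M\<^esub> x = N +>\<^bsub>M\<^esub> y"
  then have "x \<in> N +>\<^bsub>M\<^esub> y" using coset_self[OF N x] by simp
  then obtain n where n: "n \<in> N" "x = n \<oplus>\<^bsub>M\<^esub> y" unfolding coset_mem by auto
  have "x \<ominus>\<^bsub>M\<^esub> y = n" unfolding n(2) using subm_carrier[OF N n(1)] y by (simp add: M.minus_eq M.a_assoc M.r_neg)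
  then show "x \<ominus>\<^bsub>M\<^esub> y \<in> N" using n by simp
next
  have sub: "N +>\<^bsub>M\<^esub> u \<subseteq> N +>\<^bsub>M\<^esub> v" if u: "u \<in> carrier M" and v: "v \<in> carrier M" and uv: "u \<ominus>\<^bsub>M\<^esub> v \<in> N" for u v
  proof
    fix z assume "z \<in> N +>\<^bsub>M\<^esub> u"
    then obtain n where n: "n \<in> N" "z = n \<oplus>\<^bsub>M\<^esub> u" unfolding coset_mem by auto
    have "z = (n \<oplus>\<^bsub>M\<^esub> (u \<ominus>\<^bsub>M\<^esub> v)) \<oplus>\<^bsub>M\<^esub> v"
      using subm_carrier[OF N n(1)] u v n(2) by (simp add: M.a_assoc minus_add_cancel)
    then show "z \<in> N +>\<^bsub>M\<^esub> v" using subm_add[OF N n(1) uv] unfolding coset_mem by blast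
  qed
  assume xy: "x \<ominus>\<^bsub>M\<^esub> y \<in> N"
  have "y \<ominus>\<^bsub>M\<^esub> x = \<ominus>\<^bsub>M\<^esub> (x \<ominus>\<^bsub>M\<^esub> y)" using x y by (simp add: M.minus_eq M.minus_add M.a_comm)
  then have "y \<ominus>\<^bsub>M\<^esub> x \<in> N" using subm_neg[OF N xy] by simp
  then show "N +>\<^bsub>M\<^esub> x = N +>\<^bsub>M\<^esub> y" using sub x y xy by blast
qed

lemma quot_carrier: "carrier (quot_module R M N) = (\<lambda>x. N +>\<^bsub>M\<^esub> x) ` carrier M"
  unfolding quot_simps by (auto simp: A_RCOSETS_def' a_r_coset_def')

lemma quot_carrierE:
  assumes "X \<in> carrier (quot_module R M N)"
  obtains x where "x \<in> carrier M" "X = N +>\<^bsub>M\<^esub> x"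
  using assms unfolding quot_carrier by auto

lemma quot_carrierI: "x \<in> carrier M \<Longrightarrow> N +>\<^bsub>M\<^esub> x \<in> carrier (quot_module R M N)"
  unfolding quot_carrier by auto

lemma quot_add:
  assumes N: "subm R M N" and x: "x \<in> carrier M" and y: "y \<in> carrier M"
  shows "(N +>\<^bsub>M\<^esub> x) \<oplus>\<^bsub>quot_module R M N\<^esub> (N +>\<^bsub>M\<^esub> y) = N +>\<^bsub>M\<^esub> (x \<oplus>\<^bsub>M\<^esub> y)"
  unfolding quot_simps
proof
  show "(N +>\<^bsub>M\<^esub> x) <+>\<^bsub>M\<^esub> (N +>\<^bsub>M\<^esub> y) \<subseteq> N +>\<^bsub>M\<^esub> (x \<oplus>\<^bsub>M\<^esub> y)"
  proof
    fix z assume "z \<in> (N +>\<^bsub>M\<^esub> x) <+>\<^bsub>M\<^esub> (N +>\<^bsub>M\<^esub> y)"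
    then obtain n k where nk: "n \<in> N" "k \<in> N" "z = (n \<oplus>\<^bsub>M\<^esub> x) \<oplus>\<^bsub>M\<^esub> (k \<oplus>\<^bsub>M\<^esub> y)"
      by (auto simp: set_add_def' coset_mem)
    then have "z = (n \<oplus>\<^bsub>M\<^esub> k) \<oplus>\<^bsub>M\<^esub> (x \<oplus>\<^bsub>M\<^esub> y)" using subm_carrier[OF N] x y by (simp add: M.a_ac)
    then show "z \<in> N +>\<^bsub>M\<^esub> (x \<oplus>\<^bsub>M\<^esub> y)" using subm_add[OF N nk(1,2)] unfolding coset_mem by blast
  qed
  show "N +>\<^bsub>M\<^esub> (x \<oplus>\<^bsub>M\<^esub> y) \<subseteq> (N +>\<^bsub>M\<^esub> x) <+>\<^bsub>M\<^esub> (N +>\<^bsub>M\<^esub> y)"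
  proof
    fix z assume "z \<in> N +>\<^bsub>M\<^esub> (x \<oplus>\<^bsub>M\<^esub> y)"
    then obtain n where n: "n \<in> N" "z = n \<oplus>\<^bsub>M\<^esub> (x \<oplus>\<^bsub>M\<^esub> y)" unfolding coset_mem by auto
    then have "z = (n \<oplus>\<^bsub>M\<^esub> x) \<oplus>\<^bsub>M\<^esub> y" using subm_carrier[OF N] x y by (simp add: M.a_assoc)
    moreover have "n \<oplus>\<^bsub>M\<^esub> x \<in> N +>\<^bsub>M\<^esub> x" using n unfolding coset_mem by auto
    ultimately show "z \<in> (N +>\<^bsub>M\<^esub> x) <+>\<^bsub>M\<^esub> (N +>\<^bsub>M\<^esub> y)"
      using coset_self[OF N y] unfolding set_add_def' by blast
  qed
qed

lemma quot_smult:
  assumes N: "subm R M N" and x: "x \<in> carrier M" and a: "a \<in> carrier R"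
  shows "a \<odot>\<^bsub>quot_module R M N\<^esub> (N +>\<^bsub>M\<^esub> x) = N +>\<^bsub>M\<^esub> (a \<odot>\<^bsub>M\<^esub> x)"
proof -
  have "N +>\<^bsub>M\<^esub> (a \<odot>\<^bsub>M\<^esub> y) = N +>\<^bsub>M\<^esub> (a \<odot>\<^bsub>M\<^esub> x)" if "y \<in> N +>\<^bsub>M\<^esub> x" for y
  proof -
    obtain n where n: "n \<in> N" "y = n \<oplus>\<^bsub>M\<^esub> x" using \<open>y \<in> N +>\<^bsub>M\<^esub> x\<close> unfolding coset_mem by auto
    have nc: "n \<in> carrier M" by (rule subm_carrier[OF N n(1)])
    have "a \<odot>\<^bsub>M\<^esub> y \<ominus>\<^bsub>M\<^esub> a \<odot>\<^bsub>M\<^esub> x = a \<odot>\<^bsub>M\<^esub> n"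
      unfolding n(2) using nc x a by (simp add: smult_r_distr M.minus_eq M.a_assoc M.r_neg)
    then show ?thesis using coset_eq_iff[OF N, of "a \<odot>\<^bsub>M\<^esub> y" "a \<odot>\<^bsub>M\<^esub> x"] subm_smult[OF N a n(1)] nc x a n(2) by simp
  qed
  then show ?thesis unfolding quot_simps by (intro UN_constant_eq[OF coset_self[OF N x]]) simp
qed

lemma quot_module_module:
  assumes N: "subm R M N"
  shows "module R (quot_module R M N)"
proof (rule moduleI[OF R.cring_axioms])
  let ?Q = "quot_module R M N"
  have z: "zero ?Q = N +>\<^bsub>M\<^esub> \<zero>\<^bsub>M\<^esub>" unfolding quot_simps using subm_carrier[OF N]
    by (auto simp: coset_mem) 
  note s = quot_add[OF N] quot_smult[OF N] quot_carrierI
  show "abelian_group ?Q"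
  proof (rule abelian_groupI)
    show "\<zero>\<^bsub>?Q\<^esub> \<in> carrier ?Q" unfolding z by (simp add: s)
    fix X assume "X \<in> carrier ?Q"
    then obtain x where x: "x \<in> carrier M" "X = N +>\<^bsub>M\<^esub> x" by (rule quot_carrierE)
    show "\<zero>\<^bsub>?Q\<^esub> \<oplus>\<^bsub>?Q\<^esub> X = X" unfolding z x(2) using x by (simp add: s)
    show "\<exists>Y\<in>carrier ?Q. Y \<oplus>\<^bsub>?Q\<^esub> X = \<zero>\<^bsub>?Q\<^esub>"
      unfolding z x(2) using x by (intro bexI[of _ "N +>\<^bsub>M\<^esub> (\<ominus>\<^bsub>M\<^esub> x)"]) (simp_all add: s M.l_neg)
    fix Y assume "Y \<in> carrier ?Q"
    then obtain y where y: "y \<in> carrier M" "Y = N +>\<^bsub>M\<^esub> y" by (rule quot_carrierE)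
    show "X \<oplus>\<^bsub>?Q\<^esub> Y \<in> carrier ?Q" "X \<oplus>\<^bsub>?Q\<^esub> Y = Y \<oplus>\<^bsub>?Q\<^esub> X" unfolding x(2) y(2) using x y by (simp_all add: s M.a_comm)
    fix Z assume "Z \<in> carrier ?Q"
    then obtain w where w: "w \<in> carrier M" "Z = N +>\<^bsub>M\<^esub> w" by (rule quot_carrierE)
    show "X \<oplus>\<^bsub>?Q\<^esub> Y \<oplus>\<^bsub>?Q\<^esub> Z = X \<oplus>\<^bsub>?Q\<^esub> (Y \<oplus>\<^bsub>?Q\<^esub> Z)" unfolding x(2) y(2) w(2) using x y w by (simp add: s M.a_assoc)
  qed
  fix a X assume a: "a \<in> carrier R" and "X \<in> carrier ?Q"
  from this(2) obtain x where x: "x \<in> carrier M" "X = N +>\<^bsub>M\<^esub> x" by (rule quot_carrierE)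
  show "a \<odot>\<^bsub>?Q\<^esub> X \<in> carrier ?Q" unfolding x(2) using a x by (simp add: s)
  { fix b assume b: "b \<in> carrier R"
    show "(a \<oplus> b) \<odot>\<^bsub>?Q\<^esub> X = a \<odot>\<^bsub>?Q\<^esub> X \<oplus>\<^bsub>?Q\<^esub> b \<odot>\<^bsub>?Q\<^esub> X"
      "(a \<otimes> b) \<odot>\<^bsub>?Q\<^esub> X = a \<odot>\<^bsub>?Q\<^esub> (b \<odot>\<^bsub>?Q\<^esub> X)"
      unfolding x(2) using a b x by (simp_all add: s smult_l_distr smult_assoc1) }
  fix Y assume "Y \<in> carrier ?Q"
  then obtain y where y: "y \<in> carrier M" "Y = N +>\<^bsub>M\<^esub> y" by (rule quot_carrierE)
  show "a \<odot>\<^bsub>?Q\<^esub> (X \<oplus>\<^bsub>?Q\<^esub> Y) = a \<odot>\<^bsub>?Q\<^esub> X \<oplus>\<^bsub>?Q\<^esub> a \<odot>\<^bsub>?Q\<^esub> Y"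
    unfolding x(2) y(2) using a x y by (simp add: s smult_r_distr)
next
  fix X assume "X \<in> carrier (quot_module R M N)"
  then obtain x where x: "x \<in> carrier M" "X = N +>\<^bsub>M\<^esub> x" by (rule quot_carrierE)
  then show "\<one> \<odot>\<^bsub>quot_module R M N\<^esub> X = X" by (simp add: quot_smult[OF N])
qed

lemma quot_proj_hom: "subm R M N \<Longrightarrow> (\<lambda>x. N +>\<^bsub>M\<^esub> x) \<in> module_hom R M (quot_module R M N)"
  by (rule module_homI) (simp_all add: quot_add quot_smult quot_carrierI)

lemma quot_factor:
  assumes N: "subm R M N" and W: "module R W" and f: "f \<in> module_hom R M W" and z: "\<And>x. x \<in> N \<Longrightarrow> f x = \<zero>\<^bsub>W\<^esub>"
  shows "\<exists>h\<in>module_hom R (quot_module R M N) W. \<forall>x\<in>carrier M. h (N +>\<^bsub>M\<^esub> x) = f x"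
proof -
  interpret f: mod_hom R M W f by (rule mod_homI[OF module_axioms W f])
  define h where "h X = f (SOME x. x \<in> carrier M \<and> X = N +>\<^bsub>M\<^esub> x)" for X
  have hx: "h (N +>\<^bsub>M\<^esub> x) = f x" if x: "x \<in> carrier M" for x
  proof -
    define y where "y = (SOME y. y \<in> carrier M \<and> N +>\<^bsub>M\<^esub> x = N +>\<^bsub>M\<^esub> y)"
    have "y \<in> carrier M \<and> N +>\<^bsub>M\<^esub> x = N +>\<^bsub>M\<^esub> y" unfolding y_def by (rule someI[of _ x]) (use x in simp)
    then have y: "y \<in> carrier M" "N +>\<^bsub>M\<^esub> x = N +>\<^bsub>M\<^esub> y" by simp_all
    have "x \<ominus>\<^bsub>M\<^esub> y \<in> N" by (rule iffD1[OF coset_eq_iff[OF N x y(1)] y(2)])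
    then have "f (x \<ominus>\<^bsub>M\<^esub> y) = \<zero>\<^bsub>W\<^esub>" by (rule z)
    then have "f x \<ominus>\<^bsub>W\<^esub> f y = \<zero>\<^bsub>W\<^esub>" using x y by simp
    then have "f x = f y" using x y by simp
    then show ?thesis unfolding h_def y_def by simp
  qed
  have "h \<in> module_hom R (quot_module R M N) W"
  proof (rule module_homI)
    fix X assume "X \<in> carrier (quot_module R M N)"
    then obtain x where x: "x \<in> carrier M" "X = N +>\<^bsub>M\<^esub> x" by (rule quot_carrierE)
    then show "h X \<in> carrier W" by (simp add: hx)
    { fix Y assume "Y \<in> carrier (quot_module R M N)"
      then obtain y where y: "y \<in> carrier M" "Y = N +>\<^bsub>M\<^esub> y" by (rule quot_carrierE)
      show "h (X \<oplus>\<^bsub>quot_module R M N\<^esub> Y) = h X \<oplus>\<^bsub>W\<^esub> h Y"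
        unfolding x(2) y(2) using x y by (simp add: hx quot_add[OF N]) }
    fix r assume "r \<in> carrier R"
    then show "h (r \<odot>\<^bsub>quot_module R M N\<^esub> X) = r \<odot>\<^bsub>W\<^esub> h X"
      unfolding x(2) using x by (simp add: hx quot_smult[OF N])
  qed
  then show ?thesis using hx by blast
qed

lemma span_subm: "A \<subseteq> carrier M \<Longrightarrow> subm R M (span A)"
  by (rule submI) (use span_is_submodule[of A] in \<open>auto simp: LinearCombinations.submodule_def\<close>)

lemma span_upper: "A \<subseteq> carrier M \<Longrightarrow> A \<subseteq> span A"
  by (rule in_own_span)

lemma span_least: "subm R M V \<Longrightarrow> A \<subseteq> V \<Longrightarrow> span A \<subseteq> V"
  by (rule span_is_subset)
    (auto simp: LinearCombinations.submodule_def module_axioms subm_carrier subm_add subm_zero subm_smult)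

end

section \<open>Extension of scalars\<close>

locale base_change = N?: module R N + A: cring A
  for R :: "('r, 'c) ring_scheme" and N :: "('r, 'm, 'e) module_scheme" and A :: "('a, 'd) ring_scheme" +
  fixes \<phi> :: "'r \<Rightarrow> 'a"
  assumes \<phi>_hom: "\<phi> \<in> ring_hom R A"
begin

abbreviation "FA \<equiv> free_module A (carrier N \<times> carrier A)"
abbreviation "TK \<equiv> tensor_kernel R A \<phi> N"
abbreviation "TA \<equiv> tensor R A \<phi> N"
abbreviation "pt \<equiv> pure_tensor R A \<phi> N"

lemma \<phi>_closed: "r \<in> carrier R \<Longrightarrow> \<phi> r \<in> carrier A"
  using ring_hom_closed[OF \<phi>_hom] .

sublocale FA: module A FA by (rule A.free_module_module)

lemma gen_c: "m \<in> carrier N \<Longrightarrow> a \<in> carrier A \<Longrightarrow> free_gen A (m, a) \<in> carrier FA"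
  by (rule A.free_gen_closed) auto

lemma rels_closed: "tensor_rels R A \<phi> N \<subseteq> carrier FA"
  unfolding tensor_rels_def Let_def
  by (auto simp del: free_module_simps
    intro!: FA.M.minus_closed FA.M.a_closed FA.smult_closed gen_c A.m_closed A.a_closed \<phi>_closed)

lemma TK_subm: "subm A FA TK"
  unfolding tensor_kernel_def by (rule FA.span_subm[OF rels_closed])

lemma rels_TK: "tensor_rels R A \<phi> N \<subseteq> TK"
  unfolding tensor_kernel_def by (rule FA.span_upper[OF rels_closed])

lemma TA_module: "module A TA"
  unfolding tensor_def by (rule FA.quot_module_module[OF TK_subm])

sublocale TA: module A TA by (rule TA_module)

lemma pt_def': "pt m a = TK +>\<^bsub>FA\<^esub> free_gen A (m, a)"
  by (simp add: pure_tensor_def)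

lemma pt_closed: "m \<in> carrier N \<Longrightarrow> a \<in> carrier A \<Longrightarrow> pt m a \<in> carrier TA"
  unfolding pt_def' tensor_def by (rule FA.quot_carrierI[OF gen_c])

lemma pt_add_left: "m \<in> carrier N \<Longrightarrow> m' \<in> carrier N \<Longrightarrow> a \<in> carrier A \<Longrightarrow>
    pt (m \<oplus>\<^bsub>N\<^esub> m') a = pt m a \<oplus>\<^bsub>TA\<^esub> pt m' a"
proof -
  assume m: "m \<in> carrier N" and m': "m' \<in> carrier N" and a: "a \<in> carrier A"
  have "free_gen A (m \<oplus>\<^bsub>N\<^esub> m', a) \<ominus>\<^bsub>FA\<^esub> (free_gen A (m, a) \<oplus>\<^bsub>FA\<^esub> free_gen A (m', a)) \<in> TK"
    using m m' a by (intro subsetD[OF rels_TK]) (auto simp only: tensor_rels_def Let_def Un_iff mem_Collect_eq)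
  then show ?thesis unfolding pt_def' tensor_def
    using FA.coset_eq_iff[OF TK_subm] m m' a gen_c FA.quot_add[OF TK_subm] by (simp del: free_module_simps)
qed

lemma pt_balanced: "r \<in> carrier R \<Longrightarrow> m \<in> carrier N \<Longrightarrow> a \<in> carrier A \<Longrightarrow>
    pt (r \<odot>\<^bsub>N\<^esub> m) a = pt m (\<phi> r \<otimes>\<^bsub>A\<^esub> a)"
proof -
  assume r: "r \<in> carrier R" and m: "m \<in> carrier N" and a: "a \<in> carrier A"
  have "free_gen A (r \<odot>\<^bsub>N\<^esub> m, a) \<ominus>\<^bsub>FA\<^esub> free_gen A (m, \<phi> r \<otimes>\<^bsub>A\<^esub> a) \<in> TK"
    using r m a by (intro subsetD[OF rels_TK]) (auto simp only: tensor_rels_def Let_def Un_iff mem_Collect_eq)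
  then show ?thesis unfolding pt_def' tensor_def
    using FA.coset_eq_iff[OF TK_subm] r m a gen_c \<phi>_closed by (simp del: free_module_simps)
qed

lemma pt_smult: "m \<in> carrier N \<Longrightarrow> a \<in> carrier A \<Longrightarrow> b \<in> carrier A \<Longrightarrow>
    pt m (b \<otimes>\<^bsub>A\<^esub> a) = b \<odot>\<^bsub>TA\<^esub> pt m a"
proof -
  assume m: "m \<in> carrier N" and a: "a \<in> carrier A" and b: "b \<in> carrier A"
  have "free_gen A (m, b \<otimes>\<^bsub>A\<^esub> a) \<ominus>\<^bsub>FA\<^esub> (b \<odot>\<^bsub>FA\<^esub> free_gen A (m, a)) \<in> TK"
    using m a b by (intro subsetD[OF rels_TK]) (auto simp only: tensor_rels_def Let_def Un_iff mem_Collect_eq)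
  then show ?thesis unfolding pt_def' tensor_def
    using FA.coset_eq_iff[OF TK_subm] m a b gen_c FA.quot_smult[OF TK_subm] by (simp del: free_module_simps)
qed

lemma pt_one: "m \<in> carrier N \<Longrightarrow> a \<in> carrier A \<Longrightarrow> pt m a = a \<odot>\<^bsub>TA\<^esub> pt m \<one>\<^bsub>A\<^esub>"
  using pt_smult[of m "\<one>\<^bsub>A\<^esub>" a] by simp

lemma pt_smult_left: "r \<in> carrier R \<Longrightarrow> m \<in> carrier N \<Longrightarrow> pt (r \<odot>\<^bsub>N\<^esub> m) \<one>\<^bsub>A\<^esub> = \<phi> r \<odot>\<^bsub>TA\<^esub> pt m \<one>\<^bsub>A\<^esub>"
  using pt_balanced[of r m "\<one>\<^bsub>A\<^esub>"] pt_smult[of m "\<one>\<^bsub>A\<^esub>" "\<phi> r"] \<phi>_closed by simp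

lemma TA_generated:
  assumes V: "subm A TA V" and "\<And>m. m \<in> carrier N \<Longrightarrow> pt m \<one>\<^bsub>A\<^esub> \<in> V"
  shows "V = carrier TA"
proof
  show "V \<subseteq> carrier TA" by (rule TA.subm_subset[OF V])
  have proj: "(\<lambda>x. TK +>\<^bsub>FA\<^esub> x) \<in> module_hom A FA TA" unfolding tensor_def by (rule FA.quot_proj_hom[OF TK_subm])
  interpret pr: mod_hom A FA TA "\<lambda>x. TK +>\<^bsub>FA\<^esub> x" by (rule mod_homI[OF FA.module_axioms TA_module proj])
  have "TK +>\<^bsub>FA\<^esub> g \<in> V" if "g \<in> carrier FA" for g
    using that
  proof (induction rule: A.free_induct)
    case zero
    show ?case using pr.f0_is_0 TA.subm_zero[OF V] by simp
  next
    case (add a x h)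
    obtain m b where x: "x = (m, b)" "m \<in> carrier N" "b \<in> carrier A" using add.hyps by auto
    have e: "free_gen A x \<in> carrier FA" unfolding x(1) using gen_c x by simp
    have ae: "a \<odot>\<^bsub>FA\<^esub> free_gen A x \<in> carrier FA" by (rule FA.smult_closed[OF add.hyps(1) e])
    have "pt m b \<in> V" using pt_one[OF x(2,3)] TA.subm_smult[OF V x(3) assms(2)[OF x(2)]] by simp
    then have "a \<odot>\<^bsub>TA\<^esub> (TK +>\<^bsub>FA\<^esub> free_gen A x) \<in> V"
      using TA.subm_smult[OF V add.hyps(1)] unfolding x(1) pt_def' by simp
    then show ?case unfolding pr.f_add[OF ae add.hyps(3)] pr.f_smult[OF add.hyps(1) e]
      by (rule TA.subm_add[OF V _ add.IH])
  qed
  then show "carrier TA \<subseteq> V" unfolding tensor_def FA.quot_carrier by auto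
qed

text \<open>
  The free module on the symbols maps to \<open>W\<close> by the values on the basis, and the relations of
  the tensor product are mapped to zero.
\<close>

lemma TA_universal:
  assumes W: "module A W" and \<beta>: "\<And>m. m \<in> carrier N \<Longrightarrow> \<beta> m \<in> carrier W"
    "\<And>m m'. m \<in> carrier N \<Longrightarrow> m' \<in> carrier N \<Longrightarrow> \<beta> (m \<oplus>\<^bsub>N\<^esub> m') = \<beta> m \<oplus>\<^bsub>W\<^esub> \<beta> m'"
    "\<And>r m. r \<in> carrier R \<Longrightarrow> m \<in> carrier N \<Longrightarrow> \<beta> (r \<odot>\<^bsub>N\<^esub> m) = \<phi> r \<odot>\<^bsub>W\<^esub> \<beta> m"
  shows "\<exists>h\<in>module_hom A TA W. \<forall>m\<in>carrier N. \<forall>a\<in>carrier A. h (pt m a) = a \<odot>\<^bsub>W\<^esub> \<beta> m"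
proof -
  interpret W: module A W by (rule W)
  define b where "b = (\<lambda>(m, a). a \<odot>\<^bsub>W\<^esub> \<beta> m)"
  have bW: "b \<in> carrier N \<times> carrier A \<rightarrow> carrier W" unfolding b_def using \<beta>(1) by auto
  have ext: "W.fext b (free_gen A (m, a)) = a \<odot>\<^bsub>W\<^esub> \<beta> m" if "m \<in> carrier N" "a \<in> carrier A" for m a
    using W.fext_gen[OF bW, of "(m, a)"] that unfolding b_def by simp
  note hom = W.fext_hom[OF bW]
  interpret e: mod_hom A FA W "W.fext b" by (rule mod_homI[OF FA.module_axioms W hom])
  have ker: "subm A FA e.hker" by (rule e.hker_subm)
  note cl = FA.M.minus_closed FA.M.a_closed FA.smult_closed gen_c A.m_closed A.a_closed \<phi>_closed
  have wz: "w \<ominus>\<^bsub>W\<^esub> w = \<zero>\<^bsub>W\<^esub>" if "w \<in> carrier W" for w using that by (simp add: W.M.minus_eq W.M.r_neg)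
  have "tensor_rels R A \<phi> N \<subseteq> e.hker"
  proof
    fix g assume "g \<in> tensor_rels R A \<phi> N"
    then show "g \<in> e.hker" unfolding tensor_rels_def Let_def
    proof (elim UnE CollectE exE conjE, goal_cases)
      case (1 m m' a)
      have "g \<in> carrier FA" unfolding 1(1) using 1 by (intro cl) auto
      moreover have "W.fext b g = a \<odot>\<^bsub>W\<^esub> \<beta> (m \<oplus>\<^bsub>N\<^esub> m') \<ominus>\<^bsub>W\<^esub> (a \<odot>\<^bsub>W\<^esub> \<beta> m \<oplus>\<^bsub>W\<^esub> a \<odot>\<^bsub>W\<^esub> \<beta> m')"
        unfolding 1(1) using 1 by (simp add: e.f_minus e.f_add cl ext del: free_module_simps)
      ultimately show ?thesis unfolding e.hker_def using 1 \<beta> by (simp add: W.smult_r_distr wz)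
    next
      case (2 m a a')
      have "g \<in> carrier FA" unfolding 2(1) using 2 by (intro cl) auto
      moreover have "W.fext b g = (a \<oplus>\<^bsub>A\<^esub> a') \<odot>\<^bsub>W\<^esub> \<beta> m \<ominus>\<^bsub>W\<^esub> (a \<odot>\<^bsub>W\<^esub> \<beta> m \<oplus>\<^bsub>W\<^esub> a' \<odot>\<^bsub>W\<^esub> \<beta> m)"
        unfolding 2(1) using 2 by (simp add: e.f_minus e.f_add cl ext del: free_module_simps)
      ultimately show ?thesis unfolding e.hker_def using 2 \<beta> by (simp add: W.smult_l_distr wz)
    next
      case (3 r m a)
      have "g \<in> carrier FA" unfolding 3(1) using 3 by (intro cl) auto
      moreover have "W.fext b g = a \<odot>\<^bsub>W\<^esub> \<beta> (r \<odot>\<^bsub>N\<^esub> m) \<ominus>\<^bsub>W\<^esub> (\<phi> r \<otimes>\<^bsub>A\<^esub> a) \<odot>\<^bsub>W\<^esub> \<beta> m"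
        unfolding 3(1) using 3 by (simp add: e.f_minus e.f_add cl ext del: free_module_simps)
      moreover have "a \<odot>\<^bsub>W\<^esub> \<beta> (r \<odot>\<^bsub>N\<^esub> m) = (\<phi> r \<otimes>\<^bsub>A\<^esub> a) \<odot>\<^bsub>W\<^esub> \<beta> m"
        using 3 \<beta> \<phi>_closed A.m_comm[of "\<phi> r" a] by (simp add: W.smult_assoc1)
      ultimately show ?thesis unfolding e.hker_def using 3 \<beta> \<phi>_closed by (simp add: wz)
    next
      case (4 m a c)
      have "g \<in> carrier FA" unfolding 4(1) using 4 by (intro cl) auto
      moreover have "W.fext b g = (c \<otimes>\<^bsub>A\<^esub> a) \<odot>\<^bsub>W\<^esub> \<beta> m \<ominus>\<^bsub>W\<^esub> c \<odot>\<^bsub>W\<^esub> (a \<odot>\<^bsub>W\<^esub> \<beta> m)"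
        unfolding 4(1) using 4 by (simp add: e.f_minus e.f_smult cl ext del: free_module_simps)
      ultimately show ?thesis unfolding e.hker_def using 4 \<beta> by (simp add: W.smult_assoc1 wz)
    qed
  qed
  then have "TK \<subseteq> e.hker" unfolding tensor_kernel_def by (rule FA.span_least[OF ker])
  then have z: "W.fext b g = \<zero>\<^bsub>W\<^esub>" if "g \<in> TK" for g using that unfolding e.hker_def by auto
  obtain h where h: "h \<in> module_hom A TA W" "\<forall>g\<in>carrier FA. h (TK +>\<^bsub>FA\<^esub> g) = W.fext b g"
    using FA.quot_factor[OF TK_subm W hom z] unfolding tensor_def by (rule bexE)
  have "h (pt m a) = a \<odot>\<^bsub>W\<^esub> \<beta> m" if "m \<in> carrier N" "a \<in> carrier A" for m a
    unfolding pt_def' using bspec[OF h(2) gen_c[OF that]] ext[OF that] by simp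
  then show ?thesis using h(1) by blast
qed

end

lemma base_changeI: "module R N \<Longrightarrow> cring A \<Longrightarrow> \<phi> \<in> ring_hom R A \<Longrightarrow> base_change R N A \<phi>"
  by (simp add: base_change_def base_change_axioms_def)

text \<open>Pure tensors generate, so the map described in \<open>tensor_map\<close> is unique.\<close>

lemma tensor_map_props:
  assumes N: "base_change R N A \<phi>" and N': "base_change R N' A \<phi>" and f: "f \<in> module_hom R N N'"
  shows "tensor_map R A \<phi> N N' f \<in> module_hom A (tensor R A \<phi> N) (tensor R A \<phi> N')"
    and "\<And>m. m \<in> carrier N \<Longrightarrow>
      tensor_map R A \<phi> N N' f (pure_tensor R A \<phi> N m \<one>\<^bsub>A\<^esub>) = pure_tensor R A \<phi> N' (f m) \<one>\<^bsub>A\<^esub>"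
proof -
  interpret N: base_change R N A \<phi> by (rule N)
  interpret N': base_change R N' A \<phi> by (rule N')
  let ?P = "\<lambda>h. h \<in> module_hom A (tensor R A \<phi> N) (tensor R A \<phi> N') \<and>
             h \<in> extensional (carrier (tensor R A \<phi> N)) \<and>
             (\<forall>m\<in>carrier N. \<forall>a\<in>carrier A.
                h (pure_tensor R A \<phi> N m a) = pure_tensor R A \<phi> N' (f m) a)"
  have fc: "f m \<in> carrier N'" if "m \<in> carrier N" for m using f that unfolding module_hom_def by auto
  have "\<exists>h\<in>module_hom A N.TA N'.TA. \<forall>m\<in>carrier N. \<forall>a\<in>carrier A. h (N.pt m a) = a \<odot>\<^bsub>N'.TA\<^esub> N'.pt (f m) \<one>\<^bsub>A\<^esub>"
  proof (rule N.TA_universal[OF N'.TA_module])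
    show "N'.pt (f m) \<one>\<^bsub>A\<^esub> \<in> carrier N'.TA" if "m \<in> carrier N" for m using N'.pt_closed fc that by simp
    show "N'.pt (f (m \<oplus>\<^bsub>N\<^esub> m')) \<one>\<^bsub>A\<^esub> = N'.pt (f m) \<one>\<^bsub>A\<^esub> \<oplus>\<^bsub>N'.TA\<^esub> N'.pt (f m') \<one>\<^bsub>A\<^esub>"
      if "m \<in> carrier N" "m' \<in> carrier N" for m m'
      using that fc by (simp add: module_hom_add[OF f] N'.pt_add_left)
    show "N'.pt (f (r \<odot>\<^bsub>N\<^esub> m)) \<one>\<^bsub>A\<^esub> = \<phi> r \<odot>\<^bsub>N'.TA\<^esub> N'.pt (f m) \<one>\<^bsub>A\<^esub>" if "r \<in> carrier R" "m \<in> carrier N" for r m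
      using that fc by (simp add: module_hom_smult[OF f] N'.pt_smult_left)
  qed
  then obtain h where h: "h \<in> module_hom A N.TA N'.TA"
    "\<forall>m\<in>carrier N. \<forall>a\<in>carrier A. h (N.pt m a) = a \<odot>\<^bsub>N'.TA\<^esub> N'.pt (f m) \<one>\<^bsub>A\<^esub>" by (rule bexE)
  have ex: "?P (restrict h (carrier N.TA))"
  proof (intro conjI ballI)
    show "restrict h (carrier N.TA) \<in> module_hom A N.TA N'.TA"
      using h(1) unfolding module_hom_def by (auto simp: N.TA.M.a_closed N.TA.smult_closed)
    fix m a assume "m \<in> carrier N" "a \<in> carrier A"
    then show "restrict h (carrier N.TA) (N.pt m a) = N'.pt (f m) a"
      using h(2)[rule_format, of m a] N.pt_closed[of m a] N'.pt_one[of "f m" a] fc[of m] by simp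
  qed simp
  have uniq: "k = restrict h (carrier N.TA)" if k: "?P k" for k
  proof (rule extensionalityI)
    show "k \<in> extensional (carrier N.TA)" using k by simp
    show "restrict h (carrier N.TA) \<in> extensional (carrier N.TA)" by simp
    interpret k: mod_hom A N.TA N'.TA k by (rule mod_homI[OF N.TA_module N'.TA_module]) (use k in simp)
    interpret l: mod_hom A N.TA N'.TA "restrict h (carrier N.TA)"
      by (rule mod_homI[OF N.TA_module N'.TA_module]) (use ex in simp)
    have "{x \<in> carrier N.TA. k x = restrict h (carrier N.TA) x} = carrier N.TA"
    proof (rule N.TA_generated)
      show "subm A N.TA {x \<in> carrier N.TA. k x = restrict h (carrier N.TA) x}"
      proof (rule N.TA.submI)
        show "\<zero>\<^bsub>N.TA\<^esub> \<in> {x \<in> carrier N.TA. k x = restrict h (carrier N.TA) x}"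
          using k.f0_is_0 l.f0_is_0 N.TA.M.zero_closed by simp
        show "a \<oplus>\<^bsub>N.TA\<^esub> b \<in> {x \<in> carrier N.TA. k x = restrict h (carrier N.TA) x}"
          if "a \<in> {x \<in> carrier N.TA. k x = restrict h (carrier N.TA) x}" "b \<in> {x \<in> carrier N.TA. k x = restrict h (carrier N.TA) x}" for a b
          using that k.f_add[of a b] l.f_add[of a b] N.TA.M.a_closed[of a b] by simp
        show "a \<odot>\<^bsub>N.TA\<^esub> b \<in> {x \<in> carrier N.TA. k x = restrict h (carrier N.TA) x}"
          if "a \<in> carrier A" "b \<in> {x \<in> carrier N.TA. k x = restrict h (carrier N.TA) x}" for a b
          using that k.f_smult[of a b] l.f_smult[of a b] N.TA.smult_closed[of a b] by simp
      qed auto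
      fix m assume m: "m \<in> carrier N"
      have "k (N.pt m \<one>\<^bsub>A\<^esub>) = N'.pt (f m) \<one>\<^bsub>A\<^esub>"
        by (rule k[THEN conjunct2, THEN conjunct2, rule_format, OF m N.A.one_closed])
      moreover have "restrict h (carrier N.TA) (N.pt m \<one>\<^bsub>A\<^esub>) = N'.pt (f m) \<one>\<^bsub>A\<^esub>"
        by (rule ex[THEN conjunct2, THEN conjunct2, rule_format, OF m N.A.one_closed])
      ultimately show "N.pt m \<one>\<^bsub>A\<^esub> \<in> {x \<in> carrier N.TA. k x = restrict h (carrier N.TA) x}"
        using N.pt_closed[OF m N.A.one_closed] by simp
    qed
    then show "k x = restrict h (carrier N.TA) x" if "x \<in> carrier N.TA" for x using that by blast
  qed
  have "?P (tensor_map R A \<phi> N N' f)"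
    unfolding tensor_map_def by (rule theI[of ?P, OF ex uniq])
  then show "tensor_map R A \<phi> N N' f \<in> module_hom A (tensor R A \<phi> N) (tensor R A \<phi> N')"
    and "\<And>m. m \<in> carrier N \<Longrightarrow>
      tensor_map R A \<phi> N N' f (pure_tensor R A \<phi> N m \<one>\<^bsub>A\<^esub>) = pure_tensor R A \<phi> N' (f m) \<one>\<^bsub>A\<^esub>"
    by simp_all
qed

section \<open>Reduction modulo an ideal and the first Tor module\<close>

lemma (in module) fext_in_subm:
  assumes V: "subm R M V" and b: "b \<in> X \<rightarrow> V" and g: "g \<in> carrier (free_module R X)"
  shows "fext b g \<in> V"
proof -
  have bM: "b \<in> X \<rightarrow> carrier M" using b subm_subset[OF V] by auto
  have F: "module R (free_module R X)" by (rule R.free_module_module)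
  interpret F: module R "free_module R X" by (rule F)
  interpret e: mod_hom R "free_module R X" M "fext b" by (rule mod_homI[OF F module_axioms fext_hom[OF bM]])
  show ?thesis using g
  proof (induction rule: R.free_induct)
    case zero show ?case using e.f0_is_0 subm_zero[OF V] by simp
  next
    case (add a x h)
    have ex: "free_gen R x \<in> carrier (free_module R X)" by (rule R.free_gen_closed[OF add.hyps(2)])
    have "b x \<in> V" using b add.hyps by auto
    then have 1: "a \<odot>\<^bsub>M\<^esub> b x \<in> V" by (rule subm_smult[OF V add.hyps(1)])
    have "fext b (a \<odot>\<^bsub>free_module R X\<^esub> free_gen R x \<oplus>\<^bsub>free_module R X\<^esub> h) = a \<odot>\<^bsub>M\<^esub> b x \<oplus>\<^bsub>M\<^esub> fext b h"
      using e.f_add[OF F.smult_closed[OF add.hyps(1) ex] add.hyps(3)] e.f_smult[OF add.hyps(1) ex] fext_gen[OF bM add.hyps(2)]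
      by (simp del: free_module_simps)
    then show ?case using subm_add[OF V 1 add.IH] by (simp only:)
  qed
qed

text \<open>
  For a residue class ring \<open>R/\<mm>\<close> the tensor product \<open>N \<otimes> R/\<mm>\<close> is \<open>N/\<mm>N\<close>. The class \<open>cl x\<close> of
  \<open>x \<otimes> 1\<close> determines \<open>x\<close> modulo \<open>\<mm>N\<close>.
\<close>

locale reduction = N?: module R N + \<mm>: ideal \<mm> R
  for R :: "('r, 'c) ring_scheme" and N :: "('r, 'm, 'e) module_scheme" and \<mm> :: "'r set"
begin

abbreviation "A \<equiv> R Quot \<mm>"
abbreviation "\<phi> \<equiv> (\<lambda>r. \<mm> +>\<^bsub>R\<^esub> r)"

lemma A_cring: "cring A" by (rule \<mm>.quotient_is_cring[OF R.cring_axioms])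

sublocale bc: base_change R N A \<phi>
proof (rule base_changeI[OF N.module_axioms A_cring])
  show "\<phi> \<in> ring_hom R A" by (rule \<mm>.rcos_ring_hom)
qed

abbreviation "mN \<equiv> iprod N \<mm> (carrier N)"

lemma mN_subm: "subm R N mN"
  by (rule iprod_subm[OF \<mm>.ideal_axioms carrier_is_submodule])

lemma A_carrierE:
  assumes "a \<in> carrier A" obtains r where "r \<in> carrier R" "a = \<phi> r"
  using assms unfolding FactRing_def A_RCOSETS_def' by auto

lemma \<phi>_add: "r \<in> carrier R \<Longrightarrow> s \<in> carrier R \<Longrightarrow> \<phi> r \<oplus>\<^bsub>A\<^esub> \<phi> s = \<phi> (r \<oplus>\<^bsub>R\<^esub> s)"
  using ring_hom_add[OF bc.\<phi>_hom, of r s] by simp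
lemma \<phi>_mult: "r \<in> carrier R \<Longrightarrow> s \<in> carrier R \<Longrightarrow> \<phi> r \<otimes>\<^bsub>A\<^esub> \<phi> s = \<phi> (r \<otimes>\<^bsub>R\<^esub> s)"
  using ring_hom_mult[OF bc.\<phi>_hom, of r s] by simp
lemma \<phi>_one: "\<one>\<^bsub>A\<^esub> = \<phi> \<one>\<^bsub>R\<^esub>" using ring_hom_one[OF bc.\<phi>_hom] by simp

lemma \<phi>_eq_iff: "r \<in> carrier R \<Longrightarrow> s \<in> carrier R \<Longrightarrow> \<phi> r = \<phi> s \<longleftrightarrow> r \<ominus>\<^bsub>R\<^esub> s \<in> \<mm>"
  using R.quotient_eq_iff_same_a_r_cos[OF \<mm>.ideal_axioms] by simp

lemma \<phi>_\<mm>: "r \<in> \<mm> \<Longrightarrow> \<phi> r = \<zero>\<^bsub>A\<^esub>"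
  using R.a_rcos_zero[OF \<mm>.ideal_axioms] by (simp add: FactRing_def)

text \<open>The module \<open>N/\<mm>N\<close>, on which \<open>R/\<mm>\<close> acts through an arbitrary representative.\<close>

definition Wmod :: "('r set, 'm set) module" where
  "Wmod = \<lparr>carrier = carrier (quot_module R N mN), mult = undefined, one = undefined,
     zero = zero (quot_module R N mN), add = add (quot_module R N mN),
     smult = (\<lambda>a w. (SOME r. r \<in> carrier R \<and> a = \<phi> r) \<odot>\<^bsub>quot_module R N mN\<^esub> w)\<rparr>"

lemma Wmod_smult:
  assumes r: "r \<in> carrier R" and x: "x \<in> carrier N"
  shows "\<phi> r \<odot>\<^bsub>Wmod\<^esub> (mN +>\<^bsub>N\<^esub> x) = mN +>\<^bsub>N\<^esub> (r \<odot>\<^bsub>N\<^esub> x)"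
proof -
  define s where "s = (SOME s. s \<in> carrier R \<and> \<phi> r = \<phi> s)"
  have "s \<in> carrier R \<and> \<phi> r = \<phi> s" unfolding s_def by (rule someI[of _ r]) (use r in simp)
  then have s: "s \<in> carrier R" "\<phi> s = \<phi> r" by simp_all
  have "(s \<ominus>\<^bsub>R\<^esub> r) \<odot>\<^bsub>N\<^esub> x \<in> mN" using iffD1[OF \<phi>_eq_iff[OF s(1) r] s(2)] x by (intro iprod.prod)
  then have "s \<odot>\<^bsub>N\<^esub> x \<ominus>\<^bsub>N\<^esub> r \<odot>\<^bsub>N\<^esub> x \<in> mN" using smult_l_diff[OF s(1) r x] by simp
  then have "mN +>\<^bsub>N\<^esub> (s \<odot>\<^bsub>N\<^esub> x) = mN +>\<^bsub>N\<^esub> (r \<odot>\<^bsub>N\<^esub> x)"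
    using coset_eq_iff[OF mN_subm, of "s \<odot>\<^bsub>N\<^esub> x" "r \<odot>\<^bsub>N\<^esub> x"] s r x by simp
  then show ?thesis unfolding Wmod_def using quot_smult[OF mN_subm x s(1)] by (simp add: s_def)
qed

lemma Wmod_simps: "carrier Wmod = carrier (quot_module R N mN)" "zero Wmod = zero (quot_module R N mN)"
  "add Wmod = add (quot_module R N mN)"
  unfolding Wmod_def by simp_all

lemma Wmod_module: "module A Wmod"
proof (rule moduleI[OF A_cring])
  interpret Q: module R "quot_module R N mN" by (rule quot_module_module[OF mN_subm])
  show "abelian_group Wmod"
  proof (rule abelian_groupI, unfold Wmod_simps)
    fix x assume "x \<in> carrier (quot_module R N mN)"
    then show "\<exists>y\<in>carrier (quot_module R N mN). y \<oplus>\<^bsub>quot_module R N mN\<^esub> x = \<zero>\<^bsub>quot_module R N mN\<^esub>"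
      by (intro bexI[of _ "\<ominus>\<^bsub>quot_module R N mN\<^esub> x"]) (simp_all add: Q.M.l_neg)
  qed (auto simp: Q.M.a_ac)
  note q = Wmod_smult quot_add[OF mN_subm] \<phi>_add \<phi>_mult \<phi>_one
  fix a X assume "a \<in> carrier A" and "X \<in> carrier Wmod"
  then obtain r x where r: "r \<in> carrier R" "a = \<phi> r" and x: "x \<in> carrier N" "X = mN +>\<^bsub>N\<^esub> x"
    unfolding Wmod_simps by (meson A_carrierE quot_carrierE)
  show "a \<odot>\<^bsub>Wmod\<^esub> X \<in> carrier Wmod" unfolding Wmod_simps r(2) x(2) Wmod_smult[OF r(1) x(1)]
    by (rule quot_carrierI) (use r x in simp)
  { fix b assume "b \<in> carrier A"
    then obtain s where s: "s \<in> carrier R" "b = \<phi> s" by (rule A_carrierE)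
    show "(a \<oplus>\<^bsub>A\<^esub> b) \<odot>\<^bsub>Wmod\<^esub> X = a \<odot>\<^bsub>Wmod\<^esub> X \<oplus>\<^bsub>Wmod\<^esub> b \<odot>\<^bsub>Wmod\<^esub> X"
      "(a \<otimes>\<^bsub>A\<^esub> b) \<odot>\<^bsub>Wmod\<^esub> X = a \<odot>\<^bsub>Wmod\<^esub> (b \<odot>\<^bsub>Wmod\<^esub> X)"
      unfolding r(2) s(2) x(2) Wmod_simps using r s x by (simp_all add: q smult_l_distr smult_assoc1) }
  fix Y assume "Y \<in> carrier Wmod"
  then obtain y where y: "y \<in> carrier N" "Y = mN +>\<^bsub>N\<^esub> y" unfolding Wmod_simps by (rule quot_carrierE)
  show "a \<odot>\<^bsub>Wmod\<^esub> (X \<oplus>\<^bsub>Wmod\<^esub> Y) = a \<odot>\<^bsub>Wmod\<^esub> X \<oplus>\<^bsub>Wmod\<^esub> a \<odot>\<^bsub>Wmod\<^esub> Y"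
    unfolding r(2) x(2) y(2) Wmod_simps using r x y by (simp add: q smult_r_distr)
next
  fix X assume "X \<in> carrier Wmod"
  then obtain x where x: "x \<in> carrier N" "X = mN +>\<^bsub>N\<^esub> x" unfolding Wmod_simps by (rule quot_carrierE)
  then show "\<one>\<^bsub>A\<^esub> \<odot>\<^bsub>Wmod\<^esub> X = X" unfolding \<phi>_one by (simp add: Wmod_smult)
qed

abbreviation "cl x \<equiv> bc.pt x \<one>\<^bsub>A\<^esub>"

lemma cl_closed: "x \<in> carrier N \<Longrightarrow> cl x \<in> carrier bc.TA"
  by (rule bc.pt_closed) auto

lemma cl_add: "x \<in> carrier N \<Longrightarrow> y \<in> carrier N \<Longrightarrow> cl (x \<oplus>\<^bsub>N\<^esub> y) = cl x \<oplus>\<^bsub>bc.TA\<^esub> cl y"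
  by (rule bc.pt_add_left) auto

lemma cl_smult: "r \<in> carrier R \<Longrightarrow> x \<in> carrier N \<Longrightarrow> cl (r \<odot>\<^bsub>N\<^esub> x) = \<phi> r \<odot>\<^bsub>bc.TA\<^esub> cl x"
  by (rule bc.pt_smult_left)

lemma cl_kills: "x \<in> mN \<Longrightarrow> cl x = \<zero>\<^bsub>bc.TA\<^esub>"
proof (induction rule: iprod.induct)
  case (prod i x)
  have "cl (i \<odot>\<^bsub>N\<^esub> x) = \<zero>\<^bsub>A\<^esub> \<odot>\<^bsub>bc.TA\<^esub> cl x"
    using cl_smult[of i x] \<phi>_\<mm>[OF prod(1)] prod \<mm>.Icarr by simp
  then show ?case using cl_closed[OF prod(2)] by simp
next
  case (sum u v)
  then have "u \<in> carrier N" "v \<in> carrier N" using subm_carrier[OF mN_subm] by auto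
  then show ?case using sum by (simp add: cl_add)
qed

text \<open>
  Elements of \<open>\<mm>N\<close> have class zero because the tensor product is balanced. The universal
  property, applied to \<open>N/\<mm>N\<close>, separates all other classes.
\<close>

lemma cl_eq_iff:
  assumes x: "x \<in> carrier N" and y: "y \<in> carrier N"
  shows "cl x = cl y \<longleftrightarrow> x \<ominus>\<^bsub>N\<^esub> y \<in> mN"
proof
  assume "x \<ominus>\<^bsub>N\<^esub> y \<in> mN"
  then have "cl (x \<ominus>\<^bsub>N\<^esub> y) = \<zero>\<^bsub>bc.TA\<^esub>" by (rule cl_kills)
  moreover have "cl x = cl (x \<ominus>\<^bsub>N\<^esub> y) \<oplus>\<^bsub>bc.TA\<^esub> cl y"
    using cl_add[of "x \<ominus>\<^bsub>N\<^esub> y" y] x y minus_add_cancel by simp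
  ultimately show "cl x = cl y" using cl_closed[OF y] by simp
next
  assume eq: "cl x = cl y"
  have "\<exists>h\<in>module_hom A bc.TA Wmod. \<forall>m\<in>carrier N. \<forall>a\<in>carrier A. h (bc.pt m a) = a \<odot>\<^bsub>Wmod\<^esub> (mN +>\<^bsub>N\<^esub> m)"
    by (rule bc.TA_universal[OF Wmod_module])
      (simp_all add: Wmod_simps quot_carrierI quot_add[OF mN_subm] Wmod_smult)
  then obtain h where h: "\<forall>m\<in>carrier N. \<forall>a\<in>carrier A. h (bc.pt m a) = a \<odot>\<^bsub>Wmod\<^esub> (mN +>\<^bsub>N\<^esub> m)" by (rule bexE)
  have "h (cl z) = mN +>\<^bsub>N\<^esub> z" if "z \<in> carrier N" for z
    using h[rule_format, OF that, of "\<one>\<^bsub>A\<^esub>"] that Wmod_smult[OF R.one_closed that] unfolding \<phi>_one[symmetric] by simp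
  then have "mN +>\<^bsub>N\<^esub> x = mN +>\<^bsub>N\<^esub> y" using eq x y by metis
  then show "x \<ominus>\<^bsub>N\<^esub> y \<in> mN" using coset_eq_iff[OF mN_subm x y] by simp
qed

lemma cl_zero: "cl \<zero>\<^bsub>N\<^esub> = \<zero>\<^bsub>bc.TA\<^esub>"
  by (rule cl_kills[OF subm_zero[OF mN_subm]])

lemma carrier_TA: "carrier bc.TA = cl ` carrier N"
proof -
  have "subm A bc.TA (cl ` carrier N)"
  proof (rule bc.TA.submI)
    show "cl ` carrier N \<subseteq> carrier bc.TA" using cl_closed by auto
    show "\<zero>\<^bsub>bc.TA\<^esub> \<in> cl ` carrier N" using cl_zero by (metis imageI M.zero_closed)
    fix a b assume "a \<in> cl ` carrier N" "b \<in> cl ` carrier N"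
    then obtain x y where "x \<in> carrier N" "y \<in> carrier N" "a = cl x" "b = cl y" by auto
    then show "a \<oplus>\<^bsub>bc.TA\<^esub> b \<in> cl ` carrier N" using cl_add[of x y, symmetric] by auto
  next
    fix a b assume "a \<in> carrier A" "b \<in> cl ` carrier N"
    then obtain r y where "r \<in> carrier R" "y \<in> carrier N" "a = \<phi> r" "b = cl y" by (auto elim: A_carrierE)
    then show "a \<odot>\<^bsub>bc.TA\<^esub> b \<in> cl ` carrier N" using cl_smult[of r y, symmetric] by auto
  qed
  then show ?thesis using bc.TA_generated[of "cl ` carrier N"] by auto
qed

end

lemma a_kernel_eq: "a_kernel M N f = {x \<in> carrier M. f x = \<zero>\<^bsub>N\<^esub>}"
  by (simp add: a_kernel_def kernel_def)

text \<open>
  The canonical resolution reduces to \<open>F\<^sub>i/\<mm>F\<^sub>i\<close>. A cycle in degree one is the class of some \<open>x\<close>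
  with \<open>d\<^sub>1 x \<in> \<mm>F\<^sub>0\<close>, and a boundary is the class of some \<open>x\<close> with \<open>d\<^sub>1 x = 0\<close>. As \<open>d\<^sub>1\<close> maps
  \<open>F\<^sub>1\<close> onto the kernel \<open>K\<^sub>0\<close> of \<open>p\<close>, it identifies \<open>Tor\<^sub>1\<close> with \<open>(K\<^sub>0 \<inter> \<mm>F\<^sub>0)/\<mm>K\<^sub>0\<close>. The
  inverse of this identification is \<open>\<kappa>\<close>.
\<close>

locale tor_setup = N?: module R M + \<mm>: ideal \<mm> R
  for R :: "('r, 'c) ring_scheme" and M :: "('r, 'm, 'e) module_scheme" and \<mm> :: "'r set"
begin

abbreviation "A \<equiv> R Quot \<mm>"
abbreviation "\<phi> \<equiv> (\<lambda>r. \<mm> +>\<^bsub>R\<^esub> r)"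
abbreviation "F0 \<equiv> res0 R M"
abbreviation "F1 \<equiv> res1 R M"
abbreviation "F2 \<equiv> res2 R M"
abbreviation "p \<equiv> free_eval R M"
abbreviation "d1 \<equiv> free_eval R F0"
abbreviation "d2 \<equiv> free_eval R F1"
abbreviation "K0 \<equiv> relK F0 M p"
abbreviation "K1 \<equiv> relK F1 F0 d1"

lemma F0: "F0 = free_module R (carrier M)" by (simp add: res0_def)
lemma F1: "F1 = free_module R K0" by (simp add: res1_def relK_def a_kernel_eq)
lemma F2: "F2 = free_module R K1" by (simp add: res2_def relK_def a_kernel_eq)

lemma mods: "module R F0" "module R F1" "module R F2"
  unfolding F0 F1 F2 by (rule R.free_module_module)+

sublocale r0: reduction R F0 \<mm> by (rule reduction.intro[OF mods(1) \<mm>.ideal_axioms])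
sublocale r1: reduction R F1 \<mm> by (rule reduction.intro[OF mods(2) \<mm>.ideal_axioms])
sublocale r2: reduction R F2 \<mm> by (rule reduction.intro[OF mods(3) \<mm>.ideal_axioms])

lemma p_hom: "p \<in> module_hom R F0 M"
  unfolding F0 free_eval_eq_fext by (rule fext_hom) auto
lemma K0_sub: "K0 \<subseteq> carrier F0" unfolding relK_def by auto
lemma K1_sub: "K1 \<subseteq> carrier F1" unfolding relK_def by auto
lemma d1_hom: "d1 \<in> module_hom R F1 F0"
  using r0.fext_hom[of "\<lambda>x. x" K0] K0_sub unfolding F1 r0.free_eval_eq_fext by auto
lemma d2_hom: "d2 \<in> module_hom R F2 F1"
  using r1.fext_hom[of "\<lambda>x. x" K1] K1_sub unfolding F2 r1.free_eval_eq_fext by auto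

sublocale p: mod_hom R F0 M p by (rule mod_homI[OF mods(1) module_axioms p_hom])
sublocale d1: mod_hom R F1 F0 d1 by (rule mod_homI[OF mods(2,1) d1_hom])
sublocale d2: mod_hom R F2 F1 d2 by (rule mod_homI[OF mods(3,2) d2_hom])

abbreviation "e v \<equiv> free_gen R v"

lemma e1: "v \<in> K0 \<Longrightarrow> e v \<in> carrier F1" "v \<in> K0 \<Longrightarrow> d1 (e v) = v"
proof -
  assume v: "v \<in> K0"
  show "e v \<in> carrier F1" unfolding F1 by (rule R.free_gen_closed[OF v])
  show "d1 (e v) = v" unfolding r0.free_eval_eq_fext by (rule r0.fext_gen[of _ K0]) (use v K0_sub in auto)
qed

lemma d1_K0: "x \<in> carrier F1 \<Longrightarrow> d1 x \<in> K0"
  unfolding r0.free_eval_eq_fext by (rule r0.fext_in_subm[OF p.relK_subm, of _ K0]) (auto simp: F1)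

lemma d2_K1: "x \<in> carrier F2 \<Longrightarrow> d2 x \<in> K1"
  unfolding r1.free_eval_eq_fext by (rule r1.fext_in_subm[OF d1.relK_subm, of _ K1]) (auto simp: F2)

lemma K1_d2: "k \<in> K1 \<Longrightarrow> \<exists>w\<in>carrier F2. d2 w = k"
proof (rule bexI[of _ "e k"])
  assume k: "k \<in> K1"
  show "e k \<in> carrier F2" unfolding F2 by (rule R.free_gen_closed[OF k])
  show "d2 (e k) = k" unfolding r1.free_eval_eq_fext by (rule r1.fext_gen[of _ K1]) (use k K1_sub in auto)
qed

abbreviation "T0 \<equiv> tensor R A \<phi> F0"
abbreviation "T1 \<equiv> tensor R A \<phi> F1"
abbreviation "T2 \<equiv> tensor R A \<phi> F2"
abbreviation "D1 \<equiv> tensor_map R A \<phi> F1 F0 d1"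
abbreviation "D2 \<equiv> tensor_map R A \<phi> F2 F1 d2"

lemmas D1_props = tensor_map_props[OF r1.bc.base_change_axioms r0.bc.base_change_axioms d1_hom]
lemmas D2_props = tensor_map_props[OF r2.bc.base_change_axioms r1.bc.base_change_axioms d2_hom]

sublocale D1: mod_hom A T1 T0 D1 by (rule mod_homI[OF r1.bc.TA_module r0.bc.TA_module D1_props(1)])
sublocale D2: mod_hom A T2 T1 D2 by (rule mod_homI[OF r2.bc.TA_module r1.bc.TA_module D2_props(1)])

abbreviation "C \<equiv> T1\<lparr>carrier := a_kernel T1 T0 D1\<rparr>"
abbreviation "B \<equiv> D2 ` carrier T2"
abbreviation "TOR \<equiv> tor1 R A \<phi> M"

lemma TOR_eq: "TOR = quot_module A C B"
  unfolding tor1_def Let_def ..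

lemma ker_subm: "subm A T1 (a_kernel T1 T0 D1)"
  using D1.hker_subm unfolding D1.hker_def a_kernel_eq .

lemma C_module: "module A C"
  by (rule Module.submodule.submodule_is_module[OF ker_subm r1.bc.TA_module])

sublocale C: module A C by (rule C_module)

lemma in_ker_iff: "x \<in> carrier F1 \<Longrightarrow> r1.cl x \<in> carrier C \<longleftrightarrow> d1 x \<in> r0.mN"
proof -
  assume x: "x \<in> carrier F1"
  have "r1.cl x \<in> carrier C \<longleftrightarrow> r0.cl (d1 x) = r0.cl \<zero>\<^bsub>F0\<^esub>"
    using r1.cl_closed[OF x] D1_props(2)[OF x] r0.cl_zero by (simp add: a_kernel_eq)
  also have "\<dots> \<longleftrightarrow> d1 x \<ominus>\<^bsub>F0\<^esub> \<zero>\<^bsub>F0\<^esub> \<in> r0.mN" by (rule r0.cl_eq_iff) (use x in auto)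
  also have "d1 x \<ominus>\<^bsub>F0\<^esub> \<zero>\<^bsub>F0\<^esub> = d1 x"
    using r0.minus_add_cancel[of "d1 x" "\<zero>\<^bsub>F0\<^esub>"] x d1.f_im[OF x] r0.M.minus_closed[of "d1 x" "\<zero>\<^bsub>F0\<^esub>"] by simp
  finally show ?thesis .
qed

lemma B_eq: "B = r1.cl ` K1"
proof -
  have "B = (\<lambda>w. D2 (r2.cl w)) ` carrier F2" unfolding r2.carrier_TA by auto
  also have "\<dots> = (\<lambda>w. r1.cl (d2 w)) ` carrier F2" by (rule image_cong[OF refl D2_props(2)])
  also have "\<dots> = r1.cl ` K1" using d2_K1 K1_d2 by force
  finally show ?thesis .
qed

lemma B_subm: "subm A C B"
proof (rule C.submI)
  have BT: "subm A T1 B" by (rule D2.subm_image[OF r2.bc.TA.carrier_is_submodule])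
  show "B \<subseteq> carrier C"
  proof
    fix b assume "b \<in> B"
    then obtain k where k: "k \<in> K1" "b = r1.cl k" unfolding B_eq by auto
    have "d1 k = \<zero>\<^bsub>F0\<^esub>" "k \<in> carrier F1" using k unfolding relK_def by auto
    then show "b \<in> carrier C" unfolding k(2) using in_ker_iff r0.subm_zero[OF r0.mN_subm] by auto
  qed
  show "\<zero>\<^bsub>C\<^esub> \<in> B" using r1.bc.TA.subm_zero[OF BT] by simp
  show "a \<oplus>\<^bsub>C\<^esub> b \<in> B" if "a \<in> B" "b \<in> B" for a b using r1.bc.TA.subm_add[OF BT that] by simp
  show "a \<odot>\<^bsub>C\<^esub> b \<in> B" if "a \<in> carrier A" "b \<in> B" for a b using r1.bc.TA.subm_smult[OF BT that] by simp
qed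

lemma TOR_module: "module A TOR"
  unfolding TOR_eq by (rule C.quot_module_module[OF B_subm])

definition tcl where "tcl x = B +>\<^bsub>C\<^esub> r1.cl x"

abbreviation "Z1 \<equiv> {x \<in> carrier F1. d1 x \<in> r0.mN}"

lemma tcl_closed: "x \<in> Z1 \<Longrightarrow> tcl x \<in> carrier TOR"
  unfolding TOR_eq tcl_def by (rule C.quot_carrierI) (use in_ker_iff in auto)

lemma tcl_surj: "X \<in> carrier TOR \<Longrightarrow> \<exists>x\<in>Z1. X = tcl x"
proof -
  assume "X \<in> carrier TOR"
  then obtain c where c: "c \<in> carrier C" "X = B +>\<^bsub>C\<^esub> c" unfolding TOR_eq by (rule C.quot_carrierE)
  then have "c \<in> carrier T1" by (simp add: a_kernel_eq)
  then obtain x where "x \<in> carrier F1" "c = r1.cl x" unfolding r1.carrier_TA by auto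
  then show ?thesis using c in_ker_iff unfolding tcl_def by auto
qed

lemma tcl_add: "x \<in> Z1 \<Longrightarrow> y \<in> Z1 \<Longrightarrow> tcl (x \<oplus>\<^bsub>F1\<^esub> y) = tcl x \<oplus>\<^bsub>TOR\<^esub> tcl y"
proof -
  assume x: "x \<in> Z1" and y: "y \<in> Z1"
  have c: "r1.cl x \<in> carrier C" "r1.cl y \<in> carrier C" using x y in_ker_iff by blast+
  have "tcl x \<oplus>\<^bsub>TOR\<^esub> tcl y = B +>\<^bsub>C\<^esub> (r1.cl x \<oplus>\<^bsub>C\<^esub> r1.cl y)"
    unfolding tcl_def TOR_eq by (rule C.quot_add[OF B_subm c])
  also have "r1.cl x \<oplus>\<^bsub>C\<^esub> r1.cl y = r1.cl (x \<oplus>\<^bsub>F1\<^esub> y)" using r1.cl_add[of x y] x y by simp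
  finally show ?thesis unfolding tcl_def by simp
qed

lemma tcl_smult: "r \<in> carrier R \<Longrightarrow> x \<in> Z1 \<Longrightarrow> tcl (r \<odot>\<^bsub>F1\<^esub> x) = \<phi> r \<odot>\<^bsub>TOR\<^esub> tcl x"
proof -
  assume r: "r \<in> carrier R" and x: "x \<in> Z1"
  have c: "r1.cl x \<in> carrier C" using x in_ker_iff by blast
  have "\<phi> r \<odot>\<^bsub>TOR\<^esub> tcl x = B +>\<^bsub>C\<^esub> (\<phi> r \<odot>\<^bsub>C\<^esub> r1.cl x)"
    unfolding tcl_def TOR_eq by (rule C.quot_smult[OF B_subm c r1.bc.\<phi>_closed[OF r]])
  also have "\<phi> r \<odot>\<^bsub>C\<^esub> r1.cl x = r1.cl (r \<odot>\<^bsub>F1\<^esub> x)" using r1.cl_smult[of r x] r x by simp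
  finally show ?thesis unfolding tcl_def by simp
qed

text \<open>
  Both conditions say that \<open>x - y\<close> is the sum of an element of \<open>\<mm>F\<^sub>1\<close> and an element of the
  kernel of \<open>d\<^sub>1\<close>, because \<open>d\<^sub>1\<close> maps \<open>\<mm>F\<^sub>1\<close> onto \<open>\<mm>K\<^sub>0\<close>.
\<close>

lemma tcl_eq_iff:
  assumes x: "x \<in> Z1" and y: "y \<in> Z1"
  shows "tcl x = tcl y \<longleftrightarrow> d1 (x \<ominus>\<^bsub>F1\<^esub> y) \<in> iprod F0 \<mm> K0"
proof -
  have xc: "x \<in> carrier F1" and yc: "y \<in> carrier F1" using x y by auto
  have z: "x \<ominus>\<^bsub>F1\<^esub> y \<in> carrier F1" using xc yc by (rule r1.M.minus_closed)
  have c: "r1.cl x \<in> carrier C" "r1.cl y \<in> carrier C" using x y in_ker_iff by blast+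
  have mK: "\<mm> \<subseteq> carrier R" by (rule R.idl_subset[OF \<mm>.ideal_axioms])
  have d: "r1.cl x \<ominus>\<^bsub>C\<^esub> r1.cl y = r1.cl (x \<ominus>\<^bsub>F1\<^esub> y)"
  proof -
    have zC: "r1.cl (x \<ominus>\<^bsub>F1\<^esub> y) \<in> carrier C"
      using in_ker_iff[OF z] x y d1.f_minus[OF xc yc] r0.subm_minus[OF r0.mN_subm] by simp
    have "r1.cl x = r1.cl (x \<ominus>\<^bsub>F1\<^esub> y) \<oplus>\<^bsub>C\<^esub> r1.cl y"
      using r1.cl_add[OF z yc] r1.minus_add_cancel[OF xc yc] by simp
    then have "r1.cl x \<ominus>\<^bsub>C\<^esub> r1.cl y = (r1.cl (x \<ominus>\<^bsub>F1\<^esub> y) \<oplus>\<^bsub>C\<^esub> r1.cl y) \<oplus>\<^bsub>C\<^esub> \<ominus>\<^bsub>C\<^esub> r1.cl y"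
      by (simp only: C.M.minus_eq)
    also have "\<dots> = r1.cl (x \<ominus>\<^bsub>F1\<^esub> y)"
      using C.M.a_assoc[OF zC c(2) C.M.a_inv_closed[OF c(2)]] C.M.r_neg[OF c(2)] C.M.r_zero[OF zC] by argo
    finally show ?thesis .
  qed
  have "tcl x = tcl y \<longleftrightarrow> r1.cl (x \<ominus>\<^bsub>F1\<^esub> y) \<in> B"
    unfolding tcl_def using C.coset_eq_iff[OF B_subm c] d by simp
  also have "\<dots> \<longleftrightarrow> (\<exists>k\<in>K1. (x \<ominus>\<^bsub>F1\<^esub> y) \<ominus>\<^bsub>F1\<^esub> k \<in> r1.mN)"
    unfolding B_eq using r1.cl_eq_iff[OF z] K1_sub by blast
  also have "\<dots> \<longleftrightarrow> d1 (x \<ominus>\<^bsub>F1\<^esub> y) \<in> iprod F0 \<mm> K0"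
  proof
    assume "\<exists>k\<in>K1. (x \<ominus>\<^bsub>F1\<^esub> y) \<ominus>\<^bsub>F1\<^esub> k \<in> r1.mN"
    then obtain k where k: "k \<in> K1" "(x \<ominus>\<^bsub>F1\<^esub> y) \<ominus>\<^bsub>F1\<^esub> k \<in> r1.mN" by (rule bexE)
    have kc: "k \<in> carrier F1" "d1 k = \<zero>\<^bsub>F0\<^esub>" using k(1) unfolding relK_def by auto
    have "d1 ((x \<ominus>\<^bsub>F1\<^esub> y) \<ominus>\<^bsub>F1\<^esub> k) \<in> iprod F0 \<mm> (d1 ` carrier F1)"
      by (rule d1.image_iprod[OF mK order_refl k(2)])
    then have "d1 ((x \<ominus>\<^bsub>F1\<^esub> y) \<ominus>\<^bsub>F1\<^esub> k) \<in> iprod F0 \<mm> K0"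
      using iprod_mono[OF order_refl, of "d1 ` carrier F1" K0 F0 \<mm>] d1_K0 by blast
    moreover have "d1 ((x \<ominus>\<^bsub>F1\<^esub> y) \<ominus>\<^bsub>F1\<^esub> k) \<oplus>\<^bsub>F0\<^esub> d1 k = d1 (x \<ominus>\<^bsub>F1\<^esub> y)"
      using d1.f_add[OF r1.M.minus_closed[OF z kc(1)] kc(1)] r1.minus_add_cancel[OF z kc(1)] by simp
    moreover have "d1 ((x \<ominus>\<^bsub>F1\<^esub> y) \<ominus>\<^bsub>F1\<^esub> k) \<in> carrier F0"
      by (rule d1.f_im[OF r1.M.minus_closed[OF z kc(1)]])
    ultimately show "d1 (x \<ominus>\<^bsub>F1\<^esub> y) \<in> iprod F0 \<mm> K0" using kc(2) r0.M.r_zero by metis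
  next
    assume a: "d1 (x \<ominus>\<^bsub>F1\<^esub> y) \<in> iprod F0 \<mm> K0"
    have "iprod F0 \<mm> K0 \<subseteq> d1 ` r1.mN"
    proof (rule r0.iprod_least[OF d1.subm_image[OF r1.mN_subm]])
      fix i v assume i: "i \<in> \<mm>" and v: "v \<in> K0"
      have "d1 (i \<odot>\<^bsub>F1\<^esub> e v) = i \<odot>\<^bsub>F0\<^esub> v" using d1.f_smult[of i "e v"] e1[OF v] i mK by auto
      moreover have "i \<odot>\<^bsub>F1\<^esub> e v \<in> r1.mN" by (rule iprod.prod[OF i e1(1)[OF v]])
      ultimately show "i \<odot>\<^bsub>F0\<^esub> v \<in> d1 ` r1.mN" by (metis imageI)
    qed
    then obtain u where u: "u \<in> r1.mN" "d1 u = d1 (x \<ominus>\<^bsub>F1\<^esub> y)" using a by force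
    have uc: "u \<in> carrier F1" by (rule r1.subm_carrier[OF r1.mN_subm u(1)])
    have kK: "(x \<ominus>\<^bsub>F1\<^esub> y) \<ominus>\<^bsub>F1\<^esub> u \<in> K1" unfolding relK_def
      using d1.f_minus[OF z uc] u(2) r1.M.minus_closed[OF z uc] d1.f_im[OF z] by (simp add: r0.M.minus_eq r0.M.r_neg)
    have "(x \<ominus>\<^bsub>F1\<^esub> y) \<ominus>\<^bsub>F1\<^esub> ((x \<ominus>\<^bsub>F1\<^esub> y) \<ominus>\<^bsub>F1\<^esub> u) = u"
      using z uc by (simp add: r1.M.minus_eq[of "x \<ominus>\<^bsub>F1\<^esub> y"] r1.M.minus_add r1.M.r_neg2)
    then show "\<exists>k\<in>K1. (x \<ominus>\<^bsub>F1\<^esub> y) \<ominus>\<^bsub>F1\<^esub> k \<in> r1.mN" using kK u(1) by metis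
  qed
  finally show ?thesis .
qed

abbreviation "T \<equiv> relM \<mm> F0 M p"
abbreviation "mK0 \<equiv> iprod F0 \<mm> K0"

definition \<kappa> where "\<kappa> v = tcl (e v)"

lemma T_sub: "T \<subseteq> K0" unfolding relM_def by auto

lemma e_Z1: "v \<in> T \<Longrightarrow> e v \<in> Z1" using e1[of v] unfolding relM_def by auto

lemma mK0_subm: "subm R F0 mK0" by (rule r0.iprod_subm[OF \<mm>.ideal_axioms p.relK_subm])
lemma T_subm: "subm R F0 T" by (rule p.relM_subm[OF \<mm>.ideal_axioms])
lemma T_carrier: "v \<in> T \<Longrightarrow> v \<in> carrier F0" by (rule r0.subm_carrier[OF T_subm])

lemma tcl_eqI: "x \<in> Z1 \<Longrightarrow> y \<in> Z1 \<Longrightarrow> d1 x = d1 y \<Longrightarrow> tcl x = tcl y"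
proof -
  assume x: "x \<in> Z1" and y: "y \<in> Z1" and eq: "d1 x = d1 y"
  have c: "x \<in> carrier F1" "y \<in> carrier F1" using x y by auto
  have "d1 (x \<ominus>\<^bsub>F1\<^esub> y) = \<zero>\<^bsub>F0\<^esub>"
    using d1.f_minus[OF c] eq d1.f_im[OF c(2)] by (simp add: r0.M.minus_eq r0.M.r_neg)
  then show ?thesis using tcl_eq_iff[OF x y] r0.subm_zero[OF mK0_subm] by simp
qed

lemma \<kappa>_closed: "v \<in> T \<Longrightarrow> \<kappa> v \<in> carrier TOR"
  unfolding \<kappa>_def by (rule tcl_closed[OF e_Z1])

lemma \<kappa>_surj: "X \<in> carrier TOR \<Longrightarrow> \<exists>v\<in>T. X = \<kappa> v"
proof -
  assume "X \<in> carrier TOR"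
  then obtain x where x: "x \<in> Z1" "X = tcl x" using tcl_surj by blast
  have v: "d1 x \<in> T" unfolding relM_def using x d1_K0 by auto
  have "tcl x = \<kappa> (d1 x)" unfolding \<kappa>_def
    by (rule tcl_eqI[OF x(1) e_Z1[OF v]]) (use e1(2)[of "d1 x"] T_sub v in auto)
  then show ?thesis using v x(2) by (intro bexI[of _ "d1 x"]) simp_all
qed

lemma \<kappa>_add: "v \<in> T \<Longrightarrow> w \<in> T \<Longrightarrow> \<kappa> (v \<oplus>\<^bsub>F0\<^esub> w) = \<kappa> v \<oplus>\<^bsub>TOR\<^esub> \<kappa> w"
proof -
  assume v: "v \<in> T" and w: "w \<in> T"
  have vw: "v \<oplus>\<^bsub>F0\<^esub> w \<in> T" by (rule r0.subm_add[OF T_subm v w])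
  have c: "e v \<in> carrier F1" "e w \<in> carrier F1" using e_Z1 v w by auto
  have d: "d1 (e v \<oplus>\<^bsub>F1\<^esub> e w) = v \<oplus>\<^bsub>F0\<^esub> w"
    using d1.f_add[OF c] e1(2)[OF subsetD[OF T_sub v]] e1(2)[OF subsetD[OF T_sub w]] by (simp only:)
  have "tcl (e (v \<oplus>\<^bsub>F0\<^esub> w)) = tcl (e v \<oplus>\<^bsub>F1\<^esub> e w)"
  proof (rule tcl_eqI[OF e_Z1[OF vw]])
    show "e v \<oplus>\<^bsub>F1\<^esub> e w \<in> Z1" using r1.M.a_closed[OF c] d vw unfolding relM_def by auto
    show "d1 (e (v \<oplus>\<^bsub>F0\<^esub> w)) = d1 (e v \<oplus>\<^bsub>F1\<^esub> e w)" unfolding d by (rule e1(2)) (use vw T_sub in auto)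
  qed
  then show ?thesis unfolding \<kappa>_def tcl_add[OF e_Z1[OF v] e_Z1[OF w]] .
qed

lemma \<kappa>_smult: "r \<in> carrier R \<Longrightarrow> v \<in> T \<Longrightarrow> \<kappa> (r \<odot>\<^bsub>F0\<^esub> v) = \<phi> r \<odot>\<^bsub>TOR\<^esub> \<kappa> v"
proof -
  assume r: "r \<in> carrier R" and v: "v \<in> T"
  have rv: "r \<odot>\<^bsub>F0\<^esub> v \<in> T" by (rule r0.subm_smult[OF T_subm r v])
  have c: "e v \<in> carrier F1" using e_Z1 v by auto
  have d: "d1 (r \<odot>\<^bsub>F1\<^esub> e v) = r \<odot>\<^bsub>F0\<^esub> v"
    using d1.f_smult[OF r c] e1(2)[OF subsetD[OF T_sub v]] by (simp only:)
  have "tcl (e (r \<odot>\<^bsub>F0\<^esub> v)) = tcl (r \<odot>\<^bsub>F1\<^esub> e v)"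
  proof (rule tcl_eqI[OF e_Z1[OF rv]])
    show "r \<odot>\<^bsub>F1\<^esub> e v \<in> Z1" using r1.smult_closed[OF r c] d rv unfolding relM_def by auto
    show "d1 (e (r \<odot>\<^bsub>F0\<^esub> v)) = d1 (r \<odot>\<^bsub>F1\<^esub> e v)" unfolding d by (rule e1(2)) (use rv T_sub in auto)
  qed
  then show ?thesis unfolding \<kappa>_def tcl_smult[OF r e_Z1[OF v]] .
qed

lemma \<kappa>_eq: "v \<in> T \<Longrightarrow> w \<in> T \<Longrightarrow> \<kappa> v = \<kappa> w \<longleftrightarrow> v \<ominus>\<^bsub>F0\<^esub> w \<in> mK0"
proof -
  assume v: "v \<in> T" and w: "w \<in> T"
  have c: "e v \<in> carrier F1" "e w \<in> carrier F1" using e_Z1 v w by auto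
  have d: "d1 (e v \<ominus>\<^bsub>F1\<^esub> e w) = v \<ominus>\<^bsub>F0\<^esub> w"
    using d1.f_minus[OF c] e1(2)[OF subsetD[OF T_sub v]] e1(2)[OF subsetD[OF T_sub w]] by (simp only:)
  show ?thesis unfolding \<kappa>_def tcl_eq_iff[OF e_Z1[OF v] e_Z1[OF w]] d ..
qed

lemma \<kappa>_zero: "v \<in> mK0 \<Longrightarrow> v \<in> T \<Longrightarrow> \<kappa> v = \<zero>\<^bsub>TOR\<^esub>"
proof -
  assume v: "v \<in> mK0" "v \<in> T"
  interpret TOR: module A TOR by (rule TOR_module)
  have vv: "v \<oplus>\<^bsub>F0\<^esub> v \<in> T" by (rule r0.subm_add[OF T_subm v(2) v(2)])
  have "(v \<oplus>\<^bsub>F0\<^esub> v) \<ominus>\<^bsub>F0\<^esub> v = v" using T_carrier[OF v(2)] by (simp add: r0.M.minus_eq r0.M.a_assoc r0.M.r_neg)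
  then have "\<kappa> (v \<oplus>\<^bsub>F0\<^esub> v) = \<kappa> v" using \<kappa>_eq[OF vv v(2)] v(1) by simp
  then have "\<kappa> v \<oplus>\<^bsub>TOR\<^esub> \<kappa> v = \<kappa> v" using \<kappa>_add[OF v(2) v(2)] by simp
  then show ?thesis using \<kappa>_closed[OF v(2)] TOR.M.add.l_cancel_one by blast
qed

lemma mK0_T: "mK0 \<subseteq> T"
  unfolding relM_def using r0.iprod_subset[OF R.idl_subset[OF \<mm>.ideal_axioms] p.relK_subm]
    iprod_mono[OF order_refl K0_sub] by blast

text \<open>
  The set \<open>Z\<close> makes \<open>Tor\<^sub>1\<close> finitely generated, so that its dimension, defined as a least number
  of generators, is attained. Representatives of that many generators generate \<open>K\<^sub>0 \<inter> \<mm>F\<^sub>0\<close> over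
  \<open>\<mm>K\<^sub>0\<close>.
\<close>

lemma rel_len_le_dim_tor:
  assumes fld: "field A" and units: "\<And>r. r \<in> carrier R \<Longrightarrow> r \<notin> \<mm> \<Longrightarrow> r \<in> Units R"
    and Z: "finite Z" "Z \<subseteq> T" "\<And>U. subm R F0 U \<Longrightarrow> mK0 \<subseteq> U \<Longrightarrow> Z \<subseteq> U \<Longrightarrow> T \<subseteq> U"
  shows "rel_len R \<mm> F0 M p \<le> enat (vectorspace.dim A TOR)"
proof -
  interpret TOR: vectorspace A TOR by (simp add: vectorspace_def TOR_module fld)
  have TORm: "module A TOR" by (rule TOR_module)
  have \<kappa>Z: "\<kappa> ` Z \<subseteq> carrier TOR" using Z \<kappa>_closed by auto
  have sp: "subm A TOR (TOR.span (\<kappa> ` Z))" by (rule TOR.span_subm[OF \<kappa>Z])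
  have "T \<subseteq> {v \<in> T. \<kappa> v \<in> TOR.span (\<kappa> ` Z)}"
  proof (rule Z(3))
    show "subm R F0 {v \<in> T. \<kappa> v \<in> TOR.span (\<kappa> ` Z)}"
    proof (rule r0.submI)
      show "\<zero>\<^bsub>F0\<^esub> \<in> {v \<in> T. \<kappa> v \<in> TOR.span (\<kappa> ` Z)}"
        using \<kappa>_zero[OF r0.subm_zero[OF mK0_subm] r0.subm_zero[OF T_subm]] TOR.subm_zero[OF sp] r0.subm_zero[OF T_subm] by simp
    qed (use T_carrier r0.subm_add[OF T_subm] r0.subm_smult[OF T_subm] \<kappa>_add \<kappa>_smult TOR.subm_add[OF sp]
        TOR.subm_smult[OF sp] r0.bc.\<phi>_closed in auto)
    show "mK0 \<subseteq> {v \<in> T. \<kappa> v \<in> TOR.span (\<kappa> ` Z)}" using mK0_T \<kappa>_zero TOR.subm_zero[OF sp] by auto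
    show "Z \<subseteq> {v \<in> T. \<kappa> v \<in> TOR.span (\<kappa> ` Z)}" using Z TOR.span_upper[OF \<kappa>Z] by auto
  qed
  then have "carrier TOR \<subseteq> TOR.span (\<kappa> ` Z)" using \<kappa>_surj by blast
  then have "TOR.span (\<kappa> ` Z) = carrier TOR" using TOR.subm_subset[OF sp] by auto
  then have "\<exists>n. \<exists>G. finite G \<and> card G = n \<and> G \<subseteq> carrier TOR \<and> TOR.span G = carrier TOR"
    using Z(1) \<kappa>Z by blast
  then have "\<exists>G. finite G \<and> card G = TOR.dim \<and> G \<subseteq> carrier TOR \<and> TOR.span G = carrier TOR"
    unfolding TOR.dim_def by (rule LeastI_ex)
  then obtain G where G: "finite G" "card G = TOR.dim" "G \<subseteq> carrier TOR" "TOR.span G = carrier TOR" by auto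
  have "\<forall>\<gamma>\<in>G. \<exists>v. v \<in> T \<and> \<kappa> v = \<gamma>"
  proof
    fix \<gamma> assume "\<gamma> \<in> G"
    then have "\<gamma> \<in> carrier TOR" using G(3) by auto
    then have "\<exists>v\<in>T. \<gamma> = \<kappa> v" by (rule \<kappa>_surj)
    then show "\<exists>v. v \<in> T \<and> \<kappa> v = \<gamma>" by auto
  qed
  from bchoice[OF this] obtain z where "\<forall>\<gamma>\<in>G. z \<gamma> \<in> T \<and> \<kappa> (z \<gamma>) = \<gamma>" ..
  then have z: "\<And>\<gamma>. \<gamma> \<in> G \<Longrightarrow> z \<gamma> \<in> T" "\<And>\<gamma>. \<gamma> \<in> G \<Longrightarrow> \<kappa> (z \<gamma>) = \<gamma>" by simp_all
  have "clen (subm R F0) mK0 T \<le> enat (card (z ` G))"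
  proof (rule r0.clen_adjoin_le[where \<mm> = \<mm>])
    show "finite (z ` G)" using G by simp
    show "\<mm> \<subseteq> carrier R" by (rule R.idl_subset[OF \<mm>.ideal_axioms])
    show "r \<odot>\<^bsub>F0\<^esub> g \<in> mK0" if "r \<in> \<mm>" "g \<in> z ` G" for r g
      using that z(1) T_sub by (auto intro!: iprod.prod)
    fix V assume V: "subm R F0 V" "mK0 \<subseteq> V" "z ` G \<subseteq> V"
    have VT: "subm R F0 (V \<inter> T)" by (rule r0.subm_inter[OF V(1) T_subm])
    have "subm A TOR (\<kappa> ` (V \<inter> T))"
    proof (rule TOR.submI)
      show "\<kappa> ` (V \<inter> T) \<subseteq> carrier TOR" using \<kappa>_closed by auto
      show "\<zero>\<^bsub>TOR\<^esub> \<in> \<kappa> ` (V \<inter> T)"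
        using \<kappa>_zero[OF r0.subm_zero[OF mK0_subm] r0.subm_zero[OF T_subm]] r0.subm_zero[OF VT] by (metis imageI)
      fix a b assume "a \<in> \<kappa> ` (V \<inter> T)" "b \<in> \<kappa> ` (V \<inter> T)"
      then obtain x y where xy: "x \<in> V \<inter> T" "y \<in> V \<inter> T" "a = \<kappa> x" "b = \<kappa> y" by auto
      then have "a \<oplus>\<^bsub>TOR\<^esub> b = \<kappa> (x \<oplus>\<^bsub>F0\<^esub> y)" using \<kappa>_add by simp
      then show "a \<oplus>\<^bsub>TOR\<^esub> b \<in> \<kappa> ` (V \<inter> T)" using r0.subm_add[OF VT xy(1,2)] by (metis imageI)
    next
      fix a b assume "a \<in> carrier A" "b \<in> \<kappa> ` (V \<inter> T)"
      then obtain r y where ry: "r \<in> carrier R" "a = \<phi> r" "y \<in> V \<inter> T" "b = \<kappa> y" by (auto elim: r0.A_carrierE)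
      then have "a \<odot>\<^bsub>TOR\<^esub> b = \<kappa> (r \<odot>\<^bsub>F0\<^esub> y)" using \<kappa>_smult by simp
      then show "a \<odot>\<^bsub>TOR\<^esub> b \<in> \<kappa> ` (V \<inter> T)" using r0.subm_smult[OF VT ry(1,3)] by (metis imageI)
    qed
    moreover have "G \<subseteq> \<kappa> ` (V \<inter> T)"
    proof
      fix \<gamma> assume \<gamma>: "\<gamma> \<in> G"
      show "\<gamma> \<in> \<kappa> ` (V \<inter> T)" by (rule image_eqI[of _ _ "z \<gamma>"]) (use z \<gamma> V(3) in auto)
    qed
    ultimately have full: "carrier TOR \<subseteq> \<kappa> ` (V \<inter> T)" using TOR.span_least[of "\<kappa> ` (V \<inter> T)" G] G(4) by simp
    show "T \<subseteq> V"
    proof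
      fix v assume v: "v \<in> T"
      then have "\<kappa> v \<in> \<kappa> ` (V \<inter> T)" using full \<kappa>_closed by auto
      then obtain w where w: "w \<in> V" "w \<in> T" "\<kappa> v = \<kappa> w" by auto
      then have "v \<ominus>\<^bsub>F0\<^esub> w \<in> V" using \<kappa>_eq[OF v w(2)] V(2) by auto
      then show "v \<in> V" by (rule r0.subm_minus_cancel[OF V(1) _ w(1) T_carrier[OF v]])
    qed
  qed (use units mK0_subm T_subm mK0_T z in auto)
  also have "\<dots> \<le> enat TOR.dim" using card_image_le[OF G(1), of z] G(2) by simp
  finally show ?thesis unfolding rel_len_def .
qed

end

section \<open>The fraction field and modules of rank one\<close>

context domain begin

abbreviation "frac_pairs \<equiv> carrier R \<times> (carrier R - {\<zero>})"

lemma frac_rel_equiv: "equiv frac_pairs (frac_rel R)"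
proof (rule equivI)
  show "frac_rel R \<subseteq> frac_pairs \<times> frac_pairs" unfolding frac_rel_def by auto
  show "refl_on frac_pairs (frac_rel R)" unfolding frac_rel_def refl_on_def by auto
  show "sym (frac_rel R)" unfolding frac_rel_def sym_def by auto
  show "trans (frac_rel R)"
  proof (rule transI)
    fix x y z assume "(x, y) \<in> frac_rel R" "(y, z) \<in> frac_rel R"
    then obtain a b c d e f where e: "x = (a, b)" "y = (c, d)" "z = (e, f)"
      and c: "a \<in> carrier R" "b \<in> carrier R" "b \<noteq> \<zero>" "c \<in> carrier R" "d \<in> carrier R" "d \<noteq> \<zero>"
        "e \<in> carrier R" "f \<in> carrier R" "f \<noteq> \<zero>"
      and eq: "a \<otimes> d = c \<otimes> b" "c \<otimes> f = e \<otimes> d" unfolding frac_rel_def by auto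
    have "d \<otimes> (a \<otimes> f) = (a \<otimes> d) \<otimes> f" using c by algebra
    also have "\<dots> = (c \<otimes> f) \<otimes> b" unfolding eq(1) using c by algebra
    also have "\<dots> = d \<otimes> (e \<otimes> b)" unfolding eq(2) using c by algebra
    finally have "a \<otimes> f = e \<otimes> b" using m_lcancel[of d "a \<otimes> f" "e \<otimes> b"] c by simp
    then show "(x, z) \<in> frac_rel R" unfolding frac_rel_def e using c by simp
  qed
qed

lemma frac_eq_iff:
  assumes "a \<in> carrier R" "b \<in> carrier R" "b \<noteq> \<zero>" "c \<in> carrier R" "d \<in> carrier R" "d \<noteq> \<zero>"
  shows "frac R a b = frac R c d \<longleftrightarrow> a \<otimes> d = c \<otimes> b"
proof -
  have "frac R a b = frac R c d \<longleftrightarrow> ((a, b), (c, d)) \<in> frac_rel R"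
    unfolding frac_def by (rule eq_equiv_class_iff[OF frac_rel_equiv]) (use assms in auto)
  then show ?thesis unfolding frac_rel_def using assms by simp
qed

lemma frac_memE:
  assumes "(a', b') \<in> frac R a b"
  shows "a' \<in> carrier R" "b' \<in> carrier R" "b' \<noteq> \<zero>" "a \<otimes> b' = a' \<otimes> b"
  using assms unfolding frac_def frac_rel_def by auto

lemma frac_memI: "a \<in> carrier R \<Longrightarrow> b \<in> carrier R \<Longrightarrow> b \<noteq> \<zero> \<Longrightarrow> (a, b) \<in> frac R a b"
  unfolding frac_def frac_rel_def by auto

lemma frac_closed: "a \<in> carrier R \<Longrightarrow> b \<in> carrier R \<Longrightarrow> b \<noteq> \<zero> \<Longrightarrow> frac R a b \<in> carrier (fraction_field R)"
  unfolding fraction_field_def frac_def by (auto intro!: quotientI)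

lemma fraction_fieldE:
  assumes "x \<in> carrier (fraction_field R)"
  obtains a b where "a \<in> carrier R" "b \<in> carrier R" "b \<noteq> \<zero>" "x = frac R a b"
  using assms unfolding fraction_field_def frac_def by (auto elim!: quotientE)

text \<open>
  The unions over representatives in the operations on fractions collapse, since all
  representatives give the same class.
\<close>

lemma frac_UN:
  assumes c: "a \<in> carrier R" "b \<in> carrier R" "b \<noteq> \<zero>" "c \<in> carrier R" "d \<in> carrier R" "d \<noteq> \<zero>"
    and eq: "\<And>a' b' c' d'. (a', b') \<in> frac R a b \<Longrightarrow> (c', d') \<in> frac R c d \<Longrightarrow> g a' b' c' d' = z"
  shows "(\<Union>(a', b')\<in>frac R a b. \<Union>(c', d')\<in>frac R c d. g a' b' c' d') = z"
proof
  show "(\<Union>(a', b')\<in>frac R a b. \<Union>(c', d')\<in>frac R c d. g a' b' c' d') \<subseteq> z" using eq by auto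
  have "g a b c d = z" by (rule eq[OF frac_memI[OF c(1-3)] frac_memI[OF c(4-6)]])
  then show "z \<subseteq> (\<Union>(a', b')\<in>frac R a b. \<Union>(c', d')\<in>frac R c d. g a' b' c' d')"
    using frac_memI[OF c(1-3)] frac_memI[OF c(4-6)] by blast
qed

lemma frac_mult:
  assumes c: "a \<in> carrier R" "b \<in> carrier R" "b \<noteq> \<zero>" "c \<in> carrier R" "d \<in> carrier R" "d \<noteq> \<zero>"
  shows "frac R a b \<otimes>\<^bsub>fraction_field R\<^esub> frac R c d = frac R (a \<otimes> c) (b \<otimes> d)"
proof -
  have "(\<Union>(a', b')\<in>frac R a b. \<Union>(c', d')\<in>frac R c d. frac R (a' \<otimes> c') (b' \<otimes> d')) = frac R (a \<otimes> c) (b \<otimes> d)"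
  proof (rule frac_UN[OF c])
    fix a' b' c' d' assume "(a', b') \<in> frac R a b" "(c', d') \<in> frac R c d"
    note 1 = frac_memE[OF this(1)] frac_memE[OF this(2)]
    have "(a' \<otimes> c') \<otimes> (b \<otimes> d) = (a' \<otimes> b) \<otimes> (c' \<otimes> d)" using c 1(1,2,5,6) by algebra
    also have "\<dots> = (a \<otimes> c) \<otimes> (b' \<otimes> d')" unfolding 1(4)[symmetric] 1(8)[symmetric] using c 1(1,2,5,6) by algebra
    finally have eq: "(a' \<otimes> c') \<otimes> (b \<otimes> d) = (a \<otimes> c) \<otimes> (b' \<otimes> d')" .
    show "frac R (a' \<otimes> c') (b' \<otimes> d') = frac R (a \<otimes> c) (b \<otimes> d)"
      by (rule iffD2[OF frac_eq_iff eq]) (use c 1 integral_iff in auto)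
  qed
  then show ?thesis by (simp add: fraction_field_def)
qed

lemma frac_add:
  assumes c: "a \<in> carrier R" "b \<in> carrier R" "b \<noteq> \<zero>" "c \<in> carrier R" "d \<in> carrier R" "d \<noteq> \<zero>"
  shows "frac R a b \<oplus>\<^bsub>fraction_field R\<^esub> frac R c d = frac R (a \<otimes> d \<oplus> c \<otimes> b) (b \<otimes> d)"
proof -
  have "(\<Union>(a', b')\<in>frac R a b. \<Union>(c', d')\<in>frac R c d. frac R (a' \<otimes> d' \<oplus> c' \<otimes> b') (b' \<otimes> d'))
      = frac R (a \<otimes> d \<oplus> c \<otimes> b) (b \<otimes> d)"
  proof (rule frac_UN[OF c])
    fix a' b' c' d' assume "(a', b') \<in> frac R a b" "(c', d') \<in> frac R c d"
    note 1 = frac_memE[OF this(1)] frac_memE[OF this(2)]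
    have "(a' \<otimes> d' \<oplus> c' \<otimes> b') \<otimes> (b \<otimes> d) = (a' \<otimes> b) \<otimes> (d' \<otimes> d) \<oplus> (c' \<otimes> d) \<otimes> (b' \<otimes> b)" using c 1(1,2,5,6) by algebra
    also have "\<dots> = (a \<otimes> d \<oplus> c \<otimes> b) \<otimes> (b' \<otimes> d')" unfolding 1(4)[symmetric] 1(8)[symmetric] using c 1(1,2,5,6) by algebra
    finally have eq: "(a' \<otimes> d' \<oplus> c' \<otimes> b') \<otimes> (b \<otimes> d) = (a \<otimes> d \<oplus> c \<otimes> b) \<otimes> (b' \<otimes> d')" .
    show "frac R (a' \<otimes> d' \<oplus> c' \<otimes> b') (b' \<otimes> d') = frac R (a \<otimes> d \<oplus> c \<otimes> b) (b \<otimes> d)"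
      by (rule iffD2[OF frac_eq_iff eq]) (use c 1 integral_iff in auto)
  qed
  then show ?thesis by (simp add: fraction_field_def)
qed

lemma fraction_field_one: "\<one>\<^bsub>fraction_field R\<^esub> = frac R \<one> \<one>"
  and fraction_field_zero: "\<zero>\<^bsub>fraction_field R\<^esub> = frac R \<zero> \<one>"
  by (simp_all add: fraction_field_def)

lemmas frac_simps = frac_mult frac_add fraction_field_one fraction_field_zero frac_eq_iff integral_iff

lemma fraction_field_cring: "cring (fraction_field R)"
proof (rule cringI)
  show "abelian_group (fraction_field R)"
  proof (rule abelian_groupI)
    fix x y z assume "x \<in> carrier (fraction_field R)" "y \<in> carrier (fraction_field R)" "z \<in> carrier (fraction_field R)"
    then obtain a b c d e f where x: "a \<in> carrier R" "b \<in> carrier R" "b \<noteq> \<zero>" "x = frac R a b"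
      and y: "c \<in> carrier R" "d \<in> carrier R" "d \<noteq> \<zero>" "y = frac R c d"
      and z: "e \<in> carrier R" "f \<in> carrier R" "f \<noteq> \<zero>" "z = frac R e f" by (elim fraction_fieldE)
    have nz: "b \<otimes> d \<noteq> \<zero>" "d \<otimes> f \<noteq> \<zero>" using x y z integral_iff by auto
    have "((a \<otimes> d \<oplus> c \<otimes> b) \<otimes> f \<oplus> e \<otimes> (b \<otimes> d)) \<otimes> (b \<otimes> (d \<otimes> f)) =
        (a \<otimes> (d \<otimes> f) \<oplus> (c \<otimes> f \<oplus> e \<otimes> d) \<otimes> b) \<otimes> ((b \<otimes> d) \<otimes> f)" using x y z by algebra
    then show "(x \<oplus>\<^bsub>fraction_field R\<^esub> y) \<oplus>\<^bsub>fraction_field R\<^esub> z = x \<oplus>\<^bsub>fraction_field R\<^esub> (y \<oplus>\<^bsub>fraction_field R\<^esub> z)"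
      using x y z nz by (simp add: frac_simps)
  next
    fix x y assume "x \<in> carrier (fraction_field R)" "y \<in> carrier (fraction_field R)"
    then obtain a b c d where x: "a \<in> carrier R" "b \<in> carrier R" "b \<noteq> \<zero>" "x = frac R a b"
      and y: "c \<in> carrier R" "d \<in> carrier R" "d \<noteq> \<zero>" "y = frac R c d" by (elim fraction_fieldE)
    show "x \<oplus>\<^bsub>fraction_field R\<^esub> y \<in> carrier (fraction_field R)"
      unfolding x(4) y(4) using x y by (simp add: frac_add frac_closed integral_iff)
    have "(a \<otimes> d \<oplus> c \<otimes> b) \<otimes> (d \<otimes> b) = (c \<otimes> b \<oplus> a \<otimes> d) \<otimes> (b \<otimes> d)" using x y by algebra
    then show "x \<oplus>\<^bsub>fraction_field R\<^esub> y = y \<oplus>\<^bsub>fraction_field R\<^esub> x" using x y by (simp add: frac_simps)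
    show "\<zero>\<^bsub>fraction_field R\<^esub> \<oplus>\<^bsub>fraction_field R\<^esub> x = x" using x by (simp add: frac_simps)
    have "\<ominus> a \<otimes> b \<oplus> a \<otimes> b = \<zero>" using x by algebra
    then have "frac R (\<ominus> a) b \<oplus>\<^bsub>fraction_field R\<^esub> x = \<zero>\<^bsub>fraction_field R\<^esub>" using x by (simp add: frac_simps)
    then show "\<exists>y\<in>carrier (fraction_field R). y \<oplus>\<^bsub>fraction_field R\<^esub> x = \<zero>\<^bsub>fraction_field R\<^esub>"
      using frac_closed[of "\<ominus> a" b] x by auto
  qed (simp add: fraction_field_zero frac_closed)
  show "Group.comm_monoid (fraction_field R)"
  proof (rule comm_monoidI)
    fix x y z assume "x \<in> carrier (fraction_field R)" "y \<in> carrier (fraction_field R)" "z \<in> carrier (fraction_field R)"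
    then obtain a b c d e f where x: "a \<in> carrier R" "b \<in> carrier R" "b \<noteq> \<zero>" "x = frac R a b"
      and y: "c \<in> carrier R" "d \<in> carrier R" "d \<noteq> \<zero>" "y = frac R c d"
      and z: "e \<in> carrier R" "f \<in> carrier R" "f \<noteq> \<zero>" "z = frac R e f" by (elim fraction_fieldE)
    have nz: "b \<otimes> d \<noteq> \<zero>" "d \<otimes> f \<noteq> \<zero>" using x y z integral_iff by auto
    show "(x \<otimes>\<^bsub>fraction_field R\<^esub> y) \<otimes>\<^bsub>fraction_field R\<^esub> z = x \<otimes>\<^bsub>fraction_field R\<^esub> (y \<otimes>\<^bsub>fraction_field R\<^esub> z)"
      unfolding x(4) y(4) z(4) using x(1-3) y(1-3) z(1-3) nz by (simp add: frac_mult m_assoc)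
  next
    fix x y assume "x \<in> carrier (fraction_field R)" "y \<in> carrier (fraction_field R)"
    then obtain a b c d where x: "a \<in> carrier R" "b \<in> carrier R" "b \<noteq> \<zero>" "x = frac R a b"
      and y: "c \<in> carrier R" "d \<in> carrier R" "d \<noteq> \<zero>" "y = frac R c d" by (elim fraction_fieldE)
    show "x \<otimes>\<^bsub>fraction_field R\<^esub> y \<in> carrier (fraction_field R)"
      unfolding x(4) y(4) using x y by (simp add: frac_mult frac_closed integral_iff)
    show "x \<otimes>\<^bsub>fraction_field R\<^esub> y = y \<otimes>\<^bsub>fraction_field R\<^esub> x"
      unfolding x(4) y(4) using x y by (simp add: frac_mult m_comm)
    show "\<one>\<^bsub>fraction_field R\<^esub> \<otimes>\<^bsub>fraction_field R\<^esub> x = x" using x by (simp add: frac_mult fraction_field_one)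
  qed (simp add: fraction_field_one frac_closed)
  fix x y z assume "x \<in> carrier (fraction_field R)" "y \<in> carrier (fraction_field R)" "z \<in> carrier (fraction_field R)"
  then obtain a b c d e f where x: "a \<in> carrier R" "b \<in> carrier R" "b \<noteq> \<zero>" "x = frac R a b"
    and y: "c \<in> carrier R" "d \<in> carrier R" "d \<noteq> \<zero>" "y = frac R c d"
    and z: "e \<in> carrier R" "f \<in> carrier R" "f \<noteq> \<zero>" "z = frac R e f" by (elim fraction_fieldE)
  have nz: "b \<otimes> d \<noteq> \<zero>" "b \<otimes> f \<noteq> \<zero>" "d \<otimes> f \<noteq> \<zero>" "(b \<otimes> f) \<otimes> (d \<otimes> f) \<noteq> \<zero>" using x y z integral_iff by auto
  have "((a \<otimes> d \<oplus> c \<otimes> b) \<otimes> e) \<otimes> ((b \<otimes> f) \<otimes> (d \<otimes> f)) =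
      ((a \<otimes> e) \<otimes> (d \<otimes> f) \<oplus> (c \<otimes> e) \<otimes> (b \<otimes> f)) \<otimes> ((b \<otimes> d) \<otimes> f)" using x y z by algebra
  then show "(x \<oplus>\<^bsub>fraction_field R\<^esub> y) \<otimes>\<^bsub>fraction_field R\<^esub> z =
      x \<otimes>\<^bsub>fraction_field R\<^esub> z \<oplus>\<^bsub>fraction_field R\<^esub> y \<otimes>\<^bsub>fraction_field R\<^esub> z"
    using x y z nz by (simp add: frac_simps)
qed

lemma fraction_field_field: "field (fraction_field R)"
proof -
  interpret Q: cring "fraction_field R" by (rule fraction_field_cring)
  show ?thesis
  proof (rule Q.cring_fieldI2)
    show "\<zero>\<^bsub>fraction_field R\<^esub> \<noteq> \<one>\<^bsub>fraction_field R\<^esub>"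
      using frac_eq_iff[of \<zero> \<one> \<one> \<one>] by (simp add: fraction_field_one fraction_field_zero)
    fix x assume "x \<in> carrier (fraction_field R)" and nz: "x \<noteq> \<zero>\<^bsub>fraction_field R\<^esub>"
    then obtain a b where x: "a \<in> carrier R" "b \<in> carrier R" "b \<noteq> \<zero>" "x = frac R a b" by (elim fraction_fieldE)
    have a: "a \<noteq> \<zero>" using nz x frac_eq_iff[of a b \<zero> \<one>] by (auto simp: fraction_field_zero)
    have "x \<otimes>\<^bsub>fraction_field R\<^esub> frac R b a = \<one>\<^bsub>fraction_field R\<^esub>"
      unfolding x(4) using x(1-3) a frac_eq_iff[of "a \<otimes> b" "b \<otimes> a" \<one> \<one>]
      by (simp add: frac_mult fraction_field_one integral_iff m_comm)
    then show "\<exists>y\<in>carrier (fraction_field R). x \<otimes>\<^bsub>fraction_field R\<^esub> y = \<one>\<^bsub>fraction_field R\<^esub>"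
      using frac_closed[of b a] x(1-3) a by auto
  qed
qed

lemma frac_embed_hom: "frac_embed R \<in> ring_hom R (fraction_field R)"
  by (rule ring_hom_memI) (simp_all add: frac_embed_def frac_closed frac_mult frac_add fraction_field_one)

lemma frac_embed_zero_iff: "a \<in> carrier R \<Longrightarrow> frac_embed R a = \<zero>\<^bsub>fraction_field R\<^esub> \<longleftrightarrow> a = \<zero>"
  using frac_eq_iff[of a \<one> \<zero> \<one>] by (simp add: frac_embed_def fraction_field_zero)

text \<open>
  Suppose \<open>f x = 0\<close> with \<open>x \<noteq> 0\<close>. As \<open>M\<close> has no torsion, \<open>x \<otimes> 1\<close> is nonzero, and so it spans the
  one-dimensional space \<open>M \<otimes> Q\<close>. Then \<open>f \<otimes> Q\<close> vanishes, and with it \<open>f\<close>, as \<open>R\<close> embeds into \<open>Q\<close>.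
\<close>

lemma rank_one_torsion_free_inj:
  assumes M: "module R M" and fg: "fin_gen_module R M" and rk: "module_rank R M = 1"
    and tf: "torsion_submodule R M = {\<zero>\<^bsub>M\<^esub>}"
    and J: "J \<subseteq> carrier R" and f: "f \<in> module_hom R M (ideal_module R J)"
    and y: "y \<in> carrier M" "f y \<noteq> \<zero>" and x: "x \<in> carrier M" "f x = \<zero>"
  shows "x = \<zero>\<^bsub>M\<^esub>"
proof (rule ccontr)
  assume xnz: "x \<noteq> \<zero>\<^bsub>M\<^esub>"
  define Q where "Q = fraction_field R"
  interpret Q: field Q unfolding Q_def by (rule fraction_field_field)
  have eh: "frac_embed R \<in> ring_hom R Q" unfolding Q_def by (rule frac_embed_hom)
  interpret M: module R M by (rule M)
  interpret bc: base_change R M Q "frac_embed R" by (rule base_changeI[OF M Q.is_cring eh])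
  interpret V: vectorspace Q bc.TA by (simp add: vectorspace_def bc.TA_module Q.field_axioms)
  have one: "\<one>\<^bsub>Q\<^esub> \<in> carrier Q" by simp
  from fg obtain G where G: "finite G" "G \<subseteq> carrier M" "M.span G = carrier M" unfolding fin_gen_module_def by blast
  have PG: "(\<lambda>g. bc.pt g \<one>\<^bsub>Q\<^esub>) ` G \<subseteq> carrier bc.TA" using G(2) bc.pt_closed[OF _ one] by auto
  have sp: "subm Q bc.TA (bc.TA.span ((\<lambda>g. bc.pt g \<one>\<^bsub>Q\<^esub>) ` G))" (is "subm Q bc.TA ?S") by (rule bc.TA.span_subm[OF PG])
  have "subm R M {m \<in> carrier M. bc.pt m \<one>\<^bsub>Q\<^esub> \<in> ?S}"
  proof (rule M.submI)
    show "a \<odot>\<^bsub>M\<^esub> b \<in> {m \<in> carrier M. bc.pt m \<one>\<^bsub>Q\<^esub> \<in> ?S}"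
      if "a \<in> carrier R" "b \<in> {m \<in> carrier M. bc.pt m \<one>\<^bsub>Q\<^esub> \<in> ?S}" for a b
      using that bc.pt_smult_left[of a b] bc.TA.subm_smult[OF sp bc.\<phi>_closed[of a], of "bc.pt b \<one>\<^bsub>Q\<^esub>"] by simp
    have "bc.pt (\<zero> \<odot>\<^bsub>M\<^esub> \<zero>\<^bsub>M\<^esub>) \<one>\<^bsub>Q\<^esub> = \<zero>\<^bsub>Q\<^esub> \<odot>\<^bsub>bc.TA\<^esub> bc.pt \<zero>\<^bsub>M\<^esub> \<one>\<^bsub>Q\<^esub>"
      using bc.pt_smult_left[of \<zero> "\<zero>\<^bsub>M\<^esub>"] frac_embed_zero_iff[of \<zero>] unfolding Q_def by simp
    then show "\<zero>\<^bsub>M\<^esub> \<in> {m \<in> carrier M. bc.pt m \<one>\<^bsub>Q\<^esub> \<in> ?S}"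
      using bc.TA.subm_zero[OF sp] bc.pt_closed[OF M.M.zero_closed one] by simp
  qed (use bc.pt_add_left[OF _ _ one] bc.TA.subm_add[OF sp] in auto)
  then have "M.span G \<subseteq> {m \<in> carrier M. bc.pt m \<one>\<^bsub>Q\<^esub> \<in> ?S}"
    by (rule M.span_least) (use G(2) bc.TA.span_upper[OF PG] in auto)
  then have "?S = carrier bc.TA" using bc.TA_generated[OF sp] G(3) by auto
  then have "\<exists>n. \<exists>B. finite B \<and> card B = n \<and> B \<subseteq> carrier bc.TA \<and> bc.TA.span B = carrier bc.TA"
    using G(1) PG by blast
  then have "\<exists>B. finite B \<and> card B = V.dim \<and> B \<subseteq> carrier bc.TA \<and> bc.TA.span B = carrier bc.TA"
    unfolding V.dim_def by (rule LeastI_ex)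
  moreover have "V.dim = 1" using rk unfolding module_rank_def frac_tensor_def Q_def .
  ultimately obtain g where g: "g \<in> carrier bc.TA" "bc.TA.span {g} = carrier bc.TA" by (auto simp: card_1_singleton_iff)
  have fc: "f m \<in> carrier R" if "m \<in> carrier M" for m
    using f that J unfolding module_hom_def ideal_module_def by auto
  have fa: "f (m \<oplus>\<^bsub>M\<^esub> m') = f m \<oplus> f m'" if "m \<in> carrier M" "m' \<in> carrier M" for m m'
    using f that unfolding module_hom_def ideal_module_def by simp
  have fs: "f (r \<odot>\<^bsub>M\<^esub> m) = r \<otimes> f m" if "r \<in> carrier R" "m \<in> carrier M" for r m
    using f that unfolding module_hom_def ideal_module_def by simp
  have "\<exists>h\<in>module_hom Q bc.TA (ring_module Q). \<forall>m\<in>carrier M. \<forall>a\<in>carrier Q.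
      h (bc.pt m a) = a \<odot>\<^bsub>ring_module Q\<^esub> frac_embed R (f m)"
    by (rule bc.TA_universal[OF Q.ring_module_module])
      (use fc ring_hom_closed[OF eh] fa fs ring_hom_add[OF eh] ring_hom_mult[OF eh] in simp_all)
  then obtain h where h: "h \<in> module_hom Q bc.TA (ring_module Q)"
    and h': "\<forall>m\<in>carrier M. \<forall>a\<in>carrier Q. h (bc.pt m a) = a \<odot>\<^bsub>ring_module Q\<^esub> frac_embed R (f m)" by (rule bexE)
  interpret h: mod_hom Q bc.TA "ring_module Q" h by (rule mod_homI[OF bc.TA_module Q.ring_module_module h])
  have hpt: "h (bc.pt m \<one>\<^bsub>Q\<^esub>) = frac_embed R (f m)" if "m \<in> carrier M" for m
    using h'[rule_format, OF that one] ring_hom_closed[OF eh fc[OF that]] by simp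
  have px: "bc.pt x \<one>\<^bsub>Q\<^esub> \<in> carrier bc.TA" by (rule bc.pt_closed[OF x(1) one])
  have "bc.pt x \<one>\<^bsub>Q\<^esub> \<noteq> \<zero>\<^bsub>bc.TA\<^esub>"
  proof
    assume "bc.pt x \<one>\<^bsub>Q\<^esub> = \<zero>\<^bsub>bc.TA\<^esub>"
    then have "x \<in> torsion_submodule R M"
      using x(1) unfolding torsion_submodule_def frac_tensor_def a_kernel_eq Q_def by simp
    then show False using tf xnz by simp
  qed
  moreover have "carrier bc.TA \<subseteq> bc.TA.cyclic g"
    using bc.TA.span_least[OF bc.TA.cyclic_subm[OF g(1)], of "{g}"] bc.TA.cyclic_self[OF g(1)] g(2) by simp
  then obtain c where c: "c \<in> carrier Q" "bc.pt x \<one>\<^bsub>Q\<^esub> = c \<odot>\<^bsub>bc.TA\<^esub> g" using px unfolding bc.TA.cyclic_def by auto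
  ultimately have cnz: "c \<noteq> \<zero>\<^bsub>Q\<^esub>" using bc.TA.smult_l_null[OF g(1)] by metis
  have "frac_embed R (f x) = \<zero>\<^bsub>Q\<^esub>" unfolding Q_def using x(2) frac_embed_zero_iff[of \<zero>] by simp
  then have "c \<otimes>\<^bsub>Q\<^esub> h g = \<zero>\<^bsub>Q\<^esub>" using hpt[OF x(1)] h.f_smult[OF c(1) g(1)] c(2) by simp
  moreover have "h g \<in> carrier Q" using h.f_im[OF g(1)] by simp
  ultimately have "h g = \<zero>\<^bsub>Q\<^esub>" using c(1) cnz Q.integral by blast
  then have "bc.TA.span {g} \<subseteq> h.hker" by (intro bc.TA.span_least[OF h.hker_subm]) (simp add: h.hker_def g(1))
  then have "bc.pt y \<one>\<^bsub>Q\<^esub> \<in> h.hker" using g(2) bc.pt_closed[OF y(1) one] by auto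
  then have "frac_embed R (f y) = \<zero>\<^bsub>Q\<^esub>" using hpt[OF y(1)] by (simp add: h.hker_def)
  then show False using frac_embed_zero_iff[OF fc[OF y(1)]] y(2) unfolding Q_def by simp
qed

end

section \<open>Ideals of a noetherian local ring\<close>

lemma (in cring) subm_ring_module: "subm R (ring_module R) = (\<lambda>J. ideal J R)"
  by (rule ext) (rule subm_ring_module_iff)

lemma finsum_ring_module [simp]: "finsum (ring_module R) f X = finsum R f X"
  by (simp add: finsum_def finprod_def)

lemma (in cring) fext_image_Idl:
  assumes X: "finite X" and f: "\<And>x. x \<in> X \<Longrightarrow> f x \<in> carrier R"
  shows "module.fext R (ring_module R) f ` carrier (free_module R X) = Idl (f ` X)"
proof -
  interpret RM: module R "ring_module R" by (rule ring_module_module)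
  have fX: "f \<in> X \<rightarrow> carrier (ring_module R)" using f by auto
  have val: "RM.fext f g = (\<Oplus>x\<in>X. g x \<otimes> f x)" if "g \<in> carrier (free_module R X)" for g
    using RM.fext_superset[OF fX that X free_support[OF that]] by simp
  have "RM.fext f ` carrier (free_module R X) = lin (carrier R) f X"
  proof (intro equalityI subsetI)
    fix a assume "a \<in> RM.fext f ` carrier (free_module R X)"
    then obtain g where g: "g \<in> carrier (free_module R X)" "a = RM.fext f g" by auto
    show "a \<in> lin (carrier R) f X" unfolding g(2) val[OF g(1)] by (rule linI) (use free_value[OF g(1)] in auto)
  next
    fix a assume "a \<in> lin (carrier R) f X"
    then obtain e where e: "e \<in> X \<rightarrow> carrier R" "a = (\<Oplus>x\<in>X. e x \<otimes> f x)" by (rule linE)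
    define g where "g = (\<lambda>x. if x \<in> X then e x else \<zero>)"
    have g: "g \<in> carrier (free_module R X)"
      by (rule free_carrierI) (use e X in \<open>auto simp: g_def intro: finite_subset[of _ X]\<close>)
    have "a = RM.fext f g" unfolding e(2) val[OF g] by (rule finsum_cong') (use f in \<open>auto simp: g_def intro!: m_closed funcset_mem[OF e(1)]\<close>)
    then show "a \<in> RM.fext f ` carrier (free_module R X)" using g by blast
  qed
  then show ?thesis using lin_carrier_eq_Idl[OF X, of f] f by simp
qed

text \<open>The submodules of \<open>I\<close> are the ideals inside \<open>I\<close>.\<close>

lemma (in cring) Idl_span:
  assumes I: "ideal I R" and X: "X \<subseteq> I"
  shows "module.span R (ideal_module R I) X = Idl X"
proof -
  interpret RM: module R "ring_module R" by (rule ring_module_module)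
  have m: "module R (ideal_module R I)" unfolding ideal_module_def
    by (rule Module.submodule.submodule_is_module[OF iffD2[OF subm_ring_module_iff I] ring_module_module])
  interpret IM: module R "ideal_module R I" by (rule m)
  have Xc: "X \<subseteq> carrier R" using X idl_subset[OF I] by auto
  have carr: "carrier (ideal_module R I) = I" by (simp add: ideal_module_def)
  have eq: "subm R (ideal_module R I) V \<longleftrightarrow> ideal V R \<and> V \<subseteq> I" for V
  proof
    assume V: "subm R (ideal_module R I) V"
    have "ideal V R" by (rule idlI) (use IM.subm_subset[OF V] IM.subm_zero[OF V] IM.subm_add[OF V] IM.subm_smult[OF V]
        idl_subset[OF I] in \<open>auto simp: ideal_module_def\<close>)
    then show "ideal V R \<and> V \<subseteq> I" using IM.subm_subset[OF V] carr by simp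
  next
    assume V: "ideal V R \<and> V \<subseteq> I"
    show "subm R (ideal_module R I) V"
      by (rule IM.submI) (use V idl_zero idl_add idl_mult in \<open>auto simp: ideal_module_def\<close>)
  qed
  have sp: "ideal (IM.span X) R \<and> IM.span X \<subseteq> I" using IM.span_subm[of X] X unfolding carr eq by simp
  have XS: "X \<subseteq> IM.span X" by (rule IM.span_upper) (simp add: carr X)
  show ?thesis
  proof
    have "subm R (ideal_module R I) (Idl X)" unfolding eq using genideal_ideal[OF Xc] genideal_minimal[OF I X] by simp
    then show "IM.span X \<subseteq> Idl X" by (rule IM.span_least) (rule genideal_self[OF Xc])
    show "Idl X \<subseteq> IM.span X" by (rule genideal_minimal) (use sp XS in auto)
  qed
qed

lemma (in cring) min_gens_le:
  assumes I: "ideal I R" and X: "finite X" "X \<subseteq> carrier R" "Idl X = I"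
  shows "min_gens R (ideal_module R I) \<le> card X"
proof -
  have XI: "X \<subseteq> I" using genideal_self[OF X(2)] X(3) by simp
  show ?thesis unfolding min_gens_def
    by (rule Least_le) (use X XI Idl_span[OF I XI] in \<open>auto simp: ideal_module_def\<close>)
qed

lemma (in noetherian_cring) min_gens_attained:
  assumes I: "ideal I R"
  shows "\<exists>X. finite X \<and> card X = min_gens R (ideal_module R I) \<and> X \<subseteq> I \<and> Idl X = I"
proof -
  obtain G where G: "finite G" "G \<subseteq> I" "I = Idl G" using ideal_fg[OF I] by blast
  have carr: "carrier (ideal_module R I) = I" by (simp add: ideal_module_def)
  have "\<exists>k. \<exists>A. finite A \<and> card A = k \<and> A \<subseteq> carrier (ideal_module R I) \<and>
      module.span R (ideal_module R I) A = carrier (ideal_module R I)"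
    using G Idl_span[OF I G(2)] unfolding carr by blast
  then have "\<exists>A. finite A \<and> card A = min_gens R (ideal_module R I) \<and> A \<subseteq> carrier (ideal_module R I) \<and>
      module.span R (ideal_module R I) A = carrier (ideal_module R I)"
    unfolding min_gens_def by (rule LeastI_ex)
  then show ?thesis unfolding carr using Idl_span[OF I] by auto
qed

locale noetherian_local = noetherian_cring R for R (structure) +
  fixes \<mm> :: "'a set"
  assumes m_prime: "primeideal \<mm> R" and units: "\<And>r. r \<in> carrier R \<Longrightarrow> r \<notin> \<mm> \<Longrightarrow> r \<in> Units R"
begin

sublocale RM: module R "ring_module R" by (rule ring_module_module)

lemma m_ideal: "ideal \<mm> R" by (rule primeideal.axioms(1)[OF m_prime])
lemma m_carrier: "\<mm> \<subseteq> carrier R" by (rule idl_subset[OF m_ideal])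
lemma m_one: "\<one> \<notin> \<mm>" using primeideal_one_notin[OF m_prime] by simp

lemma nakayama:
  assumes J: "ideal J R" and B: "ideal B R" and JB: "J \<subseteq> B <+> \<mm> \<cdot> J"
  shows "J \<subseteq> B"
proof -
  obtain G where G: "finite G" "G \<subseteq> J" "J = Idl G" using ideal_fg[OF J] by blast
  show ?thesis
    by (rule nakayama_local[OF m_prime _ B G(1) _ G(3) JB]) (use units G(2) idl_subset[OF J] in auto)
qed

text \<open>
  A minimal set of generators is independent modulo \<open>\<mm> I\<close>: by Nakayama's lemma a generator with
  a unit as coefficient could be dropped.
\<close>

lemma min_gens_le_clen:
  assumes I: "ideal I R"
  shows "enat (min_gens R (ideal_module R I)) \<le> clen (\<lambda>J. ideal J R) (\<mm> \<cdot> I) I"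
proof -
  obtain X where X: "finite X" "card X = min_gens R (ideal_module R I)" "X \<subseteq> I" "Idl X = I"
    using min_gens_attained[OF I] by blast
  have Xc: "X \<subseteq> carrier R" using X(3) idl_subset[OF I] by auto
  have mI: "ideal (\<mm> \<cdot> I) R" by (rule ideal_prod_is_ideal[OF m_ideal I])
  have "enat (card X) \<le> clen (subm R (ring_module R)) (\<mm> \<cdot> I) I"
  proof (rule RM.clen_ge_card_independent[where \<mm> = \<mm> and v = "\<lambda>x. x"])
    fix c assume c: "c \<in> X \<rightarrow> carrier R" "(\<Oplus>\<^bsub>ring_module R\<^esub>x\<in>X. c x \<odot>\<^bsub>ring_module R\<^esub> x) \<in> \<mm> \<cdot> I"
    then have s: "(\<Oplus>x\<in>X. c x \<otimes> x) \<in> \<mm> \<cdot> I" by simp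
    show "\<forall>x\<in>X. c x \<in> \<mm>"
    proof (rule ccontr)
      assume "\<not> (\<forall>x\<in>X. c x \<in> \<mm>)"
      then obtain x where x: "x \<in> X" "c x \<notin> \<mm>" by auto
      have xc: "x \<in> carrier R" "c x \<in> carrier R" using x Xc c(1) by auto
      have u: "c x \<in> Units R" by (rule units[OF xc(2) x(2)])
      let ?Y = "X - {x}"
      have Y: "finite ?Y" "?Y \<subseteq> carrier R" using X(1) Xc by auto
      have IY: "ideal (Idl ?Y) R" by (rule genideal_ideal[OF Y(2)])
      have S: "ideal (Idl ?Y <+> \<mm> \<cdot> I) R" by (rule add_ideals[OF IY mI])
      have r: "(\<Oplus>y\<in>?Y. c y \<otimes> y) \<in> Idl ?Y"
        by (rule finsum_in_ideal[OF IY Y(1)]) (use genideal_self[OF Y(2)] c(1) in \<open>auto intro!: idl_mult[OF IY]\<close>)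
      have "(\<Oplus>x\<in>insert x ?Y. c x \<otimes> x) = c x \<otimes> x \<oplus> (\<Oplus>y\<in>?Y. c y \<otimes> y)"
        by (rule finsum_insert) (use Y c(1) xc in auto)
      moreover have "insert x ?Y = X" using x by auto
      ultimately have e: "(\<Oplus>y\<in>?Y. c y \<otimes> y) \<oplus> c x \<otimes> x \<in> \<mm> \<cdot> I"
        using s xc idl_carr[OF IY r] by (simp add: a_comm)
      have "c x \<otimes> x \<in> Idl ?Y <+> \<mm> \<cdot> I"
        by (rule idl_add_cancel[OF S subsetD[OF sum_upper2[OF IY mI] e] subsetD[OF sum_upper1[OF IY mI] r]]) (use xc in simp)
      then have "inv (c x) \<otimes> (c x \<otimes> x) \<in> Idl ?Y <+> \<mm> \<cdot> I" by (rule idl_mult[OF S _ Units_inv_closed[OF u]])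
      moreover have "inv (c x) \<otimes> (c x \<otimes> x) = x"
        using xc Units_inv_closed[OF u] Units_l_inv[OF u] by (simp add: m_assoc[symmetric])
      ultimately have "x \<in> Idl ?Y <+> \<mm> \<cdot> I" by simp
      moreover have "?Y \<subseteq> Idl ?Y <+> \<mm> \<cdot> I" using genideal_self[OF Y(2)] sum_upper1[OF IY mI] by auto
      ultimately have "X \<subseteq> Idl ?Y <+> \<mm> \<cdot> I" by auto
      then have "I \<subseteq> Idl ?Y <+> \<mm> \<cdot> I" using genideal_minimal[OF S] X(4) by auto
      then have "I \<subseteq> Idl ?Y" by (rule nakayama[OF I IY])
      moreover have "Idl ?Y \<subseteq> I" by (rule genideal_minimal[OF I]) (use X(3) in auto)
      ultimately have "min_gens R (ideal_module R I) \<le> card ?Y" by (intro min_gens_le[OF I Y]) auto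
      moreover have "card ?Y < card X" by (rule psubset_card_mono[OF X(1)]) (use x in auto)
      ultimately show False using X(2) by simp
    qed
  qed (use X m_one idl_neg[OF m_ideal] mI I ideal_prod_subset2[OF m_ideal I] subm_ring_module_iff in auto)
  then show ?thesis unfolding X(2) subm_ring_module .
qed

lemma clen_ideals_adjoin_le:
  assumes "finite G" "ideal A R" "ideal (Idl G) R" "A \<subseteq> Idl G" "G \<subseteq> carrier R" "\<And>r g. r \<in> \<mm> \<Longrightarrow> g \<in> G \<Longrightarrow> r \<otimes> g \<in> A"
  shows "clen (\<lambda>J. ideal J R) A (Idl G) \<le> enat (card G)"
  unfolding subm_ring_module[symmetric]
  by (rule RM.clen_adjoin_le[where \<mm> = \<mm>])
    (use assms units m_carrier genideal_self[of G] genideal_minimal[of _ G] in \<open>auto simp: subm_ring_module_iff\<close>)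

lemma clen_square_le:
  assumes "finite G" "G \<subseteq> carrier R" "\<mm> = Idl G"
  shows "clen (\<lambda>J. ideal J R) (\<mm> \<cdot> \<mm>) \<mm> \<le> enat (card G)"
proof -
  have "clen (\<lambda>J. ideal J R) (\<mm> \<cdot> \<mm>) (Idl G) \<le> enat (card G)"
    by (rule clen_ideals_adjoin_le)
      (use assms m_ideal ideal_prod_is_ideal[OF m_ideal m_ideal] ideal_prod_subset1[OF m_ideal m_ideal] genideal_self[OF assms(2)]
        in \<open>auto intro!: ideal_prod.prod\<close>)
  then show ?thesis using assms(3) by simp
qed

abbreviation gen_rel_len :: "'a set \<Rightarrow> enat" where
  "gen_rel_len X \<equiv> rel_len R \<mm> (free_module R X) (ring_module R) (RM.fext (\<lambda>x. x))"

text \<open>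
  Induction from the top. Let \<open>J\<close> be maximal among the ideals that contain \<open>Idl X\<close> and lie
  strictly inside \<open>B\<close>. It contains \<open>\<mm> B\<close> by Nakayama's lemma, so \<open>B = J + (y)\<close> with \<open>\<mm> y \<subseteq> J\<close>.
  Adjoining the generator \<open>y\<close> costs at most the length of \<open>\<mm>/\<mm>\<^sup>2\<close>.
\<close>

lemma gen_rel_len_larger_ideal:
  assumes G: "finite G" "G \<subseteq> carrier R" "\<mm> = Idl G" and X: "finite X" "X \<subseteq> carrier R"
    and B: "ideal B R" "Idl X \<subseteq> B" "clen (\<lambda>J. ideal J R) (Idl X) B \<le> enat k"
  shows "\<exists>Y. finite Y \<and> Y \<subseteq> carrier R \<and> Idl Y = B \<and> gen_rel_len Y \<le> gen_rel_len X + enat (k * card G)"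
  using B
proof (induction k arbitrary: B)
  case (0 B)
  have IX: "ideal (Idl X) R" by (rule genideal_ideal[OF X(2)])
  have "Idl X = B"
  proof (rule ccontr)
    assume ne: "Idl X \<noteq> B"
    have "chain_in (\<lambda>J. ideal J R) (Idl X) B 1 (\<lambda>i. if i = 0 then Idl X else B)"
      unfolding chain_in_def using 0 IX ne by auto
    then have "enat 1 \<le> clen (\<lambda>J. ideal J R) (Idl X) B" by (rule clen_geI)
    then have "enat 1 \<le> enat 0" using 0(3) by (rule order_trans)
    then show False by simp
  qed
  then show ?case using X by (intro exI[of _ X]) simp
next
  case (Suc k B)
  have IX: "ideal (Idl X) R" by (rule genideal_ideal[OF X(2)])
  show ?case
  proof (cases "Idl X = B")
    case True
    then show ?thesis using X by (intro exI[of _ X]) simp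
  next
    case False
    define C where "C = {K. ideal K R \<and> Idl X \<subseteq> K \<and> K \<subset> B}"
    have "\<exists>J\<in>C. \<forall>K\<in>C. J \<subseteq> K \<longrightarrow> K = J"
      by (rule ex_maximal_ideal_in) (use False IX Suc.prems in \<open>auto simp: C_def\<close>)
    then obtain J where JC: "J \<in> C" and mx: "\<forall>K\<in>C. J \<subseteq> K \<longrightarrow> K = J" by (rule bexE)
    from JC have J: "ideal J R" "Idl X \<subseteq> J" "J \<subset> B" unfolding C_def by auto
    have max: "K = J" if "ideal K R" "J \<subseteq> K" "K \<subset> B" for K
    proof -
      have "K \<in> C" unfolding C_def using that J(2) by auto
      then show ?thesis using bspec[OF mx] that(2) by simp
    qed
    have mB: "ideal (\<mm> \<cdot> B) R" by (rule ideal_prod_is_ideal[OF m_ideal Suc.prems(1)])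
    have JmB: "\<mm> \<cdot> B \<subseteq> J"
    proof -
      have i: "ideal (J <+> \<mm> \<cdot> B) R" by (rule add_ideals[OF J(1) mB])
      have s: "J <+> \<mm> \<cdot> B \<subseteq> B"
        by (rule sum_least[OF Suc.prems(1)]) (use J(3) ideal_prod_subset2[OF m_ideal Suc.prems(1)] in auto)
      have "J <+> \<mm> \<cdot> B \<noteq> B"
      proof
        assume "J <+> \<mm> \<cdot> B = B"
        then have "B \<subseteq> J" by (intro nakayama[OF Suc.prems(1) J(1)]) simp
        then show False using J(3) by auto
      qed
      then have "J <+> \<mm> \<cdot> B = J" by (intro max[OF i sum_upper1[OF J(1) mB]]) (use s in auto)
      then show ?thesis using sum_upper2[OF J(1) mB] by simp
    qed
    obtain y where y: "y \<in> B" "y \<notin> J" using J(3) by auto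
    have yc: "y \<in> carrier R" by (rule idl_carr[OF Suc.prems(1) y(1)])
    have Py: "ideal (PIdl y) R" by (rule cgenideal_ideal[OF yc])
    have full: "PIdl y <+> J = B"
    proof (rule ccontr)
      assume ne: "PIdl y <+> J \<noteq> B"
      have "PIdl y <+> J \<subseteq> B"
        by (rule sum_least[OF Suc.prems(1)]) (use J(3) cgenideal_minimal[OF Suc.prems(1) y(1)] in auto)
      then have "PIdl y <+> J = J"
        by (intro max[OF add_ideals[OF Py J(1)] sum_upper2[OF Py J(1)]]) (use ne in auto)
      then show False using sum_upper1[OF Py J(1)] cgenideal_self[OF yc] y(2) by auto
    qed
    have "chain_in (\<lambda>J. ideal J R) J B 1 (\<lambda>i. if i = 0 then J else B)"
      unfolding chain_in_def using J Suc.prems(1) by auto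
    then have "enat 1 \<le> clen (\<lambda>J. ideal J R) J B" by (rule clen_geI)
    then have "clen (\<lambda>J. ideal J R) (Idl X) J + enat 1 \<le> clen (\<lambda>J. ideal J R) (Idl X) J + clen (\<lambda>J. ideal J R) J B"
      by (rule add_left_mono)
    also have "\<dots> \<le> clen (\<lambda>J. ideal J R) (Idl X) B" by (rule clen_superadd) (use IX J Suc.prems in auto)
    also have "\<dots> \<le> enat (Suc k)" by (rule Suc.prems(3))
    finally have "clen (\<lambda>J. ideal J R) (Idl X) J \<le> enat k"
      by (cases "clen (\<lambda>J. ideal J R) (Idl X) J") auto
    then obtain Y where Y: "finite Y" "Y \<subseteq> carrier R" "Idl Y = J"
      and len: "gen_rel_len Y \<le> gen_rel_len X + enat (k * card G)"
      using Suc.IH[OF J(1,2)] by blast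
    have yY: "y \<notin> Y" using genideal_self[OF Y(2)] Y(3) y(2) by auto
    have "gen_rel_len (insert y Y) \<le> gen_rel_len Y + clen (\<lambda>J. ideal J R) (\<mm> \<cdot> \<mm>) \<mm>"
    proof (rule RM.rel_len_insert_le[OF m_ideal _ yY])
      show "(\<lambda>x. x) \<in> insert y Y \<rightarrow> carrier (ring_module R)" using Y(2) yc by auto
      fix r assume "r \<in> \<mm>"
      then have "r \<otimes> y \<in> J" using JmB y(1) by (auto intro: ideal_prod.prod)
      then show "r \<odot>\<^bsub>ring_module R\<^esub> y \<in> RM.fext (\<lambda>x. x) ` carrier (free_module R Y)"
        using fext_image_Idl[OF Y(1), of "\<lambda>x. x"] Y(2,3) by auto
    qed
    also have "\<dots> \<le> (gen_rel_len X + enat (k * card G)) + enat (card G)"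
      by (rule add_mono[OF len clen_square_le[OF G]])
    also have "\<dots> = gen_rel_len X + enat (Suc k * card G)" by (simp add: add.assoc add.commute)
    finally show ?thesis
      using Y(1,2) yc full Idl_insert[OF Y(2) yc] Y(3) by (intro exI[of _ "insert y Y"]) simp
  qed
qed

lemma clen_le_colength:
  assumes J: "ideal J R"
  shows "clen (\<lambda>J. ideal J R) J (carrier R) \<le> colength R J"
proof (rule clen_leI)
  fix l N assume N: "chain_in (\<lambda>J. ideal J R) J (carrier R) l N"
  have Jm: "subm R (ring_module R) J" using J subm_ring_module_iff by simp
  let ?Q = "quot_module R (ring_module R) J"
  let ?p = "\<lambda>x. J +>\<^bsub>ring_module R\<^esub> x"
  interpret p: mod_hom R "ring_module R" ?Q ?p
    by (rule mod_homI[OF RM.module_axioms RM.quot_module_module[OF Jm] RM.quot_proj_hom[OF Jm]])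
  have sub: "\<forall>i\<le>l. subm R ?Q (?p ` N i)"
    using N unfolding chain_in_def by (auto intro!: p.subm_image simp: subm_ring_module_iff)
  have "\<forall>i<l. ?p ` N i \<subset> ?p ` N (Suc i)"
  proof (intro allI impI psubsetI)
    fix i assume i: "i < l"
    have c: "ideal (N i) R" "ideal (N (Suc i)) R" "J \<subseteq> N i" "N i \<subset> N (Suc i)" using N i unfolding chain_in_def by auto
    show "?p ` N i \<subseteq> ?p ` N (Suc i)" using c(4) by auto
    obtain v where v: "v \<in> N (Suc i)" "v \<notin> N i" using c(4) by auto
    have vc: "v \<in> carrier (ring_module R)" using idl_carr[OF c(2) v(1)] by simp
    show "?p ` N i \<noteq> ?p ` N (Suc i)"
    proof
      assume "?p ` N i = ?p ` N (Suc i)"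
      then obtain w where w: "w \<in> N i" "?p v = ?p w" using v(1) by (metis imageE imageI)
      have wc: "w \<in> carrier (ring_module R)" using idl_carr[OF c(1) w(1)] by simp
      have "v \<ominus>\<^bsub>ring_module R\<^esub> w \<in> N i" using iffD1[OF RM.coset_eq_iff[OF Jm vc wc] w(2)] c(3) by auto
      then have "v \<in> N i" by (rule RM.subm_minus_cancel[OF iffD2[OF subm_ring_module_iff c(1)] _ w(1) vc])
      then show False using v(2) by simp
    qed
  qed
  with sub show "enat l \<le> module_length R ?Q" unfolding module_length_def
    by (intro Sup_upper CollectI exI[of _ l] conjI refl) (rule exI[of _ "\<lambda>i. ?p ` N i"], simp)
qed

text \<open>The layer of degree \<open>t\<close> contributes the number of monomials of degree \<open>t\<close>.\<close>

lemma clen_powers_ge: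
  assumes mv: "\<And>t A. A \<in> Mon n t \<Longrightarrow> t < s \<Longrightarrow> v A \<in> ipow \<mm> t"
    and indep: "\<And>t c A. t < s \<Longrightarrow> c \<in> Mon n t \<rightarrow> carrier R \<Longrightarrow> (\<Oplus>A\<in>Mon n t. c A \<otimes> v A) \<in> ipow \<mm> (Suc t) \<Longrightarrow>
      A \<in> Mon n t \<Longrightarrow> c A \<in> \<mm>"
  shows "enat (\<Sum>t<s. card (Mon n t)) \<le> clen (\<lambda>J. ideal J R) (ipow \<mm> s) (carrier R)"
  using assms
proof (induction s)
  case 0 show ?case by (simp add: enat_0)
next
  case (Suc s)
  have IH: "enat (\<Sum>t<s. card (Mon n t)) \<le> clen (\<lambda>J. ideal J R) (ipow \<mm> s) (carrier R)"
    by (rule Suc.IH) (use Suc.prems(1) Suc.prems(2) less_SucI in blast)+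
  have ids: "ideal (ipow \<mm> (Suc s)) R" "ideal (ipow \<mm> s) R" by (rule ipow_ideal[OF m_ideal])+
  have step: "ipow \<mm> (Suc s) \<subseteq> ipow \<mm> s" by (rule ipow_antimono[OF m_ideal]) simp
  have "enat (card (Mon n s)) \<le> clen (subm R (ring_module R)) (ipow \<mm> (Suc s)) (ipow \<mm> s)"
  proof (rule RM.clen_ge_card_independent[where \<mm> = \<mm> and v = v])
    fix c assume c: "c \<in> Mon n s \<rightarrow> carrier R"
      "(\<Oplus>\<^bsub>ring_module R\<^esub>A\<in>Mon n s. c A \<odot>\<^bsub>ring_module R\<^esub> v A) \<in> ipow \<mm> (Suc s)"
    then have "(\<Oplus>A\<in>Mon n s. c A \<otimes> v A) \<in> ipow \<mm> (Suc s)" by simp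
    then show "\<forall>A\<in>Mon n s. c A \<in> \<mm>" using Suc.prems(2)[OF lessI c(1)] by blast
  qed (use finite_Mon m_one idl_neg[OF m_ideal] ids step Suc.prems(1) subm_ring_module_iff in auto)
  then have "enat (card (Mon n s)) + enat (\<Sum>t<s. card (Mon n t)) \<le>
      clen (\<lambda>J. ideal J R) (ipow \<mm> (Suc s)) (ipow \<mm> s) + clen (\<lambda>J. ideal J R) (ipow \<mm> s) (carrier R)"
    unfolding subm_ring_module using IH by (rule add_mono)
  also have "\<dots> \<le> clen (\<lambda>J. ideal J R) (ipow \<mm> (Suc s)) (carrier R)"
    by (rule clen_superadd) (use ids step idl_subset in auto)
  finally show ?case by (simp add: add.commute)
qed

text \<open>
  The powers of \<open>\<mm>\<close> descend strictly: by Nakayama's lemma they could only stop at zero, which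
  they never reach in a domain.
\<close>

lemma clen_zero_ge:
  assumes dom: "domain R" and nz: "\<mm> \<noteq> {\<zero>}"
  shows "enat k \<le> clen (\<lambda>J. ideal J R) {\<zero>} (carrier R)"
proof -
  interpret D: domain R by (rule dom)
  obtain a where a: "a \<in> \<mm>" "a \<noteq> \<zero>" using nz idl_zero[OF m_ideal] by blast
  have ac: "a \<in> carrier R" using a m_carrier by auto
  have "enat k \<le> clen (\<lambda>J. ideal J R) (ipow \<mm> k) (carrier R)"
  proof (induction k)
    case 0 show ?case by (simp add: enat_0)
  next
    case (Suc k)
    have ids: "ideal (ipow \<mm> (Suc k)) R" "ideal (ipow \<mm> k) R" by (rule ipow_ideal[OF m_ideal])+
    have step: "ipow \<mm> (Suc k) \<subseteq> ipow \<mm> k" by (rule ipow_antimono[OF m_ideal]) simp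
    have "ipow \<mm> (Suc k) \<noteq> ipow \<mm> k"
    proof
      assume eq: "ipow \<mm> (Suc k) = ipow \<mm> k"
      have mk: "ideal (\<mm> \<cdot> ipow \<mm> k) R" by (rule ideal_prod_is_ideal[OF m_ideal ids(2)])
      have "ipow \<mm> k \<subseteq> {\<zero>} <+> \<mm> \<cdot> ipow \<mm> k"
        using sum_upper2[OF zeroideal mk] eq ipow_Suc2[OF m_ideal, of k] by simp
      then have "ipow \<mm> k \<subseteq> {\<zero>}" by (rule nakayama[OF ids(2) zeroideal])
      then have "a [^] k = \<zero>" using pow_in_ipow[OF m_ideal a(1)] by auto
      moreover have "a [^] j \<noteq> \<zero>" for j :: nat
        by (induction j) (use a ac D.integral in \<open>auto simp: nat_pow_closed\<close>)
      ultimately show False by blast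
    qed
    then have "chain_in (\<lambda>J. ideal J R) (ipow \<mm> (Suc k)) (ipow \<mm> k) 1 (\<lambda>i. if i = 0 then ipow \<mm> (Suc k) else ipow \<mm> k)"
      unfolding chain_in_def using ids step by auto
    then have "enat 1 + enat k \<le> clen (\<lambda>J. ideal J R) (ipow \<mm> (Suc k)) (ipow \<mm> k) + clen (\<lambda>J. ideal J R) (ipow \<mm> k) (carrier R)"
      by (rule add_mono[OF clen_geI Suc.IH])
    also have "\<dots> \<le> clen (\<lambda>J. ideal J R) (ipow \<mm> (Suc k)) (carrier R)"
      by (rule clen_superadd) (use ids step idl_subset in auto)
    finally show ?case by simp
  qed
  also have "\<dots> \<le> clen (\<lambda>J. ideal J R) {\<zero>} (carrier R)"
    by (rule clen_mono) (use idl_zero[OF ipow_ideal[OF m_ideal]] in auto)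
  finally show ?thesis .
qed

end

section \<open>Relations among the monomials of a regular system of parameters\<close>

text \<open>
  Refine the interval by the sum of \<open>A\<close> and the part of \<open>C\<close> in the kernel. Below it, add \<open>A\<close> to
  a submodule of the kernel; above it, take preimages.
\<close>

lemma (in mod_hom) clen_ge_kernel_image:
  assumes A: "subm R M A" and C: "subm R M C" and AC: "A \<subseteq> C"
  shows "clen (subm R M) (A \<inter> hker) (C \<inter> hker) + clen (subm R N) (f ` A) (f ` C) \<le> clen (subm R M) A C"
proof -
  have Ck: "subm R M (C \<inter> hker)" by (rule M.subm_inter[OF C hker_subm])
  let ?B = "A <+>\<^bsub>M\<^esub> (C \<inter> hker)"
  have B: "subm R M ?B" by (rule M.set_add_subm[OF A Ck])
  have AB: "A \<subseteq> ?B" by (rule M.set_add_upper1[OF A Ck])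
  have BC: "?B \<subseteq> C" by (rule M.set_add_least[OF C AC]) simp
  have 1: "clen (subm R M) (A \<inter> hker) (C \<inter> hker) \<le> clen (subm R M) A ?B"
  proof (rule clen_map_le[where \<Phi> = "\<lambda>V. A <+>\<^bsub>M\<^esub> V"])
    fix V assume V: "subm R M V" "V \<subseteq> C \<inter> hker"
    have "A <+>\<^bsub>M\<^esub> V \<subseteq> ?B" using V(2) M.set_add_upper2[OF A Ck] by (intro M.set_add_least[OF B AB]) auto
    then show "subm R M (A <+>\<^bsub>M\<^esub> V) \<and> A \<subseteq> A <+>\<^bsub>M\<^esub> V \<and> A <+>\<^bsub>M\<^esub> V \<subseteq> ?B"
      using M.set_add_subm[OF A V(1)] M.set_add_upper1[OF A V(1)] by simp
  next
    fix V W assume V: "subm R M V" and W: "subm R M W" and AV: "A \<inter> hker \<subseteq> V" and VW: "V \<subset> W" and WC: "W \<subseteq> C \<inter> hker"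
    obtain w where w: "w \<in> W" "w \<notin> V" using VW by auto
    have wc: "w \<in> carrier M" by (rule M.subm_carrier[OF W w(1)])
    have "w \<in> A <+>\<^bsub>M\<^esub> W" using w(1) M.set_add_upper2[OF A W] by auto
    moreover have "w \<notin> A <+>\<^bsub>M\<^esub> V"
    proof
      assume "w \<in> A <+>\<^bsub>M\<^esub> V"
      then obtain a v where a: "a \<in> A" and v: "v \<in> V" and e: "w = a \<oplus>\<^bsub>M\<^esub> v" by (rule M.set_addE)
      have ac: "a \<in> carrier M" and vc: "v \<in> carrier M" using M.subm_carrier[OF A a] M.subm_carrier[OF V v] by auto
      have "f w = \<zero>\<^bsub>N\<^esub>" "f v = \<zero>\<^bsub>N\<^esub>" using w(1) v VW WC unfolding hker_def by auto
      then have "f a = \<zero>\<^bsub>N\<^esub>" using f_add[OF ac vc] e f_im[OF ac] by simp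
      then have "a \<in> V" using AV a ac unfolding hker_def by auto
      then show False using M.subm_add[OF V _ v] e w(2) by simp
    qed
    moreover have "A <+>\<^bsub>M\<^esub> V \<subseteq> A <+>\<^bsub>M\<^esub> W"
      using VW M.set_add_upper1[OF A W] M.set_add_upper2[OF A W] by (intro M.set_add_least[OF M.set_add_subm[OF A W]]) auto
    ultimately show "A <+>\<^bsub>M\<^esub> V \<subset> A <+>\<^bsub>M\<^esub> W" by auto
  qed
  have 2: "clen (subm R N) (f ` A) (f ` C) \<le> clen (subm R M) ?B C"
  proof (rule clen_map_le[where \<Phi> = "\<lambda>V. C \<inter> {x \<in> carrier M. f x \<in> V}"])
    fix V assume V: "subm R N V" "f ` A \<subseteq> V" "V \<subseteq> f ` C"
    have D: "subm R M (C \<inter> {x \<in> carrier M. f x \<in> V})" by (rule M.subm_inter[OF C subm_vimage[OF V(1)]])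
    have "?B \<subseteq> C \<inter> {x \<in> carrier M. f x \<in> V}"
      by (rule M.set_add_least[OF D])
        (use V(2) AC M.subm_subset[OF A] N.subm_zero[OF V(1)] in \<open>auto simp: hker_def\<close>)
    then show "subm R M (C \<inter> {x \<in> carrier M. f x \<in> V}) \<and> ?B \<subseteq> C \<inter> {x \<in> carrier M. f x \<in> V} \<and>
      C \<inter> {x \<in> carrier M. f x \<in> V} \<subseteq> C" using D by auto
  next
    fix V W assume VW: "V \<subset> W" and W: "W \<subseteq> f ` C"
    obtain w where "w \<in> W" "w \<notin> V" using VW by auto
    then obtain c where "c \<in> C" "f c \<in> W" "f c \<notin> V" using W by auto
    then show "C \<inter> {x \<in> carrier M. f x \<in> V} \<subset> C \<inter> {x \<in> carrier M. f x \<in> W}"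
      using VW M.subm_subset[OF C] by auto
  qed
  have "clen (subm R M) (A \<inter> hker) (C \<inter> hker) + clen (subm R N) (f ` A) (f ` C) \<le>
      clen (subm R M) A ?B + clen (subm R M) ?B C" by (rule add_mono[OF 1 2])
  also have "\<dots> \<le> clen (subm R M) A C" by (rule clen_superadd[OF A AB B BC])
  finally show ?thesis .
qed

context cring begin

lemma coord_hom: "(\<lambda>g. g x) \<in> module_hom R (free_module R X) (ring_module R)"
  by (rule module_homI) (auto simp: free_value)

lemma coord_minus:
  assumes "g \<in> carrier (free_module R X)" "h \<in> carrier (free_module R X)"
  shows "(g \<ominus>\<^bsub>free_module R X\<^esub> h) x = g x \<ominus> h x"
proof -
  interpret q: mod_hom R "free_module R X" "ring_module R" "\<lambda>g. g x"
    by (rule mod_homI[OF free_module_module ring_module_module coord_hom])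
  show ?thesis using q.f_minus[OF assms] by simp
qed

lemma coord_finsum:
  assumes "finite Y" "v \<in> Y \<rightarrow> carrier (free_module R X)"
  shows "(\<Oplus>\<^bsub>free_module R X\<^esub>y\<in>Y. v y) x = (\<Oplus>y\<in>Y. v y x)"
  using assms
proof (induction Y rule: finite_induct)
  case empty
  interpret F: module R "free_module R X" by (rule free_module_module)
  have "(\<Oplus>\<^bsub>free_module R X\<^esub>y\<in>{}. v y) = \<zero>\<^bsub>free_module R X\<^esub>" by (rule F.M.finsum_empty)
  then show ?case by simp
next
  case (insert y Y)
  interpret F: module R "free_module R X" by (rule free_module_module)
  have 1: "(\<Oplus>\<^bsub>free_module R X\<^esub>y\<in>insert y Y. v y) = v y \<oplus>\<^bsub>free_module R X\<^esub> (\<Oplus>\<^bsub>free_module R X\<^esub>y\<in>Y. v y)"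
    by (rule F.M.finsum_insert[OF insert.hyps]) (use insert.prems in auto)
  have vc: "v i x \<in> carrier R" if "i \<in> insert y Y" for i
    by (rule free_value[where X = X]) (use that insert.prems in auto)
  have 2: "(\<Oplus>y\<in>insert y Y. v y x) = v y x \<oplus> (\<Oplus>y\<in>Y. v y x)"
    by (rule finsum_insert[OF insert.hyps]) (use vc in auto)
  show ?case unfolding 1 2 using insert.IH insert.prems by simp
qed

end

locale regular_system = noetherian_local R \<mm> + regular_parameters R x n
  for R (structure) and \<mm> :: "'a set" and x :: "nat \<Rightarrow> 'a" and n :: nat +
  assumes m_gen: "\<mm> = Idl (x ` {..<n})"
begin

abbreviation "W s \<equiv> free_module R (Mon n s)"
abbreviation "ev \<equiv> RM.fext (mval x)"

lemma mval_Mon_closed: "A \<in> Mon n s \<Longrightarrow> mval x A \<in> carrier R"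
  by (rule mval_c) auto

lemma W_module: "module R (W s)" by (rule free_module_module)

lemma ev_hom: "ev \<in> module_hom R (W s) (ring_module R)"
  by (rule RM.fext_hom) (simp add: mval_Mon_closed)

lemma ev_eq: "g \<in> carrier (W s) \<Longrightarrow> ev g = (\<Oplus>A\<in>Mon n s. g A \<otimes> mval x A)"
  using RM.fext_superset[of "mval x" "Mon n s" g "Mon n s"] mval_Mon_closed finite_Mon free_support[of g "Mon n s"] by auto

lemma ev_image: "ev ` carrier (W s) = ipow \<mm> s"
  using fext_image_Idl[OF finite_Mon[of n s], of "mval x"]
    lin_carrier_eq_Idl[OF finite_Mon[of n s], of "mval x"] mval_Mon_closed ipow_eq_Np[of s]
  unfolding m_gen by simp

lemma coeffs_in_m:
  assumes g: "g \<in> carrier (W s)" and e: "ev g \<in> ipow \<mm> (Suc s)"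
  shows "g A \<in> \<mm>"
proof (cases "A \<in> Mon n s")
  case True
  have "(\<Oplus>A\<in>Mon n s. g A \<otimes> mval x A) \<in> ipow (N n) (Suc s)" using e unfolding ev_eq[OF g] m_gen .
  then show ?thesis unfolding m_gen by (intro quasi_regular[OF _ _ True]) (auto simp: free_value[OF g])
next
  case False
  then show ?thesis using free_outside[OF g] idl_zero[OF m_ideal] by simp
qed

lemma card_linear_Mon: "card (Mon n (Suc 0)) = n"
  by (cases n) (simp_all add: card_Mon Mon_0_Suc)

text \<open>
  The products of a linear monomial and a basis vector are independent modulo \<open>\<mm>\<^sup>2\<close>: look at one
  coordinate and apply quasi-regularity in degree one.
\<close>

lemma clen_free_cotangent:
  "enat (n * card (Mon n s)) \<le> clen (subm R (W s)) (iprod (W s) (\<mm> \<cdot> \<mm>) (carrier (W s))) (iprod (W s) \<mm> (carrier (W s)))"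
proof -
  interpret W: module R "W s" by (rule W_module)
  let ?X = "Mon n (Suc 0) \<times> Mon n s" and ?v = "\<lambda>(U, A). mval x U \<odot>\<^bsub>W s\<^esub> free_gen R A"
  have mm: "ideal (\<mm> \<cdot> \<mm>) R" by (rule ideal_prod_is_ideal[OF m_ideal m_ideal])
  have mv: "mval x U \<in> \<mm>" if "U \<in> Mon n (Suc 0)" for U
  proof -
    have "mval x U \<in> Idl (mval x ` Mon n (Suc 0))" using genideal_self[of "mval x ` Mon n (Suc 0)"] that mval_Mon_closed by blast
    also have "\<dots> = ipow \<mm> (Suc 0)"
      using fext_image_Idl[OF finite_Mon[of n "Suc 0"], of "mval x"] mval_Mon_closed ev_image by simp
    finally show ?thesis using ipow_1[OF m_ideal] by simp
  qed
  have "enat (card ?X) \<le> clen (subm R (W s)) (iprod (W s) (\<mm> \<cdot> \<mm>) (carrier (W s))) (iprod (W s) \<mm> (carrier (W s)))"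
  proof (rule W.clen_ge_card_independent[where \<mm> = \<mm> and v = ?v])
    show "iprod (W s) (\<mm> \<cdot> \<mm>) (carrier (W s)) \<subseteq> iprod (W s) \<mm> (carrier (W s))"
      by (rule iprod_mono[OF ideal_prod_subset1[OF m_ideal m_ideal] order_refl])
    show "?v u \<in> iprod (W s) \<mm> (carrier (W s))" if "u \<in> ?X" for u
    proof -
      from that obtain U A where u: "u = (U, A)" "U \<in> Mon n (Suc 0)" "A \<in> Mon n s" by (rule SigmaE)
      show ?thesis unfolding u(1) prod.case by (rule iprod.prod[OF mv[OF u(2)] free_gen_closed[OF u(3)]])
    qed
    fix c assume c: "c \<in> ?X \<rightarrow> carrier R"
      and s: "(\<Oplus>\<^bsub>W s\<^esub>u\<in>?X. c u \<odot>\<^bsub>W s\<^esub> ?v u) \<in> iprod (W s) (\<mm> \<cdot> \<mm>) (carrier (W s))"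
    show "\<forall>u\<in>?X. c u \<in> \<mm>"
    proof
      fix u assume "u \<in> ?X"
      then obtain U B where u: "u = (U, B)" "U \<in> Mon n (Suc 0)" "B \<in> Mon n s" by (rule SigmaE)
      have fin: "finite ?X" using finite_Mon by auto
      have vc: "(\<lambda>u. c u \<odot>\<^bsub>W s\<^esub> ?v u) \<in> ?X \<rightarrow> carrier (W s)"
      proof
        fix w assume w: "w \<in> ?X"
        then obtain U A where A: "w = (U, A)" "U \<in> Mon n (Suc 0)" "A \<in> Mon n s" by (rule SigmaE)
        show "c w \<odot>\<^bsub>W s\<^esub> ?v w \<in> carrier (W s)" unfolding A(1) prod.case
          by (intro W.smult_closed free_gen_closed[OF A(3)] mval_Mon_closed[OF A(2)] funcset_mem[OF c] w[unfolded A(1)])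
      qed
      have cc: "c (U, A) \<in> carrier R" if "U \<in> Mon n (Suc 0)" "A \<in> Mon n s" for U A
        by (rule funcset_mem[OF c]) (use that in simp)
      have vB: "(c w \<odot>\<^bsub>W s\<^esub> ?v w) B \<in> carrier R" if "w \<in> ?X" for w
        by (rule free_value[OF funcset_mem[OF vc that]])
      have "(\<Oplus>\<^bsub>W s\<^esub>u\<in>?X. c u \<odot>\<^bsub>W s\<^esub> ?v u) B \<in> \<mm> \<cdot> \<mm>" using s unfolding free_iprod_iff[OF mm] by blast
      also have "(\<Oplus>\<^bsub>W s\<^esub>u\<in>?X. c u \<odot>\<^bsub>W s\<^esub> ?v u) B = (\<Oplus>u\<in>?X. (c u \<odot>\<^bsub>W s\<^esub> ?v u) B)" by (rule coord_finsum[OF fin vc])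
      also have "\<dots> = (\<Oplus>u\<in>(\<lambda>U. (U, B)) ` Mon n (Suc 0). (c u \<odot>\<^bsub>W s\<^esub> ?v u) B)"
      proof (rule add.finprod_mono_neutral_cong_right[folded finsum_def, OF fin])
        show "(c u \<odot>\<^bsub>W s\<^esub> ?v u) B = \<zero>" if "u \<in> ?X - (\<lambda>U. (U, B)) ` Mon n (Suc 0)" for u
          using that cc mval_Mon_closed by (auto simp: free_gen_def)
        show "(\<lambda>u. (c u \<odot>\<^bsub>W s\<^esub> ?v u) B) \<in> ?X \<rightarrow> carrier R" using vB by (intro funcsetI)
      qed (use u in auto)
      also have "\<dots> = (\<Oplus>U\<in>Mon n (Suc 0). (c (U, B) \<odot>\<^bsub>W s\<^esub> ?v (U, B)) B)"
        by (rule add.finprod_reindex[folded finsum_def]) (use vB u in \<open>auto simp del: free_module_simps simp: inj_on_def\<close>)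
      also have "\<dots> = (\<Oplus>U\<in>Mon n (Suc 0). c (U, B) \<otimes> mval x U)"
        by (rule finsum_cong') (use cc u mval_Mon_closed in \<open>auto simp: free_gen_def\<close>)
      finally have "(\<Oplus>U\<in>Mon n (Suc 0). c (U, B) \<otimes> mval x U) \<in> ipow (N n) (Suc (Suc 0))"
        unfolding m_gen[symmetric] ipow_Suc[of _ "Suc 0"] ipow_1[OF m_ideal] .
      from quasi_regular[OF _ this u(2)] show "c u \<in> \<mm>" unfolding m_gen u(1) using c u by auto
    qed
  qed (use finite_Mon m_one idl_neg[OF m_ideal] W.iprod_subm[OF _ W.carrier_is_submodule] mm m_ideal in auto)
  then show ?thesis by (simp add: card_linear_Mon card_cartesian_product)
qed

text \<open>
  Modulo \<open>I\<close> these are the relations among the monomials of degree \<open>s\<close>, and \<open>rel_lifts_bot\<close>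
  becomes \<open>\<mm>\<close> times the module of relations.
\<close>

definition rel_lifts :: "'a set \<Rightarrow> nat \<Rightarrow> (nat multiset \<Rightarrow> 'a) set" where
  "rel_lifts I s = {g \<in> carrier (W s). ev g \<in> I}"

definition rel_lifts_bot :: "'a set \<Rightarrow> nat \<Rightarrow> (nat multiset \<Rightarrow> 'a) set" where
  "rel_lifts_bot I s = iprod (W s) \<mm> (rel_lifts I s) <+>\<^bsub>W s\<^esub> iprod (W s) I (carrier (W s))"

text \<open>
  Evaluation maps \<open>rel_lifts\<close> onto \<open>I\<close> and \<open>rel_lifts_bot\<close> into \<open>\<mm> I\<close>, which accounts for
  \<open>\<mu>(I)\<close>. It remains to bound the length within the kernel of evaluation. By quasi-regularity
  \<open>\<mm>W\<close> contains the kernel, and \<open>\<mm>\<^sup>2W\<close> contains \<open>rel_lifts_bot\<close>. The interval from \<open>\<mm>\<^sup>2W\<close> to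
  \<open>\<mm>W\<close> has length at least \<open>n\<close> times the number of monomials of degree \<open>s\<close>, and evaluation maps
  it to \<open>\<mm>\<^sup>s\<^sup>+\<^sup>1/\<mm>\<^sup>s\<^sup>+\<^sup>2\<close>, whose length is at most the number of monomials of degree \<open>s + 1\<close>;
  the rest lies in the kernel.
\<close>

lemma monomial_relations_clen:
  assumes I: "ideal I R" "I \<subseteq> ipow \<mm> (Suc s)" and s: "s \<ge> 1"
  shows "enat (n * card (Mon n s)) + enat (min_gens R (ideal_module R I)) \<le>
    clen (subm R (W s)) (rel_lifts_bot I s) (rel_lifts I s) + enat (card (Mon n (Suc s)))"
proof -
  interpret W: module R "W s" by (rule W_module)
  interpret e: mod_hom R "W s" "ring_module R" ev by (rule mod_homI[OF W_module RM.module_axioms ev_hom])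
  let ?mW = "iprod (W s) \<mm> (carrier (W s))" and ?mmW = "iprod (W s) (\<mm> \<cdot> \<mm>) (carrier (W s))"
  have mm: "ideal (\<mm> \<cdot> \<mm>) R" by (rule ideal_prod_is_ideal[OF m_ideal m_ideal])
  have pw: "ideal (ipow \<mm> k) R" for k by (rule ipow_ideal[OF m_ideal])
  have K: "subm R (W s) (rel_lifts I s)" unfolding rel_lifts_def by (rule e.subm_vimage) (simp add: subm_ring_module_iff I)
  have KW: "rel_lifts I s \<subseteq> carrier (W s)" by (rule W.subm_subset[OF K])
  have cK: "g A \<in> \<mm>" if "g \<in> rel_lifts I s" for g A
    using that I(2) by (intro coeffs_in_m[of g s]) (auto simp: rel_lifts_def)
  have mK: "subm R (W s) (iprod (W s) \<mm> (rel_lifts I s))" by (rule W.iprod_subm[OF m_ideal K])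
  have IW: "subm R (W s) (iprod (W s) I (carrier (W s)))" by (rule W.iprod_subm[OF I(1) W.carrier_is_submodule])
  have B: "subm R (W s) (rel_lifts_bot I s)" unfolding rel_lifts_bot_def by (rule W.set_add_subm[OF mK IW])
  have mW: "subm R (W s) ?mW" by (rule W.iprod_subm[OF m_ideal W.carrier_is_submodule])
  have mmW: "subm R (W s) ?mmW" by (rule W.iprod_subm[OF mm W.carrier_is_submodule])
  have evW: "ev g \<in> ipow \<mm> s" if "g \<in> carrier (W s)" for g using ev_image that by blast
  have evc: "ev g \<in> carrier R" if "g \<in> carrier (W s)" for g using idl_carr[OF pw evW[OF that]] .
  have I2: "I \<subseteq> \<mm> \<cdot> \<mm>"
  proof -
    have "ipow \<mm> (Suc s) \<subseteq> ipow \<mm> (Suc (Suc 0))" by (rule ipow_antimono[OF m_ideal]) (use s in simp)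
    then show ?thesis using I(2) ipow_Suc[of \<mm> "Suc 0"] ipow_1[OF m_ideal] by simp
  qed
  have evm: "ev g \<in> \<mm>" if "g \<in> carrier (W s)" for g
    using evW[OF that] ipow_antimono[OF m_ideal, of "Suc 0" s] s ipow_1[OF m_ideal] by auto
  have BK: "rel_lifts_bot I s \<subseteq> rel_lifts I s" unfolding rel_lifts_bot_def
  proof (rule W.set_add_least[OF K])
    show "iprod (W s) \<mm> (rel_lifts I s) \<subseteq> rel_lifts I s" by (rule W.iprod_subset[OF m_carrier K])
    show "iprod (W s) I (carrier (W s)) \<subseteq> rel_lifts I s"
    proof (rule W.iprod_least[OF K])
      fix i g assume i: "i \<in> I" and g: "g \<in> carrier (W s)"
      have ic: "i \<in> carrier R" by (rule idl_carr[OF I(1) i])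
      have "ev (i \<odot>\<^bsub>W s\<^esub> g) = i \<otimes> ev g" using e.f_smult[OF ic g] by simp
      also have "\<dots> \<in> I" by (rule idl_mult_r[OF I(1) i evc[OF g]])
      finally show "i \<odot>\<^bsub>W s\<^esub> g \<in> rel_lifts I s" unfolding rel_lifts_def using W.smult_closed[OF ic g] by simp
    qed
  qed
  have Bm: "rel_lifts_bot I s \<subseteq> ?mmW" unfolding rel_lifts_bot_def
  proof (rule W.set_add_least[OF mmW])
    show "iprod (W s) \<mm> (rel_lifts I s) \<subseteq> ?mmW"
    proof (rule W.iprod_least[OF mmW])
      fix i g assume i: "i \<in> \<mm>" and g: "g \<in> rel_lifts I s"
      have ic: "i \<in> carrier R" by (rule idl_carr[OF m_ideal i])
      show "i \<odot>\<^bsub>W s\<^esub> g \<in> ?mmW" unfolding free_iprod_iff[OF mm]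
        using W.smult_closed[OF ic subsetD[OF KW g]] cK[OF g] i by (auto intro: ideal_prod.prod)
    qed
    show "iprod (W s) I (carrier (W s)) \<subseteq> ?mmW" by (rule iprod_mono[OF I2 order_refl])
  qed
  have eB: "ev ` rel_lifts_bot I s \<subseteq> \<mm> \<cdot> I"
  proof -
    have mI: "ideal (\<mm> \<cdot> I) R" by (rule ideal_prod_is_ideal[OF m_ideal I(1)])
    have V: "subm R (W s) {g \<in> carrier (W s). ev g \<in> \<mm> \<cdot> I}" by (rule e.subm_vimage) (simp add: subm_ring_module_iff mI)
    have "rel_lifts_bot I s \<subseteq> {g \<in> carrier (W s). ev g \<in> \<mm> \<cdot> I}" unfolding rel_lifts_bot_def
    proof (rule W.set_add_least[OF V]; rule W.iprod_least[OF V])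
      fix i g assume i: "i \<in> \<mm>" and g: "g \<in> rel_lifts I s"
      have ic: "i \<in> carrier R" by (rule idl_carr[OF m_ideal i])
      have "ev (i \<odot>\<^bsub>W s\<^esub> g) = i \<otimes> ev g" using e.f_smult[OF ic subsetD[OF KW g]] by simp
      also have "\<dots> \<in> \<mm> \<cdot> I" using i g unfolding rel_lifts_def by (auto intro: ideal_prod.prod)
      finally show "i \<odot>\<^bsub>W s\<^esub> g \<in> {g \<in> carrier (W s). ev g \<in> \<mm> \<cdot> I}" using W.smult_closed[OF ic subsetD[OF KW g]] by simp
    next
      fix i g assume i: "i \<in> I" and g: "g \<in> carrier (W s)"
      have ic: "i \<in> carrier R" by (rule idl_carr[OF I(1) i])
      have "ev (i \<odot>\<^bsub>W s\<^esub> g) = ev g \<otimes> i" using e.f_smult[OF ic g] ic evc[OF g] by (simp add: m_comm)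
      also have "\<dots> \<in> \<mm> \<cdot> I" by (rule ideal_prod.prod[OF evm[OF g] i])
      finally show "i \<odot>\<^bsub>W s\<^esub> g \<in> {g \<in> carrier (W s). ev g \<in> \<mm> \<cdot> I}" using W.smult_closed[OF ic g] by simp
    qed
    then show ?thesis by auto
  qed
  have eK: "ev ` rel_lifts I s = I"
  proof -
    have "I \<subseteq> ev ` carrier (W s)" using I(2) ipow_antimono[OF m_ideal, of s "Suc s"] unfolding ev_image by auto
    then show ?thesis unfolding rel_lifts_def by auto
  qed
  have hK: "rel_lifts I s \<inter> e.hker = ?mW \<inter> e.hker"
  proof -
    have "e.hker \<subseteq> rel_lifts I s" unfolding e.hker_def rel_lifts_def using idl_zero[OF I(1)] by auto
    moreover have "e.hker \<subseteq> ?mW"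
    proof
      fix g assume "g \<in> e.hker"
      then have g: "g \<in> carrier (W s)" "ev g = \<zero>" unfolding e.hker_def by auto
      have "g A \<in> \<mm>" for A by (rule coeffs_in_m[OF g(1)]) (unfold g(2), rule idl_zero[OF pw])
      then show "g \<in> ?mW" unfolding free_iprod_iff[OF m_ideal] using g(1) by blast
    qed
    ultimately show ?thesis by auto
  qed
  let ?L1 = "clen (subm R (W s)) (?mmW \<inter> e.hker) (?mW \<inter> e.hker)"
  have "?L1 + enat (min_gens R (ideal_module R I)) \<le>
      clen (subm R (W s)) (rel_lifts_bot I s \<inter> e.hker) (rel_lifts I s \<inter> e.hker) + clen (subm R (ring_module R)) (ev ` rel_lifts_bot I s) (ev ` rel_lifts I s)"
  proof (rule add_mono)
    show "?L1 \<le> clen (subm R (W s)) (rel_lifts_bot I s \<inter> e.hker) (rel_lifts I s \<inter> e.hker)"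
      unfolding hK by (rule clen_mono) (use Bm in auto)
    have "enat (min_gens R (ideal_module R I)) \<le> clen (\<lambda>J. ideal J R) (\<mm> \<cdot> I) I" by (rule min_gens_le_clen[OF I(1)])
    also have "\<dots> \<le> clen (\<lambda>J. ideal J R) (ev ` rel_lifts_bot I s) I" by (rule clen_mono[OF eB order_refl])
    finally show "enat (min_gens R (ideal_module R I)) \<le> clen (subm R (ring_module R)) (ev ` rel_lifts_bot I s) (ev ` rel_lifts I s)"
      unfolding eK subm_ring_module .
  qed
  also have "\<dots> \<le> clen (subm R (W s)) (rel_lifts_bot I s) (rel_lifts I s)" by (rule e.clen_ge_kernel_image[OF B K BK])
  finally have lower: "?L1 + enat (min_gens R (ideal_module R I)) \<le> clen (subm R (W s)) (rel_lifts_bot I s) (rel_lifts I s)" .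
  have img: "clen (subm R (ring_module R)) (ev ` ?mmW) (ev ` ?mW) \<le> enat (card (Mon n (Suc s)))"
  proof -
    let ?G = "mval x ` Mon n (Suc s)"
    have G: "finite ?G" "?G \<subseteq> carrier R" using finite_Mon mval_Mon_closed by auto
    have GI: "Idl ?G = ipow \<mm> (Suc s)"
      using fext_image_Idl[OF finite_Mon[of n "Suc s"], of "mval x"] mval_Mon_closed ev_image by simp
    have "clen (\<lambda>J. ideal J R) (ipow \<mm> (Suc (Suc s))) (Idl ?G) \<le> enat (card ?G)"
    proof (rule clen_ideals_adjoin_le[OF G(1)])
      show "ipow \<mm> (Suc (Suc s)) \<subseteq> Idl ?G" unfolding GI by (rule ipow_antimono[OF m_ideal]) simp
      fix r g assume "r \<in> \<mm>" "g \<in> ?G"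
      then have "r \<in> \<mm>" "g \<in> ipow \<mm> (Suc s)" using genideal_self[OF G(2)] GI by auto
      then show "r \<otimes> g \<in> ipow \<mm> (Suc (Suc s))"
        unfolding ipow_Suc2[OF m_ideal, of "Suc s"] by (rule ideal_prod.prod)
    next
      show "ideal (ipow \<mm> (Suc (Suc s))) R" by (rule pw)
      show "ideal (Idl ?G) R" by (rule genideal_ideal[OF G(2)])
    qed (rule G(2))
    also have "enat (card ?G) \<le> enat (card (Mon n (Suc s)))" using card_image_le[OF finite_Mon] by simp
    finally have 1: "clen (\<lambda>J. ideal J R) (ipow \<mm> (Suc (Suc s))) (ipow \<mm> (Suc s)) \<le> enat (card (Mon n (Suc s)))" unfolding GI .
    have "clen (\<lambda>J. ideal J R) (ev ` ?mmW) (ev ` ?mW) \<le> clen (\<lambda>J. ideal J R) (ipow \<mm> (Suc (Suc s))) (ipow \<mm> (Suc s))"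
    proof (rule clen_mono)
      show "ev ` ?mW \<subseteq> ipow \<mm> (Suc s)"
      proof -
        have V: "subm R (W s) {g \<in> carrier (W s). ev g \<in> ipow \<mm> (Suc s)}"
          by (rule e.subm_vimage[OF iffD2[OF subm_ring_module_iff pw]])
        have "?mW \<subseteq> {g \<in> carrier (W s). ev g \<in> ipow \<mm> (Suc s)}"
        proof (rule W.iprod_least[OF V])
          fix i g assume i: "i \<in> \<mm>" and g: "g \<in> carrier (W s)"
          have ic: "i \<in> carrier R" by (rule idl_carr[OF m_ideal i])
          have "ev (i \<odot>\<^bsub>W s\<^esub> g) = i \<otimes> ev g" using e.f_smult[OF ic g] by simp
          also have "\<dots> \<in> ipow \<mm> (Suc s)" unfolding ipow_Suc2[OF m_ideal] by (rule ideal_prod.prod[OF i evW[OF g]])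
          finally show "i \<odot>\<^bsub>W s\<^esub> g \<in> {g \<in> carrier (W s). ev g \<in> ipow \<mm> (Suc s)}" using W.smult_closed[OF ic g] by simp
        qed
        then show ?thesis by auto
      qed
      have "ipow \<mm> (Suc (Suc s)) = (\<mm> \<cdot> \<mm>) \<cdot> ipow \<mm> s"
        unfolding ipow_Suc2[OF m_ideal, of "Suc s"] ipow_Suc2[OF m_ideal, of s]
        by (rule ideal_prod_assoc[OF m_ideal m_ideal pw, symmetric])
      moreover have "(\<mm> \<cdot> \<mm>) \<cdot> ipow \<mm> s \<subseteq> ev ` ?mmW"
      proof (rule ideal_prod_least)
        show "ideal (ev ` ?mmW) R" using e.subm_image[OF mmW] subm_ring_module_iff by simp
        fix i y assume i: "i \<in> \<mm> \<cdot> \<mm>" and "y \<in> ipow \<mm> s"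
        then obtain g where g: "g \<in> carrier (W s)" "y = ev g" using ev_image[of s] by blast
        have "i \<otimes> y = ev (i \<odot>\<^bsub>W s\<^esub> g)" using e.f_smult[OF idl_carr[OF mm i] g(1)] g(2) by simp
        then show "i \<otimes> y \<in> ev ` ?mmW" using iprod.prod[OF i g(1)] by (rule image_eqI)
      qed
      ultimately show "ipow \<mm> (Suc (Suc s)) \<subseteq> ev ` ?mmW" by simp
    qed
    then show ?thesis unfolding subm_ring_module using 1 by (rule order_trans)
  qed
  have "enat (n * card (Mon n s)) \<le> clen (subm R (W s)) ?mmW ?mW" by (rule clen_free_cotangent)
  also have "\<dots> \<le> ?L1 + clen (subm R (ring_module R)) (ev ` ?mmW) (ev ` ?mW)" by (rule e.clen_le_kernel_image[OF mmW mW])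
  also have "\<dots> \<le> ?L1 + enat (card (Mon n (Suc s)))" by (rule add_left_mono[OF img])
  finally have "enat (n * card (Mon n s)) + enat (min_gens R (ideal_module R I)) \<le>
    (?L1 + enat (card (Mon n (Suc s)))) + enat (min_gens R (ideal_module R I))" by (rule add_right_mono)
  also have "\<dots> = (?L1 + enat (min_gens R (ideal_module R I))) + enat (card (Mon n (Suc s)))"
    by (simp only: add.assoc add.commute[of "enat (card (Mon n (Suc s)))"])
  also have "\<dots> \<le> clen (subm R (W s)) (rel_lifts_bot I s) (rel_lifts I s) + enat (card (Mon n (Suc s)))" by (rule add_right_mono[OF lower])
  finally show ?thesis .
qed

end

section \<open>Passing to a residue class ring\<close>

text \<open>
  The residue class map is an arbitrary surjection with kernel \<open>I\<close>, so that cosets need not be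
  mentioned.
\<close>

locale regular_quotient = S: regular_system S \<nn> x n + h: ring_hom_cring S R \<phi>
  for S :: "('a, 'c) ring_scheme" (structure) and \<nn> :: "'a set" and x :: "nat \<Rightarrow> 'a" and n :: nat
    and R :: "('b, 'd) ring_scheme" and \<phi> :: "'a \<Rightarrow> 'b" +
  fixes I :: "'a set" and \<mm> :: "'b set" and s :: nat
  assumes I: "ideal I S" "I \<subseteq> S.ipow \<nn> (Suc s)" and s: "s \<ge> 1"
    and surj: "\<phi> ` carrier S = carrier R"
    and ker: "\<And>a. a \<in> carrier S \<Longrightarrow> \<phi> a = \<zero>\<^bsub>R\<^esub> \<longleftrightarrow> a \<in> I"
    and m_eq: "\<mm> = \<phi> ` \<nn>"
begin

abbreviation "\<mu> \<equiv> (\<lambda>A. \<phi> (S.mval x A))"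
abbreviation "ipR J k \<equiv> J [^]\<^bsub>ideals_set R\<^esub> (k::nat)"

lemma \<phi>_eq_iff: "a \<in> carrier S \<Longrightarrow> b \<in> carrier S \<Longrightarrow> \<phi> a = \<phi> b \<longleftrightarrow> a \<ominus>\<^bsub>S\<^esub> b \<in> I"
  using ker[of "a \<ominus>\<^bsub>S\<^esub> b"] h.S.r_right_minus_eq[of "\<phi> a" "\<phi> b"] by (simp add: S.minus_eq h.S.minus_eq)

lemma image_ideal: assumes J: "ideal J S" shows "ideal (\<phi> ` J) R"
proof (rule h.S.idlI)
  show "\<phi> ` J \<subseteq> carrier R" using S.idl_subset[OF J] by auto
  show "\<zero>\<^bsub>R\<^esub> \<in> \<phi> ` J" using S.idl_zero[OF J] h.hom_zero by (metis imageI)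
  fix a b assume "a \<in> \<phi> ` J" "b \<in> \<phi> ` J"
  then obtain u v where u: "u \<in> J" "a = \<phi> u" and v: "v \<in> J" "b = \<phi> v" by auto
  have "a \<oplus>\<^bsub>R\<^esub> b = \<phi> (u \<oplus>\<^bsub>S\<^esub> v)" using u v S.idl_carr[OF J] by simp
  then show "a \<oplus>\<^bsub>R\<^esub> b \<in> \<phi> ` J" using S.idl_add[OF J u(1) v(1)] by (rule image_eqI)
next
  fix r a assume "r \<in> carrier R" "a \<in> \<phi> ` J"
  then obtain u v where u: "u \<in> J" "a = \<phi> u" and v: "v \<in> carrier S" "r = \<phi> v" using surj by (metis imageE)
  have "r \<otimes>\<^bsub>R\<^esub> a = \<phi> (v \<otimes>\<^bsub>S\<^esub> u)" using u v S.idl_carr[OF J] by simp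
  then show "r \<otimes>\<^bsub>R\<^esub> a \<in> \<phi> ` J" using S.idl_mult[OF J u(1) v(1)] by (rule image_eqI)
qed

lemma vimage_ideal: assumes J: "ideal J R" shows "ideal {a \<in> carrier S. \<phi> a \<in> J} S"
  by (rule S.idlI) (use h.S.idl_zero[OF J] h.S.idl_add[OF J] h.S.idl_mult[OF J] in auto)

lemma image_Idl: assumes G: "G \<subseteq> carrier S" shows "\<phi> ` (genideal S G) = genideal R (\<phi> ` G)"
proof
  have IG: "ideal (genideal S G) S" by (rule S.genideal_ideal[OF G])
  have G': "\<phi> ` G \<subseteq> carrier R" using G by auto
  have IG': "ideal (genideal R (\<phi> ` G)) R" by (rule h.S.genideal_ideal[OF G'])
  have "genideal S G \<subseteq> {a \<in> carrier S. \<phi> a \<in> genideal R (\<phi> ` G)}"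
    by (rule S.genideal_minimal[OF vimage_ideal[OF IG']]) (use G h.S.genideal_self[OF G'] in auto)
  then show "\<phi> ` (genideal S G) \<subseteq> genideal R (\<phi> ` G)" by auto
  show "genideal R (\<phi> ` G) \<subseteq> \<phi> ` (genideal S G)"
    by (rule h.S.genideal_minimal[OF image_ideal[OF IG]]) (use S.genideal_self[OF G] in auto)
qed

lemma image_prod:
  assumes J: "ideal J S" and K: "ideal K S"
  shows "\<phi> ` (ideal_prod S J K) = ideal_prod R (\<phi> ` J) (\<phi> ` K)"
proof
  have P: "ideal (ideal_prod R (\<phi> ` J) (\<phi> ` K)) R" by (rule h.S.ideal_prod_is_ideal[OF image_ideal[OF J] image_ideal[OF K]])
  have "ideal_prod S J K \<subseteq> {a \<in> carrier S. \<phi> a \<in> ideal_prod R (\<phi> ` J) (\<phi> ` K)}"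
    by (rule S.ideal_prod_least[OF vimage_ideal[OF P]])
      (use S.idl_carr[OF J] S.idl_carr[OF K] in \<open>auto intro!: ideal_prod.prod\<close>)
  then show "\<phi> ` (ideal_prod S J K) \<subseteq> ideal_prod R (\<phi> ` J) (\<phi> ` K)" by auto
  show "ideal_prod R (\<phi> ` J) (\<phi> ` K) \<subseteq> \<phi> ` (ideal_prod S J K)"
  proof (rule h.S.ideal_prod_least[OF image_ideal[OF S.ideal_prod_is_ideal[OF J K]]])
    fix a b assume "a \<in> \<phi> ` J" "b \<in> \<phi> ` K"
    then obtain u v where u: "u \<in> J" "a = \<phi> u" and v: "v \<in> K" "b = \<phi> v" by auto
    have "a \<otimes>\<^bsub>R\<^esub> b = \<phi> (u \<otimes>\<^bsub>S\<^esub> v)" using u v S.idl_carr[OF J] S.idl_carr[OF K] by simp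
    then show "a \<otimes>\<^bsub>R\<^esub> b \<in> \<phi> ` (ideal_prod S J K)" using ideal_prod.prod[OF u(1) v(1)] by (rule image_eqI)
  qed
qed

lemma m_ideal: "ideal \<mm> R" unfolding m_eq by (rule image_ideal[OF S.m_ideal])

lemma ipow_image: "ipR \<mm> k = \<phi> ` S.ipow \<nn> k"
proof (induction k)
  case 0 show ?case unfolding S.ipow_0 h.S.ipow_0 by (rule surj[symmetric])
next
  case (Suc k)
  show ?case unfolding S.ipow_Suc h.S.ipow_Suc Suc image_prod[OF S.ipow_ideal[OF S.m_ideal] S.m_ideal]
    by (simp only: m_eq)
qed

lemma I_ipow: "k \<le> Suc s \<Longrightarrow> I \<subseteq> S.ipow \<nn> k"
  using I(2) S.ipow_antimono[OF S.m_ideal, of k "Suc s"] by auto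

lemma I_sub: "I \<subseteq> \<nn>" using I_ipow[of "Suc 0"] S.ipow_1[OF S.m_ideal] by simp

text \<open>An ideal that contains the kernel is the full preimage of its image.\<close>

lemma image_memD:
  assumes J: "ideal J S" "I \<subseteq> J" and a: "a \<in> carrier S" "\<phi> a \<in> \<phi> ` J"
  shows "a \<in> J"
proof -
  obtain b where b: "b \<in> J" "\<phi> a = \<phi> b" using a(2) by auto
  have bc: "b \<in> carrier S" by (rule S.idl_carr[OF J(1) b(1)])
  have "a \<ominus>\<^bsub>S\<^esub> b \<in> J" using iffD1[OF \<phi>_eq_iff[OF a(1) bc] b(2)] J(2) by auto
  then have "b \<oplus>\<^bsub>S\<^esub> (a \<ominus>\<^bsub>S\<^esub> b) \<in> J" by (rule S.idl_add[OF J(1) b(1)])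
  moreover have "b \<oplus>\<^bsub>S\<^esub> (a \<ominus>\<^bsub>S\<^esub> b) = a" using a(1) bc by algebra
  ultimately show ?thesis by simp
qed

lemma m_one: "\<one>\<^bsub>R\<^esub> \<notin> \<mm>"
  using image_memD[OF S.m_ideal I_sub, of "\<one>\<^bsub>S\<^esub>"] S.m_one unfolding m_eq by auto

lemma m_units: "r \<in> carrier R \<Longrightarrow> r \<notin> \<mm> \<Longrightarrow> r \<in> Units R"
proof -
  assume r: "r \<in> carrier R" "r \<notin> \<mm>"
  then obtain a where a: "a \<in> carrier S" "r = \<phi> a" using surj by (metis imageE)
  have "a \<notin> \<nn>" using r(2) a(2) unfolding m_eq by auto
  then have u: "a \<in> Units S" by (rule S.units[OF a(1)])
  have "\<phi> a \<otimes>\<^bsub>R\<^esub> \<phi> (inv\<^bsub>S\<^esub> a) = \<one>\<^bsub>R\<^esub>"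
    using a(1) S.Units_inv_closed[OF u] S.Units_r_inv[OF u] h.hom_mult[of a "inv\<^bsub>S\<^esub> a"] h.hom_one by simp
  moreover have "\<phi> (inv\<^bsub>S\<^esub> a) \<otimes>\<^bsub>R\<^esub> \<phi> a = \<one>\<^bsub>R\<^esub>"
    using a(1) S.Units_inv_closed[OF u] S.Units_l_inv[OF u] h.hom_mult[of "inv\<^bsub>S\<^esub> a" a] h.hom_one by simp
  ultimately show ?thesis unfolding a(2) Units_def
    using h.hom_closed[OF a(1)] h.hom_closed[OF S.Units_inv_closed[OF u]] by blast
qed

lemma noetherian_local: "noetherian_local R \<mm>"
proof (intro noetherian_local.intro noetherian_cring.intro noetherian_local_axioms.intro)
  show "cring R" by (rule h.S.cring_axioms)
  show "noetherian_ring R"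
  proof (intro noetherian_ring.intro noetherian_ring_axioms.intro)
    show "ring R" by (rule h.S.ring_axioms)
    fix J assume J: "ideal J R"
    obtain G where G: "finite G" "G \<subseteq> {a \<in> carrier S. \<phi> a \<in> J}" "{a \<in> carrier S. \<phi> a \<in> J} = genideal S G"
      using S.ideal_fg[OF vimage_ideal[OF J]] by blast
    have "J = \<phi> ` {a \<in> carrier S. \<phi> a \<in> J}"
      using h.S.idl_subset[OF J] unfolding surj[symmetric] by (auto simp: subset_iff image_iff)
    also have "\<dots> = genideal R (\<phi> ` G)" unfolding G(3) by (rule image_Idl) (use G(2) in auto)
    finally show "\<exists>A\<subseteq>carrier R. finite A \<and> J = genideal R A"
      using G(1,2) by (intro exI[of _ "\<phi> ` G"]) auto
  qed
  show "primeideal \<mm> R"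
  proof (rule primeidealI[OF m_ideal h.S.cring_axioms])
    show "carrier R \<noteq> \<mm>" using m_one h.S.one_closed by blast
    fix a b assume a: "a \<in> carrier R" and b: "b \<in> carrier R" and ab: "a \<otimes>\<^bsub>R\<^esub> b \<in> \<mm>"
    show "a \<in> \<mm> \<or> b \<in> \<mm>"
    proof (rule ccontr)
      assume "\<not> (a \<in> \<mm> \<or> b \<in> \<mm>)"
      then have u: "a \<otimes>\<^bsub>R\<^esub> b \<in> Units R" using m_units[OF a] m_units[OF b] by (intro h.S.Units_m_closed) auto
      have "inv\<^bsub>R\<^esub> (a \<otimes>\<^bsub>R\<^esub> b) \<otimes>\<^bsub>R\<^esub> (a \<otimes>\<^bsub>R\<^esub> b) \<in> \<mm>" by (rule h.S.idl_mult[OF m_ideal ab h.S.Units_inv_closed[OF u]])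
      then show False using m_one h.S.Units_l_inv[OF u] by simp
    qed
  qed
  show "\<And>r. r \<in> carrier R \<Longrightarrow> r \<notin> \<mm> \<Longrightarrow> r \<in> Units R" by (rule m_units)
qed

sublocale RR: noetherian_local R \<mm> by (rule noetherian_local)

abbreviation "WR \<equiv> free_module R (Mon n s)"
abbreviation "evR \<equiv> module.fext R (ring_module R) \<mu>"
abbreviation "\<pi> \<equiv> (\<lambda>g A. \<phi> (g A))"

lemma mon_closed: "A \<in> Mon n t \<Longrightarrow> \<mu> A \<in> carrier R" using S.mval_Mon_closed by auto

lemma sum_image:
  assumes "\<And>A. A \<in> Mon n t \<Longrightarrow> g A \<in> carrier S"
  shows "(\<Oplus>\<^bsub>R\<^esub>A\<in>Mon n t. \<phi> (g A) \<otimes>\<^bsub>R\<^esub> \<mu> A) = \<phi> (\<Oplus>\<^bsub>S\<^esub>A\<in>Mon n t. g A \<otimes>\<^bsub>S\<^esub> S.mval x A)"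
proof -
  have "\<phi> (\<Oplus>\<^bsub>S\<^esub>A\<in>Mon n t. g A \<otimes>\<^bsub>S\<^esub> S.mval x A) = (\<Oplus>\<^bsub>R\<^esub>A\<in>Mon n t. (\<phi> \<circ> (\<lambda>A. g A \<otimes>\<^bsub>S\<^esub> S.mval x A)) A)"
    using h.hom_finsum[of "\<lambda>A. g A \<otimes>\<^bsub>S\<^esub> S.mval x A" "Mon n t"] assms S.mval_Mon_closed by (simp add: Pi_iff)
  also have "\<dots> = (\<Oplus>\<^bsub>R\<^esub>A\<in>Mon n t. \<phi> (g A) \<otimes>\<^bsub>R\<^esub> \<mu> A)"
    by (rule h.S.finsum_cong') (use assms S.mval_Mon_closed in auto)
  finally show ?thesis by simp
qed

lemma mon_in_power: "A \<in> Mon n t \<Longrightarrow> \<mu> A \<in> ipR \<mm> t"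
proof -
  assume A: "A \<in> Mon n t"
  have c: "S.mval x ` Mon n t \<subseteq> carrier S" using S.mval_Mon_closed by auto
  have "S.mval x A \<in> genideal S (S.mval x ` Mon n t)" using S.genideal_self[OF c] A by auto
  also have "\<dots> = S.ipow \<nn> t"
    using S.fext_image_Idl[OF finite_Mon[of n t], of "S.mval x"] S.mval_Mon_closed S.ev_image by simp
  finally show ?thesis unfolding ipow_image by (rule imageI)
qed

lemma mon_Idl: "genideal R (\<mu> ` Mon n t) = ipR \<mm> t"
proof -
  have c: "S.mval x ` Mon n t \<subseteq> carrier S" using S.mval_Mon_closed by auto
  have "genideal S (S.mval x ` Mon n t) = S.ipow \<nn> t"
    using S.fext_image_Idl[OF finite_Mon[of n t], of "S.mval x"] S.mval_Mon_closed S.ev_image by simp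
  then show ?thesis unfolding ipow_image using image_Idl[OF c] by (simp add: image_image)
qed

text \<open>Since \<open>I\<close> lies in \<open>\<nn>\<^sup>s\<^sup>+\<^sup>1\<close>, it does not disturb forms of degree at most \<open>s\<close>.\<close>

lemma mon_independent:
  assumes t: "t \<le> s" and c: "c \<in> Mon n t \<rightarrow> carrier R"
    and sum: "(\<Oplus>\<^bsub>R\<^esub>A\<in>Mon n t. c A \<otimes>\<^bsub>R\<^esub> \<mu> A) \<in> ipR \<mm> (Suc t)" and A: "A \<in> Mon n t"
  shows "c A \<in> \<mm>"
proof -
  have "\<forall>A\<in>Mon n t. \<exists>a. a \<in> carrier S \<and> \<phi> a = c A"
  proof
    fix A assume "A \<in> Mon n t"
    then have "c A \<in> \<phi> ` carrier S" using c unfolding surj by auto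
    then show "\<exists>a. a \<in> carrier S \<and> \<phi> a = c A" by auto
  qed
  from bchoice[OF this] obtain g where "\<forall>A\<in>Mon n t. g A \<in> carrier S \<and> \<phi> (g A) = c A" ..
  then have g: "\<And>A. A \<in> Mon n t \<Longrightarrow> g A \<in> carrier S" "\<And>A. A \<in> Mon n t \<Longrightarrow> \<phi> (g A) = c A" by auto
  have eq: "(\<Oplus>\<^bsub>R\<^esub>A\<in>Mon n t. c A \<otimes>\<^bsub>R\<^esub> \<mu> A) = (\<Oplus>\<^bsub>R\<^esub>A\<in>Mon n t. \<phi> (g A) \<otimes>\<^bsub>R\<^esub> \<mu> A)"
    by (rule h.S.finsum_cong') (use g mon_closed funcset_mem[OF c] in auto)
  have eq': "(\<Oplus>\<^bsub>R\<^esub>A\<in>Mon n t. \<phi> (g A) \<otimes>\<^bsub>R\<^esub> \<mu> A) = \<phi> (\<Oplus>\<^bsub>S\<^esub>A\<in>Mon n t. g A \<otimes>\<^bsub>S\<^esub> S.mval x A)"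
    by (rule sum_image) (rule g(1))
  have mem: "\<phi> (\<Oplus>\<^bsub>S\<^esub>A\<in>Mon n t. g A \<otimes>\<^bsub>S\<^esub> S.mval x A) \<in> \<phi> ` S.ipow \<nn> (Suc t)"
    using sum unfolding eq eq' ipow_image .
  have sc: "(\<Oplus>\<^bsub>S\<^esub>A\<in>Mon n t. g A \<otimes>\<^bsub>S\<^esub> S.mval x A) \<in> carrier S"
    by (rule S.finsum_closed) (use g(1) S.mval_Mon_closed in auto)
  have "(\<Oplus>\<^bsub>S\<^esub>A\<in>Mon n t. g A \<otimes>\<^bsub>S\<^esub> S.mval x A) \<in> S.ipow (S.N n) (Suc t)"
    using image_memD[OF S.ipow_ideal[OF S.m_ideal] I_ipow sc mem] t unfolding S.m_gen by simp
  from S.quasi_regular[OF _ this A] have "g A \<in> S.N n" using g(1) by auto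
  then show ?thesis unfolding m_eq S.m_gen g(2)[OF A, symmetric] by (rule imageI)
qed

lemma \<pi>_closed: "g \<in> carrier (S.W s) \<Longrightarrow> \<pi> g \<in> carrier WR"
proof (rule h.S.free_carrierI)
  assume g: "g \<in> carrier (S.W s)"
  show "\<phi> (g A) \<in> carrier R" for A using S.free_value[OF g] by simp
  show "\<phi> (g A) = \<zero>\<^bsub>R\<^esub>" if "A \<notin> Mon n s" for A using S.free_outside[OF g that] by simp
  show "finite {A. \<phi> (g A) \<noteq> \<zero>\<^bsub>R\<^esub>}" by (rule finite_subset[OF _ S.free_finite[OF g]]) auto
qed

lemma \<pi>_surj:
  assumes v: "v \<in> carrier WR" shows "\<exists>g\<in>carrier (S.W s). v = \<pi> g"
proof -
  have "\<forall>A. \<exists>a. a \<in> carrier S \<and> \<phi> a = v A"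
  proof
    fix A
    have "v A \<in> \<phi> ` carrier S" using h.S.free_value[OF v] unfolding surj .
    then show "\<exists>a. a \<in> carrier S \<and> \<phi> a = v A" by auto
  qed
  from choice[OF this] obtain u where u: "\<And>A. u A \<in> carrier S" "\<And>A. \<phi> (u A) = v A" by blast
  define g where "g = (\<lambda>A. if A \<in> Mon n s then u A else \<zero>\<^bsub>S\<^esub>)"
  have "g \<in> carrier (S.W s)"
    by (rule S.free_carrierI) (use u finite_Mon in \<open>auto simp: g_def intro: finite_subset[of _ "Mon n s"]\<close>)
  moreover have "v = \<pi> g" by (rule ext) (use u h.S.free_outside[OF v] in \<open>auto simp: g_def\<close>)
  ultimately show ?thesis by blast
qed

lemma evR_\<pi>: "g \<in> carrier (S.W s) \<Longrightarrow> evR (\<pi> g) = \<phi> (S.ev g)"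
proof -
  assume g: "g \<in> carrier (S.W s)"
  have "evR (\<pi> g) = (\<Oplus>\<^bsub>R\<^esub>A\<in>Mon n s. \<pi> g A \<otimes>\<^bsub>R\<^esub> \<mu> A)"
    using RR.RM.fext_superset[of \<mu> "Mon n s" "\<pi> g" "Mon n s"] mon_closed finite_Mon \<pi>_closed[OF g] h.S.free_support[OF \<pi>_closed[OF g]]
    by auto
  also have "\<dots> = \<phi> (S.ev g)" unfolding S.ev_eq[OF g] by (rule sum_image) (rule S.free_value[OF g])
  finally show ?thesis .
qed

text \<open>
  Reduce coefficients modulo \<open>I\<close>. Strict inclusions survive: forms with the same reduction
  differ by a form with coefficients in \<open>I\<close>, which lies in \<open>rel_lifts_bot\<close>.
\<close>

lemma clen_le_rel_len: "clen (subm S (S.W s)) (S.rel_lifts_bot I s) (S.rel_lifts I s) \<le> rel_len R \<mm> WR (ring_module R) evR"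
proof -
  interpret W: module S "S.W s" by (rule S.W_module)
  interpret WR: module R WR by (rule h.S.free_module_module)
  have add: "\<pi> g \<oplus>\<^bsub>WR\<^esub> \<pi> k = \<pi> (g \<oplus>\<^bsub>S.W s\<^esub> k)" if "g \<in> carrier (S.W s)" "k \<in> carrier (S.W s)" for g k
    using S.free_value[OF that(1)] S.free_value[OF that(2)] by simp
  have smult: "\<phi> a \<odot>\<^bsub>WR\<^esub> \<pi> g = \<pi> (a \<odot>\<^bsub>S.W s\<^esub> g)" if "a \<in> carrier S" "g \<in> carrier (S.W s)" for a g
    using that(1) S.free_value[OF that(2)] by simp
  interpret eS: mod_hom S "S.W s" "ring_module S" S.ev by (rule mod_homI[OF S.W_module S.RM.module_axioms S.ev_hom])
  have KW: "S.rel_lifts I s \<subseteq> carrier (S.W s)" unfolding S.rel_lifts_def by auto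
  have K: "subm S (S.W s) (S.rel_lifts I s)" unfolding S.rel_lifts_def by (rule eS.subm_vimage) (simp add: S.subm_ring_module_iff I)
  have mK: "subm S (S.W s) (iprod (S.W s) \<nn> (S.rel_lifts I s))" by (rule W.iprod_subm[OF S.m_ideal K])
  have IW: "subm S (S.W s) (iprod (S.W s) I (carrier (S.W s)))" by (rule W.iprod_subm[OF I(1) W.carrier_is_submodule])
  show ?thesis unfolding rel_len_def
  proof (rule clen_map_le[where \<Phi> = "\<lambda>V. \<pi> ` V"])
    fix V assume V: "subm S (S.W s) V" and BV: "S.rel_lifts_bot I s \<subseteq> V" and VK: "V \<subseteq> S.rel_lifts I s"
    have VW: "V \<subseteq> carrier (S.W s)" by (rule W.subm_subset[OF V])
    have mV: "iprod (S.W s) \<nn> (S.rel_lifts I s) \<subseteq> V" using BV W.set_add_upper1[OF mK IW] unfolding S.rel_lifts_bot_def by auto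
    have sub: "subm R WR (\<pi> ` V)"
    proof (rule WR.submI)
      show "\<pi> ` V \<subseteq> carrier WR" using VW \<pi>_closed by auto
      have "\<zero>\<^bsub>WR\<^esub> = \<pi> \<zero>\<^bsub>S.W s\<^esub>" by simp
      then show "\<zero>\<^bsub>WR\<^esub> \<in> \<pi> ` V" using W.subm_zero[OF V] by (rule image_eqI)
      fix a b assume "a \<in> \<pi> ` V" "b \<in> \<pi> ` V"
      then obtain u v where u: "u \<in> V" "a = \<pi> u" and v: "v \<in> V" "b = \<pi> v" by blast
      have "a \<oplus>\<^bsub>WR\<^esub> b = \<pi> (u \<oplus>\<^bsub>S.W s\<^esub> v)" unfolding u(2) v(2) by (rule add) (use u v VW in auto)
      then show "a \<oplus>\<^bsub>WR\<^esub> b \<in> \<pi> ` V" using W.subm_add[OF V u(1) v(1)] by (rule image_eqI)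
  next
      fix r a assume "r \<in> carrier R" "a \<in> \<pi> ` V"
      then obtain u v where u: "u \<in> V" "a = \<pi> u" and v: "v \<in> carrier S" "r = \<phi> v" using surj by blast
      have "r \<odot>\<^bsub>WR\<^esub> a = \<pi> (v \<odot>\<^bsub>S.W s\<^esub> u)" unfolding u(2) v(2) by (rule smult) (use u v VW in auto)
      then show "r \<odot>\<^bsub>WR\<^esub> a \<in> \<pi> ` V" using W.subm_smult[OF V v(1) u(1)] by (rule image_eqI)
    qed
    have "iprod WR \<mm> (relK WR (ring_module R) evR) \<subseteq> \<pi> ` V"
    proof (rule WR.iprod_least[OF sub])
      fix i v assume "i \<in> \<mm>" "v \<in> relK WR (ring_module R) evR"
      then obtain a where a: "a \<in> \<nn>" "i = \<phi> a" and vc: "v \<in> carrier WR" and z: "evR v = \<zero>\<^bsub>R\<^esub>"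
        unfolding m_eq relK_def by auto
      obtain g where g: "g \<in> carrier (S.W s)" "v = \<pi> g" using \<pi>_surj[OF vc] by (rule bexE)
      have "S.ev g \<in> carrier S" using eS.f_im[OF g(1)] by simp
      from ker[OF this] have "S.ev g \<in> I" using z unfolding g(2) evR_\<pi>[OF g(1)] by (rule iffD1)
      then have gK: "g \<in> S.rel_lifts I s" unfolding S.rel_lifts_def using g(1) by simp
      have "a \<odot>\<^bsub>S.W s\<^esub> g \<in> V" by (rule subsetD[OF mV iprod.prod[OF a(1) gK]])
      moreover have "i \<odot>\<^bsub>WR\<^esub> v = \<pi> (a \<odot>\<^bsub>S.W s\<^esub> g)"
        unfolding a(2) g(2) by (rule smult[OF S.idl_carr[OF S.m_ideal a(1)] g(1)])
      ultimately show "i \<odot>\<^bsub>WR\<^esub> v \<in> \<pi> ` V" by (intro image_eqI)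
    qed
    moreover have "\<pi> ` V \<subseteq> relM \<mm> WR (ring_module R) evR"
    proof
      fix v assume "v \<in> \<pi> ` V"
      then obtain g where g: "g \<in> S.rel_lifts I s" "v = \<pi> g" using VK by blast
      have gW: "g \<in> carrier (S.W s)" and gI: "S.ev g \<in> I" using g(1) unfolding S.rel_lifts_def by auto
      have "evR v = \<zero>\<^bsub>R\<^esub>" unfolding g(2) evR_\<pi>[OF gW] using ker[of "S.ev g"] S.idl_carr[OF I(1) gI] gI by simp
      moreover have "v A \<in> \<mm>" for A unfolding g(2) m_eq
        by (rule imageI) (rule S.coeffs_in_m[OF gW subsetD[OF I(2) gI]])
      ultimately show "v \<in> relM \<mm> WR (ring_module R) evR"
        unfolding relM_def relK_def Int_iff h.S.free_iprod_iff[OF m_ideal] using \<pi>_closed[OF gW] g(2) by simp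
    qed
    ultimately show "subm R WR (\<pi> ` V) \<and> iprod WR \<mm> (relK WR (ring_module R) evR) \<subseteq> \<pi> ` V \<and>
      \<pi> ` V \<subseteq> relM \<mm> WR (ring_module R) evR" using sub by blast
  next
    fix V V' assume V: "subm S (S.W s) V" and BV: "S.rel_lifts_bot I s \<subseteq> V" and V': "V \<subset> V'" "V' \<subseteq> S.rel_lifts I s"
    have VW: "V \<subseteq> carrier (S.W s)" by (rule W.subm_subset[OF V])
    have IV: "iprod (S.W s) I (carrier (S.W s)) \<subseteq> V" using BV W.set_add_upper2[OF mK IW] unfolding S.rel_lifts_bot_def by auto
    obtain w where w: "w \<in> V'" "w \<notin> V" using V'(1) by auto
    have wW: "w \<in> carrier (S.W s)" using w(1) V'(2) KW by auto
    have "\<pi> w \<notin> \<pi> ` V"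
    proof
      assume "\<pi> w \<in> \<pi> ` V"
      then obtain v where v: "v \<in> V" "\<pi> w = \<pi> v" by blast
      have vW: "v \<in> carrier (S.W s)" using v(1) VW by auto
      have "(w \<ominus>\<^bsub>S.W s\<^esub> v) A \<in> I" for A
        unfolding S.coord_minus[OF wW vW] using fun_cong[OF v(2), of A] \<phi>_eq_iff[OF S.free_value[OF wW] S.free_value[OF vW]] by simp
      then have "w \<ominus>\<^bsub>S.W s\<^esub> v \<in> iprod (S.W s) I (carrier (S.W s))"
        unfolding S.free_iprod_iff[OF I(1)] using W.M.minus_closed[OF wW vW] by blast
      then have "w \<ominus>\<^bsub>S.W s\<^esub> v \<in> V" using IV by auto
      then have "w \<in> V" by (rule W.subm_minus_cancel[OF V _ v(1) wW])
      then show False using w(2) by simp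
    qed
    then show "\<pi> ` V \<subset> \<pi> ` V'" using w(1) V'(1) by blast
  qed
qed

end

section \<open>Presentations with the same image\<close>

context module begin

lemma rel_len_same_image:
  assumes m: "ideal \<mm> R" and b: "b \<in> X \<rightarrow> carrier M" and b': "b' \<in> Y \<rightarrow> carrier M"
    and im: "fext b ` carrier (free_module R X) = fext b' ` carrier (free_module R Y)"
  shows "rel_len R \<mm> (free_module R X) M (fext b) \<le> rel_len R \<mm> (free_module R Y) M (fext b')"
proof -
  note mods = R.free_module_module[of X] R.free_module_module[of Y] module_axioms
  note h = fext_hom[OF b] fext_hom[OF b']
  obtain \<phi> where \<phi>: "\<phi> \<in> module_hom R (free_module R X) (free_module R Y)"
      and p\<phi>: "\<forall>v\<in>carrier (free_module R X). fext b' (\<phi> v) = fext b v"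
    using free_module_lift[OF mods(3) mods(2) h(1) h(2)] im by blast
  obtain \<psi> where \<psi>: "\<psi> \<in> module_hom R (free_module R Y) (free_module R X)"
      and p\<psi>: "\<forall>v\<in>carrier (free_module R Y). fext b (\<psi> v) = fext b' v"
    using free_module_lift[OF mods(3) mods(1) h(2) h(1)] im by blast
  show ?thesis
    by (rule compare_presentations_len[OF mods m h \<phi> \<psi>])
      (rule bspec[OF p\<phi>], assumption, rule bspec[OF p\<psi>], assumption)
qed

text \<open>
  The relations of a finite presentation are finitely generated. Transport them along \<open>\<psi>\<close>: since
  \<open>\<psi> (\<phi> v)\<close> differs from \<open>v\<close> by an element of \<open>\<mm>K\<close>, they generate over \<open>\<mm>K\<close>.
\<close>

lemma relM_fg:
  assumes noeth: "noetherian_cring R"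
    and m: "ideal \<mm> R" and b: "b \<in> X \<rightarrow> carrier M" and b': "b' \<in> Y \<rightarrow> carrier M" and Y: "finite Y"
    and im: "fext b ` carrier (free_module R X) = fext b' ` carrier (free_module R Y)"
  shows "\<exists>Z. finite Z \<and> Z \<subseteq> relM \<mm> (free_module R X) M (fext b) \<and>
    (\<forall>U. subm R (free_module R X) U \<longrightarrow> iprod (free_module R X) \<mm> (relK (free_module R X) M (fext b)) \<subseteq> U \<longrightarrow> Z \<subseteq> U \<longrightarrow>
      relM \<mm> (free_module R X) M (fext b) \<subseteq> U)"
proof -
  define FX where "FX = free_module R X"
  define FY where "FY = free_module R Y"
  have mods: "module R FX" "module R FY" "module R M" unfolding FX_def FY_def by (rule R.free_module_module module_axioms)+
  have h: "fext b \<in> module_hom R FX M" "fext b' \<in> module_hom R FY M" unfolding FX_def FY_def by (rule fext_hom[OF b] fext_hom[OF b'])+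
  obtain \<phi> where \<phi>: "\<phi> \<in> module_hom R FX FY" and p\<phi>: "\<forall>v\<in>carrier FX. fext b' (\<phi> v) = fext b v"
    using free_module_lift[OF mods(3) mods(2) h(1)[unfolded FX_def] h(2)] im unfolding FX_def FY_def by blast
  obtain \<psi> where \<psi>: "\<psi> \<in> module_hom R FY FX" and p\<psi>: "\<forall>v\<in>carrier FY. fext b (\<psi> v) = fext b' v"
    using free_module_lift[OF mods(3) mods(1) h(2)[unfolded FY_def] h(1)] im unfolding FX_def FY_def by blast
  interpret FX: module R FX by (rule mods)
  interpret FY: module R FY by (rule mods)
  interpret p: mod_hom R FX M "fext b" by (rule mod_homI[OF mods(1,3) h(1)])
  interpret p': mod_hom R FY M "fext b'" by (rule mod_homI[OF mods(2,3) h(2)])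
  interpret \<psi>: mod_hom R FY FX \<psi> by (rule mod_homI[OF mods(2,1) \<psi>])
  let ?TX = "relM \<mm> FX M (fext b)" and ?TY = "relM \<mm> FY M (fext b')"
  have TY: "subm R FY ?TY" by (rule p'.relM_subm[OF m])
  have TX: "subm R FX ?TX" by (rule p.relM_subm[OF m])
  obtain G where G: "finite G" "G \<subseteq> ?TY" and Gl: "\<forall>U. subm R FY U \<longrightarrow> G \<subseteq> U \<longrightarrow> ?TY \<subseteq> U"
    using noetherian_cring.free_submodule_fg[OF noeth Y TY[unfolded FY_def]] unfolding FY_def by blast
  have \<psi>T: "\<psi> v \<in> ?TX" if "v \<in> ?TY" for v
    using that by - (rule compare_presentations_relM[OF mods(2,1,3) m h(2,1) \<psi> \<phi>],
      rule bspec[OF p\<psi>], assumption, rule bspec[OF p\<phi>], assumption, assumption)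
  have \<phi>T: "\<phi> v \<in> ?TY" if "v \<in> ?TX" for v
    using that by - (rule compare_presentations_relM[OF mods m h \<phi> \<psi>],
      rule bspec[OF p\<phi>], assumption, rule bspec[OF p\<psi>], assumption, assumption)
  have diff: "\<psi> (\<phi> v) \<ominus>\<^bsub>FX\<^esub> v \<in> iprod FX \<mm> (relK FX M (fext b))" if "v \<in> iprod FX \<mm> (carrier FX)" for v
    using that by - (rule compare_presentations_diff[OF mods m h \<phi> \<psi>],
      rule bspec[OF p\<phi>], assumption, rule bspec[OF p\<psi>], assumption, assumption)
  have "?TX \<subseteq> U" if U: "subm R FX U" "iprod FX \<mm> (relK FX M (fext b)) \<subseteq> U" "\<psi> ` G \<subseteq> U" for U
  proof
    fix v assume v: "v \<in> ?TX"
    have vc: "v \<in> carrier FX" by (rule FX.subm_carrier[OF TX v])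
    have "?TY \<subseteq> {w \<in> carrier FY. \<psi> w \<in> U}"
      by (rule Gl[rule_format, OF \<psi>.subm_vimage[OF U(1)]]) (use G(2) U(3) FY.subm_subset[OF TY] in auto)
    then have wU: "\<psi> (\<phi> v) \<in> U" using \<phi>T[OF v] by auto
    have wc: "\<psi> (\<phi> v) \<in> carrier FX" by (rule FX.subm_carrier[OF U(1) wU])
    have "v \<in> iprod FX \<mm> (carrier FX)" using v unfolding relM_def by simp
    from diff[OF this] have "\<psi> (\<phi> v) \<ominus>\<^bsub>FX\<^esub> v \<in> U" using U(2) by auto
    then have "\<psi> (\<phi> v) \<ominus>\<^bsub>FX\<^esub> (\<psi> (\<phi> v) \<ominus>\<^bsub>FX\<^esub> v) \<in> U" by (rule FX.subm_minus[OF U(1) wU])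
    moreover have "\<psi> (\<phi> v) \<ominus>\<^bsub>FX\<^esub> (\<psi> (\<phi> v) \<ominus>\<^bsub>FX\<^esub> v) = v"
      using vc wc by (simp add: FX.M.minus_eq FX.M.minus_add FX.M.r_neg2)
    ultimately show "v \<in> U" by simp
  qed
  moreover have "\<psi> ` G \<subseteq> ?TX" using G(2) \<psi>T by auto
  ultimately show ?thesis using G(1) unfolding FX_def[symmetric] by (intro exI[of _ "\<psi> ` G"]) auto
qed

end

section \<open>Regular local rings have regular systems of parameters\<close>

lemma (in cring) sum_assoc_insert:
  assumes A: "ideal A R" and y: "y \<in> carrier R" and T: "T \<subseteq> carrier R"
  shows "A <+> Idl (insert y T) = (A <+> PIdl y) <+> Idl T"
proof -
  have P: "ideal (PIdl y) R" by (rule cgenideal_ideal[OF y])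
  have IT: "ideal (Idl T) R" by (rule genideal_ideal[OF T])
  have PT: "ideal (PIdl y <+> Idl T) R" by (rule add_ideals[OF P IT])
  have AP: "ideal (A <+> PIdl y) R" by (rule add_ideals[OF A P])
  have L: "ideal (A <+> (PIdl y <+> Idl T)) R" by (rule add_ideals[OF A PT])
  have R': "ideal ((A <+> PIdl y) <+> Idl T) R" by (rule add_ideals[OF AP IT])
  have "A <+> (PIdl y <+> Idl T) \<subseteq> (A <+> PIdl y) <+> Idl T"
  proof (rule sum_least[OF R'])
    show "A \<subseteq> (A <+> PIdl y) <+> Idl T" using sum_upper1[OF A P] sum_upper1[OF AP IT] by (rule order_trans)
    show "PIdl y <+> Idl T \<subseteq> (A <+> PIdl y) <+> Idl T"
      by (rule sum_least[OF R' order_trans[OF sum_upper2[OF A P] sum_upper1[OF AP IT]] sum_upper2[OF AP IT]])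
  qed
  moreover have "(A <+> PIdl y) <+> Idl T \<subseteq> A <+> (PIdl y <+> Idl T)"
  proof (rule sum_least[OF L])
    show "Idl T \<subseteq> A <+> (PIdl y <+> Idl T)" using sum_upper2[OF P IT] sum_upper2[OF A PT] by (rule order_trans)
    show "A <+> PIdl y \<subseteq> A <+> (PIdl y <+> Idl T)"
      by (rule sum_least[OF L sum_upper1[OF A PT] order_trans[OF sum_upper1[OF P IT] sum_upper2[OF A PT]]])
  qed
  ultimately show ?thesis unfolding Idl_insert[OF T y] by (rule equalityI)
qed

lemma (in cring) sum_zero_right: "ideal A R \<Longrightarrow> A <+> {\<zero>} = A"
  using sum_upper1[OF _ zeroideal, of A] sum_least[of A A "{\<zero>}"] idl_zero[of A] by auto

lemma (in cring) regseq_nth: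
  assumes "ideal A R" "set ys \<subseteq> carrier R" "regseq A ys" "i < length ys" "a \<in> carrier R"
    "a \<otimes> ys ! i \<in> A <+> Idl (set (take i ys))"
  shows "a \<in> A <+> Idl (set (take i ys))"
  using assms
proof (induction ys arbitrary: A i)
  case Nil then show ?case by simp
next
  case (Cons y ys A i)
  show ?case
  proof (cases i)
    case 0
    then have "a \<otimes> y \<in> A" using Cons.prems(6) sum_zero_right[OF Cons.prems(1)] by (simp add: Idl_empty)
    then have "a \<in> A" using Cons.prems(3,5) by simp
    then show ?thesis using 0 sum_zero_right[OF Cons.prems(1)] by (simp add: Idl_empty)
  next
    case (Suc j)
    have y: "y \<in> carrier R" and ys: "set ys \<subseteq> carrier R" using Cons.prems(2) by auto
    have T: "set (take j ys) \<subseteq> carrier R" using ys set_take_subset[of j ys] by auto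
    have eq: "A <+> Idl (set (take i (y # ys))) = (A <+> PIdl y) <+> Idl (set (take j ys))"
      using sum_assoc_insert[OF Cons.prems(1) y T] Suc by simp
    have "a \<in> (A <+> PIdl y) <+> Idl (set (take j ys))"
    proof (rule Cons.IH[OF add_ideals[OF Cons.prems(1) cgenideal_ideal[OF y]] ys _ _ Cons.prems(5)])
      show "regseq (A <+> PIdl y) ys" using Cons.prems(3) by simp
      show "j < length ys" using Cons.prems(4) Suc by simp
      show "a \<otimes> ys ! j \<in> (A <+> PIdl y) <+> Idl (set (take j ys))" using Cons.prems(6) unfolding eq using Suc by simp
    qed
    then show ?thesis unfolding eq .
  qed
qed

text \<open>A finite supremum of natural numbers is attained.\<close>

lemma krull_dim_chain:
  assumes dim: "krull_dim R = enat d" and P: "primeideal P R"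
  shows "\<exists>C :: nat \<Rightarrow> _. (\<forall>i\<le>d. primeideal (C i) R) \<and> (\<forall>i<d. C i \<subset> C (Suc i))"
proof (cases d)
  case 0 then show ?thesis using P by (intro exI[of _ "\<lambda>_. P"]) simp
next
  case (Suc k)
  show ?thesis
  proof (rule ccontr)
    assume no: "\<not> ?thesis"
    have "krull_dim R \<le> enat k" unfolding krull_dim_def
    proof (rule Sup_least)
      fix e assume "e \<in> {enat l |l. \<exists>P :: nat \<Rightarrow> _. (\<forall>i\<le>l. primeideal (P i) R) \<and> (\<forall>i<l. P i \<subset> P (Suc i))}"
      then obtain l C where l: "e = enat l" "\<forall>i\<le>l. primeideal (C i) R" "\<forall>i<l. C i \<subset> C (Suc i)" by blast
      have "\<not> d \<le> l"
      proof
        assume "d \<le> l"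
        then have "(\<forall>i\<le>d. primeideal (C i) R) \<and> (\<forall>i<d. C i \<subset> C (Suc i))" using l(2,3) by auto
        then show False using no by blast
      qed
      then show "e \<le> enat k" using l(1) Suc by simp
    qed
    then show False using dim Suc by simp
  qed
qed

lemma (in noetherian_local) prime_below:
  assumes P: "primeideal P R" shows "P \<subseteq> \<mm>"
proof
  fix r assume r: "r \<in> P"
  interpret P: primeideal P R by (rule P)
  show "r \<in> \<mm>"
  proof (rule ccontr)
    assume "r \<notin> \<mm>"
    then have u: "r \<in> Units R" using units[OF P.Icarr[OF r]] by simp
    have "inv r \<otimes> r \<in> P" by (rule P.I_l_closed[OF r Units_inv_closed[OF u]])
    then show False using primeideal_one_notin[OF P] Units_l_inv[OF u] by simp
  qed
qed

text \<open>
  A chain of primes of length \<open>d\<close> ends in \<open>\<mm>\<close>, as it could be prolonged otherwise, contrary to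
  \<open>prime_chain_length_le\<close>. So minimal generators of \<open>\<mm>\<close> form a regular sequence.
\<close>

lemma (in noetherian_local) regular_system_exists:
  assumes dim: "krull_dim R = enat d" and d: "min_gens R (ideal_module R \<mm>) = d"
  shows "\<exists>x. regular_system R \<mm> x d"
proof -
  obtain X where X: "finite X" "card X = d" "X \<subseteq> \<mm>" "Idl X = \<mm>" using min_gens_attained[OF m_ideal] d by blast
  obtain x where "bij_betw x {0..<card X} X" using ex_bij_betw_nat_finite[OF X(1)] by blast
  then have x: "x ` {..<d} = X" using X(2) unfolding bij_betw_def by (simp add: lessThan_atLeast0)
  define ys where "ys = map x [0..<d]"
  have ys: "set ys = X" "length ys = d" unfolding ys_def using x by (auto simp: lessThan_atLeast0)
  have Xc: "X \<subseteq> carrier R" using X(3) m_carrier by auto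
  obtain C where C: "\<forall>i\<le>d. primeideal (C i) R" "\<forall>i<d. C i \<subset> C (Suc i)"
    using krull_dim_chain[OF dim m_prime] by blast
  have gen: "\<mm> \<subseteq> J" if "ideal J R" "set ys \<subseteq> J" for J using genideal_minimal[OF that(1)] that(2) ys(1) X(4) by blast
  have top: "C d = \<mm>"
  proof (rule ccontr)
    assume ne: "C d \<noteq> \<mm>"
    then have "C d \<subset> \<mm>" using prime_below[of "C d"] C(1) by simp
    define D where "D = (\<lambda>i. if i \<le> d then C i else \<mm>)"
    have "D i \<subset> D (Suc i)" if "i < Suc d" for i
    proof (cases "i = d")
      case True then show ?thesis using \<open>C d \<subset> \<mm>\<close> unfolding D_def by simp
    next
      case False then show ?thesis using that C(2) unfolding D_def by simp
    qed
    then have "prime_chain (Suc d) (C 0) \<mm>" unfolding prime_chain_def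
      using C(1) m_prime by (intro exI[of _ D]) (simp add: D_def)
    then have "Suc d \<le> length ys"
      by (rule prime_chain_length_le) (unfold ys(1), rule X(3), rule gen, assumption, simp only: ys(1))
    then show False using ys(2) by simp
  qed
  have pc: "prime_chain (length ys) (C 0) \<mm>" unfolding prime_chain_def ys(2) using C top by (intro exI[of _ C]) simp
  have "C 0 = {\<zero>} \<and> regseq {\<zero>} ys"
  proof (rule prime_chain_regseq[OF m_prime _ zeroideal _ _ _ _ pc])
    show "\<And>u. u \<in> carrier R - \<mm> \<Longrightarrow> u \<in> Units R" using units by simp
    show C0: "primeideal (C 0) R" using C(1) by simp
    show "{\<zero>} \<subseteq> C 0" using idl_zero[OF primeideal.axioms(1)[OF C0]] by simp
    show "set ys \<subseteq> \<mm>" unfolding ys(1) by (rule X(3))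
    show "\<And>J. ideal J R \<Longrightarrow> {\<zero>} \<subseteq> J \<Longrightarrow> set ys \<subseteq> J \<Longrightarrow> \<mm> \<subseteq> J" by (rule gen)
  qed
  then have reg: "regseq {\<zero>} ys" ..
  have "regular_parameters R x d"
  proof (intro regular_parameters.intro regular_parameters_axioms.intro)
    show "cring R" by (rule cring_axioms)
    show xc: "x i \<in> carrier R" if "i < d" for i using that x Xc by auto
    fix i a assume i: "i < d" and a: "a \<in> carrier R" and ax: "a \<otimes> x i \<in> Idl (x ` {..<i})"
    have T: "set (take i ys) = x ` {..<i}" unfolding ys_def using i by (auto simp: take_map lessThan_atLeast0)
    have Ti: "ideal (Idl (x ` {..<i})) R" by (rule genideal_ideal) (use xc i in auto)
    have z: "{\<zero>} <+> Idl (x ` {..<i}) = Idl (x ` {..<i})"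
      using sum_upper2[OF zeroideal Ti] sum_least[OF Ti, of "{\<zero>}" "Idl (x ` {..<i})"] idl_zero[OF Ti] by auto
    have "a \<in> {\<zero>} <+> Idl (set (take i ys))"
      by (rule regseq_nth[OF zeroideal _ reg _ a]) (use ys Xc i ax z T in \<open>auto simp: ys_def\<close>)
    then show "a \<in> Idl (x ` {..<i})" unfolding T z .
  qed
  then show ?thesis
    using noetherian_local_axioms X(4) x
    by (intro exI[of _ x] regular_system.intro regular_system_axioms.intro) auto
qed

section \<open>The inequality between Betti numbers and colength\<close>

context regular_quotient begin

text \<open>As \<open>I \<subseteq> \<nn>\<^sup>2\<close>, lifts of generators of \<open>\<mm>\<close> generate \<open>\<nn>\<close>, by Nakayama's lemma.\<close>

lemma min_gens_m:
  assumes n: "min_gens S (ideal_module S \<nn>) = n"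
  shows "min_gens R (ideal_module R \<mm>) = n"
proof (rule antisym)
  let ?X = "x ` {..<n}"
  have X: "?X \<subseteq> carrier S" using S.x_closed by auto
  have "\<mm> = genideal R (\<phi> ` ?X)" unfolding m_eq S.m_gen by (rule image_Idl[OF X])
  then have "min_gens R (ideal_module R \<mm>) \<le> card (\<phi> ` ?X)" using X by (intro h.S.min_gens_le[OF m_ideal]) auto
  also have "\<dots> \<le> card {..<n}" unfolding image_image by (rule card_image_le) simp
  finally show "min_gens R (ideal_module R \<mm>) \<le> n" by simp
  obtain Y where Y: "finite Y" "card Y = min_gens R (ideal_module R \<mm>)" "Y \<subseteq> \<mm>" "genideal R Y = \<mm>"
    using RR.min_gens_attained[OF m_ideal] by blast
  from Y(3) have "Y \<subseteq> \<phi> ` \<nn>" unfolding m_eq .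
  then obtain Z where Z: "Z \<subseteq> \<nn>" "finite Z" "Y = \<phi> ` Z" "card Z \<le> card Y"
    using Y(1) by (metis card_image finite_imageD subset_image_inj order_refl)
  have Zc: "Z \<subseteq> carrier S" using Z(1) S.m_carrier by auto
  have IZ: "ideal (genideal S Z) S" by (rule S.genideal_ideal[OF Zc])
  have nn: "ideal (ideal_prod S \<nn> \<nn>) S" by (rule S.ideal_prod_is_ideal[OF S.m_ideal S.m_ideal])
  have I2: "I \<subseteq> ideal_prod S \<nn> \<nn>"
    using I_ipow[of "Suc (Suc 0)"] s unfolding S.ipow_Suc[of _ "Suc 0"] S.ipow_1[OF S.m_ideal] by simp
  have sum: "ideal (genideal S Z <+>\<^bsub>S\<^esub> ideal_prod S \<nn> \<nn>) S" by (rule S.add_ideals[OF IZ nn])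
  have "\<nn> \<subseteq> genideal S Z <+>\<^bsub>S\<^esub> ideal_prod S \<nn> \<nn>"
  proof
    fix a assume a: "a \<in> \<nn>"
    have ac: "a \<in> carrier S" using a S.m_carrier by auto
    have "\<phi> a \<in> \<phi> ` (genideal S Z)" unfolding image_Idl[OF Zc] Z(3)[symmetric] Y(4) m_eq using a by (rule imageI)
    then have "\<phi> a \<in> \<phi> ` (genideal S Z <+>\<^bsub>S\<^esub> ideal_prod S \<nn> \<nn>)" using S.sum_upper1[OF IZ nn] by auto
    with ac show "a \<in> genideal S Z <+>\<^bsub>S\<^esub> ideal_prod S \<nn> \<nn>"
      by (rule image_memD[OF sum order_trans[OF I2 S.sum_upper2[OF IZ nn]]])
  qed
  then have "\<nn> \<subseteq> genideal S Z" by (rule S.nakayama[OF S.m_ideal IZ])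
  moreover have "genideal S Z \<subseteq> \<nn>" by (rule S.genideal_minimal[OF S.m_ideal Z(1)])
  ultimately have "min_gens S (ideal_module S \<nn>) \<le> card Z" by (intro S.min_gens_le[OF S.m_ideal Z(2) Zc]) auto
  then show "n \<le> min_gens R (ideal_module R \<mm>)" using n Z(4) Y(2) by simp
qed

lemma maximal_eq:
  assumes M: "maximalideal M R" shows "M = \<mm>"
proof -
  interpret M: maximalideal M R by (rule M)
  have "M \<subseteq> \<mm>"
  proof
    fix r assume r: "r \<in> M"
    show "r \<in> \<mm>"
    proof (rule ccontr)
      assume "r \<notin> \<mm>"
      then have u: "r \<in> Units R" by (rule m_units[OF M.Icarr[OF r]])
      have "inv\<^bsub>R\<^esub> r \<otimes>\<^bsub>R\<^esub> r \<in> M" by (rule M.I_l_closed[OF r h.S.Units_inv_closed[OF u]])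
      then have "\<one>\<^bsub>R\<^esub> \<in> M" using h.S.Units_l_inv[OF u] by simp
      then show False using M.one_imp_carrier M.I_notcarr by simp
    qed
  qed
  then have "\<mm> = M \<or> \<mm> = carrier R" by (intro M.I_maximal[OF m_ideal] h.S.idl_subset[OF m_ideal])
  then show ?thesis using m_one h.S.one_closed by auto
qed

text \<open>
  The same \<open>rel_len\<close> is followed through four presentations: of \<open>M\<close> by its canonical resolution,
  of the isomorphic ideal \<open>J\<close> by finitely many generators, of \<open>\<mm>\<^sup>s\<close> by these and further
  generators, and of \<open>\<mm>\<^sup>s\<close> by monomials.
\<close>

lemma betti_bound:
  assumes M: "module R M" and f: "f \<in> module_hom R M (ring_module R)"
    and inj: "\<And>x. x \<in> carrier M \<Longrightarrow> f x = \<zero>\<^bsub>R\<^esub> \<Longrightarrow> x = \<zero>\<^bsub>M\<^esub>"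
    and J: "ideal J R" "f ` carrier M = J" "J \<subseteq> ipR \<mm> s"
    and k: "clen (\<lambda>J. ideal J R) J (ipR \<mm> s) \<le> enat k" and fld: "field (R Quot \<mm>)"
  shows "n * card (Mon n s) + min_gens S (ideal_module S I) \<le>
    vectorspace.dim (R Quot \<mm>) (tor1 R (R Quot \<mm>) (\<lambda>r. \<mm> +>\<^bsub>R\<^esub> r) M) + k * n + card (Mon n (Suc s))"
proof -
  interpret t: tor_setup R M \<mm> by (rule tor_setup.intro[OF M m_ideal])
  interpret f: mod_hom R M "ring_module R" f by (rule mod_homI[OF M RR.RM.module_axioms f])
  let ?D = "vectorspace.dim (R Quot \<mm>) (tor1 R (R Quot \<mm>) (\<lambda>r. \<mm> +>\<^bsub>R\<^esub> r) M)"
  let ?G = "\<phi> ` x ` {..<n}"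
  have F0: "res0 R M = free_module R (carrier M)" by (simp add: res0_def)
  have fM: "f \<in> carrier M \<rightarrow> carrier (ring_module R)" using f.f_im by auto
  have idM: "(\<lambda>y. y) \<in> carrier M \<rightarrow> carrier M" by simp
  have pe: "free_eval R M = t.fext (\<lambda>y. y)" by (rule t.free_eval_eq_fext)
  have ff: "RR.RM.fext f g = f (free_eval R M g)" if g: "g \<in> carrier (res0 R M)" for g
  proof (rule RR.RM.free_hom_eq[of _ "carrier M" "\<lambda>g. f (free_eval R M g)"])
    show "RR.RM.fext f \<in> module_hom R (free_module R (carrier M)) (ring_module R)" by (rule RR.RM.fext_hom[OF fM])
    show "(\<lambda>g. f (free_eval R M g)) \<in> module_hom R (free_module R (carrier M)) (ring_module R)"
      unfolding F0[symmetric]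
      by (rule module_homI) (use t.p.f_im f.f_im t.p.f_add f.f_add t.p.f_smult f.f_smult in auto)
    show "RR.RM.fext f (free_gen R y) = f (free_eval R M (free_gen R y))" if "y \<in> carrier M" for y
      unfolding RR.RM.fext_gen[OF fM that] pe t.fext_gen[OF idM that] ..
    show "g \<in> carrier (free_module R (carrier M))" using g unfolding F0 .
  qed
  have pim: "free_eval R M ` carrier (res0 R M) = carrier M"
  proof
    show "free_eval R M ` carrier (res0 R M) \<subseteq> carrier M" using t.p.f_im by auto
    show "carrier M \<subseteq> free_eval R M ` carrier (res0 R M)"
    proof
      fix y assume y: "y \<in> carrier M"
      have "y = free_eval R M (free_gen R y)" unfolding pe t.fext_gen[OF idM y] ..
      moreover have "free_gen R y \<in> carrier (res0 R M)" unfolding F0 by (rule h.S.free_gen_closed[OF y])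
      ultimately show "y \<in> free_eval R M ` carrier (res0 R M)" by (rule image_eqI)
    qed
  qed
  have "RR.RM.fext f ` carrier (res0 R M) = f ` (free_eval R M ` carrier (res0 R M))"
    unfolding image_image by (rule image_cong[OF refl ff])
  then have "RR.RM.fext f ` carrier (res0 R M) = J" unfolding pim J(2) .
  then have im0: "RR.RM.fext f ` carrier (free_module R (carrier M)) = J" unfolding F0 .
  (* As f is injective, the canonical free module presents J with the same relations as M. *)
  have K0: "relK (res0 R M) (ring_module R) (RR.RM.fext f) = relK (res0 R M) M (free_eval R M)"
  proof -
    have "RR.RM.fext f v = \<zero>\<^bsub>ring_module R\<^esub> \<longleftrightarrow> free_eval R M v = \<zero>\<^bsub>M\<^esub>" if v: "v \<in> carrier (res0 R M)" for v
      unfolding ff[OF v] using inj[OF t.p.f_im[OF v]] f.f0_is_0 by auto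
    then show ?thesis unfolding relK_def by (intro Collect_cong conj_cong refl)
  qed
  have rl0: "rel_len R \<mm> (res0 R M) (ring_module R) (RR.RM.fext f) = rel_len R \<mm> (res0 R M) M (free_eval R M)"
    unfolding rel_len_def relM_def K0 ..
  from RR.ideal_fg[OF J(1)] obtain X where "finite X \<and> X \<subseteq> J \<and> J = genideal R X" by (rule exE)
  note X = conjunct1[OF this] conjunct1[OF conjunct2[OF this]] conjunct2[OF conjunct2[OF this]]
  have IJ: "genideal R X = J" by (rule X(3)[symmetric])
  have Xc: "X \<subseteq> carrier R" using X(2) h.S.idl_subset[OF J(1)] by auto
  have idX: "(\<lambda>y. y) \<in> Y \<rightarrow> carrier (ring_module R)" if "Y \<subseteq> carrier R" for Y using that by auto
  have imX: "RR.RM.fext (\<lambda>y. y) ` carrier (free_module R Y) = genideal R Y" if "finite Y" "Y \<subseteq> carrier R" for Y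
    using h.S.fext_image_Idl[OF that(1), of "\<lambda>y. y"] that(2) by auto
  have "RR.RM.fext f ` carrier (free_module R (carrier M)) = RR.RM.fext (\<lambda>y. y) ` carrier (free_module R X)"
    unfolding im0 imX[OF X(1) Xc] IJ ..
  note RR.RM.relM_fg[OF RR.noetherian_cring_axioms m_ideal fM idX[OF Xc] X(1) this, folded F0]
  from this obtain Z where "finite Z \<and> Z \<subseteq> relM \<mm> (res0 R M) (ring_module R) (RR.RM.fext f) \<and>
      (\<forall>U. subm R (res0 R M) U \<longrightarrow> iprod (res0 R M) \<mm> (relK (res0 R M) (ring_module R) (RR.RM.fext f)) \<subseteq> U \<longrightarrow>
        Z \<subseteq> U \<longrightarrow> relM \<mm> (res0 R M) (ring_module R) (RR.RM.fext f) \<subseteq> U)" by (rule exE)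
  note Z = conjunct1[OF this] conjunct1[OF conjunct2[OF this]] conjunct2[OF conjunct2[OF this], rule_format]
  have T0: "relM \<mm> (res0 R M) (ring_module R) (RR.RM.fext f) = relM \<mm> (res0 R M) M (free_eval R M)"
    unfolding relM_def K0 ..
  have tor: "rel_len R \<mm> (res0 R M) M (free_eval R M) \<le> enat ?D"
  proof (rule t.rel_len_le_dim_tor[OF fld m_units Z(1)])
    show "Z \<subseteq> t.T" using Z(2) unfolding T0 .
    show "t.T \<subseteq> U" if "subm R t.F0 U" "t.mK0 \<subseteq> U" "Z \<subseteq> U" for U
      using Z(3)[of U] that unfolding T0 K0 by blast
  qed
  have "RR.gen_rel_len X \<le> rel_len R \<mm> (free_module R (carrier M)) (ring_module R) (RR.RM.fext f)"
    by (rule RR.RM.rel_len_same_image[OF m_ideal idX[OF Xc] fM]) (simp only: im0 imX[OF X(1) Xc] IJ)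
  then have lenX: "RR.gen_rel_len X \<le> enat ?D" using tor rl0 unfolding F0[symmetric] by simp
  have G: "finite ?G" "?G \<subseteq> carrier R" "\<mm> = genideal R ?G"
    using S.x_closed unfolding m_eq S.m_gen by (auto intro!: image_Idl)
  have cG: "card ?G \<le> n" unfolding image_image using card_image_le[of "{..<n}" "\<lambda>i. \<phi> (x i)"] by simp
  have JX: "genideal R X \<subseteq> ipR \<mm> s" "clen (\<lambda>J. ideal J R) (genideal R X) (ipR \<mm> s) \<le> enat k"
    unfolding IJ by (rule J(3), rule k)
  from RR.gen_rel_len_larger_ideal[OF G X(1) Xc h.S.ipow_ideal[OF m_ideal, of s] JX]
  obtain Y where "finite Y \<and> Y \<subseteq> carrier R \<and> genideal R Y = ipR \<mm> s \<and>
    RR.gen_rel_len Y \<le> RR.gen_rel_len X + enat (k * card ?G)" by (rule exE)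
  then have Y: "finite Y" "Y \<subseteq> carrier R" "genideal R Y = ipR \<mm> s"
    and lenY: "RR.gen_rel_len Y \<le> RR.gen_rel_len X + enat (k * card ?G)" by simp_all
  have muc: "\<mu> \<in> Mon n s \<rightarrow> carrier (ring_module R)" using mon_closed by auto
  have imW: "evR ` carrier WR = ipR \<mm> s"
    using h.S.fext_image_Idl[OF finite_Mon[of n s], of \<mu>] mon_closed mon_Idl[of s] by simp
  (* Both sides present the same ideal, a power of the maximal ideal. *)
  have "rel_len R \<mm> WR (ring_module R) evR \<le> RR.gen_rel_len Y"
    by (rule RR.RM.rel_len_same_image[OF m_ideal muc idX[OF Y(2)]]) (simp only: imW imX[OF Y(1,2)] Y(3))
  also have "\<dots> \<le> enat ?D + enat (k * card ?G)" by (rule order_trans[OF lenY add_right_mono[OF lenX]])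
  also have "\<dots> \<le> enat (?D + k * n)" using cG by simp
  finally have "clen (subm S (S.W s)) (S.rel_lifts_bot I s) (S.rel_lifts I s) \<le> enat (?D + k * n)" using clen_le_rel_len by (rule order_trans[rotated])
  then have "enat (n * card (Mon n s)) + enat (min_gens S (ideal_module S I)) \<le> enat (?D + k * n) + enat (card (Mon n (Suc s)))"
    by (rule order_trans[OF S.monomial_relations_clen[OF I s] add_right_mono])
  then show ?thesis by simp
qed

lemma colength_bound:
  assumes J: "ideal J R" "J \<subseteq> ipR \<mm> s"
  shows "clen (\<lambda>J. ideal J R) J (ipR \<mm> s) + enat (\<Sum>t<s. card (Mon n t)) \<le> colength R J"
proof -
  have "enat (\<Sum>t<s. card (Mon n t)) \<le> clen (\<lambda>J. ideal J R) (ipR \<mm> s) (carrier R)"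
  proof (rule RR.clen_powers_ge[where v = \<mu>])
    show "\<mu> A \<in> ipR \<mm> t" if "A \<in> Mon n t" for t A by (rule mon_in_power[OF that])
    show "c A \<in> \<mm>" if "t < s" "c \<in> Mon n t \<rightarrow> carrier R"
      "(\<Oplus>\<^bsub>R\<^esub>A\<in>Mon n t. c A \<otimes>\<^bsub>R\<^esub> \<mu> A) \<in> ipR \<mm> (Suc t)" "A \<in> Mon n t" for t c A
      using that by (intro mon_independent[of t]) auto
  qed
  then have "clen (\<lambda>J. ideal J R) J (ipR \<mm> s) + enat (\<Sum>t<s. card (Mon n t)) \<le>
      clen (\<lambda>J. ideal J R) J (ipR \<mm> s) + clen (\<lambda>J. ideal J R) (ipR \<mm> s) (carrier R)" by (rule add_left_mono)
  also have "\<dots> \<le> clen (\<lambda>J. ideal J R) J (carrier R)"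
    by (rule clen_superadd) (use J h.S.ipow_ideal[OF m_ideal] h.S.idl_subset in auto)
  also have "\<dots> \<le> colength R J" by (rule RR.clen_le_colength[OF J(1)])
  finally show ?thesis .
qed

end

text \<open>
  Multiply the first bound by \<open>n\<close> and add the second one; the monomials of degree at most \<open>s\<close>
  number \<open>(n+s choose s)\<close>, and \<open>(s+1) (n+s choose s+1) = n (n+s choose s)\<close>.
\<close>

lemma binomial_arith:
  fixes H D \<mu> n s :: nat
  assumes n: "n > 0" and k: "k + (\<Sum>t<s. card (Mon n t)) \<le> H"
    and b: "n * card (Mon n s) + \<mu> \<le> D + k * n + card (Mon n (Suc s))"
  shows "real H \<ge> (- real D + real \<mu>) / real n + real ((n + s) choose s) * (real s / real (s + 1))"
proof -
  obtain n' where n': "n = Suc n'" using n by (cases n) auto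
  have tot: "(\<Sum>t<s. card (Mon n t)) + card (Mon n s) = (n + s) choose s"
    using sum_card_Mon[of n s] card_Mon[of n s] by (simp add: lessThan_Suc_atMost[symmetric])
  have top: "card (Mon n (Suc s)) = (n + s) choose (Suc s)" unfolding n' using card_Mon[of n' "Suc s"] by simp
  have "Suc s * ((n + s) choose Suc s) = n * ((n + s) choose s)"
  proof -
    have "Suc s * ((n + s) choose Suc s) = (n + s - s) * ((n + s) choose s)"
      using binomial_absorption[of s "n + s"] binomial_absorb_comp[of "n + s" s] by simp
    then show ?thesis by simp
  qed
  then have abs: "real (s + 1) * real ((n + s) choose Suc s) = real n * real ((n + s) choose s)"
    by (metis Suc_eq_plus1 of_nat_mult)
  define C where "C = real ((n + s) choose s)"
  define B where "B = real ((n + s) choose Suc s)"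
  have B: "real n * (C * (real s / real (s + 1))) = real n * C - B"
    using abs unfolding C_def[symmetric] B_def[symmetric] by (simp add: field_simps)
  have "n * (k + (\<Sum>t<s. card (Mon n t))) \<le> n * H" using k by (rule mult_le_mono2)
  then have "n * ((n + s) choose s) + \<mu> \<le> D + n * H + ((n + s) choose Suc s)"
    using b unfolding tot[symmetric] top[symmetric] by (simp add: algebra_simps)
  then have "real (n * ((n + s) choose s) + \<mu>) \<le> real (D + n * H + ((n + s) choose Suc s))" by (rule of_nat_mono)
  then have "real n * C + real \<mu> \<le> real D + real n * real H + B" unfolding C_def B_def by simp
  then have le: "- real D + real \<mu> + real n * (C * (real s / real (s + 1))) \<le> real n * real H" unfolding B by linarith
  define q where "q = C * (real s / real (s + 1))"
  have "- real D + real \<mu> \<le> (real H - q) * real n" using le unfolding q_def[symmetric] by (simp add: algebra_simps)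
  then have "(- real D + real \<mu>) / real n \<le> real H - q" using n by (intro iffD2[OF pos_divide_le_eq]) simp_all
  then show ?thesis unfolding C_def[symmetric] q_def[symmetric] by linarith
qed

section \<open>Torsion in modules of rank one\<close>

text \<open>A nonunit generates a proper ideal, and this lies in some maximal ideal.\<close>

lemma (in noetherian_cring) unique_maximal_imp_local:
  assumes M: "maximalideal \<mm> R" and unique: "\<And>M. maximalideal M R \<Longrightarrow> M = \<mm>"
  shows "noetherian_local R \<mm>"
proof (intro noetherian_local.intro noetherian_local_axioms.intro)
  show "noetherian_cring R" by (rule noetherian_cring_axioms)
  show "primeideal \<mm> R" by (rule maximalideal_prime[OF M])
  fix r assume r: "r \<in> carrier R" "r \<notin> \<mm>"
  show "r \<in> Units R"
  proof (rule ccontr)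
    assume nu: "r \<notin> Units R"
    have P: "ideal (PIdl r) R" by (rule cgenideal_ideal[OF r(1)])
    have "\<one> \<notin> PIdl r"
    proof
      assume "\<one> \<in> PIdl r"
      then obtain t where t: "t \<in> carrier R" "\<one> = t \<otimes> r" by (rule PIdlE)
      then have "r \<otimes> t = \<one>" using m_comm[OF t(1) r(1)] by simp
      then show False using nu t r(1) unfolding Units_def by auto
    qed
    then have ne: "PIdl r \<noteq> carrier R" by auto
    define C where "C = {K. ideal K R \<and> PIdl r \<subseteq> K \<and> K \<noteq> carrier R}"
    have "\<exists>J\<in>C. \<forall>K\<in>C. J \<subseteq> K \<longrightarrow> K = J"
      by (rule ex_maximal_ideal_in) (use P ne in \<open>auto simp: C_def\<close>)
    then obtain J where J: "J \<in> C" and max: "\<forall>K\<in>C. J \<subseteq> K \<longrightarrow> K = J" by (rule bexE)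
    have "maximalideal J R"
    proof (rule maximalidealI)
      show "ideal J R" "carrier R \<noteq> J" using J unfolding C_def by auto
      fix K assume K: "ideal K R" "J \<subseteq> K" "K \<subseteq> carrier R"
      show "K = J \<or> K = carrier R"
      proof (cases "K = carrier R")
        case False
        then have "K \<in> C" using K J unfolding C_def by auto
        then show ?thesis using bspec[OF max] K(2) by simp
      qed simp
    qed
    then have "J = \<mm>" by (rule unique)
    then show False using J r cgenideal_self[OF r(1)] unfolding C_def by auto
  qed
qed

theorem theorem1:
  fixes S :: "'a ring" and R :: "'a set ring" and M :: "('a set, 'm) module"
    and I \<nn> :: "'a set" and \<mm> :: "'a set set" and n s :: nat
  assumes "regular_local_ring S" and "maximalideal \<nn> S"
    and "ideal I S" and "R = S Quot I"
    and "domain R" and "krull_dim R = 1" and "\<not> regular_local_ring R"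
    and "maximalideal \<mm> R" and "min_gens R (ideal_module R \<mm>) = n"
    and "module R M" and "fin_gen_module R M" and "module_rank R M = 1" and "min_gens R M \<ge> 2"
    and "s \<ge> 1" and "I \<subseteq> \<nn> [^]\<^bsub>ideals_set S\<^esub> (s + 1)"
    and "\<exists>J. partial_trace_ideal R M J \<and> J \<subseteq> \<mm> [^]\<^bsub>ideals_set R\<^esub> s"
    and "ereal_of_enat (h_inv R M) <
           ereal ((- real (vectorspace.dim (R Quot \<mm>) (tor1 R (R Quot \<mm>) (\<lambda>r. \<mm> +>\<^bsub>R\<^esub> r) M))
                   + real (min_gens S (ideal_module S I))) / real n
                  + real ((n + s) choose s) * (real s / real (s + 1)))"
  shows "torsion_submodule R M \<noteq> {\<zero>\<^bsub>M\<^esub>}"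
proof
  assume tf: "torsion_submodule R M = {\<zero>\<^bsub>M\<^esub>}"
  have S: "noetherian_ring S" "cring S" "\<And>M. maximalideal M S \<Longrightarrow> M = \<nn>"
    "enat (min_gens S (ideal_module S \<nn>)) = krull_dim S"
    using assms(1,2) unfolding regular_local_ring_def local_ring_def by auto
  interpret S: noetherian_cring S by (rule noetherian_cring.intro[OF S(2,1)])
  interpret S: noetherian_local S \<nn> by (rule S.unique_maximal_imp_local[OF assms(2) S(3)])
  define d where "d = min_gens S (ideal_module S \<nn>)"
  from S.regular_system_exists[OF S(4)[symmetric] refl] obtain x where x: "regular_system S \<nn> x d"
    unfolding d_def ..
  have I: "I \<subseteq> S.ipow \<nn> (Suc s)" using assms(15) by simp
  interpret I: ideal I S by (rule assms(3))
  have hom: "ring_hom_cring S R (\<lambda>a. I +>\<^bsub>S\<^esub> a)" unfolding assms(4) by (rule I.rcos_ring_hom_cring[OF S(2)])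
  interpret q: regular_quotient S \<nn> x d R "\<lambda>a. I +>\<^bsub>S\<^esub> a" I "(\<lambda>a. I +>\<^bsub>S\<^esub> a) ` \<nn>" s
  proof (intro regular_quotient.intro regular_quotient_axioms.intro)
    show "(\<lambda>a. I +>\<^bsub>S\<^esub> a) ` carrier S = carrier R" unfolding assms(4) FactRing_def A_RCOSETS_def' by auto
    have zero: "I +>\<^bsub>S\<^esub> \<zero>\<^bsub>S\<^esub> = \<zero>\<^bsub>R\<^esub>"
      unfolding assms(4) using S.a_rcos_zero[OF assms(3) I.zero_closed] by (simp add: FactRing_def)
    show "(I +>\<^bsub>S\<^esub> a = \<zero>\<^bsub>R\<^esub>) = (a \<in> I)" if "a \<in> carrier S" for a
      using S.quotient_eq_iff_same_a_r_cos[OF assms(3) that S.zero_closed] that unfolding zero by (simp add: S.minus_eq)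
  qed (rule x hom assms(3) I assms(14) refl)+
  have m: "\<mm> = (\<lambda>a. I +>\<^bsub>S\<^esub> a) ` \<nn>" by (rule q.maximal_eq[OF assms(8)])
  have n: "n = d" using q.min_gens_m[OF d_def[symmetric]] assms(9) unfolding m by simp
  interpret R: domain R by (rule assms(5))
  obtain C :: "nat \<Rightarrow> _" where C: "\<forall>i\<le>1. primeideal (C i) R" "\<forall>i<1. C i \<subset> C (Suc i)"
    using krull_dim_chain[of R 1, OF _ q.RR.m_prime] assms(6) by (auto simp: one_enat_def)
  (* A chain of two primes rules out that the maximal ideal is zero. *)
  have mnz: "\<mm> \<noteq> {\<zero>\<^bsub>R\<^esub>}"
  proof
    assume "\<mm> = {\<zero>\<^bsub>R\<^esub>}"
    then have "C 1 \<subseteq> {\<zero>\<^bsub>R\<^esub>}" using q.RR.prime_below[of "C 1"] C(1) unfolding m by simp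
    moreover have "\<zero>\<^bsub>R\<^esub> \<in> C 0" using q.h.S.idl_zero[OF primeideal.axioms(1)] C(1) by simp
    ultimately show False using C(2) by auto
  qed
  have n0: "n > 0"
  proof (rule ccontr)
    assume "\<not> n > 0"
    then have "\<nn> = {\<zero>\<^bsub>S\<^esub>}" using q.S.m_gen n S.Idl_empty by simp
    then show False using mnz q.h.hom_zero unfolding m by simp
  qed
  obtain J where J: "ideal J R" "J \<subseteq> \<mm> [^]\<^bsub>ideals_set R\<^esub> s" and col: "colength R J = h_inv R M"
    and sj: "surjects_onto_ideal R M J"
    using assms(16) unfolding partial_trace_ideal_def surjects_onto_ideal_def by auto
  from sj obtain f where f: "f \<in> module_hom R M (ideal_module R J)" "f ` carrier M = J"
    unfolding surjects_onto_ideal_def by auto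
  obtain H where H: "h_inv R M = enat H" using assms(17) by (cases "h_inv R M") auto
  have Jm: "J \<subseteq> q.ipR ((\<lambda>a. I +>\<^bsub>S\<^esub> a) ` \<nn>) s" using J(2) unfolding m .
  have Jc: "J \<subseteq> carrier R" by (rule q.h.S.idl_subset[OF J(1)])
  (* The zero ideal has infinite colength, but the hypothesis makes h(M) finite. *)
  have "J \<noteq> {\<zero>\<^bsub>R\<^esub>}"
  proof
    assume Jz: "J = {\<zero>\<^bsub>R\<^esub>}"
    have "enat (Suc H) \<le> clen (\<lambda>J. ideal J R) J (carrier R)"
      unfolding Jz by (rule q.RR.clen_zero_ge[OF assms(5) mnz[unfolded m]])
    also have "\<dots> \<le> enat H" using q.RR.clen_le_colength[OF J(1)] col H by simp
    finally show False by simp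
  qed
  then obtain y where y: "y \<in> carrier M" "f y \<noteq> \<zero>\<^bsub>R\<^esub>" using f(2) q.h.S.idl_zero[OF J(1)] by auto
  (* Without torsion, f identifies M with J. *)
  have inj: "z = \<zero>\<^bsub>M\<^esub>" if "z \<in> carrier M" "f z = \<zero>\<^bsub>R\<^esub>" for z
    by (rule R.rank_one_torsion_free_inj[OF assms(10-12) tf Jc f(1) y that])
  have fR: "f \<in> module_hom R M (ring_module R)"
    using f(1) Jc unfolding module_hom_def ideal_module_def by auto
  have "clen (\<lambda>J. ideal J R) J (q.ipR ((\<lambda>a. I +>\<^bsub>S\<^esub> a) ` \<nn>) s) + enat (\<Sum>t<s. card (Mon d t)) \<le> enat H"
    using q.colength_bound[OF J(1) Jm] col H by simp
  then obtain k where k: "clen (\<lambda>J. ideal J R) J (q.ipR ((\<lambda>a. I +>\<^bsub>S\<^esub> a) ` \<nn>) s) = enat k"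
    "k + (\<Sum>t<s. card (Mon d t)) \<le> H"
    by (cases "clen (\<lambda>J. ideal J R) J (q.ipR ((\<lambda>a. I +>\<^bsub>S\<^esub> a) ` \<nn>) s)") auto
  have fld: "field (R Quot \<mm>)" by (rule maximalideal.quotient_is_field[OF assms(8) q.h.S.cring_axioms])
  have "d * card (Mon d s) + min_gens S (ideal_module S I) \<le>
    vectorspace.dim (R Quot \<mm>) (tor1 R (R Quot \<mm>) (\<lambda>r. \<mm> +>\<^bsub>R\<^esub> r) M) + k * d + card (Mon d (Suc s))"
    unfolding m by (rule q.betti_bound[OF assms(10) fR inj J(1) f(2) Jm eq_refl[OF k(1)] fld[unfolded m]])
  from binomial_arith[OF n0 k(2)[folded n] this[folded n]] show False
    using assms(17) unfolding H by simp
qed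

end
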